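(* Let $N\ge1$, $s\in(0,1)$, $m>0$, $T>0$, let $\Omega\subset\mathbb{R}^N$ satisfy the domain assumptions in the context, let $u_0\in L^\infty(\Omega)$ with $u_0=0$ on $\mathbb{R}^N\setminus\Omega$, let $u$ be a weak solution of the fractional diffusion problem in the context, $w=|u|^{m-1}u$, $w_0=|u_0|^{m-1}u_0$, and let $W$ be the fully discrete approximation defined in the context. Then there exists a constant $c>0$ independent of $h$ and $\tau$ such that $$\int_0^T\|w-W\|_{(w,\frac{m+1}{m})}^2+\int_{\mathbb{R}^N}\int_{\mathbb{R}^N}\frac{|(\bar w(x)-\bar w(z))-(\overline W(x)-\overline W(z))|^2}{|x-z|^{N+2s}}\,dz\,dx$$ $$\le c\Bigg(\sum_{n=1}^M\int_{I_n}\|w_n-w\|_{(w,\frac{m+1}{m})}^2+\int_0^T\|w-P_hw\|_{(w,\frac{m+1}{m})}^2+\|\psi(w_0)-\Pi_h\psi(w_0)\|_{L^2}^2$$ $$+\int_{\mathbb{R}^N}\int_{\mathbb{R}^N}\frac{\left|\tau\sum_{n=1}^M\big[(\bar w^n(x)-\bar w^n(z))-(P_h\bar w^n(x)-P_h\bar w^n(z))\big]\right|^2}{|x-z|^{N+2s}}\,dz\,dx\Bigg),$$ where $\bar w(x)=\int_0^Tw(x,t)\,dt$ and $\overline W(x)=\int_0^TW(x,t)\,dt$.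
   Context: Domain: $\Omega\subset\mathbb{R}^N$ is a bounded, convex, open polyhedral domain; $\partial\Omega=\bigcup_{k=1}^K\overline{\Gamma}_k$ with each $\Gamma_k$ an $(N-1)$-dimensional polyhedron, $\Gamma_i\cap\Gamma_k=\emptyset$ for $i\ne k$, and $\partial\Gamma_{k_1}\cap\dots\cap\partial\Gamma_{k_j}=\emptyset$ whenever $j>N$, $k_1<\dots<k_j$. Problem: $u_t=-(-\Delta)^s(|u|^{m-1}u)$ in $\Omega\times(0,T]$, $u=0$ on $(\mathbb{R}^N\setminus\Omega)\times(0,T]$, $u(\cdot,0)=u_0$. Weak solution: $-\int_0^T\int_{\mathbb{R}^N}u\varphi_t+\int_0^T\int\int\frac{(|u|^{m-1}u)(x)-(|u|^{m-1}u)(z)}{|x-z|^{N+2s}}(\varphi(x)-\varphi(z))\,dz\,dx\,dt=\int_{\mathbb{R}^N}u_0\varphi(\cdot,0)$ for all test $\varphi$ with $\varphi(\cdot,T)\equiv0$. Notation: $\psi(y)=|y|^{\frac{1-m}{m}}y$. $\tau>0$, $M\tau=T$, $t_n=n\tau$, $I_n=(t_{n-1},t_n)$, $w_n=w(\cdot,t_n)$, $\bar w^n=\tau^{-1}\int_{I_n}w(\cdot,t)\,dt$ for $n\ge1$. $T_h$: regular family of triangulations of $\Omega$ into closed $N$-simplices, mesh size $h$, $|K|\ge c(\mathrm{diam}\,K)^N$. $S_h=\{\phi_h\in C^0(\overline\Omega)$ piecewise linear w.r.t. $T_h$, $\phi_h=0$ on $\mathbb{R}^N\setminus\Omega\}$;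 $\Pi_h$ is the piecewise linear interpolant. $H^s(\mathbb{R}^N)=\{v\in L^2: \|v\|_{L^2}+|v|_{H^s}<\infty\}$ with $|v|_{H^s}^2=\int\int\frac{(v(x)-v(z))^2}{|x-z|^{N+2s}}dz\,dx$. $P_h:H^s(\mathbb{R}^N)\to S_h$ is defined by $\int\int\frac{(v-P_hv)(x)-(v-P_hv)(z)}{|x-z|^{N+2s}}(\chi(x)-\chi(z))\,dz\,dx=0$ for all $\chi\in S_h$. $(\cdot,\cdot)$ is the $L^2$ inner product. Scheme: $W_0=\psi^{-1}(\Pi_h\psi(w_0))$, and $W_n\in S_h$ ($1\le n\le M$) satisfy $\left(\frac{\psi(W_n)-\psi(W_{n-1})}{\tau},\chi\right)+\int\int\frac{W_n(x)-W_n(z)}{|x-z|^{N+2s}}(\chi(x)-\chi(z))\,dz\,dx=0$ for all $\chi\in S_h$; $W(\cdot,0)=W_0$ and $W(\cdot,t)=W_n$ for $t\in(t_{n-1},t_n]$. Quasi-norm: for $p>1$, $\|v_2\|_{(v_1,p)}^2=\int_\Omega(|v_1|+|v_2|)^{p-2}|v_2|^2$. *)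

theory Defs
  imports "HOL-Analysis.Analysis"
begin

definition polyhedral_domain :: "(real^'n) set \<Rightarrow> bool" where
  "polyhedral_domain \<Omega> \<longleftrightarrow>
     \<Omega> \<noteq> {} \<and> open \<Omega> \<and> bounded \<Omega> \<and> convex \<Omega> \<and> polyhedron (closure \<Omega>) \<and>
     (\<exists>(K::nat) (\<Gamma>::nat \<Rightarrow> (real^'n) set).
        frontier \<Omega> = (\<Union>k<K. closure (\<Gamma> k)) \<and>
        (\<forall>k<K. polyhedron (closure (\<Gamma> k)) \<and> rel_interior (\<Gamma> k) = \<Gamma> k \<and>
               aff_dim (\<Gamma> k) = int CARD('n) - 1) \<and>
        (\<forall>i<K. \<forall>k<K. i \<noteq> k \<longrightarrow> \<Gamma> i \<inter> \<Gamma> k = {}) \<and>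
        (\<forall>J. J \<subseteq> {..<K} \<and> card J > CARD('n) \<longrightarrow> (\<Inter>k\<in>J. rel_frontier (\<Gamma> k)) = {}))"

definition psi :: "real \<Rightarrow> real \<Rightarrow> real" where
  "psi m y = \<bar>y\<bar> powr ((1 - m) / m) * y"

definition pw :: "real \<Rightarrow> real \<Rightarrow> real" where
  "pw m y = \<bar>y\<bar> powr (m - 1) * y"

definition gagliardo_sq :: "real \<Rightarrow> (real^'n \<Rightarrow> real) \<Rightarrow> ennreal" where
  "gagliardo_sq s v =
     (\<integral>\<^sup>+ x. (\<integral>\<^sup>+ z. ennreal ((v x - v z)\<^sup>2 / norm (x - z) powr (real CARD('n) + 2 * s)) \<partial>lebesgue) \<partial>lebesgue)"

definition frac_form :: "real \<Rightarrow> (real^'n \<Rightarrow> real) \<Rightarrow> (real^'n \<Rightarrow> real) \<Rightarrow> real" where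
  "frac_form s v \<zeta> =
     (\<integral>x. (\<integral>z. (v x - v z) * (\<zeta> x - \<zeta> z) / norm (x - z) powr (real CARD('n) + 2 * s) \<partial>lebesgue) \<partial>lebesgue)"

definition L2_inner :: "(real^'n \<Rightarrow> real) \<Rightarrow> (real^'n \<Rightarrow> real) \<Rightarrow> real" where
  "L2_inner f g = (\<integral>x. f x * g x \<partial>lebesgue)"

definition qnorm_sq :: "(real^'n) set \<Rightarrow> real \<Rightarrow> (real^'n \<Rightarrow> real) \<Rightarrow> (real^'n \<Rightarrow> real) \<Rightarrow> ennreal" where
  "qnorm_sq \<Omega> p v1 v2 =
     (\<integral>\<^sup>+ x\<in>\<Omega>. ennreal ((\<bar>v1 x\<bar> + \<bar>v2 x\<bar>) powr (p - 2) * (v2 x)\<^sup>2) \<partial>lebesgue)"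

definition triangulation_of :: "(real^'n) set \<Rightarrow> (real^'n) set set \<Rightarrow> bool" where
  "triangulation_of \<Omega> \<T> \<longleftrightarrow>
     triangulation \<T> \<and> (\<forall>K\<in>\<T>. int CARD('n) simplex K) \<and> \<Union>\<T> = closure \<Omega>"

definition mesh_size :: "(real^'n) set set \<Rightarrow> real" where
  "mesh_size \<T> = Max (diameter ` \<T>)"

definition vertices_of :: "(real^'n) set set \<Rightarrow> (real^'n) set" where
  "vertices_of \<T> = {a. \<exists>K\<in>\<T>. a extreme_point_of K}"

definition Sh :: "(real^'n) set \<Rightarrow> (real^'n) set set \<Rightarrow> (real^'n \<Rightarrow> real) set" where
  "Sh \<Omega> \<T> = {\<phi>. continuous_on (closure \<Omega>) \<phi> \<and>
                 (\<forall>K\<in>\<T>. \<exists>(a::real^'n) (b::real). \<forall>x\<in>K. \<phi> x = a \<bullet> x + b) \<and>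
                 (\<forall>x. x \<notin> \<Omega> \<longrightarrow> \<phi> x = 0)}"

definition interp :: "(real^'n) set \<Rightarrow> (real^'n) set set \<Rightarrow> (real^'n \<Rightarrow> real) \<Rightarrow> (real^'n \<Rightarrow> real)" where
  "interp \<Omega> \<T> v = (THE \<phi>. \<phi> \<in> Sh \<Omega> \<T> \<and> (\<forall>a\<in>vertices_of \<T>. \<phi> a = v a))"

definition ritz :: "real \<Rightarrow> (real^'n) set \<Rightarrow> (real^'n) set set \<Rightarrow> (real^'n \<Rightarrow> real) \<Rightarrow> (real^'n \<Rightarrow> real)" where
  "ritz s \<Omega> \<T> v = (THE p. p \<in> Sh \<Omega> \<T> \<and> (\<forall>\<zeta>\<in>Sh \<Omega> \<T>. frac_form s (\<lambda>x. v x - p x) \<zeta> = 0))"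

definition discrete_solution ::
  "real \<Rightarrow> real \<Rightarrow> (real^'n) set \<Rightarrow> (real^'n) set set \<Rightarrow> real \<Rightarrow> nat
   \<Rightarrow> (real^'n \<Rightarrow> real) \<Rightarrow> (nat \<Rightarrow> real^'n \<Rightarrow> real) \<Rightarrow> bool" where
  "discrete_solution s m \<Omega> \<T> \<tau> M w0 W \<longleftrightarrow>
     W 0 = (\<lambda>x. inv (psi m) (interp \<Omega> \<T> (\<lambda>y. psi m (w0 y)) x)) \<and>
     (\<forall>n\<in>{1..M}. W n \<in> Sh \<Omega> \<T> \<and>
        (\<forall>\<zeta>\<in>Sh \<Omega> \<T>.
           L2_inner (\<lambda>x. (psi m (W n x) - psi m (W (n - 1) x)) / \<tau>) \<zeta> + frac_form s (W n) \<zeta> = 0))"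

text \<open>Piecewise constant in time extension: W(.,0) = W_0, W(.,t) = W_n on (t_{n-1}, t_n].\<close>

definition step_ext :: "real \<Rightarrow> (nat \<Rightarrow> real^'n \<Rightarrow> real) \<Rightarrow> real^'n \<Rightarrow> real \<Rightarrow> real" where
  "step_ext \<tau> W x t = W (nat \<lceil>t / \<tau>\<rceil>) x"

definition test_fun :: "(real^'n) set \<Rightarrow> (real^'n \<Rightarrow> real \<Rightarrow> real) \<Rightarrow> bool" where
  "test_fun \<Omega> \<phi> \<longleftrightarrow>
     (\<exists>D :: ((real^'n) \<times> real) \<Rightarrow> ((real^'n) \<times> real) \<Rightarrow>\<^sub>L real.
        (\<forall>p. ((\<lambda>q. \<phi> (fst q) (snd q)) has_derivative blinfun_apply (D p)) (at p)) \<and>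
        continuous_on UNIV D) \<and>
     (\<exists>C. compact C \<and> C \<subseteq> \<Omega> \<and> (\<forall>x t. x \<notin> C \<longrightarrow> \<phi> x t = 0))"

text \<open>Weak solution of u_t = -(-Delta)^s(|u|^{m-1}u), u = 0 outside Omega, u(.,0) = u0,
with w = |u|^{m-1}u in L^2(0,T;H^s(R^N)).\<close>

definition weak_solution ::
  "real \<Rightarrow> real \<Rightarrow> real \<Rightarrow> (real^'n) set \<Rightarrow> (real^'n \<Rightarrow> real) \<Rightarrow> (real^'n \<Rightarrow> real \<Rightarrow> real) \<Rightarrow> bool" where
  "weak_solution s m T \<Omega> u0 u \<longleftrightarrow>
     (\<lambda>p. u (fst p) (snd p)) \<in> borel_measurable lborel \<and>
     (\<forall>x t. x \<notin> \<Omega> \<and> t \<in> {0<..T} \<longrightarrow> u x t = 0) \<and>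
     (\<integral>\<^sup>+ t\<in>{0..T}. (\<integral>\<^sup>+ x. ennreal \<bar>u x t\<bar> \<partial>lebesgue) \<partial>lborel) < \<infinity> \<and>
     (\<integral>\<^sup>+ t\<in>{0..T}. (\<integral>\<^sup>+ x. ennreal ((pw m (u x t))\<^sup>2) \<partial>lebesgue)
                       + gagliardo_sq s (\<lambda>x. pw m (u x t)) \<partial>lborel) < \<infinity> \<and>
     (\<forall>\<phi>. test_fun \<Omega> \<phi> \<and> (\<forall>x. \<phi> x T = 0) \<longrightarrow>
        - (LINT t:{0..T}|lborel. (\<integral>x. u x t * deriv (\<lambda>\<sigma>. \<phi> x \<sigma>) t \<partial>lebesgue))
        + (LINT t:{0..T}|lborel. frac_form s (\<lambda>x. pw m (u x t)) (\<lambda>x. \<phi> x t))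
        = (\<integral>x. u0 x * \<phi> x 0 \<partial>lebesgue))"

end

theory Submission imports Defs begin

text \<open>Expanding in a basis of the finite element space that is orthonormal for the fractional form turns
  the Ritz projection into a coordinate map and both the weak and the discrete equation, integrated in time,
  into identities for moments of u and psi(W). Subtracting them and testing with the increment of the
  time-integrated error over the n-th step yields a telescoping sum of squares, while monotonicity of psi and Young's
  inequality for the quasi-norm bound the nonlinear term from below. The solution at a grid point need not be
  related to the solution at nearby times, so it is compared with an affine extrapolation
  of u from two times in the step at which w is close to w(t_n) and the moment identities hold.\<close>

section \<open>Pointwise inequalities for the quasi-norm\<close>

text \<open>The weak equation does not see the grid value w_n, so w_n serves only as a reference
  point: it controls how far generic values of w within one step lie from each other in the
  quasi-norm. The equation is needed at the end of the step, however, and there the extrapolated u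
  satisfies the moment identity only up to a defect. This defect has to be bounded as a sum of
  squared coordinates, without any power of 1/\<tau>. That is possible because the defect is the
  integral of P_h w(r) minus its mean over [t1,t2]. Its square therefore grows at the rate of defect
  times derivative, and this product pairs the extrapolation error of u with an increment of P_h w,
  which monotonicity of psi bounds by quasi-norm errors. Young's inequality with weight 1/2 then
  costs half the square of the coordinate increment, exactly the surplus of the telescoping
  identity. All constants come from pointwise inequalities in m and from the Poincare inequality on
  \<Omega>, hence their independence of h and \<tau>.\<close>

lemma one_plus_mult_le_powr:
  fixes t q :: real
  assumes "1 \<le> q" "0 \<le> t" "t \<le> 1"
  shows "1 + q * (t - 1) \<le> t powr q"
proof (cases "t = 0")
  case True
  then show ?thesis using assms by simp
next
  case False
  then have t: "t > 0" using assms by simp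
  have "1 powr q - q * 1 \<le> t powr q - q * t"
  proof (rule DERIV_nonpos_imp_nonincreasing[where f = "\<lambda>x. x powr q - q * x"])
    show "\<exists>y. ((\<lambda>x. x powr q - q * x) has_real_derivative y) (at x) \<and> y \<le> 0" if "t \<le> x" "x \<le> 1" for x
    proof -
      have "x powr (q - 1) \<le> 1 powr (q - 1)" using that t assms by (intro powr_mono2) auto
      then have "q * x powr (q - 1) - q \<le> 0" using assms by (simp add: mult_left_le)
      then show ?thesis using that t
        by (intro exI[of _ "q * x powr (q - 1) - q"]) (auto intro!: derivative_eq_intros)
    qed
  qed (use assms in auto)
  then show ?thesis by (simp add: algebra_simps)
qed

text \<open>For \<open>q < 1\<close> the lower bound is Bernoulli's inequality with exponent
  \<open>1/q\<close> at the point \<open>t powr q\<close>; the remaining bounds are Bernoulli itself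
  and the comparison of \<open>t\<close> with \<open>t powr q\<close>.\<close>

lemma one_minus_powr_bounds:
  fixes t q :: real
  assumes "0 < q" "0 \<le> t" "t \<le> 1"
  shows "min 1 q * (1 - t) \<le> 1 - t powr q" "1 - t powr q \<le> max 1 q * (1 - t)"
proof -
  have "min 1 q * (1 - t) \<le> 1 - t powr q \<and> 1 - t powr q \<le> max 1 q * (1 - t)"
  proof (cases "1 \<le> q")
    case True
    have "t powr q \<le> t"
      using powr_mono'[of 1 q t] True assms by simp
    then show ?thesis using one_plus_mult_le_powr[OF True assms(2,3)] True
      by (simp add: algebra_simps)
  next
    case False
    have "t \<le> t powr q"
      using powr_mono'[of q 1 t] False assms by simp
    moreover have "1 + (1/q) * (t powr q - 1) \<le> (t powr q) powr (1/q)"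
      using False assms by (intro one_plus_mult_le_powr) (auto simp: powr_le1)
    then have "1 + (1/q) * (t powr q - 1) \<le> t"
      using assms by (simp add: powr_powr)
    then have "q + (t powr q - 1) \<le> q * t"
      using assms by (simp add: field_simps)
    ultimately show ?thesis using False by (simp add: algebra_simps min_def max_def)
  qed
  then show "min 1 q * (1 - t) \<le> 1 - t powr q" "1 - t powr q \<le> max 1 q * (1 - t)" by auto
qed

text \<open>By homogeneity: after division by \<open>b powr q\<close> only the ratio
  \<open>a / b\<close> in [0,1] remains.\<close>

lemma powr_diff_bounds:
  fixes a b q :: real
  assumes "0 < q" "0 \<le> a" "a \<le> b" "0 < b"
  shows "min 1 q * (b powr (q - 1) * (b - a)) \<le> b powr q - a powr q"
    and "b powr q - a powr q \<le> max 1 q * (b powr (q - 1) * (b - a))"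
proof -
  have 1: "b powr q - a powr q = b powr q * (1 - (a / b) powr q)"
    using assms by (simp add: powr_divide algebra_simps)
  have 2: "b powr (q - 1) * (b - a) = b powr q * (1 - a / b)"
    using assms by (simp add: powr_diff field_simps)
  have 3: "0 \<le> a / b" "a / b \<le> 1" using assms by auto
  note bd = one_minus_powr_bounds[OF assms(1) 3]
  show "min 1 q * (b powr (q - 1) * (b - a)) \<le> b powr q - a powr q"
    unfolding 1 2 using mult_left_mono[OF bd(1), of "b powr q"] by (simp add: mult_ac)
  show "b powr q - a powr q \<le> max 1 q * (b powr (q - 1) * (b - a))"
    unfolding 1 2 using mult_left_mono[OF bd(2), of "b powr q"] by (simp add: mult_ac)
qed

text \<open>The integrand of the squared quasi-norm for p = (m + 1) / m, since p - 2 = (1 - m) / m.\<close>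

definition shifted_sq :: "real \<Rightarrow> real \<Rightarrow> real \<Rightarrow> real" where
  "shifted_sq m a x = (\<bar>a\<bar> + \<bar>x\<bar>) powr ((1 - m) / m) * x\<^sup>2"

lemma shifted_sq_nonneg [simp]: "0 \<le> shifted_sq m a x"
  by (simp add: shifted_sq_def)

lemma shifted_sq_minus [simp]: "shifted_sq m a (- x) = shifted_sq m a x"
  by (simp add: shifted_sq_def)

lemma shifted_sq_commute: "shifted_sq m a (x - y) = shifted_sq m a (y - x)"
  using shifted_sq_minus[of m a "x - y"] by simp

lemma psi_nonneg_arg: "0 < m \<Longrightarrow> 0 \<le> y \<Longrightarrow> psi m y = y powr (1 / m)"
proof -
  assume "0 < m" "0 \<le> y"
  moreover have "(1 - m) / m = 1 / m - 1" using \<open>0 < m\<close> by (simp add: field_simps)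
  ultimately show ?thesis by (cases "y = 0") (simp_all add: psi_def powr_diff)
qed

lemma psi_minus [simp]: "psi m (- y) = - psi m y"
  by (simp add: psi_def)

text \<open>Both sides are symmetric in a and b and invariant under a simultaneous change of sign,
  so it suffices to treat \<open>\<bar>a\<bar> \<le> b\<close>, where the maximum is b.\<close>

lemma psi_diff_max_bounds:
  assumes "0 < m"
  shows "\<exists>c>0. \<exists>C>0. \<forall>a b. c * (max \<bar>a\<bar> \<bar>b\<bar> powr ((1 - m) / m) * (b - a)\<^sup>2) \<le> (psi m b - psi m a) * (b - a)
      \<and> \<bar>psi m b - psi m a\<bar> \<le> C * (max \<bar>a\<bar> \<bar>b\<bar> powr ((1 - m) / m) * \<bar>b - a\<bar>)"
proof -
  define r where "r = (1 - m) / m"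
  define q where "q = 1 / m"
  have rq: "r = q - 1" "0 < q" using assms by (simp_all add: r_def q_def field_simps)
  \<comment> \<open>\<open>min 1 q\<close> and \<open>max 1 q\<close> serve arguments of equal sign.
    The values 1/2 and 2 serve opposite signs, where nothing cancels: the difference of psi lies
    between \<open>b powr q\<close> and twice that, and \<open>b - a\<close> between b and 2
    b.\<close>
  define c where "c = min (1/2) (min 1 q)"
  define C where "C = max 2 (max 1 q)"
  have cC: "0 < c" "0 < C" using rq by (simp_all add: c_def C_def)
  let ?P = "\<lambda>a b. c * (max \<bar>a\<bar> \<bar>b\<bar> powr r * (b - a)\<^sup>2) \<le> (psi m b - psi m a) * (b - a)
      \<and> \<bar>psi m b - psi m a\<bar> \<le> C * (max \<bar>a\<bar> \<bar>b\<bar> powr r * \<bar>b - a\<bar>)"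
  have pos: "?P a b" if ab: "\<bar>a\<bar> \<le> b" "0 < b" for a b
  proof -
    have mx: "max \<bar>a\<bar> \<bar>b\<bar> = b" using ab by simp
    have b: "psi m b = b powr q" using psi_nonneg_arg[OF assms, of b] ab by (simp add: q_def)
    have ba: "b - a \<ge> 0" using ab by simp
    have main: "c * (b powr r * (b - a)) \<le> psi m b - psi m a \<and> psi m b - psi m a \<le> C * (b powr r * (b - a))"
    proof (cases "0 \<le> a")
      case True
      have a: "psi m a = a powr q" using psi_nonneg_arg[OF assms, of a] True by (simp add: q_def)
      note bd = powr_diff_bounds[OF rq(2) True _ ab(2)]
      have "0 \<le> b powr r * (b - a)" using ba by simp
      then have "c * (b powr r * (b - a)) \<le> min 1 q * (b powr r * (b - a))"
        "max 1 q * (b powr r * (b - a)) \<le> C * (b powr r * (b - a))"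
        using rq by (auto intro!: mult_right_mono simp: c_def C_def simp del: mult_le_cancel_right)
      moreover have "a \<le> b" using ab by simp
      ultimately show ?thesis using bd unfolding a b rq(1) by linarith
    next
      case False
      have a: "psi m a = - ((-a) powr q)" using psi_nonneg_arg[OF assms, of "-a"] False by (simp add: q_def)
      have bb: "b powr r * b = b powr q" using ab rq by (simp add: powr_diff)
      have aq: "0 \<le> (-a) powr q" "(-a) powr q \<le> b powr q"
        using ab False rq by (auto intro!: powr_mono2)
      have le: "b powr r * b \<le> b powr r * (b - a)" "b powr r * (b - a) \<le> b powr r * (2 * b)"
        using ab False by (auto intro!: mult_left_mono)
      have "c * (b powr r * (b - a)) \<le> (1/2) * (b powr r * (2 * b))"
        using le(2) cC ba ab by (intro mult_mono le(2)) (auto simp: c_def)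
      also have "\<dots> = b powr q" using bb by simp
      finally have 1: "c * (b powr r * (b - a)) \<le> b powr q" .
      have "2 * (b powr r * b) \<le> C * (b powr r * (b - a))"
        using le ba ab False by (intro mult_mono) (auto simp: C_def)
      then show ?thesis using 1 aq bb unfolding a b by linarith
    qed
    have "c * (b powr r * (b - a)) * (b - a) \<le> (psi m b - psi m a) * (b - a)"
      using main ba by (intro mult_right_mono) auto
    moreover have "0 \<le> c * (b powr r * (b - a))" using cC ba by simp
    ultimately show ?thesis using main ba mx by (simp add: power2_eq_square mult_ac)
  qed
  have "?P a b" for a b
  proof -
    consider "a = 0" "b = 0" | "\<bar>a\<bar> \<le> b" "0 < b" | "\<bar>a\<bar> \<le> -b" "0 < -b"
      | "\<bar>b\<bar> \<le> a" "0 < a" | "\<bar>b\<bar> \<le> -a" "0 < -a" by linarith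
    then show ?thesis
    proof cases
      case 1 then show ?thesis by simp
    next
      case 2 then show ?thesis by (rule pos)
    next
      case 3
      have "?P (-a) (-b)" using 3 by (intro pos) auto
      then show ?thesis by (simp add: power2_commute abs_minus_commute algebra_simps)
    next
      case 4
      have "?P b a" using 4 by (intro pos) auto
      then show ?thesis by (simp add: power2_commute abs_minus_commute max.commute algebra_simps)
    next
      case 5
      have "?P (-b) (-a)" using 5 by (intro pos) auto
      then show ?thesis by (simp add: power2_commute abs_minus_commute max.commute algebra_simps)
    qed
  qed
  then show ?thesis using cC unfolding r_def by blast
qed

text \<open>The ratio 3 is the one between the maximum of the moduli of a and b and
  \<open>\<bar>a\<bar> + \<bar>b - a\<bar>\<close>. A bounded ratio makes powers comparable for
  either sign of the exponent, and (1 - m) / m is negative when m > 1.\<close>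

lemma powr_comparable:
  fixes r :: real
  shows "\<exists>k>0. \<exists>K>0. \<forall>x y. 0 \<le> x \<and> x \<le> y \<and> y \<le> 3 * x \<longrightarrow> k * y powr r \<le> x powr r \<and> x powr r \<le> K * y powr r"
proof -
  have "min 1 (3 powr - r) * y powr r \<le> x powr r \<and> x powr r \<le> max 1 (3 powr - r) * y powr r"
    if xy: "0 \<le> x" "x \<le> y" "y \<le> 3 * x" for x y :: real
  proof (cases "x = 0")
    case True then show ?thesis using xy by simp
  next
    case False
    then have x: "x > 0" using xy by simp
    have 3: "3 powr - r * y powr r = (y / 3) powr r"
      using xy by (simp add: powr_divide powr_minus field_simps)
    show ?thesis
    proof (cases "0 \<le> r")
      case True
      have 1: "(y/3) powr r \<le> x powr r" "x powr r \<le> y powr r" using xy True x by (auto intro!: powr_mono2)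
      have "min 1 (3 powr - r) * y powr r \<le> 3 powr - r * y powr r"
        "1 * y powr r \<le> max 1 (3 powr - r) * y powr r" by (intro mult_right_mono; simp)+
      then show ?thesis using 1 3 by linarith
    next
      case False
      have 1: "x powr r \<le> (y/3) powr r" "y powr r \<le> x powr r" using xy False x by (auto intro!: powr_mono2')
      have "3 powr - r * y powr r \<le> max 1 (3 powr - r) * y powr r"
        "min 1 (3 powr - r) * y powr r \<le> 1 * y powr r" by (intro mult_right_mono; simp)+
      then show ?thesis using 1 3 by linarith
    qed
  qed
  then show ?thesis by (intro exI[of _ "min 1 (3 powr - r)"] exI[of _ "max 1 (3 powr - r)"] conjI) auto
qed

text \<open>With \<open>\<bar>a\<bar> + \<bar>b - a\<bar>\<close> in place of the maximum, the
  monotonicity bound takes the form of the quasi-norm integrand: a fixed shift a and an increment b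
  - a. Every later pointwise estimate rests on these two bounds.\<close>

lemma psi_diff_bounds:
  assumes "0 < m"
  obtains c C where "0 < c" "0 < C"
    "\<And>a b. c * shifted_sq m a (b - a) \<le> (psi m b - psi m a) * (b - a)"
    "\<And>a b. \<bar>psi m b - psi m a\<bar> \<le> C * ((\<bar>a\<bar> + \<bar>b - a\<bar>) powr ((1 - m) / m) * \<bar>b - a\<bar>)"
proof -
  let ?r = "(1 - m) / m"
  obtain c C where c: "0 < c" "0 < C"
    "\<And>a b. c * (max \<bar>a\<bar> \<bar>b\<bar> powr ?r * (b - a)\<^sup>2) \<le> (psi m b - psi m a) * (b - a)"
    "\<And>a b. \<bar>psi m b - psi m a\<bar> \<le> C * (max \<bar>a\<bar> \<bar>b\<bar> powr ?r * \<bar>b - a\<bar>)"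
    using psi_diff_max_bounds[OF assms] by blast
  obtain k K where k: "0 < k" "0 < K"
    "\<And>x y. 0 \<le> x \<Longrightarrow> x \<le> y \<Longrightarrow> y \<le> 3 * x \<Longrightarrow> k * y powr ?r \<le> x powr ?r \<and> x powr ?r \<le> K * y powr ?r"
    using powr_comparable[of ?r] by blast
  have cmp: "k * (\<bar>a\<bar> + \<bar>b - a\<bar>) powr ?r \<le> max \<bar>a\<bar> \<bar>b\<bar> powr ?r \<and> max \<bar>a\<bar> \<bar>b\<bar> powr ?r \<le> K * (\<bar>a\<bar> + \<bar>b - a\<bar>) powr ?r"
    for a b :: real by (rule k(3)) linarith+
  show ?thesis
  proof (rule that[of "c * k" "C * K"])
    show "c * k * shifted_sq m a (b - a) \<le> (psi m b - psi m a) * (b - a)" for a b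
    proof -
      have "c * (k * (\<bar>a\<bar> + \<bar>b - a\<bar>) powr ?r * (b - a)\<^sup>2) \<le> c * (max \<bar>a\<bar> \<bar>b\<bar> powr ?r * (b - a)\<^sup>2)"
        using cmp[of a b] c by (intro mult_left_mono mult_right_mono) auto
      then show ?thesis using c(3)[of a b] by (simp add: shifted_sq_def mult_ac)
    qed
    show "\<bar>psi m b - psi m a\<bar> \<le> C * K * ((\<bar>a\<bar> + \<bar>b - a\<bar>) powr ?r * \<bar>b - a\<bar>)" for a b
    proof -
      have "C * (max \<bar>a\<bar> \<bar>b\<bar> powr ?r * \<bar>b - a\<bar>) \<le> C * (K * (\<bar>a\<bar> + \<bar>b - a\<bar>) powr ?r * \<bar>b - a\<bar>)"
        using cmp[of a b] c by (intro mult_left_mono mult_right_mono) auto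
      then show ?thesis using c(4)[where a = a and b = b] by (simp add: mult_ac)
    qed
  qed (use c k in auto)
qed

text \<open>The first factor decreases when m > 1. Writing the product as
  \<open>(A + x) powr (1 / m)\<close> times \<open>x / (A + x)\<close> exhibits two increasing
  factors for every m.\<close>

lemma shifted_flux_mono:
  fixes A x y :: real
  assumes "0 < m" "0 \<le> A" "0 \<le> x" "x \<le> y"
  shows "(A + x) powr ((1 - m) / m) * x \<le> (A + y) powr ((1 - m) / m) * y"
proof (cases "x = 0")
  case True then show ?thesis using assms by simp
next
  case False
  have rq: "(1 - m) / m = 1 / m - 1" using assms by (simp add: field_simps)
  have e: "(A + z) powr ((1 - m) / m) * z = (A + z) powr (1 / m) * (z / (A + z))" if "0 < z" for z
    using that assms by (simp add: rq powr_diff)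
  have "x / (A + x) \<le> y / (A + y)" using assms False by (simp add: field_simps mult_left_mono)
  moreover have "(A + x) powr (1 / m) \<le> (A + y) powr (1 / m)" using assms by (intro powr_mono2) auto
  ultimately have "(A + x) powr (1 / m) * (x / (A + x)) \<le> (A + y) powr (1 / m) * (y / (A + y))"
    using assms by (intro mult_mono) auto
  then show ?thesis using e[of x] e[of y] False assms by simp
qed

text \<open>A Young inequality with the small constant on the difference of psi. Instead of
  conjugate functions a dichotomy is used: either x is small compared with b - a and the product is
  absorbed, or b - a is controlled by x and monotonicity of the flux applies.\<close>

lemma shifted_young:
  assumes "0 < m" "0 < \<epsilon>"
  obtains C where "0 < C"
    "\<And>a b x. \<bar>(psi m b - psi m a) * x\<bar> \<le> \<epsilon> * shifted_sq m a (b - a) + C * shifted_sq m a x"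
proof -
  let ?r = "(1 - m) / m"
  obtain C where C: "0 < C"
    "\<And>a b. \<bar>psi m b - psi m a\<bar> \<le> C * ((\<bar>a\<bar> + \<bar>b - a\<bar>) powr ?r * \<bar>b - a\<bar>)"
    using psi_diff_bounds[OF assms(1)] by metis
  \<comment> \<open>The threshold of the dichotomy: for y at most \<kappa> d the factor C \<kappa>
    is at most \<epsilon>, otherwise d is at most y / \<kappa> and the powers of 1 / \<kappa> go
    into \<open>D\<close>.\<close>
  define \<kappa> where "\<kappa> = min 1 (\<epsilon> / C)"
  have k: "0 < \<kappa>" "\<kappa> \<le> 1" "C * \<kappa> \<le> \<epsilon>" using C assms
    by (auto simp: \<kappa>_def min_def field_simps)
  define D where "D = C * (1 / \<kappa>) * max 1 ((1 / \<kappa>) powr ?r)"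
  have D: "0 < D" using C k by (simp add: D_def)
  have main: "C * ((A + d) powr ?r * d) * y \<le> \<epsilon> * ((A + d) powr ?r * d\<^sup>2) + D * ((A + y) powr ?r * y\<^sup>2)"
    if A: "0 \<le> A" "0 \<le> d" "0 \<le> y" for A d y :: real
  proof (cases "y \<le> \<kappa> * d")
    case True
    have "C * ((A + d) powr ?r * d) * y \<le> C * ((A + d) powr ?r * d) * (\<kappa> * d)"
      using True A C by (intro mult_left_mono) auto
    also have "\<dots> = (C * \<kappa>) * ((A + d) powr ?r * d\<^sup>2)" by (simp add: power2_eq_square mult_ac)
    also have "\<dots> \<le> \<epsilon> * ((A + d) powr ?r * d\<^sup>2)" using k by (intro mult_right_mono) auto
    moreover have "0 \<le> D * ((A + y) powr ?r * y\<^sup>2)" using D by simp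
    ultimately show ?thesis by linarith
  next
    case False
    moreover have "0 \<le> \<kappa> * d" using A k by simp
    ultimately have y: "0 < y" "d \<le> y / \<kappa>" using A k by (linarith, simp add: field_simps)
    have "(A + d) powr ?r * d \<le> (A + y / \<kappa>) powr ?r * (y / \<kappa>)"
      using A y k by (intro shifted_flux_mono[OF assms(1)]) auto
    also have "(A + y / \<kappa>) powr ?r \<le> max 1 ((1 / \<kappa>) powr ?r) * (A + y) powr ?r"
    proof (cases "0 \<le> ?r")
      case True
      have "A \<le> A / \<kappa>" using A k by (simp add: le_divide_eq mult_left_le)
      then have "(A + y / \<kappa>) powr ?r \<le> ((1 / \<kappa>) * (A + y)) powr ?r"
        using A y k True by (intro powr_mono2) (auto simp: add_divide_distrib)
      also have "\<dots> = (1 / \<kappa>) powr ?r * (A + y) powr ?r" using A y k by (intro powr_mult)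
      also have "\<dots> \<le> max 1 ((1 / \<kappa>) powr ?r) * (A + y) powr ?r" by (intro mult_right_mono) auto
      finally show ?thesis .
    next
      case r: False
      have "y \<le> y / \<kappa>" using y k by (simp add: le_divide_eq mult_left_le)
      then have "(A + y / \<kappa>) powr ?r \<le> 1 * (A + y) powr ?r"
        using A y k r by (simp) (intro powr_mono2', auto)
      also have "\<dots> \<le> max 1 ((1 / \<kappa>) powr ?r) * (A + y) powr ?r" by (intro mult_right_mono) auto
      finally show ?thesis .
    qed
    finally have 1: "(A + d) powr ?r * d \<le> max 1 ((1 / \<kappa>) powr ?r) * (A + y) powr ?r * (y / \<kappa>)"
      using y k by (meson mult_right_mono divide_nonneg_nonneg less_imp_le order_trans)
    have "C * ((A + d) powr ?r * d) * y \<le> C * (max 1 ((1 / \<kappa>) powr ?r) * (A + y) powr ?r * (y / \<kappa>)) * y"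
      using 1 C y by (intro mult_right_mono mult_left_mono) auto
    also have "\<dots> = D * ((A + y) powr ?r * y\<^sup>2)" by (simp add: D_def power2_eq_square mult_ac)
    moreover have "0 \<le> \<epsilon> * ((A + d) powr ?r * d\<^sup>2)" using assms by simp
    ultimately show ?thesis by linarith
  qed
  show ?thesis
  proof (rule that[OF D])
    fix a b x
    have "\<bar>(psi m b - psi m a) * x\<bar> \<le> C * ((\<bar>a\<bar> + \<bar>b - a\<bar>) powr ?r * \<bar>b - a\<bar>) * \<bar>x\<bar>"
      using C(2)[of b a] by (simp add: abs_mult mult_right_mono)
    also have "\<dots> \<le> \<epsilon> * ((\<bar>a\<bar> + \<bar>b - a\<bar>) powr ?r * \<bar>b - a\<bar>\<^sup>2) + D * ((\<bar>a\<bar> + \<bar>x\<bar>) powr ?r * \<bar>x\<bar>\<^sup>2)"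
      by (rule main) auto
    finally show "\<bar>(psi m b - psi m a) * x\<bar> \<le> \<epsilon> * shifted_sq m a (b - a) + D * shifted_sq m a x"
      by (simp add: shifted_sq_def)
  qed
qed

text \<open>Monotonicity is tested with the increment x + y, and each summand is treated by Young
  with a quarter of the coercivity constant, so that half of the left side survives.\<close>

lemma shifted_sq_add:
  assumes "0 < m"
  obtains K where "0 < K"
    "\<And>a x y. shifted_sq m a (x + y) \<le> K * (shifted_sq m a x + shifted_sq m a y)"
proof -
  obtain c where c: "0 < c"
    "\<And>a b. c * shifted_sq m a (b - a) \<le> (psi m b - psi m a) * (b - a)"
    using psi_diff_bounds[OF assms] by metis
  obtain C where C: "0 < C"
    "\<And>a b x. \<bar>(psi m b - psi m a) * x\<bar> \<le> (c/4) * shifted_sq m a (b - a) + C * shifted_sq m a x"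
    using shifted_young[OF assms, of "c/4"] c by auto
  show ?thesis
  proof (rule that[of "2 * C / c"])
    fix a x y
    let ?d = "psi m (a + (x + y)) - psi m a"
    have "c * shifted_sq m a (x + y) \<le> ?d * x + ?d * y"
      using c(2)[of a "a + (x + y)"] by (simp add: algebra_simps)
    moreover have "?d * x \<le> (c/4) * shifted_sq m a (x + y) + C * shifted_sq m a x"
      using C(2)[of "a + (x + y)" a x] by simp
    moreover have "?d * y \<le> (c/4) * shifted_sq m a (x + y) + C * shifted_sq m a y"
      using C(2)[of "a + (x + y)" a y] by simp
    ultimately have "(c/2) * shifted_sq m a (x + y) \<le> C * (shifted_sq m a x + shifted_sq m a y)"
      by (simp add: algebra_simps)
    then show "shifted_sq m a (x + y) \<le> 2 * C / c * (shifted_sq m a x + shifted_sq m a y)"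
      using c by (simp add: field_simps)
  qed (use c C in auto)
qed

text \<open>The coercive product at shift b is split by inserting \<open>psi m a\<close>; both parts
  are then Young products at shift a.\<close>

lemma shifted_sq_change_shift:
  assumes "0 < m"
  obtains K where "0 < K"
    "\<And>a b x. shifted_sq m b x \<le> K * (shifted_sq m a x + shifted_sq m a (a - b))"
proof -
  obtain c where c: "0 < c"
    "\<And>a b. c * shifted_sq m a (b - a) \<le> (psi m b - psi m a) * (b - a)"
    using psi_diff_bounds[OF assms] by metis
  obtain C where C: "0 < C"
    "\<And>a b x. \<bar>(psi m b - psi m a) * x\<bar> \<le> 1 * shifted_sq m a (b - a) + C * shifted_sq m a x"
    using shifted_young[OF assms, of 1] by auto
  obtain K where K: "0 < K"
    "\<And>a x y. shifted_sq m a (x + y) \<le> K * (shifted_sq m a x + shifted_sq m a y)"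
    using shifted_sq_add[OF assms] by blast
  show ?thesis
  proof (rule that[of "(K + 1 + 2 * C) / c"])
    fix a b x
    let ?q = "shifted_sq m a (a - b)" and ?x = "shifted_sq m a x"
    have "c * shifted_sq m b x \<le> (psi m (b + x) - psi m b) * x"
      using c(2)[of b "b + x"] by simp
    also have "\<dots> = (psi m (b + x) - psi m a) * x - (psi m b - psi m a) * x" by (simp add: algebra_simps)
    also have "\<dots> \<le> (shifted_sq m a (b + x - a) + C * ?x) + (shifted_sq m a (b - a) + C * ?x)"
      using C(2)[of "b + x" a x] C(2)[of b a x] by linarith
    also have "shifted_sq m a (b + x - a) \<le> K * (shifted_sq m a (b - a) + ?x)"
      using K(2)[of a "b - a" x] by (simp add: algebra_simps)
    also have "shifted_sq m a (b - a) = ?q" by (rule shifted_sq_commute)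
    finally have "c * shifted_sq m b x \<le> (K + 1) * ?q + (K + 2 * C) * ?x" by (simp add: algebra_simps)
    also have "\<dots> \<le> (K + 1 + 2 * C) * ?q + (K + 1 + 2 * C) * ?x"
      using C(1) by (intro add_mono[OF mult_right_mono mult_right_mono]) auto
    also have "\<dots> = (K + 1 + 2 * C) * (?x + ?q)" by (simp add: algebra_simps)
    finally show "shifted_sq m b x \<le> (K + 1 + 2 * C) / c * (?x + ?q)"
      using c by (simp add: field_simps)
  qed (use c C K in auto)
qed

text \<open>Up to one constant, \<open>shifted_sq m a (a - b)\<close> behaves like a squared
  distance between a and b: symmetry is a change of shift, and the triangle inequality combines the
  quasi-additivity with a change of shift.\<close>

lemma shifted_quasi_metric:
  assumes "0 < m"
  obtains K where "1 \<le> K"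
    "\<And>a x y. shifted_sq m a (x + y) \<le> K * (shifted_sq m a x + shifted_sq m a y)"
    "\<And>a b x. shifted_sq m b x \<le> K * (shifted_sq m a x + shifted_sq m a (a - b))"
    "\<And>a b. shifted_sq m a (a - b) \<le> K * shifted_sq m b (b - a)"
    "\<And>a b c. shifted_sq m a (a - c) \<le> K * (shifted_sq m a (a - b) + shifted_sq m b (b - c))"
proof -
  obtain K1 where K1: "0 < K1"
    "\<And>a x y. shifted_sq m a (x + y) \<le> K1 * (shifted_sq m a x + shifted_sq m a y)"
    using shifted_sq_add[OF assms] by blast
  obtain K2 where K2: "0 < K2"
    "\<And>a b x. shifted_sq m b x \<le> K2 * (shifted_sq m a x + shifted_sq m a (a - b))"
    using shifted_sq_change_shift[OF assms] by blast
  have sym: "shifted_sq m a (a - b) \<le> (2 * K2) * shifted_sq m b (b - a)" for a b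
    using K2(2)[of a "a - b" b] by (simp add: shifted_sq_commute[of m b a b] algebra_simps)
  have tri: "shifted_sq m a (a - c) \<le> (K1 * (1 + K2 + 2 * K2 * K2)) * (shifted_sq m a (a - b) + shifted_sq m b (b - c))" for a b c
  proof -
    have "shifted_sq m a (a - c) \<le> K1 * (shifted_sq m a (a - b) + shifted_sq m a (b - c))"
      using K1(2)[of a "a - b" "b - c"] by simp
    also have "shifted_sq m a (b - c) \<le> K2 * (shifted_sq m b (b - c) + shifted_sq m b (b - a))"
      by (rule K2(2))
    also have "shifted_sq m b (b - a) \<le> (2 * K2) * shifted_sq m a (a - b)" by (rule sym)
    finally have "shifted_sq m a (a - c) \<le> K1 * (shifted_sq m a (a - b) + K2 * (shifted_sq m b (b - c) + 2 * K2 * shifted_sq m a (a - b)))"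
      using K1(1) K2(1) by simp
    also have "\<dots> = K1 * ((1 + 2 * K2 * K2) * shifted_sq m a (a - b) + K2 * shifted_sq m b (b - c))"
      by (simp add: algebra_simps)
    also have "\<dots> \<le> K1 * ((1 + K2 + 2 * K2 * K2) * shifted_sq m a (a - b) + (1 + K2 + 2 * K2 * K2) * shifted_sq m b (b - c))"
      using K1(1) K2(1) by (intro mult_left_mono add_mono mult_right_mono) auto
    finally show ?thesis by (simp add: algebra_simps)
  qed
  define K where "K = 1 + K1 + 2 * K2 + K1 * (1 + K2 + 2 * K2 * K2)"
  have le: "1 \<le> K" "K1 \<le> K" "K2 \<le> K" "2 * K2 \<le> K" "K1 * (1 + K2 + 2 * K2 * K2) \<le> K"
    using K1(1) K2(1) by (auto simp: K_def)
  show ?thesis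
  proof (rule that[of K])
    fix a b c x y
    show "shifted_sq m a (x + y) \<le> K * (shifted_sq m a x + shifted_sq m a y)"
      by (rule order_trans[OF K1(2)]) (intro mult_right_mono le add_nonneg_nonneg shifted_sq_nonneg)
    show "shifted_sq m b x \<le> K * (shifted_sq m a x + shifted_sq m a (a - b))"
      by (rule order_trans[OF K2(2)[of _ _ a]]) (intro mult_right_mono le add_nonneg_nonneg shifted_sq_nonneg)
    show "shifted_sq m a (a - b) \<le> K * shifted_sq m b (b - a)"
      by (rule order_trans[OF sym]) (intro mult_right_mono le add_nonneg_nonneg shifted_sq_nonneg)
    show "shifted_sq m a (a - c) \<le> K * (shifted_sq m a (a - b) + shifted_sq m b (b - c))"
      by (rule order_trans[OF tri[of _ _ b]]) (intro mult_right_mono le add_nonneg_nonneg shifted_sq_nonneg)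
  qed (rule le)
qed

text \<open>The counterpart of \<open>shifted_young\<close> with the small constant on the free
  factor x and the large one on the difference of psi. Both versions are needed, since the term to
  be absorbed appears sometimes inside psi and sometimes outside.\<close>

lemma shifted_young_dual:
  assumes "0 < m" "0 < \<epsilon>"
  obtains C where "0 < C"
    "\<And>a b x. \<bar>(psi m b - psi m a) * x\<bar> \<le> \<epsilon> * shifted_sq m a x + C * shifted_sq m a (b - a)"
proof -
  let ?r = "(1 - m) / m"
  obtain C where C: "0 < C"
    "\<And>a b. \<bar>psi m b - psi m a\<bar> \<le> C * ((\<bar>a\<bar> + \<bar>b - a\<bar>) powr ?r * \<bar>b - a\<bar>)"
    using psi_diff_bounds[OF assms(1)] by metis
  \<comment> \<open>The entry \<open>\<epsilon> / C\<close> serves a nonnegative exponent. For a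
    negative exponent scaling produces \<open>\<kappa> powr (1 / m)\<close>, which the entry
    \<open>(\<epsilon> / C) powr m\<close> keeps below \<open>\<epsilon> / C\<close>.\<close>
  define \<kappa> where "\<kappa> = min 1 (min (\<epsilon> / C) ((\<epsilon> / C) powr m))"
  have k: "0 < \<kappa>" "\<kappa> \<le> 1" "\<kappa> \<le> \<epsilon> / C" using C assms by (auto simp: \<kappa>_def)
  have "\<kappa> powr (1 / m) \<le> ((\<epsilon> / C) powr m) powr (1 / m)"
    using k assms by (intro powr_mono2) (auto simp: \<kappa>_def)
  then have k2: "\<kappa> powr (1 / m) \<le> \<epsilon> / C" using assms C by (simp add: powr_powr)
  define D where "D = C / \<kappa>"
  have D: "0 < D" using C k by (simp add: D_def)
  have main: "C * ((A + d) powr ?r * d) * y \<le> \<epsilon> * ((A + y) powr ?r * y\<^sup>2) + D * ((A + d) powr ?r * d\<^sup>2)"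
    if A: "0 \<le> A" "0 \<le> d" "0 \<le> y" for A d y :: real
  proof (cases "\<kappa> * y \<le> d")
    case True
    have "y \<le> d / \<kappa>" using True k by (simp add: field_simps)
    then have "C * ((A + d) powr ?r * d) * y \<le> C * ((A + d) powr ?r * d) * (d / \<kappa>)"
      using A C by (intro mult_left_mono) auto
    also have "\<dots> = D * ((A + d) powr ?r * d\<^sup>2)" by (simp add: D_def power2_eq_square mult_ac)
    finally show ?thesis using assms A by (simp add: add_increasing)
  next
    case False
    have "0 \<le> \<kappa> * d" using A k by simp
    have y: "0 < y" using False A k
      by (metis linorder_not_le mult_eq_0_iff order_antisym_conv)
    have "(A + d) powr ?r * d \<le> (A + \<kappa> * y) powr ?r * (\<kappa> * y)"
      using A False by (intro shifted_flux_mono[OF assms(1)]) auto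
    also have "\<dots> \<le> (\<epsilon> / C) * ((A + y) powr ?r * y)"
    proof (cases "0 \<le> ?r")
      case True
      have "\<kappa> * y \<le> y" using k y by simp
      then have "(A + \<kappa> * y) powr ?r \<le> (A + y) powr ?r" using A y k True by (intro powr_mono2) auto
      then have "(A + \<kappa> * y) powr ?r * (\<kappa> * y) \<le> (A + y) powr ?r * ((\<epsilon> / C) * y)"
        using k y by (intro mult_mono) auto
      then show ?thesis by (simp add: mult_ac)
    next
      case r: False
      have "\<kappa> * A \<le> A" using k A by (simp add: mult_left_le_one_le)
      then have "(A + \<kappa> * y) powr ?r \<le> (\<kappa> * (A + y)) powr ?r"
        using A y k r by (intro powr_mono2') (auto simp: distrib_left intro!: add_nonneg_pos)
      also have "\<dots> = \<kappa> powr ?r * (A + y) powr ?r" using A y k by (simp add: powr_mult)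
      finally have "(A + \<kappa> * y) powr ?r * (\<kappa> * y) \<le> \<kappa> powr ?r * (A + y) powr ?r * (\<kappa> * y)"
        using k y by (intro mult_right_mono) auto
      also have "\<dots> = (\<kappa> powr ?r * \<kappa>) * ((A + y) powr ?r * y)" by simp
      also have "\<kappa> powr ?r * \<kappa> = \<kappa> powr (?r + 1)" using k by (simp add: powr_add)
      also have "?r + 1 = 1 / m" using assms by (simp add: field_simps)
      also have "\<kappa> powr (1 / m) * ((A + y) powr ?r * y) \<le> (\<epsilon> / C) * ((A + y) powr ?r * y)"
        using k2 y by (intro mult_right_mono) auto
      finally show ?thesis .
    qed
    finally have "C * ((A + d) powr ?r * d) * y \<le> C * ((\<epsilon> / C) * ((A + y) powr ?r * y)) * y"
      using C y by (intro mult_right_mono mult_left_mono) auto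
    also have "\<dots> = \<epsilon> * ((A + y) powr ?r * y\<^sup>2)" using C by (simp add: power2_eq_square)
    moreover have "0 \<le> D * ((A + d) powr ?r * d\<^sup>2)" using D by simp
    ultimately show ?thesis by linarith
  qed
  show ?thesis
  proof (rule that[OF D])
    fix a b x
    have "\<bar>(psi m b - psi m a) * x\<bar> \<le> C * ((\<bar>a\<bar> + \<bar>b - a\<bar>) powr ?r * \<bar>b - a\<bar>) * \<bar>x\<bar>"
      using C(2)[of b a] by (simp add: abs_mult mult_right_mono)
    also have "\<dots> \<le> \<epsilon> * ((\<bar>a\<bar> + \<bar>x\<bar>) powr ?r * \<bar>x\<bar>\<^sup>2) + D * ((\<bar>a\<bar> + \<bar>b - a\<bar>) powr ?r * \<bar>b - a\<bar>\<^sup>2)"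
      by (rule main) auto
    finally show "\<bar>(psi m b - psi m a) * x\<bar> \<le> \<epsilon> * shifted_sq m a x + D * shifted_sq m a (b - a)"
      by (simp add: shifted_sq_def)
  qed
qed

text \<open>Extrapolating psi by at most the length of the base interval moves the argument by no
  more than a multiple of the distance of the two base values: in the monotonicity bound at b the
  difference of psi is replaced by \<rho> times the known one, and the dual Young inequality absorbs
  the factor d - b.\<close>

lemma shifted_extrapolation:
  assumes "0 < m"
  obtains C where "0 < C"
    "\<And>a b d \<rho>. psi m d - psi m b = \<rho> * (psi m b - psi m a) \<Longrightarrow> 0 \<le> \<rho> \<Longrightarrow> \<rho> \<le> 1 \<Longrightarrow> 
       shifted_sq m b (b - d) \<le> C * shifted_sq m b (b - a)"
proof -
  obtain c where c: "0 < c"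
    "\<And>a b. c * shifted_sq m a (b - a) \<le> (psi m b - psi m a) * (b - a)"
    using psi_diff_bounds[OF assms] by metis
  obtain C where C: "0 < C"
    "\<And>a b x. \<bar>(psi m b - psi m a) * x\<bar> \<le> (c/2) * shifted_sq m a x + C * shifted_sq m a (b - a)"
    using shifted_young_dual[OF assms, of "c/2"] c by auto
  show ?thesis
  proof (rule that[of "2 * C / c"])
    fix a b d \<rho> assume h: "psi m d - psi m b = \<rho> * (psi m b - psi m a)" "0 \<le> \<rho>" "\<rho> \<le> 1"
    let ?X = "\<bar>(psi m a - psi m b) * (d - b)\<bar>"
    have "c * shifted_sq m b (d - b) \<le> (psi m d - psi m b) * (d - b)" by (rule c)
    also have "\<dots> = \<rho> * - ((psi m a - psi m b) * (d - b))" unfolding h(1) by (simp add: algebra_simps)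
    also have "\<dots> \<le> \<rho> * ?X" using h by (intro mult_left_mono) auto
    also have "\<dots> \<le> ?X" using h by (intro mult_left_le_one_le) auto
    also have "\<dots> \<le> (c/2) * shifted_sq m b (d - b) + C * shifted_sq m b (a - b)" by (rule C)
    finally show "shifted_sq m b (b - d) \<le> 2 * C / c * shifted_sq m b (b - a)"
      using c by (simp add: shifted_sq_commute[of m b d b] shifted_sq_commute[of m b a b] field_simps)
  qed (use c C in auto)
qed

text \<open>In the next three lemmas w stands for a value of the exact solution, V for one of
  the discrete solution, P for one of the Ritz projection, and va, wa for values of the
  extrapolated comparison function.\<close>

lemma error_pointwise_lower:
  assumes "0 < m"
  obtains c C where "0 < c" "0 < C"
    "\<And>w V P va. c * shifted_sq m w (w - V) \<le> (psi m va - psi m V) * (P - V)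
        + C * (shifted_sq m w (w - P) + shifted_sq m w (w - va))"
proof -
  obtain c where c: "0 < c"
    "\<And>a b. c * shifted_sq m a (b - a) \<le> (psi m b - psi m a) * (b - a)"
    using psi_diff_bounds[OF assms] by metis
  obtain C where C: "0 < C"
    "\<And>a b x. \<bar>(psi m b - psi m a) * x\<bar> \<le> (c/4) * shifted_sq m a (b - a) + C * shifted_sq m a x"
    using shifted_young[OF assms, of "c/4"] c by auto
  obtain D where D: "0 < D"
    "\<And>a b x. \<bar>(psi m b - psi m a) * x\<bar> \<le> (c/4) * shifted_sq m a x + D * shifted_sq m a (b - a)"
    using shifted_young_dual[OF assms, of "c/4"] c by auto
  have "(c/2) * shifted_sq m w (w - V) \<le> (psi m va - psi m V) * (P - V)
        + (C + 2 * D + c) * (shifted_sq m w (w - P) + shifted_sq m w (w - va))" for w V P va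
  proof -
    have 1: "c * shifted_sq m w (w - V) \<le> (psi m w - psi m V) * (w - V)"
      using c(2)[of w V] by (simp add: shifted_sq_commute[of m w V w] algebra_simps)
    have 2: "- ((psi m w - psi m V) * (P - w)) \<le> (c/4) * shifted_sq m w (w - V) + C * shifted_sq m w (w - P)"
      using C(2)[of V w "P - w"] by (simp add: shifted_sq_commute[of m w V w] shifted_sq_commute[of m w P w] algebra_simps)
    have 3: "- ((psi m va - psi m w) * (P - w)) \<le> (c/4) * shifted_sq m w (w - P) + D * shifted_sq m w (w - va)"
      using D(2)[of va w "P - w"] by (simp add: shifted_sq_commute[of m w va w] shifted_sq_commute[of m w P w] algebra_simps)
    have 4: "- ((psi m va - psi m w) * (w - V)) \<le> (c/4) * shifted_sq m w (w - V) + D * shifted_sq m w (w - va)"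
      using D(2)[of va w "w - V"] by (simp add: shifted_sq_commute[of m w va w] algebra_simps)
    \<comment> \<open>Only the first of the four products has a sign. The second and the fourth each
      cost a quarter of it, the third consists of projection and comparison errors alone.\<close>
    have 5: "(psi m va - psi m V) * (P - V) = (psi m w - psi m V) * (w - V) + (psi m w - psi m V) * (P - w)
       + (psi m va - psi m w) * (P - w) + (psi m va - psi m w) * (w - V)" by (simp add: algebra_simps)
    have "(c/2) * shifted_sq m w (w - V) \<le> (psi m va - psi m V) * (P - V)
        + (C + c/4) * shifted_sq m w (w - P) + (2 * D) * shifted_sq m w (w - va)"
      using 1 2 3 4 5 by (simp add: algebra_simps)
    also have "\<dots> \<le> (psi m va - psi m V) * (P - V)
        + (C + 2 * D + c) * shifted_sq m w (w - P) + (C + 2 * D + c) * shifted_sq m w (w - va)"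
      using c(1) C(1) D(1) by (intro add_mono[OF add_mono[OF order_refl mult_right_mono] mult_right_mono]) auto
    finally show ?thesis by (simp add: algebra_simps)
  qed
  then show ?thesis using c C D by (intro that[of "c/2" "C + 2 * D + c"]) auto
qed

lemma drift_pointwise_upper:
  assumes "0 < m"
  obtains C where "0 < C"
    "\<And>w w' P P' wa. - ((psi m w - psi m wa) * (P - P'))
        \<le> C * (shifted_sq m w (w - P) + shifted_sq m w' (w' - P') + shifted_sq m w' (w' - wa))"
proof -
  obtain K where K: "1 \<le> K"
    "\<And>a x y. shifted_sq m a (x + y) \<le> K * (shifted_sq m a x + shifted_sq m a y)"
    "\<And>a b x. shifted_sq m b x \<le> K * (shifted_sq m a x + shifted_sq m a (a - b))"
    "\<And>a b. shifted_sq m a (a - b) \<le> K * shifted_sq m b (b - a)"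
    "\<And>a b c. shifted_sq m a (a - c) \<le> K * (shifted_sq m a (a - b) + shifted_sq m b (b - c))"
    using shifted_quasi_metric[OF assms] by metis
  obtain c where c: "0 < c"
    "\<And>a b. c * shifted_sq m a (b - a) \<le> (psi m b - psi m a) * (b - a)"
    using psi_diff_bounds[OF assms] by metis
  have cK: "0 < c / (4 * K)" using c K by simp
  obtain C where C: "0 < C"
    "\<And>a b x. \<bar>(psi m b - psi m a) * x\<bar> \<le> (c/(4 * K)) * shifted_sq m a (b - a) + C * shifted_sq m a x"
    using shifted_young[OF assms cK] by auto
  show ?thesis
  proof (rule that[of "3 * C * K"])
    fix w w' P P' wa
    let ?q = "shifted_sq m w (w - wa)" and ?q' = "shifted_sq m w' (w' - wa)"
    have q0: "0 \<le> c * ?q" using c by simp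
    \<comment> \<open>This monotone product is the reservoir: three of the four quarters of
      \<open>c * ?q\<close> are spent below.\<close>
    have 0: "c * ?q \<le> (psi m w - psi m wa) * (w - wa)"
      using c(2)[of w wa] by (simp add: shifted_sq_commute[of m w wa w] algebra_simps)
    have qK: "c / (4 * K) * ?q \<le> c / 4 * ?q"
      using K c by (intro mult_right_mono) (auto simp: field_simps)
    have 1: "- ((psi m w - psi m wa) * (P - w)) \<le> (c/4) * ?q + C * shifted_sq m w (w - P)"
      using C(2)[of wa w "P - w"] qK
      by (simp add: shifted_sq_commute[of m w wa w] shifted_sq_commute[of m w P w] algebra_simps)
    have b: "c / (4 * K) * shifted_sq m wa (w - wa) \<le> c / 4 * ?q"
    proof -
      have "c / (4 * K) * shifted_sq m wa (wa - w) \<le> c / (4 * K) * (K * ?q)"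
        using cK by (intro mult_left_mono K(4)) auto
      then show ?thesis using K by (simp add: shifted_sq_commute[of m wa w wa])
    qed
    have 2: "- ((psi m w - psi m wa) * (wa - w')) \<le> (c/4) * ?q + C * shifted_sq m wa (wa - w')"
      using C(2)[of w wa "wa - w'"] b by linarith
    have 3: "- ((psi m w - psi m wa) * (w' - P')) \<le> (c/4) * ?q + C * shifted_sq m wa (w' - P')"
      using C(2)[of w wa "w' - P'"] b by linarith
    have 4: "C * shifted_sq m wa (wa - w') \<le> C * (K * ?q')"
      using C by (intro mult_left_mono K(4)) auto
    have 5: "C * shifted_sq m wa (w' - P') \<le> C * (K * (shifted_sq m w' (w' - P') + ?q'))"
      using C by (intro mult_left_mono K(3)) auto
    \<comment> \<open>P - P' is telescoped along the chain P, w, wa, w', P', which isolates the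
      monotone product.\<close>
    have 6: "(psi m w - psi m wa) * (P - P') = (psi m w - psi m wa) * (P - w) + (psi m w - psi m wa) * (w - wa)
      + (psi m w - psi m wa) * (wa - w') + (psi m w - psi m wa) * (w' - P')" by (simp add: algebra_simps)
    have "- ((psi m w - psi m wa) * (P - P')) \<le> C * shifted_sq m w (w - P) + C * (K * ?q') + C * (K * (shifted_sq m w' (w' - P') + ?q'))"
      using 0 1 2 3 4 5 6 q0 by linarith
    also have "\<dots> = (C * 1) * shifted_sq m w (w - P) + (C * K) * shifted_sq m w' (w' - P') + (2 * (C * K)) * ?q'"
      by (simp add: algebra_simps)
    also have "\<dots> \<le> (3 * C * K) * shifted_sq m w (w - P) + (3 * C * K) * shifted_sq m w' (w' - P') + (3 * C * K) * ?q'"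
    proof (rule add_mono[OF add_mono[OF mult_right_mono mult_right_mono] mult_right_mono])
      have "C * 1 \<le> C * K" using K C by (intro mult_left_mono) auto
      moreover have "0 \<le> C * K" using K C by simp
      ultimately show "C * 1 \<le> 3 * C * K" "C * K \<le> 3 * C * K" "2 * (C * K) \<le> 3 * C * K" by (simp_all add: mult.assoc)
    qed simp_all
    finally show "- ((psi m w - psi m wa) * (P - P'))
        \<le> 3 * C * K * (shifted_sq m w (w - P) + shifted_sq m w' (w' - P') + shifted_sq m w' (w' - wa))"
      by (simp add: algebra_simps)
  qed (use C K in auto)
qed

lemma extrapolation_pointwise:
  assumes "0 < m"
  obtains C where "0 < C"
    "\<And>w w1 w2 wa v \<rho>. psi m wa - psi m w2 = \<rho> * (psi m w2 - psi m w1) \<Longrightarrow> 0 \<le> \<rho> \<Longrightarrow> \<rho> \<le> 1 \<Longrightarrow>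
       shifted_sq m w (w - wa) \<le> C * (shifted_sq m w (w - v) + shifted_sq m w1 (w1 - v) + shifted_sq m w2 (w2 - v))"
proof -
  obtain K where K: "1 \<le> K"
    "\<And>a b. shifted_sq m a (a - b) \<le> K * shifted_sq m b (b - a)"
    "\<And>a b c. shifted_sq m a (a - c) \<le> K * (shifted_sq m a (a - b) + shifted_sq m b (b - c))"
    using shifted_quasi_metric[OF assms] by metis
  obtain E where E: "0 < E"
    "\<And>a b d \<rho>. psi m d - psi m b = \<rho> * (psi m b - psi m a) \<Longrightarrow> 0 \<le> \<rho> \<Longrightarrow> \<rho> \<le> 1 \<Longrightarrow> 
       shifted_sq m b (b - d) \<le> E * shifted_sq m b (b - a)"
    using shifted_extrapolation[OF assms] by metis
  let ?C = "K * (1 + K * (K + E * K * (1 + K)))"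
  show ?thesis
  proof (rule that[of ?C])
    fix w w1 w2 wa v \<rho>
    assume h: "psi m wa - psi m w2 = \<rho> * (psi m w2 - psi m w1)" "0 \<le> \<rho>" "\<rho> \<le> 1"
    let ?a = "shifted_sq m w (w - v)" and ?b = "shifted_sq m w1 (w1 - v)" and ?c = "shifted_sq m w2 (w2 - v)"
    let ?s = "?a + ?b + ?c"
    have s: "0 \<le> ?s" "?a \<le> ?s" "?b \<le> ?s" "?c \<le> ?s" by simp_all
    \<comment> \<open>The base values w1 and w2 are compared through the reference value v.
      Extrapolation then controls w2 to wa, and two more triangle inequalities lead from w through v
      and w2 to wa.\<close>
    have "shifted_sq m w2 (w2 - w1) \<le> K * (?c + shifted_sq m v (v - w1))" by (rule K(3))
    also have "shifted_sq m v (v - w1) \<le> K * ?b" by (rule K(2))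
    finally have "shifted_sq m w2 (w2 - w1) \<le> K * (?c + K * ?b)" using K(1) by simp
    also have "\<dots> \<le> K * (?s + K * ?s)" using s K(1) by (intro mult_left_mono add_mono) auto
    finally have "E * shifted_sq m w2 (w2 - w1) \<le> E * (K * (?s + K * ?s))" using E by simp
    then have 1: "shifted_sq m w2 (w2 - wa) \<le> E * (K * (?s + K * ?s))" using E(2)[OF h] by linarith
    have "shifted_sq m v (v - wa) \<le> K * (shifted_sq m v (v - w2) + shifted_sq m w2 (w2 - wa))" by (rule K(3))
    also have "\<dots> \<le> K * (K * ?s + E * (K * (?s + K * ?s)))"
    proof (intro mult_left_mono add_mono 1)
      have "K * ?c \<le> K * ?s" using s K(1) by (intro mult_left_mono) auto
      then show "shifted_sq m v (v - w2) \<le> K * ?s" using K(2)[of v w2] by linarith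
    qed (use K in auto)
    finally have 2: "shifted_sq m v (v - wa) \<le> K * (K * ?s + E * (K * (?s + K * ?s)))" .
    have "shifted_sq m w (w - wa) \<le> K * (?a + shifted_sq m v (v - wa))" by (rule K(3))
    also have "\<dots> \<le> K * (?s + K * (K * ?s + E * (K * (?s + K * ?s))))"
      using K(1) s 2 by (intro mult_left_mono add_mono) auto
    finally show "shifted_sq m w (w - wa) \<le> ?C * ?s" by (simp only: algebra_simps)
  qed (use K E in \<open>auto intro!: mult_pos_pos add_pos_nonneg\<close>)
qed

lemma psi_pw:
  assumes m: "0 < m"
  shows "psi m (pw m y) = y"
proof -
  have pos: "psi m (pw m y) = y" if "0 \<le> y" for y
  proof -
    have "pw m y = y powr m" using that by (cases "y = 0") (simp_all add: pw_def powr_diff)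
    then show ?thesis using that m by (simp add: psi_nonneg_arg powr_powr)
  qed
  have "pw m (- y) = - pw m y" by (simp add: pw_def)
  then show ?thesis using pos[of y] pos[of "- y"] by (cases "0 \<le> y") auto
qed

section \<open>Integration in time\<close>

text \<open>The chain rule for the square of a primitive. As f is merely integrable, it is obtained
  by Fubini: the square of the integral is the integral of f(r) f(s) over a square, whose two
  triangles contribute equally.\<close>

lemma square_integral_eq:
  fixes f :: "real \<Rightarrow> real"
  assumes f: "set_integrable lborel {a..b} f" and ab: "a \<le> b"
  shows "set_integrable lborel {a..b} (\<lambda>r. f r * (LINT s:{a..r}|lborel. f s))"
    and "(LINT r:{a..b}|lborel. f r)\<^sup>2 = 2 * (LINT r:{a..b}|lborel. f r * (LINT s:{a..r}|lborel. f s))"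
proof -
  define F where "F = (\<lambda>r. indicator {a..b} r * f r)"
  have F: "integrable lborel F" using f by (simp add: F_def set_integrable_def)
  have [measurable]: "F \<in> borel_measurable borel" using F by (simp add: borel_measurable_integrable)
  have FF: "integrable (lborel \<Otimes>\<^sub>M lborel) (\<lambda>(r, s). F r * F s)"
  proof (rule lborel_pair.Fubini_integrable)
    show "integrable lborel (\<lambda>x. \<integral>y. norm (case (x, y) of (r, s) \<Rightarrow> F r * F s) \<partial>lborel)"
      using F by (simp add: abs_mult)
    show "AE x in lborel. integrable lborel (\<lambda>y. case (x, y) of (r, s) \<Rightarrow> F r * F s)"
      using F by simp
  qed simp
  have 1: "integrable (lborel \<Otimes>\<^sub>M lborel) (\<lambda>(r, s). indicator {..r} s * (F r * F s))"
    by (rule Bochner_Integration.integrable_bound[OF FF]) (auto simp: indicator_def split_beta')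
  have 2: "integrable (lborel \<Otimes>\<^sub>M lborel) (\<lambda>(r, s). indicator {r<..} s * (F r * F s))"
    by (rule Bochner_Integration.integrable_bound[OF FF]) (auto simp: indicator_def split_beta')
  have inner: "indicator {a..b} r * (f r * (LINT s:{a..r}|lborel. f s)) = (LINT s|lborel. indicator {..r} s * (F r * F s))" for r
  proof (cases "r \<in> {a..b}")
    case True
    have "(LINT s|lborel. indicator {..r} s * (F r * F s)) = (LINT s|lborel. F r * (indicator {a..r} s * f s))"
      using True by (intro Bochner_Integration.integral_cong) (auto simp: F_def indicator_def)
    then show ?thesis using True by (simp add: F_def set_lebesgue_integral_def)
  qed (simp add: F_def)
  have "integrable lborel (\<lambda>r. LINT s|lborel. indicator {..r} s * (F r * F s))"
    using lborel_pair.integrable_fst[OF 1] by simp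
  then show "set_integrable lborel {a..b} (\<lambda>r. f r * (LINT s:{a..r}|lborel. f s))"
    unfolding set_integrable_def by (simp only: real_scaleR_def inner)
  have e1: "(LINT r:{a..b}|lborel. f r * (LINT s:{a..r}|lborel. f s)) = (LINT r|lborel. LINT s|lborel. indicator {..r} s * (F r * F s))"
    by (subst set_lebesgue_integral_def) (simp only: real_scaleR_def inner)
  have "(LINT r|lborel. LINT s|lborel. indicator {r<..} s * (F r * F s)) = (LINT s|lborel. LINT r|lborel. indicator {r<..} s * (F r * F s))"
    using lborel_pair.Fubini_integral[of "\<lambda>r s. indicator {r<..} s * (F r * F s)"] 2 by simp
  also have "\<dots> = (LINT s|lborel. LINT r|lborel. indicator {..s} r * (F s * F r))"
  proof (rule Bochner_Integration.integral_cong[OF refl])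
    fix s
    show "(LINT r|lborel. indicator {r<..} s * (F r * F s)) = (LINT r|lborel. indicator {..s} r * (F s * F r))"
    proof (rule integral_cong_AE)
      show "AE r in lborel. indicator {r<..} s * (F r * F s) = indicator {..s} r * (F s * F r)"
        using AE_lborel_singleton[of s] by eventually_elim (auto simp: indicator_def)
      have "{r. r < s} \<in> sets borel" by simp
      then have "(\<lambda>r. indicator {..<s} r * (F r * F s)) \<in> borel_measurable lborel" by simp
      then show "(\<lambda>r. indicator {r<..} s * (F r * F s)) \<in> borel_measurable lborel"
        by (simp add: indicator_def)
    qed simp
  qed
  finally have e2: "(LINT r|lborel. LINT s|lborel. indicator {r<..} s * (F r * F s)) = (LINT r|lborel. LINT s|lborel. indicator {..r} s * (F r * F s))" .
  have "(LINT r:{a..b}|lborel. f r)\<^sup>2 = (LINT r|lborel. F r) * (LINT s|lborel. F s)"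
    by (simp add: power2_eq_square set_lebesgue_integral_def F_def)
  also have "\<dots> = (LINT r|lborel. LINT s|lborel. F r * F s)" by simp
  also have "\<dots> = (\<integral>z. (case z of (r, s) \<Rightarrow> F r * F s) \<partial>(lborel \<Otimes>\<^sub>M lborel))"
    using lborel_pair.integral_fst[OF FF] by simp
  also have "\<dots> = (\<integral>z. (case z of (r, s) \<Rightarrow> indicator {..r} s * (F r * F s)) + (case z of (r, s) \<Rightarrow> indicator {r<..} s * (F r * F s)) \<partial>(lborel \<Otimes>\<^sub>M lborel))"
    by (intro Bochner_Integration.integral_cong) (auto simp: indicator_def)
  also have "\<dots> = (\<integral>z. (case z of (r, s) \<Rightarrow> indicator {..r} s * (F r * F s)) \<partial>(lborel \<Otimes>\<^sub>M lborel)) + (\<integral>z. (case z of (r, s) \<Rightarrow> indicator {r<..} s * (F r * F s)) \<partial>(lborel \<Otimes>\<^sub>M lborel))"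
    by (rule Bochner_Integration.integral_add[OF 1 2])
  also have "\<dots> = (LINT r|lborel. LINT s|lborel. indicator {..r} s * (F r * F s)) + (LINT r|lborel. LINT s|lborel. indicator {r<..} s * (F r * F s))"
    using lborel_pair.integral_fst[OF 1] lborel_pair.integral_fst[OF 2] by simp
  finally show "(LINT r:{a..b}|lborel. f r)\<^sup>2 = 2 * (LINT r:{a..b}|lborel. f r * (LINT s:{a..r}|lborel. f s))"
    using e1 e2 by simp
qed

text \<open>Supplies the two base times of the extrapolation: a value not above the mean is found
  inside the full-measure set where the equation holds.\<close>

lemma exists_le_mean:
  fixes f :: "real \<Rightarrow> real"
  assumes f: "set_integrable lborel {a..b} f" and ab: "a < b"
    and P: "AE t in lborel. t \<in> {a..b} \<longrightarrow> P t"
  shows "\<exists>t\<in>{a..b}. P t \<and> f t \<le> (LINT t:{a..b}|lborel. f t) / (b - a)"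
proof (rule ccontr)
  assume neg: "\<not> ?thesis"
  define k where "k = (LINT t:{a..b}|lborel. f t) / (b - a)"
  have gt: "AE t in lborel. t \<in> {a..b} \<longrightarrow> k < f t"
    using P by eventually_elim (use neg in \<open>auto simp: k_def not_le\<close>)
  have int: "integrable lborel (\<lambda>t. indicator {a..b} t * (f t - k))"
    using set_integral_diff(1)[OF f, of "\<lambda>_. k"] ab
    by (simp add: set_integrable_def)
  have "(LINT t:{a..b}|lborel. f t - k) = (LINT t:{a..b}|lborel. f t) - k * (b - a)"
    using set_integral_diff(2)[OF f, of "\<lambda>_. k"] ab by (simp add: set_integrable_def set_lebesgue_integral_def)
  then have "(LINT t|lborel. indicator {a..b} t * (f t - k)) = 0"
    using ab by (simp add: k_def set_lebesgue_integral_def)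
  moreover have "AE t in lborel. 0 \<le> indicator {a..b} t * (f t - k)"
    using gt by eventually_elim (auto simp: indicator_def)
  ultimately have "AE t in lborel. indicator {a..b} t * (f t - k) = 0"
    using integral_nonneg_eq_0_iff_AE[OF int] by simp
  then have "AE t in lborel. t \<notin> {a..b}" using gt
    by eventually_elim (auto simp: indicator_def)
  then have "emeasure lborel {a..b} = 0"
    by (subst (asm) AE_iff_measurable[of "{a..b}"]) auto
  then show False using ab by simp
qed

section \<open>Calculus of integrals over time intervals\<close>

lemma set_integral_le_AE:
  fixes f g :: "real \<Rightarrow> real"
  assumes "set_integrable lborel A f" "set_integrable lborel A g" "AE t in lborel. t \<in> A \<longrightarrow> f t \<le> g t"
  shows "(LINT t:A|lborel. f t) \<le> (LINT t:A|lborel. g t)"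
  unfolding set_lebesgue_integral_def
proof (rule integral_mono_AE)
  show "AE t in lborel. indicator A t *\<^sub>R f t \<le> indicator A t *\<^sub>R g t"
    using assms(3) by eventually_elim (auto simp: indicator_def)
qed (use assms in \<open>simp_all add: set_integrable_def\<close>)

lemma set_integrable_sub:
  fixes f :: "real \<Rightarrow> real"
  assumes "set_integrable lborel {l..R} f" "l \<le> a" "b \<le> R"
  shows "set_integrable lborel {a..b} f"
  by (rule set_integrable_subset[OF assms(1)]) (use assms in auto)

lemma set_integral_sub_le:
  fixes f :: "real \<Rightarrow> real"
  assumes "set_integrable lborel {l..R} f" "l \<le> a" "b \<le> R" "\<And>t. 0 \<le> f t"
  shows "(LINT t:{a..b}|lborel. f t) \<le> (LINT t:{l..R}|lborel. f t)"
  unfolding set_lebesgue_integral_def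
  using set_integrable_sub[OF assms(1-3)] assms
  by (intro integral_mono) (auto simp: set_integrable_def indicator_def)

lemma set_integrable_const_Icc [simp]: "set_integrable lborel {a..b::real} (\<lambda>_. k :: real)"
proof -
  have "integrable lborel (indicator {a..b} :: real \<Rightarrow> real)"
    by (rule integrable_real_indicator) (auto simp: emeasure_lborel_Icc_eq)
  then show ?thesis by (simp add: set_integrable_def)
qed

lemma set_integral_nonneg:
  fixes f :: "real \<Rightarrow> real"
  shows "(\<And>t. 0 \<le> f t) \<Longrightarrow> 0 \<le> (LINT t:A|lborel. f t)"
  unfolding set_lebesgue_integral_def by (intro Bochner_Integration.integral_nonneg) auto

lemma set_integral_const_Icc: "a \<le> b \<Longrightarrow> (LINT t:{a..b}|lborel. (k::real)) = (b - a) * k"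
  by (simp add: set_lebesgue_integral_def)

section \<open>Galerkin systems\<close>

lemma borel_measurable_psi [measurable]: "psi m \<in> borel_measurable borel"
  unfolding psi_def by measurable

lemma borel_measurable_pw [measurable]: "pw m \<in> borel_measurable borel"
  unfolding pw_def by measurable

lemma borel_measurable_shifted_sq [measurable (raw)]:
  assumes [measurable]: "f \<in> borel_measurable M" "g \<in> borel_measurable M"
  shows "(\<lambda>x. shifted_sq m (f x) (g x)) \<in> borel_measurable M"
  unfolding shifted_sq_def by measurable

lemma abs_psi: "0 < m \<Longrightarrow> \<bar>psi m y\<bar> = \<bar>y\<bar> powr (1 / m)"
  using psi_nonneg_arg[of m "\<bar>y\<bar>"] by (simp add: psi_def abs_mult)

lemma (in finite_measure) integrable_bounded_mult:
  fixes f g :: "'a \<Rightarrow> real"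
  assumes f: "integrable M f" and g: "g \<in> borel_measurable M" "\<And>x. x \<in> space M \<Longrightarrow> \<bar>g x\<bar> \<le> B"
  shows "integrable M (\<lambda>x. f x * g x)"
proof (rule Bochner_Integration.integrable_bound)
  show "integrable M (\<lambda>x. B * f x)" using f by simp
  show "(\<lambda>x. f x * g x) \<in> borel_measurable M"
    using f g by (simp add: borel_measurable_times borel_measurable_integrable)
  show "AE x in M. norm (f x * g x) \<le> norm (B * f x)"
  proof (rule AE_I2)
    fix x assume "x \<in> space M"
    then have "\<bar>g x\<bar> \<le> \<bar>B\<bar>" using g(2) by fastforce
    then show "norm (f x * g x) \<le> norm (B * f x)"
      by (simp add: abs_mult mult.commute[of "\<bar>B\<bar>"] mult_left_mono)
  qed
qed

text \<open>The e i will be a basis of the finite element space that is orthonormal for the fractional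
  form, so both equations are encoded by moments: \<open>\<alpha> i t\<close> is the i-th coordinate of the
  Ritz projection of w(t), \<open>A i\<close> its primitive, and the moments of u = psi m w are \<open>g i - A i t\<close>.\<close>

locale galerkin_system = finite_measure \<mu> for \<mu> :: "'a measure" +
  fixes m c1 C1 C2 C3 Be :: real and e :: "nat \<Rightarrow> 'a \<Rightarrow> real" and d :: nat
  assumes m: "0 < m" and pos: "0 < c1" "0 < C1" "0 < C2" "0 < C3"
    and lower: "\<And>w V P va. c1 * shifted_sq m w (w - V) \<le> (psi m va - psi m V) * (P - V)
        + C1 * (shifted_sq m w (w - P) + shifted_sq m w (w - va))"
    and drift: "\<And>w w' P P' wa. - ((psi m w - psi m wa) * (P - P'))
        \<le> C2 * (shifted_sq m w (w - P) + shifted_sq m w' (w' - P') + shifted_sq m w' (w' - wa))"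
    and extrapolate: "\<And>w w1 w2 wa v \<rho>. psi m wa - psi m w2 = \<rho> * (psi m w2 - psi m w1) \<Longrightarrow> 0 \<le> \<rho> \<Longrightarrow> \<rho> \<le> 1 \<Longrightarrow>
       shifted_sq m w (w - wa) \<le> C3 * (shifted_sq m w (w - v) + shifted_sq m w1 (w1 - v) + shifted_sq m w2 (w2 - v))"
    and e_meas [measurable]: "\<And>i. i < d \<Longrightarrow> e i \<in> borel_measurable \<mu>"
    and e_bdd: "\<And>i x. i < d \<Longrightarrow> x \<in> space \<mu> \<Longrightarrow> \<bar>e i x\<bar> \<le> Be"
begin

definition lin :: "(nat \<Rightarrow> real) \<Rightarrow> 'a \<Rightarrow> real" where
  "lin a x = (\<Sum>i<d. a i * e i x)"

lemma lin_meas [measurable]: "lin a \<in> borel_measurable \<mu>"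
  unfolding lin_def by (intro borel_measurable_sum borel_measurable_times borel_measurable_const e_meas) auto

lemma lin_bdd: "x \<in> space \<mu> \<Longrightarrow> \<bar>lin a x\<bar> \<le> (\<Sum>i<d. \<bar>a i\<bar> * Be)"
  unfolding lin_def
  by (rule order_trans[OF sum_abs]) (auto intro!: sum_mono mult_left_mono e_bdd simp: abs_mult)

lemma lin_diff: "lin a x - lin b x = lin (\<lambda>i. a i - b i) x"
  by (simp add: lin_def sum_subtractf algebra_simps)

lemma integrable_mult_lin: "integrable \<mu> f \<Longrightarrow> integrable \<mu> (\<lambda>x. f x * lin a x)"
  by (rule integrable_bounded_mult[OF _ lin_meas lin_bdd])

lemma integral_mult_lin:
  assumes "integrable \<mu> f"
  shows "(\<integral>x. f x * lin a x \<partial>\<mu>) = (\<Sum>i<d. a i * (\<integral>x. f x * e i x \<partial>\<mu>))"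
proof -
  have *: "integrable \<mu> (\<lambda>x. f x * e i x)" if "i < d" for i
    by (rule integrable_bounded_mult[OF assms e_meas[OF that] e_bdd[OF that]])
  have "(\<integral>x. f x * lin a x \<partial>\<mu>) = (\<integral>x. (\<Sum>i<d. a i * (f x * e i x)) \<partial>\<mu>)"
    by (simp add: lin_def sum_distrib_left mult_ac)
  also have "\<dots> = (\<Sum>i<d. \<integral>x. a i * (f x * e i x) \<partial>\<mu>)"
    by (rule Bochner_Integration.integral_sum) (use * in auto)
  finally show ?thesis by simp
qed

lemma integrable_psi_lin: "integrable \<mu> (\<lambda>x. psi m (lin a x))"
proof (rule integrable_const_bound)
  show "AE x in \<mu>. norm (psi m (lin a x)) \<le> (\<Sum>i<d. \<bar>a i\<bar> * Be) powr (1 / m)"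
    using m lin_bdd by (intro AE_I2) (simp add: abs_psi powr_mono2)
qed simp

text \<open>Collects what holds at almost every time. Its integrability clauses ensure that the
  moments, \<open>proj_err\<close> and \<open>dist_err\<close> at that time are genuine integrals
  and not the default value 0.\<close>

definition good :: "(nat \<Rightarrow> real \<Rightarrow> real) \<Rightarrow> (nat \<Rightarrow> real \<Rightarrow> real) \<Rightarrow> (nat \<Rightarrow> real) \<Rightarrow> ('a \<Rightarrow> real \<Rightarrow> real) \<Rightarrow> ('a \<Rightarrow> real) \<Rightarrow> real \<Rightarrow> bool" where
  "good \<alpha> A g w v t \<longleftrightarrow> (\<lambda>x. w x t) \<in> borel_measurable \<mu> \<and> v \<in> borel_measurable \<mu> \<and>
     integrable \<mu> (\<lambda>x. psi m (w x t)) \<and>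
     (\<forall>i<d. (\<integral>x. psi m (w x t) * e i x \<partial>\<mu>) = g i - A i t) \<and>
     integrable \<mu> (\<lambda>x. shifted_sq m (w x t) (w x t - lin (\<lambda>i. \<alpha> i t) x)) \<and>
     integrable \<mu> (\<lambda>x. shifted_sq m (w x t) (w x t - v x))"

definition proj_err :: "(nat \<Rightarrow> real \<Rightarrow> real) \<Rightarrow> ('a \<Rightarrow> real \<Rightarrow> real) \<Rightarrow> real \<Rightarrow> real" where
  "proj_err \<alpha> w t = (\<integral>x. shifted_sq m (w x t) (w x t - lin (\<lambda>i. \<alpha> i t) x) \<partial>\<mu>)"

definition dist_err :: "('a \<Rightarrow> real \<Rightarrow> real) \<Rightarrow> ('a \<Rightarrow> real) \<Rightarrow> real \<Rightarrow> real" where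
  "dist_err w v t = (\<integral>x. shifted_sq m (w x t) (w x t - v x) \<partial>\<mu>)"

lemma err_nonneg: "0 \<le> proj_err \<alpha> w t" "0 \<le> dist_err w v t"
  unfolding proj_err_def dist_err_def by (auto intro!: Bochner_Integration.integral_nonneg)

text \<open>The comparison function for the n-th time step. The weak formulation determines u only for
  almost every t, so the solution at the grid point itself cannot be used; instead u, which is
  psi m w, is extrapolated affinely from two generic times t1 and t2 inside the step.\<close>

definition extra :: "('a \<Rightarrow> real \<Rightarrow> real) \<Rightarrow> real \<Rightarrow> real \<Rightarrow> real \<Rightarrow> 'a \<Rightarrow> real" where
  "extra w t1 t2 t x = pw m (psi m (w x t2) + (t - t2) / (t2 - t1) * (psi m (w x t2) - psi m (w x t1)))"

lemma psi_extra: "psi m (extra w t1 t2 t x) = psi m (w x t2) + (t - t2) / (t2 - t1) * (psi m (w x t2) - psi m (w x t1))"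
  by (simp add: extra_def psi_pw[OF m])

lemma
  assumes g: "good \<alpha> A g w v t1" "good \<alpha> A g w v t2"
  shows integrable_psi_extra: "integrable \<mu> (\<lambda>x. psi m (extra w t1 t2 t x))"
    and moment_extra: "i < d \<Longrightarrow> (\<integral>x. psi m (extra w t1 t2 t x) * e i x \<partial>\<mu>)
        = g i - A i t2 - (t - t2) / (t2 - t1) * (A i t2 - A i t1)"
    and extra_meas: "extra w t1 t2 t \<in> borel_measurable \<mu>"
proof -
  have [measurable]: "(\<lambda>x. w x t1) \<in> borel_measurable \<mu>" "(\<lambda>x. w x t2) \<in> borel_measurable \<mu>"
    using g by (auto simp: good_def)
  have i: "integrable \<mu> (\<lambda>x. psi m (w x t1))" "integrable \<mu> (\<lambda>x. psi m (w x t2))"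
    using g by (auto simp: good_def)
  show "integrable \<mu> (\<lambda>x. psi m (extra w t1 t2 t x))"
    unfolding psi_extra using i by simp
  show "extra w t1 t2 t \<in> borel_measurable \<mu>" unfolding extra_def by measurable
  assume d: "i < d"
  have j: "integrable \<mu> (\<lambda>x. psi m (w x t1) * e i x)" "integrable \<mu> (\<lambda>x. psi m (w x t2) * e i x)"
    using integrable_bounded_mult[OF _ e_meas[OF d] e_bdd[OF d]] i by blast+
  have "(\<integral>x. psi m (extra w t1 t2 t x) * e i x \<partial>\<mu>) = (\<integral>x. psi m (w x t2) * e i x + (t - t2) / (t2 - t1) * (psi m (w x t2) * e i x - psi m (w x t1) * e i x) \<partial>\<mu>)"
    by (intro Bochner_Integration.integral_cong) (auto simp: psi_extra algebra_simps)
  also have "\<dots> = (\<integral>x. psi m (w x t2) * e i x \<partial>\<mu>) + (t - t2) / (t2 - t1) * ((\<integral>x. psi m (w x t2) * e i x \<partial>\<mu>) - (\<integral>x. psi m (w x t1) * e i x \<partial>\<mu>))"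
    using j by simp
  also have "\<dots> = g i - A i t2 - (t - t2) / (t2 - t1) * (A i t2 - A i t1)"
  proof -
    have eq: "(\<integral>x. psi m (w x t1) * e i x \<partial>\<mu>) = g i - A i t1" "(\<integral>x. psi m (w x t2) * e i x \<partial>\<mu>) = g i - A i t2"
      using g d by (auto simp: good_def)
    have alg: "a + k * (a - b) = a - k * (b - a)" for a b k :: real by (simp add: algebra_simps)
    show ?thesis unfolding eq by (subst alg) simp
  qed
  finally show "(\<integral>x. psi m (extra w t1 t2 t x) * e i x \<partial>\<mu>)
        = g i - A i t2 - (t - t2) / (t2 - t1) * (A i t2 - A i t1)" .
qed

text \<open>The condition \<open>t - t2 \<le> t2 - t1\<close> says that the extrapolation ratio is
  at most 1. As the pointwise bound involves no relation between r and t, the comparison function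
  built for one time t is close to w(r) at every good time r.\<close>

lemma dist_extra:
  assumes g: "good \<alpha> A g w v t1" "good \<alpha> A g w v t2" "good \<alpha> A g w v r"
    and t: "t1 < t2" "t2 \<le> t" "t - t2 \<le> t2 - t1"
  shows "integrable \<mu> (\<lambda>x. shifted_sq m (w x r) (w x r - extra w t1 t2 t x))"
    and "dist_err w (extra w t1 t2 t) r \<le> C3 * (dist_err w v r + dist_err w v t1 + dist_err w v t2)"
proof -
  have [measurable]: "(\<lambda>x. w x r) \<in> borel_measurable \<mu>" "extra w t1 t2 t \<in> borel_measurable \<mu>"
    using g extra_meas[OF g(1,2)] by (auto simp: good_def)
  let ?R = "\<lambda>x. C3 * (shifted_sq m (w x r) (w x r - v x) + shifted_sq m (w x t1) (w x t1 - v x) + shifted_sq m (w x t2) (w x t2 - v x))"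
  have le: "shifted_sq m (w x r) (w x r - extra w t1 t2 t x) \<le> ?R x" for x
    by (rule extrapolate[of _ _ "(t - t2) / (t2 - t1)"]) (use t in \<open>auto simp: psi_extra\<close>)
  have I: "integrable \<mu> ?R" using g by (auto simp: good_def)
  show 1: "integrable \<mu> (\<lambda>x. shifted_sq m (w x r) (w x r - extra w t1 t2 t x))"
    by (rule Bochner_Integration.integrable_bound[OF I]) (use le in \<open>auto intro: order_trans[OF _ abs_ge_self]\<close>)
  have "dist_err w (extra w t1 t2 t) r \<le> (\<integral>x. ?R x \<partial>\<mu>)"
    unfolding dist_err_def by (rule integral_mono[OF 1 I le])
  then show "dist_err w (extra w t1 t2 t) r \<le> C3 * (dist_err w v r + dist_err w v t1 + dist_err w v t2)"
    using g by (simp add: good_def dist_err_def)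
qed

text \<open>Up to sign, the moment vector of the deviation of u from its affine extrapolation through
  the times t1 and t2.\<close>

definition dev :: "(nat \<Rightarrow> real \<Rightarrow> real) \<Rightarrow> real \<Rightarrow> real \<Rightarrow> real \<Rightarrow> nat \<Rightarrow> real" where
  "dev A t1 t2 t i = A i t - A i t2 - (t - t2) / (t2 - t1) * (A i t2 - A i t1)"

text \<open>The sum is, up to sign, the pairing of u(r) minus its extrapolation to the time r with
  the increment of the projected solution between r' and r; the pointwise drift inequality applies
  under the integral.\<close>

lemma dev_drift_pair:
  assumes g: "good \<alpha> A g w v t1" "good \<alpha> A g w v t2" "good \<alpha> A g w v r" "good \<alpha> A g w v r'"
    and t: "t1 < t2" "t2 \<le> r" "r - t2 \<le> t2 - t1"
  shows "(\<Sum>i<d. dev A t1 t2 r i * (\<alpha> i r - \<alpha> i r'))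
      \<le> C2 * (proj_err \<alpha> w r + proj_err \<alpha> w r' + C3 * (dist_err w v r' + dist_err w v t1 + dist_err w v t2))"
proof -
  let ?wa = "extra w t1 t2 r"
  let ?P = "lin (\<lambda>i. \<alpha> i r)" and ?P' = "lin (\<lambda>i. \<alpha> i r')"
  have iu: "integrable \<mu> (\<lambda>x. psi m (w x r))" using g by (auto simp: good_def)
  have ia: "integrable \<mu> (\<lambda>x. psi m (?wa x))" by (rule integrable_psi_extra[OF g(1,2)])
  have id: "integrable \<mu> (\<lambda>x. psi m (w x r) - psi m (?wa x))" using iu ia by simp
  have mom: "(\<integral>x. (psi m (w x r) - psi m (?wa x)) * e i x \<partial>\<mu>) = - dev A t1 t2 r i" if "i < d" for i
  proof -
    have "(\<integral>x. (psi m (w x r) - psi m (?wa x)) * e i x \<partial>\<mu>) = (\<integral>x. psi m (w x r) * e i x \<partial>\<mu>) - (\<integral>x. psi m (?wa x) * e i x \<partial>\<mu>)"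
      using integrable_bounded_mult[OF iu e_meas[OF that] e_bdd[OF that]] integrable_bounded_mult[OF ia e_meas[OF that] e_bdd[OF that]]
      by (simp add: left_diff_distrib)
    also have "\<dots> = - dev A t1 t2 r i"
      using g that moment_extra[OF g(1,2) that] by (simp add: good_def dev_def)
    finally show ?thesis .
  qed
  have "(\<Sum>i<d. dev A t1 t2 r i * (\<alpha> i r - \<alpha> i r')) = - (\<integral>x. (psi m (w x r) - psi m (?wa x)) * lin (\<lambda>i. \<alpha> i r - \<alpha> i r') x \<partial>\<mu>)"
    unfolding integral_mult_lin[OF id] sum_negf[symmetric]
    by (intro sum.cong refl) (subst mom, auto)
  also have "\<dots> = (\<integral>x. - ((psi m (w x r) - psi m (?wa x)) * (?P x - ?P' x)) \<partial>\<mu>)"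
    by (simp add: lin_diff)
  also have "\<dots> \<le> (\<integral>x. C2 * (shifted_sq m (w x r) (w x r - ?P x) + shifted_sq m (w x r') (w x r' - ?P' x) + shifted_sq m (w x r') (w x r' - ?wa x)) \<partial>\<mu>)"
  proof (rule integral_mono[OF _ _ drift])
    show "integrable \<mu> (\<lambda>x. - ((psi m (w x r) - psi m (?wa x)) * (?P x - ?P' x)))"
      unfolding lin_diff using integrable_mult_lin[OF id] by simp
  qed (use g dist_extra(1)[OF g(1,2,4) t] in \<open>auto simp: good_def\<close>)
  also have "\<dots> = C2 * (proj_err \<alpha> w r + proj_err \<alpha> w r' + dist_err w ?wa r')"
    using g dist_extra(1)[OF g(1,2,4) t] by (simp add: good_def proj_err_def dist_err_def)
  also have "\<dots> \<le> C2 * (proj_err \<alpha> w r + proj_err \<alpha> w r' + C3 * (dist_err w v r' + dist_err w v t1 + dist_err w v t2))"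
    using pos dist_extra(2)[OF g(1,2,4) t] by simp
  finally show ?thesis .
qed

text \<open>\<open>A\<close> enters only through its increments, so the same data describe every
  time step; the normalisation at time 0 is used only when the steps are summed.\<close>

definition interval_data :: "(nat \<Rightarrow> real \<Rightarrow> real) \<Rightarrow> (nat \<Rightarrow> real \<Rightarrow> real) \<Rightarrow> (nat \<Rightarrow> real) \<Rightarrow> ('a \<Rightarrow> real \<Rightarrow> real) \<Rightarrow> ('a \<Rightarrow> real) \<Rightarrow> real \<Rightarrow> real \<Rightarrow> bool" where
  "interval_data \<alpha> A g w v l R \<longleftrightarrow> l < R \<and>
     (\<forall>i<d. set_integrable lborel {l..R} (\<alpha> i)) \<and>
     (\<forall>i<d. \<forall>s t. l \<le> s \<longrightarrow> s \<le> t \<longrightarrow> t \<le> R \<longrightarrow> A i t - A i s = (LINT r:{s..t}|lborel. \<alpha> i r)) \<and>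
     set_integrable lborel {l..R} (proj_err \<alpha> w) \<and> set_integrable lborel {l..R} (dist_err w v) \<and>
     (AE t in lborel. t \<in> {l..R} \<longrightarrow> good \<alpha> A g w v t)"

text \<open>Averaging the pairwise bound over r' in [t1,t2] turns \<open>\<alpha> i r'\<close> into
  the slope of the extrapolation. The second factor thereby becomes the time derivative of
  \<open>dev\<close>.\<close>

lemma dev_drift:
  assumes D: "interval_data \<alpha> A g w v l R"
    and g: "good \<alpha> A g w v t1" "good \<alpha> A g w v t2" "good \<alpha> A g w v r"
    and t: "l \<le> t1" "t1 < t2" "t2 \<le> R" "t2 \<le> r" "r - t2 \<le> t2 - t1"
  shows "(t2 - t1) * (\<Sum>i<d. dev A t1 t2 r i * (\<alpha> i r - (A i t2 - A i t1) / (t2 - t1)))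
      \<le> C2 * ((t2 - t1) * proj_err \<alpha> w r + (LINT t:{l..R}|lborel. proj_err \<alpha> w t)
          + C3 * ((LINT t:{l..R}|lborel. dist_err w v t) + (t2 - t1) * (dist_err w v t1 + dist_err w v t2)))"
proof -
  have \<alpha>i: "set_integrable lborel {t1..t2} (\<alpha> i)" if "i < d" for i
    using D t that by (auto simp: interval_data_def intro: set_integrable_sub)
  have pe: "set_integrable lborel {t1..t2} (proj_err \<alpha> w)" and de: "set_integrable lborel {t1..t2} (dist_err w v)"
    using D t by (auto simp: interval_data_def intro: set_integrable_sub)
  have dA: "A i t2 - A i t1 = (LINT r:{t1..t2}|lborel. \<alpha> i r)" if "i < d" for i
    using D t that by (auto simp: interval_data_def)
  have int1: "set_integrable lborel {t1..t2} (\<lambda>r'. dev A t1 t2 r i * (\<alpha> i r - \<alpha> i r'))" if "i < d" for i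
    using \<alpha>i[OF that] by (intro set_integrable_mult_right set_integral_diff) auto
  have int2: "set_integrable lborel {t1..t2} (\<lambda>r'. \<Sum>i<d. dev A t1 t2 r i * (\<alpha> i r - \<alpha> i r'))"
    unfolding set_integrable_def scaleR_sum_right
    using int1 by (intro Bochner_Integration.integrable_sum) (auto simp: set_integrable_def)
  have "(LINT r':{t1..t2}|lborel. (\<Sum>i<d. dev A t1 t2 r i * (\<alpha> i r - \<alpha> i r')))
      = (\<Sum>i<d. LINT r':{t1..t2}|lborel. dev A t1 t2 r i * (\<alpha> i r - \<alpha> i r'))"
    unfolding set_lebesgue_integral_def scaleR_sum_right
    using int1 by (intro Bochner_Integration.integral_sum) (auto simp: set_integrable_def)
  also have "\<dots> = (\<Sum>i<d. dev A t1 t2 r i * ((t2 - t1) * \<alpha> i r - (A i t2 - A i t1)))"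
  proof (intro sum.cong refl)
    fix i assume "i \<in> {..<d}"
    then show "(LINT r':{t1..t2}|lborel. dev A t1 t2 r i * (\<alpha> i r - \<alpha> i r')) = dev A t1 t2 r i * ((t2 - t1) * \<alpha> i r - (A i t2 - A i t1))"
      using \<alpha>i[of i] dA[of i] t by (simp add: set_integral_diff set_integral_const_Icc)
  qed
  also have "\<dots> = (t2 - t1) * (\<Sum>i<d. dev A t1 t2 r i * (\<alpha> i r - (A i t2 - A i t1) / (t2 - t1)))"
    unfolding sum_distrib_left
  proof (intro sum.cong refl)
    fix i
    have "(t2 - t1) * (\<alpha> i r - (A i t2 - A i t1) / (t2 - t1)) = (t2 - t1) * \<alpha> i r - (A i t2 - A i t1)"
    proof -
      have "(t2 - t1) * ((A i t2 - A i t1) / (t2 - t1)) = A i t2 - A i t1" using t by simp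
      then show ?thesis by (simp only: right_diff_distrib[of "t2 - t1" "\<alpha> i r"])
    qed
    then show "dev A t1 t2 r i * ((t2 - t1) * \<alpha> i r - (A i t2 - A i t1)) = (t2 - t1) * (dev A t1 t2 r i * (\<alpha> i r - (A i t2 - A i t1) / (t2 - t1)))"
      by (simp only: mult.left_commute[of "t2 - t1" "dev A t1 t2 r i"])
  qed
  finally have "(t2 - t1) * (\<Sum>i<d. dev A t1 t2 r i * (\<alpha> i r - (A i t2 - A i t1) / (t2 - t1)))
      = (LINT r':{t1..t2}|lborel. (\<Sum>i<d. dev A t1 t2 r i * (\<alpha> i r - \<alpha> i r')))" ..
  also have "\<dots> \<le> (LINT r':{t1..t2}|lborel. C2 * (proj_err \<alpha> w r + proj_err \<alpha> w r' + C3 * (dist_err w v r' + dist_err w v t1 + dist_err w v t2)))"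
  proof (rule set_integral_le_AE[OF int2])
    show "set_integrable lborel {t1..t2} (\<lambda>r'. C2 * (proj_err \<alpha> w r + proj_err \<alpha> w r' + C3 * (dist_err w v r' + dist_err w v t1 + dist_err w v t2)))"
      using pe de by (intro set_integrable_mult_right set_integral_add) auto
    have "AE r' in lborel. r' \<in> {l..R} \<longrightarrow> good \<alpha> A g w v r'" using D by (simp add: interval_data_def)
    then show "AE r' in lborel. r' \<in> {t1..t2} \<longrightarrow> (\<Sum>i<d. dev A t1 t2 r i * (\<alpha> i r - \<alpha> i r'))
       \<le> C2 * (proj_err \<alpha> w r + proj_err \<alpha> w r' + C3 * (dist_err w v r' + dist_err w v t1 + dist_err w v t2))"
    proof eventually_elim
      case (elim r')
      show ?case
      proof
        assume "r' \<in> {t1..t2}"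
        then have "good \<alpha> A g w v r'" using elim t by auto
        then show "(\<Sum>i<d. dev A t1 t2 r i * (\<alpha> i r - \<alpha> i r'))
           \<le> C2 * (proj_err \<alpha> w r + proj_err \<alpha> w r' + C3 * (dist_err w v r' + dist_err w v t1 + dist_err w v t2))"
          by (rule dev_drift_pair[OF g]) (use t in auto)
      qed
    qed
  qed
  also have "\<dots> = C2 * ((t2 - t1) * proj_err \<alpha> w r + (LINT t:{t1..t2}|lborel. proj_err \<alpha> w t)
          + C3 * ((LINT t:{t1..t2}|lborel. dist_err w v t) + (t2 - t1) * dist_err w v t1 + (t2 - t1) * dist_err w v t2))"
    using pe de t by (simp add: set_integral_add set_integral_const_Icc)
  also have "\<dots> \<le> C2 * ((t2 - t1) * proj_err \<alpha> w r + (LINT t:{l..R}|lborel. proj_err \<alpha> w t)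
          + C3 * ((LINT t:{l..R}|lborel. dist_err w v t) + (t2 - t1) * dist_err w v t1 + (t2 - t1) * dist_err w v t2))"
    using D t pos by (intro mult_left_mono add_mono order_refl set_integral_sub_le)
      (auto simp: interval_data_def err_nonneg)
  finally show ?thesis by (simp add: algebra_simps)
qed

text \<open>\<open>dev\<close> vanishes at t2 and has derivative \<open>z\<close>, so its square at
  R is twice the integral of \<open>z\<close> times \<open>dev\<close> over [t2,R], whose integrand
  is bounded by the drift estimate.\<close>

lemma dev_square:
  assumes D: "interval_data \<alpha> A g w v l R"
    and g: "good \<alpha> A g w v t1" "good \<alpha> A g w v t2"
    and t: "l \<le> t1" "t1 < t2" "t2 \<le> R" "R - t2 \<le> t2 - t1"
  shows "(\<Sum>i<d. (dev A t1 t2 R i)\<^sup>2) \<le> 2 * C2 * (2 * (LINT t:{l..R}|lborel. proj_err \<alpha> w t)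
          + C3 * ((LINT t:{l..R}|lborel. dist_err w v t) + (t2 - t1) * (dist_err w v t1 + dist_err w v t2)))"
proof -
  define z where "z i r = \<alpha> i r - (A i t2 - A i t1) / (t2 - t1)" for i r
  define E where "E = (LINT t:{l..R}|lborel. proj_err \<alpha> w t)"
  define K where "K = C2 * (E + C3 * ((LINT t:{l..R}|lborel. dist_err w v t) + (t2 - t1) * (dist_err w v t1 + dist_err w v t2)))"
  have E0: "0 \<le> E" unfolding E_def by (rule set_integral_nonneg) (auto simp: err_nonneg)
  have "0 \<le> (LINT t:{l..R}|lborel. dist_err w v t)" by (rule set_integral_nonneg) (auto simp: err_nonneg)
  then have K0: "0 \<le> K" using pos t E0 err_nonneg(2) by (simp add: K_def)
  have \<alpha>i: "set_integrable lborel {t2..R} (\<alpha> i)" if "i < d" for i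
    using D t that by (auto simp: interval_data_def intro: set_integrable_sub)
  have z: "set_integrable lborel {t2..R} (z i)" if "i < d" for i
    unfolding z_def using \<alpha>i[OF that] by (intro set_integral_diff) auto
  have devz: "dev A t1 t2 r i = (LINT s:{t2..r}|lborel. z i s)" if "i < d" "t2 \<le> r" "r \<le> R" for i r
  proof -
    have "A i r - A i t2 = (LINT s:{t2..r}|lborel. \<alpha> i s)" using D t that by (auto simp: interval_data_def)
    moreover have "set_integrable lborel {t2..r} (\<alpha> i)" by (rule set_integrable_sub[OF \<alpha>i]) (use that in auto)
    moreover define k where "k = (A i t2 - A i t1) / (t2 - t1)"
    moreover have "dev A t1 t2 r i = A i r - A i t2 - (r - t2) * k" by (simp add: dev_def k_def)
    ultimately show ?thesis using that unfolding z_def k_def[symmetric]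
      by (simp add: set_integral_diff set_integral_const_Icc)
  qed
  have sq: "(dev A t1 t2 R i)\<^sup>2 = 2 * (LINT r:{t2..R}|lborel. z i r * dev A t1 t2 r i)"
    and sqi: "set_integrable lborel {t2..R} (\<lambda>r. z i r * dev A t1 t2 r i)" if i: "i < d" for i
  proof -
    have c: "set_integrable lborel {t2..R} (\<lambda>r. z i r * dev A t1 t2 r i) = set_integrable lborel {t2..R} (\<lambda>r. z i r * (LINT s:{t2..r}|lborel. z i s))"
      by (rule set_integrable_cong) (auto simp: devz[OF i])
    show "set_integrable lborel {t2..R} (\<lambda>r. z i r * dev A t1 t2 r i)"
      unfolding c by (rule square_integral_eq(1)[OF z[OF i] t(3)])
    have "(LINT r:{t2..R}|lborel. z i r * dev A t1 t2 r i) = (LINT r:{t2..R}|lborel. z i r * (LINT s:{t2..r}|lborel. z i s))"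
      by (rule set_lebesgue_integral_cong) (auto simp: devz[OF i])
    then show "(dev A t1 t2 R i)\<^sup>2 = 2 * (LINT r:{t2..R}|lborel. z i r * dev A t1 t2 r i)"
      using square_integral_eq(2)[OF z[OF i] t(3)] devz[OF i t(3)] by simp
  qed
  have "(\<Sum>i<d. (dev A t1 t2 R i)\<^sup>2) = 2 * (\<Sum>i<d. LINT r:{t2..R}|lborel. z i r * dev A t1 t2 r i)"
    by (simp add: sq sum_distrib_left)
  also have "(\<Sum>i<d. LINT r:{t2..R}|lborel. z i r * dev A t1 t2 r i) = (LINT r:{t2..R}|lborel. (\<Sum>i<d. z i r * dev A t1 t2 r i))"
    unfolding set_lebesgue_integral_def scaleR_sum_right
    using sqi by (intro Bochner_Integration.integral_sum[symmetric]) (auto simp: set_integrable_def)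
  also have "\<dots> \<le> (LINT r:{t2..R}|lborel. C2 * proj_err \<alpha> w r + K / (t2 - t1))"
  proof (rule set_integral_le_AE)
    show "set_integrable lborel {t2..R} (\<lambda>r. \<Sum>i<d. z i r * dev A t1 t2 r i)"
      unfolding set_integrable_def scaleR_sum_right
      using sqi by (intro Bochner_Integration.integrable_sum) (auto simp: set_integrable_def)
    show "set_integrable lborel {t2..R} (\<lambda>r. C2 * proj_err \<alpha> w r + K / (t2 - t1))"
      using D t by (intro set_integral_add set_integrable_mult_right) (auto simp: interval_data_def intro: set_integrable_sub)
    have "AE r in lborel. r \<in> {l..R} \<longrightarrow> good \<alpha> A g w v r" using D by (simp add: interval_data_def)
    then show "AE r in lborel. r \<in> {t2..R} \<longrightarrow> (\<Sum>i<d. z i r * dev A t1 t2 r i) \<le> C2 * proj_err \<alpha> w r + K / (t2 - t1)"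
    proof eventually_elim
      case (elim r)
      show ?case
      proof
        assume r: "r \<in> {t2..R}"
        then have "good \<alpha> A g w v r" using elim t by auto
        from dev_drift[OF D g this] r t have "(t2 - t1) * (\<Sum>i<d. dev A t1 t2 r i * z i r) \<le> C2 * (t2 - t1) * proj_err \<alpha> w r + K"
          by (simp add: z_def K_def E_def algebra_simps)
        then have "(\<Sum>i<d. dev A t1 t2 r i * z i r) \<le> (C2 * (t2 - t1) * proj_err \<alpha> w r + K) / (t2 - t1)"
          using t by (simp add: pos_le_divide_eq mult.commute)
        then show "(\<Sum>i<d. z i r * dev A t1 t2 r i) \<le> C2 * proj_err \<alpha> w r + K / (t2 - t1)"
          using t by (simp add: add_divide_distrib mult.commute)
      qed
    qed
  qed
  also have "\<dots> = C2 * (LINT r:{t2..R}|lborel. proj_err \<alpha> w r) + (R - t2) * (K / (t2 - t1))"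
  proof -
    have "set_integrable lborel {t2..R} (proj_err \<alpha> w)"
      using D t by (auto simp: interval_data_def intro: set_integrable_sub)
    then show ?thesis using t by (simp add: set_integral_add set_integral_const_Icc)
  qed
  also have "\<dots> \<le> C2 * E + K"
  proof (rule add_mono)
    show "C2 * (LINT r:{t2..R}|lborel. proj_err \<alpha> w r) \<le> C2 * E"
      unfolding E_def using D t pos by (intro mult_left_mono set_integral_sub_le) (auto simp: interval_data_def err_nonneg)
    \<comment> \<open>The division by t2 - t1 made in the drift estimate is compensated here,
      because the extrapolation reaches no farther than the length of its base interval; no inverse
      power of the step size survives.\<close>
    show "(R - t2) * (K / (t2 - t1)) \<le> K"
      using t K0 by (simp add: divide_le_eq mult.commute mult_left_mono)
  qed
  finally show ?thesis by (simp add: K_def E_def algebra_simps)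
qed

text \<open>Taking t1 in the first and t2 in the last third of the step guarantees
  \<open>R - t2 \<le> t2 - t1\<close>. Both are chosen with \<open>dist_err\<close> at most the mean
  over their third, so that their errors are controlled by the integral over the whole step.\<close>

lemma interval_comparison:
  assumes D: "interval_data \<alpha> A g w v l R"
  obtains wa where "wa \<in> borel_measurable \<mu>" "integrable \<mu> (\<lambda>x. psi m (wa x))"
    "(\<Sum>i<d. (g i - A i R - (\<integral>x. psi m (wa x) * e i x \<partial>\<mu>))\<^sup>2) \<le> 2 * C2 * (2 * (LINT t:{l..R}|lborel. proj_err \<alpha> w t) + 7 * C3 * (LINT t:{l..R}|lborel. dist_err w v t))"
    "AE r in lborel. r \<in> {l..R} \<longrightarrow> integrable \<mu> (\<lambda>x. shifted_sq m (w x r) (w x r - wa x)) \<and>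
       dist_err w wa r \<le> C3 * (dist_err w v r + 6 / (R - l) * (LINT t:{l..R}|lborel. dist_err w v t))"
proof -
  define \<tau> where "\<tau> = R - l"
  define I where "I = (LINT t:{l..R}|lborel. dist_err w v t)"
  have lR: "l < R" "0 < \<tau>" using D by (auto simp: interval_data_def \<tau>_def)
  have G: "AE r in lborel. r \<in> {l..R} \<longrightarrow> good \<alpha> A g w v r" using D by (simp add: interval_data_def)
  have de: "set_integrable lborel {l..R} (dist_err w v)" using D by (simp add: interval_data_def)
  have I0: "0 \<le> I" unfolding I_def by (rule set_integral_nonneg) (auto simp: err_nonneg)
  have lR': "l + \<tau> / 3 \<le> R" "l \<le> R - \<tau> / 3" using lR by (auto simp: \<tau>_def field_simps)
  \<comment> \<open>The factor 3 / \<tau> is the reciprocal of the length of one third.\<close>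
  have pick: "\<exists>t\<in>{a..b}. good \<alpha> A g w v t \<and> dist_err w v t \<le> 3 / \<tau> * I"
    if ab: "l \<le> a" "b \<le> R" "b - a = \<tau> / 3" for a b
  proof -
    have "a < b" using ab lR by simp
    have "AE t in lborel. t \<in> {a..b} \<longrightarrow> good \<alpha> A g w v t"
      using G by eventually_elim (use ab in auto)
    from exists_le_mean[OF set_integrable_sub[OF de ab(1,2)] \<open>a < b\<close> this]
    obtain t where t: "t \<in> {a..b}" "good \<alpha> A g w v t" "dist_err w v t \<le> (LINT t:{a..b}|lborel. dist_err w v t) / (b - a)"
      by blast
    have "(LINT t:{a..b}|lborel. dist_err w v t) / (b - a) \<le> I / (b - a)"
      unfolding I_def using ab \<open>a < b\<close> by (intro divide_right_mono set_integral_sub_le de err_nonneg) auto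
    also have "\<dots> = 3 / \<tau> * I" unfolding ab(3) by simp
    finally show ?thesis using t by force
  qed
  obtain t1 where t1: "t1 \<in> {l..l + \<tau> / 3}" "good \<alpha> A g w v t1" "dist_err w v t1 \<le> 3 / \<tau> * I"
    using pick[of l "l + \<tau> / 3"] lR lR' by auto
  obtain t2 where t2: "t2 \<in> {R - \<tau> / 3..R}" "good \<alpha> A g w v t2" "dist_err w v t2 \<le> 3 / \<tau> * I"
    using pick[of "R - \<tau> / 3" R] lR lR' by auto
  have t: "l \<le> t1" "t1 < t2" "t2 \<le> R" "R - t2 \<le> t2 - t1" "t2 - t1 \<le> \<tau>"
  proof -
    have "R = l + \<tau>" by (simp add: \<tau>_def)
    moreover have "l \<le> t1" "t1 \<le> l + \<tau> / 3" "R - \<tau> / 3 \<le> t2" "t2 \<le> R" using t1(1) t2(1) by auto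
    ultimately show "l \<le> t1" "t1 < t2" "t2 \<le> R" "R - t2 \<le> t2 - t1" "t2 - t1 \<le> \<tau>"
      using lR(2) by linarith+
  qed
  let ?wa = "extra w t1 t2 R"
  show ?thesis
  proof (rule that[of ?wa])
    show "?wa \<in> borel_measurable \<mu>" by (rule extra_meas[OF t1(2) t2(2)])
    show "integrable \<mu> (\<lambda>x. psi m (?wa x))" by (rule integrable_psi_extra[OF t1(2) t2(2)])
    have "(\<Sum>i<d. (g i - A i R - (\<integral>x. psi m (?wa x) * e i x \<partial>\<mu>))\<^sup>2) = (\<Sum>i<d. (dev A t1 t2 R i)\<^sup>2)"
    proof (intro sum.cong refl)
      fix i assume "i \<in> {..<d}"
      then have "g i - A i R - (\<integral>x. psi m (?wa x) * e i x \<partial>\<mu>) = - dev A t1 t2 R i"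
        using moment_extra[OF t1(2) t2(2), of i R] by (simp add: dev_def)
      then show "(g i - A i R - (\<integral>x. psi m (?wa x) * e i x \<partial>\<mu>))\<^sup>2 = (dev A t1 t2 R i)\<^sup>2" by simp
    qed
    also have "\<dots> \<le> 2 * C2 * (2 * (LINT t:{l..R}|lborel. proj_err \<alpha> w t) + C3 * (I + (t2 - t1) * (dist_err w v t1 + dist_err w v t2)))"
      unfolding I_def by (rule dev_square[OF D t1(2) t2(2) t(1-4)])
    also have "\<dots> \<le> 2 * C2 * (2 * (LINT t:{l..R}|lborel. proj_err \<alpha> w t) + C3 * (I + \<tau> * (3 / \<tau> * I + 3 / \<tau> * I)))"
    proof -
      have "(t2 - t1) * (dist_err w v t1 + dist_err w v t2) \<le> \<tau> * (3 / \<tau> * I + 3 / \<tau> * I)"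
        by (rule mult_mono[OF t(5) add_mono[OF t1(3) t2(3)]]) (use lR err_nonneg(2) in auto)
      then show ?thesis using pos by simp
    qed
    \<comment> \<open>Together with the single \<open>I\<close> already present this gives the
      factor 7 of the claim.\<close>
    also have "\<tau> * (3 / \<tau> * I + 3 / \<tau> * I) = 6 * I" using lR by (simp add: field_simps)
    finally show "(\<Sum>i<d. (g i - A i R - (\<integral>x. psi m (?wa x) * e i x \<partial>\<mu>))\<^sup>2) \<le> 2 * C2 * (2 * (LINT t:{l..R}|lborel. proj_err \<alpha> w t) + 7 * C3 * (LINT t:{l..R}|lborel. dist_err w v t))"
      by (simp add: I_def algebra_simps)
    show "AE r in lborel. r \<in> {l..R} \<longrightarrow> integrable \<mu> (\<lambda>x. shifted_sq m (w x r) (w x r - ?wa x)) \<and>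
       dist_err w ?wa r \<le> C3 * (dist_err w v r + 6 / (R - l) * (LINT t:{l..R}|lborel. dist_err w v t))"
      using G
    proof eventually_elim
      case (elim r)
      show ?case
      proof
        assume "r \<in> {l..R}"
        then have r: "good \<alpha> A g w v r" using elim by simp
        have "C3 * (dist_err w v r + dist_err w v t1 + dist_err w v t2) \<le> C3 * (dist_err w v r + 6 / \<tau> * I)"
          using pos t1(3) t2(3) by (intro mult_left_mono) auto
        then show "integrable \<mu> (\<lambda>x. shifted_sq m (w x r) (w x r - ?wa x)) \<and>
           dist_err w ?wa r \<le> C3 * (dist_err w v r + 6 / (R - l) * (LINT t:{l..R}|lborel. dist_err w v t))"
          using dist_extra[OF t1(2) t2(2) r t(2,3,4)] by (simp add: \<tau>_def I_def)
      qed
    qed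
  qed
qed

text \<open>The pointwise lower bound is integrated with P = P_h w(r) and V the discrete solution.
  Its product term depends on r only through \<open>\<alpha> i r - \<beta> i\<close>, since the
  comparison function is fixed on the step; integrating in r therefore yields the increment of the
  accumulated coordinate error.\<close>

lemma interval_step:
  assumes D: "interval_data \<alpha> A g w v l R"
    and q: "dist_err w (lin \<beta>) \<in> borel_measurable borel"
  shows "AE r in lborel. r \<in> {l..R} \<longrightarrow> integrable \<mu> (\<lambda>x. shifted_sq m (w x r) (w x r - lin \<beta> x))"
    and "set_integrable lborel {l..R} (dist_err w (lin \<beta>))"
    and "c1 * (LINT t:{l..R}|lborel. dist_err w (lin \<beta>) t)
      \<le> (\<Sum>i<d. (g i - A i R - (\<integral>x. psi m (lin \<beta> x) * e i x \<partial>\<mu>)) * (A i R - A i l - (R - l) * \<beta> i))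
        + (\<Sum>i<d. (A i R - A i l - (R - l) * \<beta> i)\<^sup>2) / 2
        + (C1 + 2 * C2) * (LINT t:{l..R}|lborel. proj_err \<alpha> w t)
        + 7 * C3 * (C1 + C2) * (LINT t:{l..R}|lborel. dist_err w v t)"
proof -
  define E where "E = (LINT t:{l..R}|lborel. proj_err \<alpha> w t)"
  define I where "I = (LINT t:{l..R}|lborel. dist_err w v t)"
  define S where "S i = A i R - A i l - (R - l) * \<beta> i" for i
  define Z where "Z i = g i - A i R - (\<integral>x. psi m (lin \<beta> x) * e i x \<partial>\<mu>)" for i
  obtain wa where wa: "wa \<in> borel_measurable \<mu>" "integrable \<mu> (\<lambda>x. psi m (wa x))"
    "(\<Sum>i<d. (g i - A i R - (\<integral>x. psi m (wa x) * e i x \<partial>\<mu>))\<^sup>2) \<le> 2 * C2 * (2 * E + 7 * C3 * I)"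
    "AE r in lborel. r \<in> {l..R} \<longrightarrow> integrable \<mu> (\<lambda>x. shifted_sq m (w x r) (w x r - wa x)) \<and>
       dist_err w wa r \<le> C3 * (dist_err w v r + 6 / (R - l) * I)"
    using interval_comparison[OF D] unfolding E_def I_def by blast
  define y where "y i = g i - A i R - (\<integral>x. psi m (wa x) * e i x \<partial>\<mu>)" for i
  have lR: "l < R" using D by (simp add: interval_data_def)
  have \<alpha>i: "set_integrable lborel {l..R} (\<alpha> i)" if "i < d" for i using D that by (simp add: interval_data_def)
  have pe: "set_integrable lborel {l..R} (proj_err \<alpha> w)" and de: "set_integrable lborel {l..R} (dist_err w v)"
    using D by (auto simp: interval_data_def)
  have iW: "integrable \<mu> (\<lambda>x. psi m (lin \<beta> x))" by (rule integrable_psi_lin)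
  have idf: "integrable \<mu> (\<lambda>x. psi m (wa x) - psi m (lin \<beta> x))" using iW wa by simp
  have mom: "(\<integral>x. (psi m (wa x) - psi m (lin \<beta> x)) * e i x \<partial>\<mu>) = Z i - y i" if "i < d" for i
    using integrable_bounded_mult[OF iW e_meas[OF that] e_bdd[OF that]] integrable_bounded_mult[OF wa(2) e_meas[OF that] e_bdd[OF that]]
    by (simp add: left_diff_distrib Z_def y_def)
  define B where "B r = (\<Sum>i<d. (\<alpha> i r - \<beta> i) * (Z i - y i)) + C1 * (proj_err \<alpha> w r + C3 * (dist_err w v r + 6 / (R - l) * I))" for r
  have G: "AE r in lborel. r \<in> {l..R} \<longrightarrow> good \<alpha> A g w v r" using D by (simp add: interval_data_def)
  have bd: "AE r in lborel. r \<in> {l..R} \<longrightarrow> integrable \<mu> (\<lambda>x. shifted_sq m (w x r) (w x r - lin \<beta> x)) \<and>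
     c1 * dist_err w (lin \<beta>) r \<le> B r"
    using G wa(4)
  proof eventually_elim
    case (elim r)
    show ?case
    proof
      assume "r \<in> {l..R}"
      then have r: "good \<alpha> A g w v r" "integrable \<mu> (\<lambda>x. shifted_sq m (w x r) (w x r - wa x))"
        "dist_err w wa r \<le> C3 * (dist_err w v r + 6 / (R - l) * I)" using elim by auto
      have [measurable]: "(\<lambda>x. w x r) \<in> borel_measurable \<mu>" using r by (simp add: good_def)
      let ?P = "lin (\<lambda>i. \<alpha> i r)"
      let ?F = "\<lambda>x. (psi m (wa x) - psi m (lin \<beta> x)) * (?P x - lin \<beta> x)
        + C1 * (shifted_sq m (w x r) (w x r - ?P x) + shifted_sq m (w x r) (w x r - wa x))"
      have iPl: "integrable \<mu> (\<lambda>x. (psi m (wa x) - psi m (lin \<beta> x)) * (?P x - lin \<beta> x))"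
        unfolding lin_diff by (rule integrable_mult_lin[OF idf])
      have iq: "integrable \<mu> (\<lambda>x. shifted_sq m (w x r) (w x r - ?P x))" using r by (simp add: good_def)
      have IF: "integrable \<mu> ?F" using iPl iq r(2) by simp
      have le: "c1 * shifted_sq m (w x r) (w x r - lin \<beta> x) \<le> ?F x" for x by (rule lower)
      have ic: "integrable \<mu> (\<lambda>x. c1 * shifted_sq m (w x r) (w x r - lin \<beta> x))"
        by (rule Bochner_Integration.integrable_bound[OF IF])
          (use le pos in \<open>auto intro: order_trans[OF _ abs_ge_self]\<close>)
      have 1: "integrable \<mu> (\<lambda>x. shifted_sq m (w x r) (w x r - lin \<beta> x))"
        using ic pos by simp
      have "c1 * dist_err w (lin \<beta>) r = (\<integral>x. c1 * shifted_sq m (w x r) (w x r - lin \<beta> x) \<partial>\<mu>)"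
        by (simp add: dist_err_def)
      also have "\<dots> \<le> (\<integral>x. ?F x \<partial>\<mu>)" by (rule integral_mono[OF ic IF le])
      also have "\<dots> = (\<integral>x. (psi m (wa x) - psi m (lin \<beta> x)) * lin (\<lambda>i. \<alpha> i r - \<beta> i) x \<partial>\<mu>) + C1 * (proj_err \<alpha> w r + dist_err w wa r)"
        using iPl iq r(2) by (simp add: proj_err_def dist_err_def lin_diff)
      also have "(\<integral>x. (psi m (wa x) - psi m (lin \<beta> x)) * lin (\<lambda>i. \<alpha> i r - \<beta> i) x \<partial>\<mu>) = (\<Sum>i<d. (\<alpha> i r - \<beta> i) * (Z i - y i))"
        unfolding integral_mult_lin[OF idf] by (intro sum.cong refl) (subst mom, auto)
      also have "C1 * (proj_err \<alpha> w r + dist_err w wa r) \<le> C1 * (proj_err \<alpha> w r + C3 * (dist_err w v r + 6 / (R - l) * I))"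
        using pos r(3) by simp
      finally show "integrable \<mu> (\<lambda>x. shifted_sq m (w x r) (w x r - lin \<beta> x)) \<and> c1 * dist_err w (lin \<beta>) r \<le> B r"
        using 1 by (simp add: B_def)
    qed
  qed
  show "AE r in lborel. r \<in> {l..R} \<longrightarrow> integrable \<mu> (\<lambda>x. shifted_sq m (w x r) (w x r - lin \<beta> x))"
    using bd by eventually_elim auto
  have terms: "set_integrable lborel {l..R} (\<lambda>r. (\<alpha> i r - \<beta> i) * (Z i - y i))"
    "(LINT r:{l..R}|lborel. (\<alpha> i r - \<beta> i) * (Z i - y i)) = S i * (Z i - y i)" if i: "i < d" for i
  proof -
    show "set_integrable lborel {l..R} (\<lambda>r. (\<alpha> i r - \<beta> i) * (Z i - y i))"
      using \<alpha>i[OF i] by (intro set_integrable_mult_left set_integral_diff) auto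
    have "(LINT r:{l..R}|lborel. \<alpha> i r - \<beta> i) = S i"
      using D i \<alpha>i[OF i] lR by (auto simp: interval_data_def S_def set_integral_diff set_integral_const_Icc)
    then show "(LINT r:{l..R}|lborel. (\<alpha> i r - \<beta> i) * (Z i - y i)) = S i * (Z i - y i)"
      by simp
  qed
  have si: "set_integrable lborel {l..R} (\<lambda>r. \<Sum>i<d. (\<alpha> i r - \<beta> i) * (Z i - y i))"
    unfolding set_integrable_def scaleR_sum_right
    using terms(1) by (intro Bochner_Integration.integrable_sum) (auto simp: set_integrable_def)
  have se: "(LINT r:{l..R}|lborel. \<Sum>i<d. (\<alpha> i r - \<beta> i) * (Z i - y i)) = (\<Sum>i<d. S i * (Z i - y i))"
  proof -
    have "(LINT r:{l..R}|lborel. \<Sum>i<d. (\<alpha> i r - \<beta> i) * (Z i - y i)) = (\<Sum>i<d. LINT r:{l..R}|lborel. (\<alpha> i r - \<beta> i) * (Z i - y i))"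
      unfolding set_lebesgue_integral_def scaleR_sum_right
      using terms(1) by (intro Bochner_Integration.integral_sum) (auto simp: set_integrable_def)
    also have "\<dots> = (\<Sum>i<d. S i * (Z i - y i))" by (intro sum.cong refl terms(2)) simp
    finally show ?thesis .
  qed
  have BI: "set_integrable lborel {l..R} B"
    unfolding B_def using si pe de by (intro set_integral_add set_integrable_mult_right) auto
  have I2: "(LINT r:{l..R}|lborel. B r) = (\<Sum>i<d. S i * (Z i - y i)) + C1 * (E + C3 * (I + 6 * I))"
  proof -
    have "(LINT r:{l..R}|lborel. 6 / (R - l) * I) = (R - l) * (6 / (R - l) * I)"
      by (rule set_integral_const_Icc) (use lR in simp)
    also have "\<dots> = 6 * I" using lR by (simp add: field_simps)
    finally have "(LINT r:{l..R}|lborel. 6 / (R - l) * I) = 6 * I" .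
    then show ?thesis
      unfolding B_def using si pe de by (simp add: set_integral_add se flip: E_def I_def)
  qed
  \<comment> \<open>Integrability of the discretisation error is a conclusion: it follows from
    domination by \<open>B\<close>.\<close>
  have cq: "set_integrable lborel {l..R} (\<lambda>r. c1 * dist_err w (lin \<beta>) r)"
  proof (rule set_integrable_bound[OF BI])
    show "set_borel_measurable lborel {l..R} (\<lambda>r. c1 * dist_err w (lin \<beta>) r)"
      using q unfolding set_borel_measurable_def by measurable
    show "AE r in lborel. r \<in> {l..R} \<longrightarrow> norm (c1 * dist_err w (lin \<beta>) r) \<le> norm (B r)"
      using bd by eventually_elim (use pos err_nonneg(2) in \<open>auto simp: abs_mult\<close>)
  qed
  then show "set_integrable lborel {l..R} (dist_err w (lin \<beta>))"
    using pos by (simp add: set_integrable_def mult.left_commute[of _ c1])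
  have "c1 * (LINT t:{l..R}|lborel. dist_err w (lin \<beta>) t) = (LINT t:{l..R}|lborel. c1 * dist_err w (lin \<beta>) t)" by simp
  also have "\<dots> \<le> (LINT r:{l..R}|lborel. B r)"
    by (rule set_integral_le_AE[OF cq BI]) (use bd in auto)
  also have "\<dots> = (\<Sum>i<d. S i * (Z i - y i)) + C1 * (E + 7 * C3 * I)" unfolding I2 by (simp add: algebra_simps)
  \<comment> \<open>The weight 1/2 is forced: half the squared increment is what the telescoping sum
    can give back.\<close>
  also have "(\<Sum>i<d. S i * (Z i - y i)) \<le> (\<Sum>i<d. Z i * S i + ((y i)\<^sup>2 / 2 + (S i)\<^sup>2 / 2))"
  proof (rule sum_mono)
    fix i
    have "0 \<le> (S i + y i)\<^sup>2" by simp
    then show "S i * (Z i - y i) \<le> Z i * S i + ((y i)\<^sup>2 / 2 + (S i)\<^sup>2 / 2)"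
      by (simp add: power2_eq_square algebra_simps)
  qed
  also have "\<dots> = (\<Sum>i<d. Z i * S i) + ((\<Sum>i<d. (y i)\<^sup>2) / 2 + (\<Sum>i<d. (S i)\<^sup>2) / 2)"
    by (simp add: sum.distrib sum_divide_distrib)
  also have "(\<Sum>i<d. (y i)\<^sup>2) / 2 \<le> C2 * (2 * E + 7 * C3 * I)"
    using wa(3) by (simp add: y_def)
  finally show "c1 * (LINT t:{l..R}|lborel. dist_err w (lin \<beta>) t)
      \<le> (\<Sum>i<d. (g i - A i R - (\<integral>x. psi m (lin \<beta> x) * e i x \<partial>\<mu>)) * (A i R - A i l - (R - l) * \<beta> i))
        + (\<Sum>i<d. (A i R - A i l - (R - l) * \<beta> i)\<^sup>2) / 2
        + (C1 + 2 * C2) * (LINT t:{l..R}|lborel. proj_err \<alpha> w t)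
        + 7 * C3 * (C1 + C2) * (LINT t:{l..R}|lborel. dist_err w v t)"
    by (simp add: S_def Z_def E_def I_def algebra_simps)
qed

text \<open>\<open>S n\<close> is the coordinate vector of the projected error integrated up to the
  n-th grid time, and \<open>G - S n\<close> is the moment vector of the error at that time.
  Summation telescopes; of the final half of the squared norm of \<open>S M\<close>, one quarter
  absorbs the initial mismatch \<open>G\<close> and one quarter remains.\<close>

lemma galerkin_estimate:
  fixes M :: nat and T \<tau> R3 :: real
  assumes \<tau>: "0 < \<tau>"
    and D: "\<And>n. n \<in> {1..M} \<Longrightarrow> interval_data \<alpha> A g w (v n) (\<tau> * real (n - 1)) (\<tau> * real n)"
    and A0: "\<And>i. i < d \<Longrightarrow> A i 0 = 0"
    and W: "\<And>n i. n \<in> {1..M} \<Longrightarrow> i < d \<Longrightarrow> (\<integral>x. psi m (lin (\<beta> n) x) * e i x \<partial>\<mu>) = gh i - \<tau> * (\<Sum>k=1..n. \<beta> k i)"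
    and R3: "\<And>a. (\<Sum>i<d. (g i - gh i) * a i) \<le> R3 + (\<Sum>i<d. (a i)\<^sup>2) / 4"
    and q: "\<And>n. n \<in> {1..M} \<Longrightarrow> dist_err w (lin (\<beta> n)) \<in> borel_measurable borel"
  shows "c1 * (\<Sum>n=1..M. LINT t:{\<tau> * real (n - 1)..\<tau> * real n}|lborel. dist_err w (lin (\<beta> n)) t)
      + (\<Sum>i<d. (A i (\<tau> * real M) - \<tau> * (\<Sum>k=1..M. \<beta> k i))\<^sup>2) / 4
    \<le> R3 + (C1 + 2 * C2) * (\<Sum>n=1..M. LINT t:{\<tau> * real (n - 1)..\<tau> * real n}|lborel. proj_err \<alpha> w t)
      + 7 * C3 * (C1 + C2) * (\<Sum>n=1..M. LINT t:{\<tau> * real (n - 1)..\<tau> * real n}|lborel. dist_err w (v n) t)"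
proof -
  define S where "S n i = A i (\<tau> * real n) - \<tau> * (\<Sum>k=1..n. \<beta> k i)" for n i
  define G where "G i = g i - gh i" for i
  define Q where "Q n = (LINT t:{\<tau> * real (n - 1)..\<tau> * real n}|lborel. dist_err w (lin (\<beta> n)) t)" for n
  define E where "E n = (LINT t:{\<tau> * real (n - 1)..\<tau> * real n}|lborel. proj_err \<alpha> w t)" for n
  define I where "I n = (LINT t:{\<tau> * real (n - 1)..\<tau> * real n}|lborel. dist_err w (v n) t)" for n
  have S0: "S 0 i = 0" if "i < d" for i using A0[OF that] by (simp add: S_def)
  have step: "c1 * Q n \<le> (\<Sum>i<d. G i * (S n i - S (n - 1) i)) - (\<Sum>i<d. (S n i)\<^sup>2) / 2 + (\<Sum>i<d. (S (n - 1) i)\<^sup>2) / 2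
      + (C1 + 2 * C2) * E n + 7 * C3 * (C1 + C2) * I n" if n: "n \<in> {1..M}" for n
  proof -
    have len: "\<tau> * real n - \<tau> * real (n - 1) = \<tau>" using n by (simp add: of_nat_diff algebra_simps)
    have Sd: "S n i - S (n - 1) i = A i (\<tau> * real n) - A i (\<tau> * real (n - 1)) - \<tau> * \<beta> n i" for i
    proof -
      obtain k where "n = Suc k" using n by (cases n) auto
      then show ?thesis by (simp add: S_def algebra_simps)
    qed
    have Z: "(g i - A i (\<tau> * real n) - (\<integral>x. psi m (lin (\<beta> n) x) * e i x \<partial>\<mu>)) = G i - S n i" if "i < d" for i
      using W[OF n that] by (simp add: G_def S_def)
    have "c1 * Q n \<le> (\<Sum>i<d. (G i - S n i) * (S n i - S (n - 1) i)) + (\<Sum>i<d. (S n i - S (n - 1) i)\<^sup>2) / 2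
      + (C1 + 2 * C2) * E n + 7 * C3 * (C1 + C2) * I n"
      using interval_step(3)[OF D[OF n] q[OF n]] unfolding len Sd[symmetric] Q_def[symmetric] E_def[symmetric] I_def[symmetric]
      by (simp add: Z)
    \<comment> \<open>The squared increment from Young's inequality completes -S_n (S_n - S_{n-1})
      to the exact difference of half squares.\<close>
    also have "(\<Sum>i<d. (G i - S n i) * (S n i - S (n - 1) i)) + (\<Sum>i<d. (S n i - S (n - 1) i)\<^sup>2) / 2
      = (\<Sum>i<d. G i * (S n i - S (n - 1) i)) - (\<Sum>i<d. (S n i)\<^sup>2) / 2 + (\<Sum>i<d. (S (n - 1) i)\<^sup>2) / 2"
      unfolding sum_divide_distrib sum_subtractf[symmetric] sum.distrib[symmetric]
      by (intro sum.cong refl) (simp add: power2_eq_square field_simps)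
    finally show ?thesis by simp
  qed
  have tel: "c1 * (\<Sum>n=1..N. Q n) \<le> (\<Sum>i<d. G i * S N i) - (\<Sum>i<d. (S N i)\<^sup>2) / 2
      + (C1 + 2 * C2) * (\<Sum>n=1..N. E n) + 7 * C3 * (C1 + C2) * (\<Sum>n=1..N. I n)" if "N \<le> M" for N
    using that
  proof (induction N)
    case 0
    then show ?case by (simp add: S0)
  next
    case (Suc N)
    have "c1 * (\<Sum>n=1..Suc N. Q n) = c1 * (\<Sum>n=1..N. Q n) + c1 * Q (Suc N)" by (simp add: distrib_left)
    also have "\<dots> \<le> ((\<Sum>i<d. G i * S N i) - (\<Sum>i<d. (S N i)\<^sup>2) / 2
        + (C1 + 2 * C2) * (\<Sum>n=1..N. E n) + 7 * C3 * (C1 + C2) * (\<Sum>n=1..N. I n))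
      + ((\<Sum>i<d. G i * (S (Suc N) i - S N i)) - (\<Sum>i<d. (S (Suc N) i)\<^sup>2) / 2 + (\<Sum>i<d. (S N i)\<^sup>2) / 2
      + (C1 + 2 * C2) * E (Suc N) + 7 * C3 * (C1 + C2) * I (Suc N))"
      using Suc step[of "Suc N"] by (intro add_mono) auto
    also have "(\<Sum>i<d. G i * (S (Suc N) i - S N i)) = (\<Sum>i<d. G i * S (Suc N) i) - (\<Sum>i<d. G i * S N i)"
      by (simp add: right_diff_distrib sum_subtractf)
    finally show ?case by (simp add: distrib_left)
  qed
  define P where "P = (\<Sum>i<d. (S M i)\<^sup>2)"
  have "(\<Sum>i<d. G i * S M i) \<le> R3 + P / 4" using R3[of "S M"] by (simp add: G_def P_def)
  then have "c1 * (\<Sum>n=1..M. Q n) + P / 4 \<le> R3 + (C1 + 2 * C2) * (\<Sum>n=1..M. E n) + 7 * C3 * (C1 + C2) * (\<Sum>n=1..M. I n)"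
    using tel[of M] by (simp add: P_def)
  then show ?thesis by (simp add: P_def S_def Q_def E_def I_def)
qed

end

section \<open>The fractional form\<close>

text \<open>On the diagonal the weight is 1 / 0 = 0, so it is finite everywhere.\<close>

definition gag_weight :: "real \<Rightarrow> (real^'n) \<times> (real^'n) \<Rightarrow> real" where
  "gag_weight s p = 1 / norm (fst p - snd p) powr (real CARD('n) + 2 * s)"

text \<open>With this measure the fractional form is the L2 inner product of the difference
  functions \<open>diff2\<close>, so that ordinary integration theory on pairs applies to
  it.\<close>

definition gag_measure :: "real \<Rightarrow> ((real^'n) \<times> (real^'n)) measure" where
  "gag_measure s = density (lborel \<Otimes>\<^sub>M lborel) (\<lambda>p. ennreal (gag_weight s p))"

definition diff2 :: "('a \<Rightarrow> real) \<Rightarrow> 'a \<times> 'a \<Rightarrow> real" where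
  "diff2 v p = v (fst p) - v (snd p)"

text \<open>Borel rather than Lebesgue measurability, so that \<open>diff2 v\<close> is measurable
  for the product sigma-algebra that carries \<open>gag_measure\<close>.\<close>

definition hs_fun :: "real \<Rightarrow> (real^'n \<Rightarrow> real) \<Rightarrow> bool" where
  "hs_fun s v \<longleftrightarrow> v \<in> borel_measurable borel \<and> gagliardo_sq s v < \<infinity>"

lemma gag_weight_nonneg [simp]: "0 \<le> gag_weight s p"
  by (simp add: gag_weight_def)

lemma gag_weight_measurable [measurable]: "gag_weight s \<in> borel_measurable (lborel \<Otimes>\<^sub>M lborel)"
  unfolding gag_weight_def by measurable

lemma sets_gag_measure [measurable_cong]: "sets (gag_measure s) = sets (borel \<Otimes>\<^sub>M borel)"
  by (simp add: gag_measure_def)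

lemma diff2_measurable [measurable (raw)]:
  "v \<in> borel_measurable borel \<Longrightarrow> diff2 v \<in> borel_measurable (borel \<Otimes>\<^sub>M borel)"
  unfolding diff2_def by simp

lemma diff2_add: "diff2 (\<lambda>x. v x + w x) p = diff2 v p + diff2 w p"
  by (simp add: diff2_def)

lemma nn_integral_gag_measure:
  assumes [measurable]: "f \<in> borel_measurable (borel \<Otimes>\<^sub>M borel)"
  shows "(\<integral>\<^sup>+p. f p \<partial>gag_measure s) = (\<integral>\<^sup>+x. \<integral>\<^sup>+z. ennreal (gag_weight s (x, z)) * f (x, z) \<partial>lborel \<partial>lborel)"
proof -
  have "(\<integral>\<^sup>+p. f p \<partial>gag_measure s) = (\<integral>\<^sup>+p. ennreal (gag_weight s p) * f p \<partial>(lborel \<Otimes>\<^sub>M lborel))"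
    unfolding gag_measure_def by (rule nn_integral_density) auto
  also have "\<dots> = (\<integral>\<^sup>+x. \<integral>\<^sup>+z. ennreal (gag_weight s (x, z)) * f (x, z) \<partial>lborel \<partial>lborel)"
    by (subst lborel.nn_integral_fst[symmetric]) auto
  finally show ?thesis .
qed

lemma gagliardo_eq:
  fixes v :: "real^'n \<Rightarrow> real"
  assumes [measurable]: "v \<in> borel_measurable borel"
  shows "gagliardo_sq s v = (\<integral>\<^sup>+p. ennreal ((diff2 v p)\<^sup>2) \<partial>gag_measure s)"
proof -
  have "gagliardo_sq s v = (\<integral>\<^sup>+x. \<integral>\<^sup>+z. ennreal ((v x - v z)\<^sup>2 / norm (x - z) powr (real CARD('n) + 2 * s)) \<partial>lborel \<partial>lborel)"
    unfolding gagliardo_sq_def by (simp add: nn_integral_completion)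
  also have "\<dots> = (\<integral>\<^sup>+x. \<integral>\<^sup>+z. ennreal (gag_weight s (x, z)) * ennreal ((diff2 v (x, z))\<^sup>2) \<partial>lborel \<partial>lborel)"
    by (simp add: gag_weight_def diff2_def ennreal_mult'[symmetric])
  also have "\<dots> = (\<integral>\<^sup>+p. ennreal ((diff2 v p)\<^sup>2) \<partial>gag_measure s)"
    by (rule nn_integral_gag_measure[symmetric]) measurable
  finally show ?thesis .
qed

lemma hs_fun_measurable: "hs_fun s v \<Longrightarrow> v \<in> borel_measurable borel"
  by (simp add: hs_fun_def)

lemma integrable_diff2_sq:
  assumes "hs_fun s v"
  shows "integrable (gag_measure s) (\<lambda>p. (diff2 v p)\<^sup>2)"
proof (rule integrableI_bounded)
  have [measurable]: "v \<in> borel_measurable borel" using assms by (rule hs_fun_measurable)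
  show "(\<lambda>p. (diff2 v p)\<^sup>2) \<in> borel_measurable (gag_measure s)" by measurable
  show "(\<integral>\<^sup>+p. ennreal (norm ((diff2 v p)\<^sup>2)) \<partial>gag_measure s) < \<infinity>"
    using assms gagliardo_eq[of v s] by (simp add: hs_fun_def)
qed

lemma integrable_diff2_mult:
  assumes "hs_fun s v" "hs_fun s w"
  shows "integrable (gag_measure s) (\<lambda>p. diff2 v p * diff2 w p)"
proof (rule Bochner_Integration.integrable_bound)
  have [measurable]: "v \<in> borel_measurable borel" "w \<in> borel_measurable borel" using assms by (auto intro: hs_fun_measurable)
  show "integrable (gag_measure s) (\<lambda>p. (diff2 v p)\<^sup>2 + (diff2 w p)\<^sup>2)"
    using assms by (intro Bochner_Integration.integrable_add integrable_diff2_sq)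
  show "(\<lambda>p. diff2 v p * diff2 w p) \<in> borel_measurable (gag_measure s)" by measurable
  show "AE p in gag_measure s. norm (diff2 v p * diff2 w p) \<le> norm ((diff2 v p)\<^sup>2 + (diff2 w p)\<^sup>2)"
  proof (intro always_eventually allI)
    fix p
    have "0 \<le> (\<bar>diff2 v p\<bar> - \<bar>diff2 w p\<bar>)\<^sup>2" by simp
    then have "2 * (\<bar>diff2 v p\<bar> * \<bar>diff2 w p\<bar>) \<le> (diff2 v p)\<^sup>2 + (diff2 w p)\<^sup>2"
      by (simp add: power2_eq_square algebra_simps)
    moreover have "0 \<le> \<bar>diff2 v p\<bar> * \<bar>diff2 w p\<bar>" by simp
    ultimately have "\<bar>diff2 v p\<bar> * \<bar>diff2 w p\<bar> \<le> (diff2 v p)\<^sup>2 + (diff2 w p)\<^sup>2" by linarith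
    then show "norm (diff2 v p * diff2 w p) \<le> norm ((diff2 v p)\<^sup>2 + (diff2 w p)\<^sup>2)" by (simp add: abs_mult)
  qed
qed

lemma hs_fun_lincomb:
  assumes "hs_fun s v" "hs_fun s w"
  shows "hs_fun s (\<lambda>x. a * v x + b * w x)"
proof -
  have [measurable]: "v \<in> borel_measurable borel" "w \<in> borel_measurable borel" using assms by (auto intro: hs_fun_measurable)
  have e: "(diff2 (\<lambda>x. a * v x + b * w x) p)\<^sup>2 = a\<^sup>2 * (diff2 v p)\<^sup>2 + (2 * a * b) * (diff2 v p * diff2 w p) + b\<^sup>2 * (diff2 w p)\<^sup>2" for p
    by (simp add: diff2_def power2_eq_square algebra_simps)
  have "integrable (gag_measure s) (\<lambda>p. (diff2 (\<lambda>x. a * v x + b * w x) p)\<^sup>2)"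
    unfolding e using integrable_diff2_sq[OF assms(1)] integrable_diff2_sq[OF assms(2)] integrable_diff2_mult[OF assms]
    by auto
  then have "(\<integral>\<^sup>+p. ennreal ((diff2 (\<lambda>x. a * v x + b * w x) p)\<^sup>2) \<partial>gag_measure s) < \<infinity>"
    by (subst (asm) integrable_iff_bounded) simp
  then show ?thesis by (simp add: hs_fun_def gagliardo_eq)
qed

lemma hs_fun_zero: "hs_fun s (\<lambda>x. 0)"
  by (simp add: hs_fun_def gagliardo_sq_def)

lemma hs_fun_add: "hs_fun s v \<Longrightarrow> hs_fun s w \<Longrightarrow> hs_fun s (\<lambda>x. v x + w x)"
  and hs_fun_diff: "hs_fun s v \<Longrightarrow> hs_fun s w \<Longrightarrow> hs_fun s (\<lambda>x. v x - w x)"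
  and hs_fun_mult: "hs_fun s v \<Longrightarrow> hs_fun s (\<lambda>x. k * v x)"
  using hs_fun_lincomb[of s v w 1 1] hs_fun_lincomb[of s v w 1 "-1"] hs_fun_lincomb[of s v "\<lambda>_. 0" k 0] hs_fun_zero by auto

lemma hs_fun_sum: "(\<And>i. i \<in> I \<Longrightarrow> hs_fun s (f i)) \<Longrightarrow> hs_fun s (\<lambda>x. \<Sum>i\<in>I. f i x)"
  by (induction I rule: infinite_finite_induct) (auto intro: hs_fun_add hs_fun_zero)

lemma frac_form_lborel:
  fixes v w :: "real^'n \<Rightarrow> real"
  assumes [measurable]: "v \<in> borel_measurable borel" "w \<in> borel_measurable borel"
  shows "frac_form s v w = (\<integral>x. \<integral>z. gag_weight s (x, z) * ((v x - v z) * (w x - w z)) \<partial>lborel \<partial>lborel)"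
proof -
  have "frac_form s v w = (\<integral>x. (\<integral>z. (v x - v z) * (w x - w z) / norm (x - z) powr (real CARD('n) + 2 * s) \<partial>lborel) \<partial>lebesgue)"
    unfolding frac_form_def by (simp add: integral_completion)
  also have "\<dots> = (\<integral>x. (\<integral>z. (v x - v z) * (w x - w z) / norm (x - z) powr (real CARD('n) + 2 * s) \<partial>lborel) \<partial>lborel)"
    by (rule integral_completion) measurable
  finally show ?thesis by (simp add: gag_weight_def)
qed

lemma frac_form_eq:
  fixes v w :: "real^'n \<Rightarrow> real"
  assumes [measurable]: "v \<in> borel_measurable borel" "w \<in> borel_measurable borel"
    and int: "integrable (gag_measure s) (\<lambda>p. diff2 v p * diff2 w p)"
  shows "frac_form s v w = (\<integral>p. diff2 v p * diff2 w p \<partial>gag_measure s)"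
proof -
  have I: "integrable (lborel \<Otimes>\<^sub>M lborel) (\<lambda>p. gag_weight s p * (diff2 v p * diff2 w p))"
    using int unfolding gag_measure_def by (subst (asm) integrable_density) auto
  have "frac_form s v w = (\<integral>x. \<integral>z. gag_weight s (x, z) * (diff2 v (x, z) * diff2 w (x, z)) \<partial>lborel \<partial>lborel)"
    by (simp add: frac_form_lborel diff2_def)
  also have "\<dots> = (\<integral>p. gag_weight s p * (diff2 v p * diff2 w p) \<partial>(lborel \<Otimes>\<^sub>M lborel))"
    using lborel_pair.integral_fst'[OF I] by simp
  also have "\<dots> = (\<integral>p. diff2 v p * diff2 w p \<partial>gag_measure s)"
    unfolding gag_measure_def by (subst integral_density) auto
  finally show ?thesis .
qed

lemma frac_form_hs: "hs_fun s v \<Longrightarrow> hs_fun s w \<Longrightarrow> frac_form s v w = (\<integral>p. diff2 v p * diff2 w p \<partial>gag_measure s)"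
  by (intro frac_form_eq integrable_diff2_mult) (auto dest: hs_fun_measurable)

lemma frac_form_commute: "frac_form s v w = frac_form s w v"
  by (simp add: frac_form_def mult.commute)

lemma frac_form_lincomb_left:
  assumes "hs_fun s v" "hs_fun s w" "hs_fun s z"
  shows "frac_form s (\<lambda>x. a * v x + b * w x) z = a * frac_form s v z + b * frac_form s w z"
proof -
  have e: "diff2 (\<lambda>x. a * v x + b * w x) p * diff2 z p = a * (diff2 v p * diff2 z p) + b * (diff2 w p * diff2 z p)" for p
    by (simp add: diff2_def algebra_simps)
  show ?thesis
    using integrable_diff2_mult[OF assms(1,3)] integrable_diff2_mult[OF assms(2,3)]
    by (simp add: frac_form_hs assms hs_fun_lincomb e)
qed

lemma frac_form_diff_left: "hs_fun s v \<Longrightarrow> hs_fun s w \<Longrightarrow> hs_fun s z \<Longrightarrow>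
    frac_form s (\<lambda>x. v x - w x) z = frac_form s v z - frac_form s w z"
  using frac_form_lincomb_left[of s v w z 1 "-1"] by simp

lemma frac_form_zero_left: "frac_form s (\<lambda>x. 0) z = 0"
  by (simp add: frac_form_def)

lemma frac_form_sum_left:
  assumes "\<And>i. i \<in> I \<Longrightarrow> hs_fun s (f i)" "hs_fun s z"
  shows "frac_form s (\<lambda>x. \<Sum>i\<in>I. a i * f i x) z = (\<Sum>i\<in>I. a i * frac_form s (f i) z)"
  using assms(1)
proof (induction I rule: infinite_finite_induct)
  case (insert i I)
  have "hs_fun s (\<lambda>x. \<Sum>i\<in>I. a i * f i x)" using insert by (intro hs_fun_sum hs_fun_mult) auto
  then show ?case
    using frac_form_lincomb_left[of s "f i" "\<lambda>x. \<Sum>i\<in>I. a i * f i x" z "a i" 1] insert assms(2) by simp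
qed (simp_all add: frac_form_zero_left)

lemma gagliardo_frac_form: "hs_fun s v \<Longrightarrow> gagliardo_sq s v = ennreal (frac_form s v v)"
proof -
  assume h: "hs_fun s v"
  have "(\<integral>\<^sup>+p. ennreal ((diff2 v p)\<^sup>2) \<partial>gag_measure s) = ennreal (\<integral>p. (diff2 v p)\<^sup>2 \<partial>gag_measure s)"
    by (rule nn_integral_eq_integral[OF integrable_diff2_sq[OF h]]) simp
  then show ?thesis using h by (simp add: gagliardo_eq hs_fun_def frac_form_hs power2_eq_square)
qed

lemma frac_form_nonneg: "hs_fun s v \<Longrightarrow> 0 \<le> frac_form s v v"
  by (simp add: frac_form_hs)

lemma frac_form_Cauchy_Schwarz:
  assumes "hs_fun s v" "hs_fun s w"
  shows "(frac_form s v w)\<^sup>2 \<le> frac_form s v v * frac_form s w w"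
proof -
  let ?a = "frac_form s w w" and ?b = "frac_form s v w" and ?c = "frac_form s v v"
  have *: "0 \<le> ?c + 2 * t * ?b + t\<^sup>2 * ?a" for t
  proof -
    have "0 \<le> frac_form s (\<lambda>x. 1 * v x + t * w x) (\<lambda>x. 1 * v x + t * w x)"
      by (intro frac_form_nonneg hs_fun_lincomb assms)
    also have "\<dots> = ?c + 2 * t * ?b + t\<^sup>2 * ?a"
      using frac_form_lincomb_left[OF assms hs_fun_lincomb[OF assms], of 1 t 1 t]
        frac_form_lincomb_left[OF assms assms(1), of 1 t] frac_form_lincomb_left[OF assms assms(2), of 1 t]
        frac_form_commute[of s v "\<lambda>x. 1 * v x + t * w x"] frac_form_commute[of s w "\<lambda>x. 1 * v x + t * w x"] frac_form_commute[of s w v]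
      by (simp add: power2_eq_square algebra_simps)
    finally show ?thesis .
  qed
  show ?thesis
  proof (cases "?a = 0")
    case True
    have "?b = 0"
    proof (rule ccontr)
      assume b: "?b \<noteq> 0"
      \<comment> \<open>When the quadratic term vanishes the polynomial is affine in t; this value
        of t makes it equal to -1.\<close>
      have "0 \<le> ?c + 2 * (- (?c + 1) / (2 * ?b)) * ?b" using *[of "- (?c + 1) / (2 * ?b)"] True by simp
      then show False using b by (simp add: field_simps)
    qed
    then show ?thesis using True by simp
  next
    case False
    then have a: "0 < ?a" using frac_form_nonneg[OF assms(2)] by simp
    have "0 \<le> ?c + 2 * (- ?b / ?a) * ?b + (- ?b / ?a)\<^sup>2 * ?a" by (rule *)
    also have "\<dots> = ?c - ?b\<^sup>2 / ?a" using a by (simp add: power2_eq_square field_simps)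
    finally show ?thesis using a by (simp add: field_simps)
  qed
qed

section \<open>Lipschitz functions and the Poincare inequality\<close>

lemma powr_dyadic_bracket:
  fixes r :: real
  assumes "0 < r"
  obtains j :: nat where "1 \<le> r" "2 ^ j \<le> r" "r < 2 ^ (j + 1)"
  | j :: nat where "r < 1" "(1 / 2) ^ (j + 1) \<le> r" "r < (1 / 2) ^ j"
proof (cases "1 \<le> r")
  case True
  obtain n where n: "r < 2 ^ n" using real_arch_pow[of 2 r] by auto
  define j where "j = (LEAST n. r < 2 ^ n)"
  have j: "r < 2 ^ j" unfolding j_def by (rule LeastI) (rule n)
  have "j \<noteq> 0" using j True by (intro notI) simp
  then obtain i where i: "j = Suc i" by (cases j) auto
  have "\<not> r < 2 ^ i" using not_less_Least[of i "\<lambda>n. r < 2 ^ n"] i by (simp add: j_def)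
  then show ?thesis using that(1)[of i] True j i by simp
next
  case False
  obtain n where n: "(1/2) ^ n < r" using real_arch_pow_inv[of r "1/2"] assms by auto
  then have n: "(1/2) ^ n \<le> r" by simp
  define j where "j = (LEAST n. (1/2) ^ n \<le> r)"
  have j: "(1/2) ^ j \<le> r" unfolding j_def by (rule LeastI) (rule n)
  have "j \<noteq> 0" using j False by (intro notI) simp
  then obtain i where i: "j = Suc i" by (cases j) auto
  have "\<not> (1/2) ^ i \<le> r" using not_less_Least[of i "\<lambda>n. (1/2) ^ n \<le> r"] i by (simp add: j_def)
  then show ?thesis using that(2)[of i] False j i by simp
qed

text \<open>Dyadic decomposition: on each shell the kernel is bounded by its extreme value and the
  shell by the full ball around it, which leads to two geometric series. The far shells converge
  because s > 0, the shells near the origin because s < 1.\<close>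

lemma nn_integral_truncated_kernel:
  assumes s: "0 < s" "s < 1"
  shows "(\<integral>\<^sup>+h. ennreal (min ((norm (h :: real^'n))\<^sup>2) 1 / norm h powr (real CARD('n) + 2 * s)) \<partial>lborel) < \<infinity>"
proof -
  let ?N = "real CARD('n) + 2 * s"
  define a where "a j = (1 / 2 powr ?N) ^ j" for j :: nat
  define b where "b j = (1 / 4) ^ j * (2 powr ?N) ^ (j + 1)" for j :: nat
  \<comment> \<open>\<open>a j\<close> bounds the kernel for norms between 2^j and 2^(j+1), and
    \<open>b j\<close> for norms between 2^-(j+1) and 2^-j, where the truncated numerator is at most
    4^-j.\<close>
  define F :: "real^'n \<Rightarrow> nat \<Rightarrow> ennreal" where
    "F h j = ennreal (a j) * indicator (ball 0 (2 ^ (j + 1))) h + ennreal (b j) * indicator (ball 0 ((1/2) ^ j)) h" for h j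
  have N0: "0 < ?N" using s by simp
  have ab: "0 \<le> a j" "0 \<le> b j" for j by (simp_all add: a_def b_def)
  have pw: "(x ^ k) powr ?N = (x powr ?N) ^ k" if "0 < x" for x :: real and k :: nat
    using that by (simp add: powr_realpow[symmetric] powr_powr mult.commute)
  have le: "ennreal (min ((norm h)\<^sup>2) 1 / norm h powr ?N) \<le> (\<Sum>j. F h j)" for h
  proof (cases "h = 0")
    case True
    then show ?thesis by simp
  next
    case False
    then have "0 < norm h" by simp
    then show ?thesis
    proof (cases rule: powr_dyadic_bracket)
      case (1 j)
      have "min ((norm h)\<^sup>2) 1 / norm h powr ?N \<le> 1 / (2 ^ j) powr ?N"
        using 1 N0 by (intro frac_le powr_mono2) auto
      also have "\<dots> = a j" by (simp add: a_def pw power_one_over)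
      finally have "ennreal (min ((norm h)\<^sup>2) 1 / norm h powr ?N) \<le> ennreal (a j)" by (rule ennreal_leI)
      also have "\<dots> \<le> F h j" using 1 by (simp add: F_def)
      also have "\<dots> \<le> (\<Sum>j. F h j)" using sum_le_suminf[of "F h" "{j}"] by simp
      finally show ?thesis .
    next
      case (2 j)
      have "min ((norm h)\<^sup>2) 1 / norm h powr ?N \<le> ((1/2) ^ j)\<^sup>2 / ((1/2) ^ (j + 1)) powr ?N"
      proof (intro frac_le powr_mono2)
        have "(norm h)\<^sup>2 \<le> ((1/2) ^ j)\<^sup>2" using 2 by (intro power_mono) auto
        then show "min ((norm h)\<^sup>2) 1 \<le> ((1/2) ^ j)\<^sup>2" by (rule min.coboundedI1)
      qed (use 2 N0 in auto)
      also have "\<dots> = b j"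
      proof -
        have "((1/2) ^ (j + 1)) powr ?N = 1 / (2 powr ?N) ^ (j + 1)"
          by (subst pw) (simp_all add: powr_divide power_divide power_one_over)
        moreover have "(((1/2) ^ j)\<^sup>2 :: real) = (1/4) ^ j"
          by (simp add: power2_eq_square power_mult_distrib[symmetric])
        ultimately show ?thesis by (simp add: b_def)
      qed
      finally have "ennreal (min ((norm h)\<^sup>2) 1 / norm h powr ?N) \<le> ennreal (b j)" by (rule ennreal_leI)
      also have "\<dots> \<le> F h j" using 2 by (simp add: F_def)
      also have "\<dots> \<le> (\<Sum>j. F h j)" using sum_le_suminf[of "F h" "{j}"] by simp
      finally show ?thesis .
    qed
  qed
  let ?V = "unit_ball_vol (real CARD('n))"
  \<comment> \<open>\<open>qa\<close> and \<open>qb\<close> are the ratios of the two geometric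
    series after multiplication by the ball volumes, which contribute 2^N and 2^-N per
    index.\<close>
  define qa where "qa = 2 powr (- 2 * s)"
  define qb where "qb = 2 powr (2 * s - 2)"
  have q: "0 \<le> qa" "qa < 1" "0 \<le> qb" "qb < 1"
    using s powr_less_mono[of "- 2 * s" 0 2] powr_less_mono[of "2 * s - 2" 0 2] by (auto simp: qa_def qb_def)
  have vol: "emeasure lborel (ball (0::real^'n) r) = ennreal (?V * r ^ CARD('n))" if "0 \<le> r" for r
    using emeasure_ball[OF that, of "0::real^'n"] by simp
  have two: "(2::real) ^ CARD('n) = 2 powr real CARD('n)" by (simp add: powr_realpow)
  have Fint: "(\<integral>\<^sup>+h. F h j \<partial>lborel) = ennreal (?V * 2 ^ CARD('n) * qa ^ j + ?V * 2 powr ?N * qb ^ j)" for j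
  proof -
    have A: "a j * (?V * (2 ^ (j + 1)) ^ CARD('n)) = ?V * 2 ^ CARD('n) * qa ^ j"
    proof -
      have "(1 / 2 powr ?N) * 2 ^ CARD('n) = qa"
        unfolding two qa_def by (simp add: powr_minus_divide[symmetric] powr_add[symmetric])
      then have "(1 / 2 powr ?N) ^ j * (2 ^ CARD('n)) ^ j = qa ^ j" by (metis power_mult_distrib)
      moreover have "((2::real) ^ (j + 1)) ^ CARD('n) = 2 ^ CARD('n) * (2 ^ CARD('n)) ^ j"
        by (simp add: power_mult_distrib power_mult[symmetric] mult.commute)
      ultimately show ?thesis by (simp add: a_def mult_ac)
    qed
    have B: "b j * (?V * ((1/2) ^ j) ^ CARD('n)) = ?V * 2 powr ?N * qb ^ j"
    proof -
      have "(1/4) * 2 powr ?N * (1/2) ^ CARD('n) = qb"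
      proof -
        have "(1/2) ^ CARD('n) = (2::real) powr - real CARD('n)" by (simp add: powr_minus powr_realpow power_one_over inverse_eq_divide)
        moreover have "(1/4 :: real) = 2 powr (- 2)" by (simp add: powr_minus)
        ultimately have "(1/4) * 2 powr ?N * (1/2) ^ CARD('n) = 2 powr (-2) * 2 powr ?N * 2 powr - real CARD('n)"
          by (simp only:)
        also have "\<dots> = 2 powr (-2 + ?N - real CARD('n))" by (simp only: powr_add[symmetric] diff_conv_add_uminus)
        finally show ?thesis by (simp add: qb_def)
      qed
      then have "(1/4) ^ j * (2 powr ?N) ^ j * ((1/2) ^ CARD('n)) ^ j = qb ^ j" by (metis power_mult_distrib)
      moreover have "((1/2 :: real) ^ j) ^ CARD('n) = ((1/2) ^ CARD('n)) ^ j"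
        by (simp only: power_mult[symmetric] mult.commute)
      ultimately show ?thesis by (simp add: b_def mult_ac)
    qed
    have "(\<integral>\<^sup>+h. F h j \<partial>lborel) = ennreal (a j) * emeasure lborel (ball (0::real^'n) (2 ^ (j + 1))) + ennreal (b j) * emeasure lborel (ball (0::real^'n) ((1/2) ^ j))"
    proof -
      have [measurable]: "ball (0::real^'n) r \<in> sets borel" for r by simp
      have "(\<integral>\<^sup>+h. F h j \<partial>lborel) = (\<integral>\<^sup>+h. ennreal (a j) * indicator (ball (0::real^'n) (2 ^ (j + 1))) h \<partial>lborel)
          + (\<integral>\<^sup>+h. ennreal (b j) * indicator (ball (0::real^'n) ((1/2) ^ j)) h \<partial>lborel)"
        unfolding F_def by (rule nn_integral_add) measurable
      then show ?thesis by (simp add: nn_integral_cmult_indicator)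
    qed
    also have "\<dots> = ennreal (a j * (?V * (2 ^ (j + 1)) ^ CARD('n))) + ennreal (b j * (?V * ((1/2) ^ j) ^ CARD('n)))"
      by (subst (1 2) vol) (simp_all add: ennreal_mult'[OF ab(1)] ennreal_mult'[OF ab(2)])
    also have "\<dots> = ennreal (?V * 2 ^ CARD('n) * qa ^ j + ?V * 2 powr ?N * qb ^ j)"
      unfolding A B using q by (subst ennreal_plus) auto
    finally show ?thesis .
  qed
  have "(\<integral>\<^sup>+h. ennreal (min ((norm (h :: real^'n))\<^sup>2) 1 / norm h powr ?N) \<partial>lborel) \<le> (\<integral>\<^sup>+h. (\<Sum>j. F h j) \<partial>lborel)"
    by (rule nn_integral_mono[OF le])
  also have "\<dots> = (\<Sum>j. \<integral>\<^sup>+h. F h j \<partial>lborel)"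
  proof (rule nn_integral_suminf)
    have [measurable]: "ball (0::real^'n) r \<in> sets borel" for r by simp
    show "(\<lambda>h. F h j) \<in> borel_measurable lborel" for j unfolding F_def by measurable
  qed
  also have "\<dots> = (\<Sum>j. ennreal (?V * 2 ^ CARD('n) * qa ^ j + ?V * 2 powr ?N * qb ^ j))" by (simp only: Fint)
  also have "\<dots> < \<infinity>"
  proof -
    have "summable (\<lambda>j. ?V * 2 ^ CARD('n) * qa ^ j + ?V * 2 powr ?N * qb ^ j)"
      using q by (intro summable_add summable_mult summable_geometric) auto
    then show ?thesis
      using q by (subst suminf_ennreal2) (auto intro!: add_nonneg_nonneg mult_nonneg_nonneg)
  qed
  finally show ?thesis .
qed

section \<open>An integrable majorant for differences of Lipschitz functions\<close>

lemma nn_integral_lborel_diff: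
  fixes x :: "'a::euclidean_space"
  assumes [measurable]: "f \<in> borel_measurable borel"
  shows "(\<integral>\<^sup>+z. f (x - z) \<partial>lborel) = (\<integral>\<^sup>+z. f z \<partial>lborel)"
    and "(\<integral>\<^sup>+z. f (z - x) \<partial>lborel) = (\<integral>\<^sup>+z. f z \<partial>lborel)"
proof -
  have 1: "lborel = distr lborel borel (\<lambda>z. x + (-1) *\<^sub>R z)"
    using lborel_affine[of "-1" x] by (simp add: density_1)
  have 2: "lborel = distr lborel borel (\<lambda>z. - x + 1 *\<^sub>R z)"
    using lborel_affine[of 1 "- x"] by (simp add: density_1)
  have "(\<integral>\<^sup>+z. f z \<partial>lborel) = (\<integral>\<^sup>+z. f z \<partial>distr lborel borel (\<lambda>z. x + (-1) *\<^sub>R z))" by (subst 1) simp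
  also have "\<dots> = (\<integral>\<^sup>+z. f (x - z) \<partial>lborel)" by (subst nn_integral_distr) auto
  finally show "(\<integral>\<^sup>+z. f (x - z) \<partial>lborel) = (\<integral>\<^sup>+z. f z \<partial>lborel)" ..
  have "(\<integral>\<^sup>+z. f z \<partial>lborel) = (\<integral>\<^sup>+z. f z \<partial>distr lborel borel (\<lambda>z. - x + 1 *\<^sub>R z))" by (subst 2) simp
  also have "\<dots> = (\<integral>\<^sup>+z. f (z - x) \<partial>lborel)" by (subst nn_integral_distr) auto
  finally show "(\<integral>\<^sup>+z. f (z - x) \<partial>lborel) = (\<integral>\<^sup>+z. f z \<partial>lborel)" ..
qed

text \<open>The common majorant, up to a factor, of the squared differences of all functions that
  vanish outside D and share a bound and a Lipschitz constant. It yields finite seminorms and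
  dominates the limits of mollified test functions.\<close>

definition gag_dom :: "'a::real_normed_vector set \<Rightarrow> 'a \<times> 'a \<Rightarrow> real" where
  "gag_dom D p = min ((norm (fst p - snd p))\<^sup>2) 1 * (indicator D (fst p) + indicator D (snd p))"

lemma gag_dom_nonneg [simp]: "0 \<le> gag_dom D p"
  by (simp add: gag_dom_def)

text \<open>Each indicator confines one of the two variables to D. Integrating the other one first
  and using translation invariance leaves the volume of D times the truncated kernel
  integral.\<close>

lemma integrable_gag_dom:
  fixes D :: "(real^'n) set"
  assumes s: "0 < s" "s < 1" and D: "bounded D" "D \<in> sets borel"
  shows "integrable (gag_measure s) (gag_dom D)"
proof (rule integrableI_nonneg)
  let ?N = "real CARD('n) + 2 * s"
  have [measurable]: "D \<in> sets borel" by fact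
  show "gag_dom D \<in> borel_measurable (gag_measure s)" unfolding gag_dom_def by measurable
  define g :: "real^'n \<Rightarrow> ennreal" where "g h = ennreal (min ((norm h)\<^sup>2) 1 / norm h powr ?N)" for h
  have [measurable]: "g \<in> borel_measurable borel" unfolding g_def by measurable
  have g: "(\<integral>\<^sup>+h. g h \<partial>lborel) < \<infinity>" unfolding g_def by (rule nn_integral_truncated_kernel[OF s])
  have "(\<integral>\<^sup>+p. ennreal (gag_dom D p) \<partial>gag_measure s) = (\<integral>\<^sup>+x. \<integral>\<^sup>+z. ennreal (gag_weight s (x, z)) * ennreal (gag_dom D (x, z)) \<partial>lborel \<partial>lborel)"
    by (rule nn_integral_gag_measure) (unfold gag_dom_def, measurable)
  also have "\<dots> = (\<integral>\<^sup>+x. \<integral>\<^sup>+z. indicator D x * g (x - z) + indicator D z * g (x - z) \<partial>lborel \<partial>lborel)"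
  proof (intro nn_integral_cong)
    fix x z
    have "ennreal (gag_weight s (x, z)) * ennreal (gag_dom D (x, z)) = ennreal (min ((norm (x - z))\<^sup>2) 1 / norm (x - z) powr ?N) * ennreal (indicator D x + indicator D z)"
    proof -
      have "ennreal (gag_weight s (x, z)) * ennreal (gag_dom D (x, z)) = ennreal (gag_weight s (x, z) * gag_dom D (x, z))"
        by (rule ennreal_mult[symmetric]) auto
      also have "gag_weight s (x, z) * gag_dom D (x, z) = (min ((norm (x - z))\<^sup>2) 1 / norm (x - z) powr ?N) * (indicator D x + indicator D z)"
        by (simp add: gag_weight_def gag_dom_def)
      also have "ennreal \<dots> = ennreal (min ((norm (x - z))\<^sup>2) 1 / norm (x - z) powr ?N) * ennreal (indicator D x + indicator D z)"
        by (rule ennreal_mult) auto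
      finally show ?thesis .
    qed
    also have "ennreal (indicator D x + indicator D z) = indicator D x + indicator D z"
      by (simp add: indicator_def)
    finally show "ennreal (gag_weight s (x, z)) * ennreal (gag_dom D (x, z)) = indicator D x * g (x - z) + indicator D z * g (x - z)"
      by (simp add: g_def distrib_right mult.commute)
  qed
  also have "\<dots> = (\<integral>\<^sup>+x. \<integral>\<^sup>+z. indicator D x * g (x - z) \<partial>lborel \<partial>lborel) + (\<integral>\<^sup>+x. \<integral>\<^sup>+z. indicator D z * g (x - z) \<partial>lborel \<partial>lborel)"
    by (simp add: nn_integral_add)
  also have "(\<integral>\<^sup>+x. \<integral>\<^sup>+z. indicator D z * g (x - z) \<partial>lborel \<partial>lborel) = (\<integral>\<^sup>+z. \<integral>\<^sup>+x. indicator D z * g (x - z) \<partial>lborel \<partial>lborel)"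
    by (rule lborel_pair.Fubini'[symmetric]) measurable
  also have "\<dots> = emeasure lborel D * (\<integral>\<^sup>+h. g h \<partial>lborel)"
    by (simp add: nn_integral_cmult nn_integral_lborel_diff nn_integral_multc)
  also have "(\<integral>\<^sup>+x. \<integral>\<^sup>+z. indicator D x * g (x - z) \<partial>lborel \<partial>lborel) = emeasure lborel D * (\<integral>\<^sup>+h. g h \<partial>lborel)"
    by (simp add: nn_integral_cmult nn_integral_lborel_diff nn_integral_multc)
  also have "emeasure lborel D * (\<integral>\<^sup>+h. g h \<partial>lborel) + emeasure lborel D * (\<integral>\<^sup>+h. g h \<partial>lborel) < \<infinity>"
    using g emeasure_bounded_finite[OF D(1)] by (auto simp: ennreal_mult_less_top)
  finally show "(\<integral>\<^sup>+p. ennreal (gag_dom D p) \<partial>gag_measure s) < \<infinity>" .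
qed simp

lemma diff2_sq_le_gag_dom:
  assumes lip: "\<And>x y. \<bar>f x - f y\<bar> \<le> L * norm (x - y)"
    and bd: "\<And>x. \<bar>f x\<bar> \<le> B" and out: "\<And>x. x \<notin> D \<Longrightarrow> f x = 0"
  shows "(diff2 f p)\<^sup>2 \<le> max (L\<^sup>2) ((2 * B)\<^sup>2) * gag_dom D p"
proof (cases p)
  case (Pair x z)
  let ?C = "max (L\<^sup>2) ((2 * B)\<^sup>2)"
  have C0: "0 \<le> ?C" by (simp add: le_max_iff_disj)
  have sq: "(f x - f z)\<^sup>2 \<le> ?C * min ((norm (x - z))\<^sup>2) 1"
  proof -
    have "\<bar>f x - f z\<bar>\<^sup>2 \<le> (L * norm (x - z))\<^sup>2" by (intro power_mono lip) auto
    also have "\<dots> \<le> ?C * (norm (x - z))\<^sup>2" by (simp add: power_mult_distrib mult_right_mono)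
    finally have 1: "(f x - f z)\<^sup>2 \<le> ?C * (norm (x - z))\<^sup>2" by simp
    have "\<bar>f x - f z\<bar> \<le> 2 * B" using bd[of x] bd[of z] by linarith
    then have "\<bar>f x - f z\<bar>\<^sup>2 \<le> (2 * B)\<^sup>2" by (intro power_mono) auto
    then have 2: "(f x - f z)\<^sup>2 \<le> ?C * 1" by simp
    have "?C * min ((norm (x - z))\<^sup>2) 1 = ?C * (norm (x - z))\<^sup>2 \<or> ?C * min ((norm (x - z))\<^sup>2) 1 = ?C * 1" by (simp add: min_def)
    then show ?thesis using 1 2 by metis
  qed
  show ?thesis
  proof (cases "x \<in> D \<or> z \<in> D")
    case True
    have "?C * (min ((norm (x - z))\<^sup>2) 1 * 1) \<le> ?C * (min ((norm (x - z))\<^sup>2) 1 * (indicator D x + indicator D z))"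
      using True C0 by (intro mult_left_mono) (auto simp: indicator_def)
    then show ?thesis using sq by (simp add: Pair diff2_def gag_dom_def)
  next
    case False
    then show ?thesis using out C0 by (simp add: Pair diff2_def)
  qed
qed

lemma borel_measurable_Lipschitz:
  fixes f :: "'a::real_normed_vector \<Rightarrow> real"
  assumes lip: "\<And>x y. \<bar>f x - f y\<bar> \<le> L * norm (x - y)"
  shows "f \<in> borel_measurable borel"
proof -
  have "\<bar>f x - f y\<bar> \<le> \<bar>L\<bar> * norm (x - y)" for x y
    by (rule order_trans[OF lip]) (intro mult_right_mono, auto)
  then have "\<bar>L\<bar>-lipschitz_on UNIV f" by (intro lipschitz_onI) (auto simp: dist_norm)
  then show ?thesis
    by (intro borel_measurable_continuous_onI) (rule lipschitz_on_continuous_on)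
qed

lemma hs_fun_Lipschitz:
  fixes f :: "real^'n \<Rightarrow> real"
  assumes s: "0 < s" "s < 1" and lip: "\<And>x y. \<bar>f x - f y\<bar> \<le> L * norm (x - y)"
    and bd: "\<And>x. \<bar>f x\<bar> \<le> B" and out: "\<And>x. x \<notin> D \<Longrightarrow> f x = 0" and D: "bounded D" "D \<in> sets borel"
  shows "hs_fun s f"
proof -
  have [measurable]: "f \<in> borel_measurable borel" by (rule borel_measurable_Lipschitz[OF lip])
  have "integrable (gag_measure s) (\<lambda>p. (diff2 f p)\<^sup>2)"
  proof (rule Bochner_Integration.integrable_bound)
    show "integrable (gag_measure s) (\<lambda>p. max (L\<^sup>2) ((2 * B)\<^sup>2) * gag_dom D p)"
      using integrable_gag_dom[OF s D] by simp
    show "AE p in gag_measure s. norm ((diff2 f p)\<^sup>2) \<le> norm (max (L\<^sup>2) ((2 * B)\<^sup>2) * gag_dom D p)"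
      using diff2_sq_le_gag_dom[OF lip bd out] by (intro always_eventually allI) (auto intro: order_trans[OF _ abs_ge_self])
  qed measurable
  then have "(\<integral>\<^sup>+p. ennreal ((diff2 f p)\<^sup>2) \<partial>gag_measure s) < \<infinity>"
    by (subst (asm) integrable_iff_bounded) simp
  then show ?thesis by (simp add: hs_fun_def gagliardo_eq)
qed

text \<open>The seminorm sees the exterior: restricting the inner integral to a ball where f
  vanishes leaves the square of f(x) times a kernel that is bounded below.\<close>

lemma poincare:
  fixes D :: "(real^'n) set"
  assumes s: "0 < s" and D: "bounded D"
  obtains C where "0 < C" "\<And>f. f \<in> borel_measurable borel \<Longrightarrow> (\<And>x. x \<notin> D \<Longrightarrow> f x = 0) \<Longrightarrow>
     (\<integral>\<^sup>+x. ennreal ((f x)\<^sup>2) \<partial>lborel) \<le> ennreal C * gagliardo_sq s f"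
proof -
  let ?N = "real CARD('n) + 2 * s"
  obtain R where R: "0 < R" "D \<subseteq> ball 0 R" using bounded_subset_ballD[OF D] by blast
  obtain b :: "real^'n" where b: "b \<in> Basis" using nonempty_Basis by blast
  \<comment> \<open>A ball of radius R disjoint from the ball of radius R around 0; points of the
    two are at most 4 R apart, which explains the constant \<open>c\<close>.\<close>
  define E where "E = ball ((2 * R) *\<^sub>R b) R"
  define V where "V = measure lborel E"
  have Vp: "0 < V" unfolding V_def E_def using R content_ball_pos[of R] by simp
  have EV: "emeasure lborel E = ennreal V" unfolding V_def E_def
    by (rule emeasure_eq_ennreal_measure) (metis emeasure_lborel_ball_finite infinity_ennreal_def less_irrefl)
  define c where "c = V / (4 * R) powr ?N"
  have c: "0 < c" using Vp R by (simp add: c_def)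
  have E: "R \<le> norm z \<and> norm z \<le> 3 * R" if "z \<in> E" for z
  proof -
    have d: "norm ((2 * R) *\<^sub>R b - z) < R" using that by (simp add: E_def dist_norm)
    have n: "norm ((2 * R) *\<^sub>R b) = 2 * R" using b R by (simp add: norm_Basis)
    show ?thesis using d n norm_triangle_ineq2[of "(2 * R) *\<^sub>R b" z] norm_triangle_ineq2[of z "(2 * R) *\<^sub>R b"]
      by (simp add: norm_minus_commute)
  qed
  show ?thesis
  proof (rule that[of "1 / c"])
    fix f :: "real^'n \<Rightarrow> real"
    assume [measurable]: "f \<in> borel_measurable borel" and out: "\<And>x. x \<notin> D \<Longrightarrow> f x = 0"
    have "ennreal (c * (f x)\<^sup>2) \<le> (\<integral>\<^sup>+z. ennreal ((f x - f z)\<^sup>2 / norm (x - z) powr ?N) \<partial>lborel)" for x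
    proof (cases "x \<in> D")
      case True
      then have x: "norm x < R" using R by auto
      have "ennreal (c * (f x)\<^sup>2) = ennreal ((f x)\<^sup>2 / (4 * R) powr ?N) * emeasure lborel E"
        unfolding EV by (subst ennreal_mult[symmetric]) (auto simp: c_def V_def)
      also have "\<dots> = (\<integral>\<^sup>+z. ennreal ((f x)\<^sup>2 / (4 * R) powr ?N) * indicator E z \<partial>lborel)"
        by (rule nn_integral_cmult_indicator[symmetric]) (simp add: E_def)
      also have "\<dots> \<le> (\<integral>\<^sup>+z. ennreal ((f x - f z)\<^sup>2 / norm (x - z) powr ?N) \<partial>lborel)"
      proof (rule nn_integral_mono)
        fix z
        show "ennreal ((f x)\<^sup>2 / (4 * R) powr ?N) * indicator E z \<le> ennreal ((f x - f z)\<^sup>2 / norm (x - z) powr ?N)"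
        proof (cases "z \<in> E")
          case True
          then have "z \<notin> D" using E[OF True] R by auto
          then have fz: "f z = 0" by (rule out)
          have "norm (x - z) \<le> 4 * R" "0 < norm (x - z)"
            using E[OF True] x norm_triangle_ineq4[of x z] by auto
          then have "(f x)\<^sup>2 / (4 * R) powr ?N \<le> (f x)\<^sup>2 / norm (x - z) powr ?N"
            using s by (intro divide_left_mono powr_mono2 mult_pos_pos) auto
          then show ?thesis using True fz by (simp add: ennreal_leI)
        qed simp
      qed
      finally show ?thesis .
    qed (simp add: out)
    then have "(\<integral>\<^sup>+x. ennreal (c * (f x)\<^sup>2) \<partial>lborel) \<le> (\<integral>\<^sup>+x. \<integral>\<^sup>+z. ennreal ((f x - f z)\<^sup>2 / norm (x - z) powr ?N) \<partial>lborel \<partial>lborel)"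
      by (intro nn_integral_mono)
    also have "\<dots> = gagliardo_sq s f" unfolding gagliardo_sq_def by (simp add: nn_integral_completion)
    finally have "ennreal c * (\<integral>\<^sup>+x. ennreal ((f x)\<^sup>2) \<partial>lborel) \<le> gagliardo_sq s f"
      using c by (simp add: ennreal_mult' nn_integral_cmult)
    then have "ennreal (1 / c) * (ennreal c * (\<integral>\<^sup>+x. ennreal ((f x)\<^sup>2) \<partial>lborel)) \<le> ennreal (1 / c) * gagliardo_sq s f"
      by (rule mult_left_mono) simp
    moreover have "ennreal (1 / c) * ennreal c = 1" using c by (subst ennreal_mult[symmetric]) auto
    ultimately show "(\<integral>\<^sup>+x. ennreal ((f x)\<^sup>2) \<partial>lborel) \<le> ennreal (1 / c) * gagliardo_sq s f"
      by (simp add: mult.assoc[symmetric])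
  qed (use c in simp)
qed

section \<open>The finite element space\<close>

locale triangulated_domain =
  fixes \<Omega> :: "(real^'n) set" and \<T> :: "(real^'n) set set"
  assumes op: "open \<Omega>" and bd: "bounded \<Omega>" and cvx: "convex \<Omega>" and ne: "\<Omega> \<noteq> {}"
    and tri: "triangulation_of \<Omega> \<T>"
begin

lemma finite_T: "finite \<T>" and Union_T: "\<Union>\<T> = closure \<Omega>"
  and face_T: "K \<in> \<T> \<Longrightarrow> K' \<in> \<T> \<Longrightarrow> (K \<inter> K') face_of K"
  using tri by (auto simp: triangulation_of_def triangulation_def)

lemma simplex_T:
  assumes "K \<in> \<T>"
  obtains C where "finite C" "\<not> affine_dependent C" "K = convex hull C"
  using tri assms by (auto simp: triangulation_of_def simplex)

lemma compact_T: "K \<in> \<T> \<Longrightarrow> compact K"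
  by (erule simplex_T) (simp add: finite_imp_compact_convex_hull)

lemma convex_T: "K \<in> \<T> \<Longrightarrow> convex K"
  by (erule simplex_T) simp

lemma extreme_T: 
  assumes "K \<in> \<T>" shows "K = convex hull {a. a extreme_point_of K}" "finite {a. a extreme_point_of K}"
    "{a. a extreme_point_of K} \<subseteq> vertices_of \<T>" "\<not> affine_dependent {a. a extreme_point_of K}"
proof -
  obtain C where C: "finite C" "\<not> affine_dependent C" "K = convex hull C" using simplex_T[OF assms] .
  have eq: "{a. a extreme_point_of K} = C"
    using extreme_point_of_convex_hull_affine_independent[OF C(2)] C(3) by auto
  show "K = convex hull {a. a extreme_point_of K}" "finite {a. a extreme_point_of K}" "\<not> affine_dependent {a. a extreme_point_of K}"
    unfolding eq using C by auto
  show "{a. a extreme_point_of K} \<subseteq> vertices_of \<T>" using assms by (auto simp: vertices_of_def)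
qed

lemma finite_vertices: "finite (vertices_of \<T>)"
proof -
  have "vertices_of \<T> = (\<Union>K\<in>\<T>. {a. a extreme_point_of K})" by (auto simp: vertices_of_def)
  then show ?thesis using finite_T extreme_T(2) by auto
qed

lemma affine_eq_on_hull:
  fixes a a' :: "real^'n"
  assumes "\<And>c. c \<in> C \<Longrightarrow> a \<bullet> c + b = a' \<bullet> c + b'" "x \<in> convex hull C"
  shows "a \<bullet> x + b = a' \<bullet> x + b'"
proof -
  have "convex hull C \<subseteq> {x. (a - a') \<bullet> x = b' - b}"
  proof (rule hull_minimal)
    show "C \<subseteq> {x. (a - a') \<bullet> x = b' - b}" using assms(1) by (force simp: inner_diff_left)
    show "convex {x. (a - a') \<bullet> x = b' - b}" by (rule convex_hyperplane)
  qed
  then show ?thesis using assms(2) by (auto simp: inner_diff_left)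
qed

text \<open>Differences to one chosen vertex are linearly independent, so a linear functional with
  prescribed values exists; the adjoint at 1 represents it as an inner product.\<close>

lemma affine_interpolation:
  fixes C :: "(real^'n) set" and f :: "real^'n \<Rightarrow> real"
  assumes "\<not> affine_dependent C"
  obtains a b where "\<And>c. c \<in> C \<Longrightarrow> a \<bullet> c + b = f c"
proof (cases "C = {}")
  case True then show ?thesis using that by blast
next
  case False
  then obtain c0 where c0: "c0 \<in> C" by blast
  let ?B = "(\<lambda>x. - c0 + x) ` (C - {c0})"
  have "independent ?B" using assms c0 affine_dependent_iff_dependent2[OF c0] by simp
  from linear_independent_extend[OF this, of "\<lambda>y. f (c0 + y) - f c0"]
  obtain g :: "real^'n \<Rightarrow> real" where g: "linear g" "\<And>y. y \<in> ?B \<Longrightarrow> g y = f (c0 + y) - f c0" by blast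
  define a where "a = adjoint g 1"
  have a: "g x = a \<bullet> x" for x
    using adjoint_works[OF g(1), of x 1] by (simp add: a_def inner_commute)
  show ?thesis
  proof (rule that[of a "f c0 - a \<bullet> c0"])
    fix c assume c: "c \<in> C"
    show "a \<bullet> c + (f c0 - a \<bullet> c0) = f c"
    proof (cases "c = c0")
      case False
      then have "g (- c0 + c) = f c - f c0" using g(2)[of "- c0 + c"] c by simp
      then show ?thesis by (simp add: a inner_diff_right inner_add_right)
    qed simp
  qed
qed

lemma extreme_point_in_face: "F face_of K \<Longrightarrow> a extreme_point_of F \<Longrightarrow> a extreme_point_of K"
  using extreme_point_of_face by blast

text \<open>Affine interpolation on each simplex. The pieces agree on an intersection of two
  simplices because it is a common face and hence the hull of shared vertices.\<close>

lemma Sh_exists: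
  assumes f: "\<And>a. a \<in> vertices_of \<T> \<Longrightarrow> a \<notin> \<Omega> \<Longrightarrow> f a = 0"
  shows "\<exists>\<phi>\<in>Sh \<Omega> \<T>. \<forall>a\<in>vertices_of \<T>. \<phi> a = f a"
proof -
  have "\<forall>K\<in>\<T>. \<exists>p. \<forall>c. c extreme_point_of K \<longrightarrow> fst p \<bullet> c + snd p = f c"
  proof
    fix K assume K: "K \<in> \<T>"
    obtain a b where "\<And>c. c \<in> {c. c extreme_point_of K} \<Longrightarrow> a \<bullet> c + b = f c"
      using affine_interpolation[OF extreme_T(4)[OF K], of f] by blast
    then show "\<exists>p. \<forall>c. c extreme_point_of K \<longrightarrow> fst p \<bullet> c + snd p = f c" by (intro exI[of _ "(a, b)"]) auto
  qed
  then obtain p where p: "\<And>K c. K \<in> \<T> \<Longrightarrow> c extreme_point_of K \<Longrightarrow> fst (p K) \<bullet> c + snd (p K) = f c" by metis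
  define l where "l K x = fst (p K) \<bullet> x + snd (p K)" for K x
  have lv: "K \<in> \<T> \<Longrightarrow> c extreme_point_of K \<Longrightarrow> l K c = f c" for K c by (simp add: l_def p)
  have cons: "l K x = l K' x" if "K \<in> \<T>" "K' \<in> \<T>" "x \<in> K" "x \<in> K'" for K K' x
  proof -
    let ?F = "K \<inter> K'"
    have F: "?F face_of K" "?F face_of K'" using face_T[OF that(1,2)] face_T[OF that(2,1)] by (auto simp: Int_commute)
    have "?F = convex hull {a. a extreme_point_of ?F}"
      using compact_T convex_T that by (intro Krein_Milman_Minkowski) (auto intro: convex_Int compact_Int)
    then have x: "x \<in> convex hull {a. a extreme_point_of ?F}" using that by blast
    show ?thesis unfolding l_def
    proof (rule affine_eq_on_hull[OF _ x])
      fix c assume "c \<in> {a. a extreme_point_of ?F}"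
      then have "c extreme_point_of K" "c extreme_point_of K'" using F extreme_point_in_face by auto
      then show "fst (p K) \<bullet> c + snd (p K) = fst (p K') \<bullet> c + snd (p K')" using p that by simp
    qed
  qed
  \<comment> \<open>A supporting hyperplane of the convex domain at x cuts K in a face containing x.
    All vertices of that face lie on the hyperplane, hence outside \<Omega>, where the data
    vanish.\<close>
  have bdry: "l K x = 0" if K: "K \<in> \<T>" "x \<in> K" "x \<notin> \<Omega>" for K x
  proof -
    have "x \<notin> rel_interior \<Omega>" using that op by (simp add: rel_interior_open)
    moreover have "x \<in> closure \<Omega>" using K Union_T by blast
    ultimately obtain a where a: "\<And>y. y \<in> closure \<Omega> \<Longrightarrow> a \<bullet> x \<le> a \<bullet> y" "\<And>y. y \<in> rel_interior \<Omega> \<Longrightarrow> a \<bullet> x < a \<bullet> y"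
      using supporting_hyperplane_rel_boundary[of "closure \<Omega>" x] cvx
      by (metis convex_closure convex_rel_interior_closure closure_closure)
    let ?F = "K \<inter> {y. a \<bullet> y = a \<bullet> x}"
    have KO: "K \<subseteq> closure \<Omega>" using K Union_T by blast
    have F: "?F face_of K"
    proof -
      have "K \<inter> {y. a \<bullet> y = a \<bullet> x} face_of K"
        by (rule face_of_Int_supporting_hyperplane_ge[OF convex_T[OF K(1)]]) (use a(1) KO in auto)
      then show ?thesis .
    qed
    have "compact ?F" using compact_T[OF K(1)] closed_hyperplane by (intro compact_Int_closed)
    then have "?F = convex hull {a. a extreme_point_of ?F}"
      using F face_of_imp_convex Krein_Milman_Minkowski by blast
    then have x: "x \<in> convex hull {a. a extreme_point_of ?F}" using K by blast
    have "fst (p K) \<bullet> x + snd (p K) = 0 \<bullet> x + 0"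
    proof (rule affine_eq_on_hull[OF _ x])
      fix c assume c: "c \<in> {a. a extreme_point_of ?F}"
      then have cK: "c extreme_point_of K" using F extreme_point_in_face by auto
      have "c \<in> ?F" using c by (simp add: extreme_point_of_def)
      then have "c \<notin> rel_interior \<Omega>" using a(2) by force
      then have "c \<notin> \<Omega>" using op by (simp add: rel_interior_open)
      moreover have "c \<in> vertices_of \<T>" using cK K by (auto simp: vertices_of_def)
      ultimately have "f c = 0" using f by blast
      then show "fst (p K) \<bullet> c + snd (p K) = 0 \<bullet> c + 0" using p[OF K(1) cK] by simp
    qed
    then show ?thesis by (simp add: l_def)
  qed
  \<comment> \<open>The chosen simplex does not matter, by \<open>cons\<close>; the value 0 outside
    agrees with every piece there, by \<open>bdry\<close>.\<close>
  define \<phi> where "\<phi> x = (if x \<in> \<Omega> then l (SOME K. K \<in> \<T> \<and> x \<in> K) x else 0)" for x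
  have phi: "\<phi> x = l K x" if "K \<in> \<T>" "x \<in> K" for K x
  proof (cases "x \<in> \<Omega>")
    case True
    define K0 where "K0 = (SOME K. K \<in> \<T> \<and> x \<in> K)"
    have "K0 \<in> \<T> \<and> x \<in> K0" unfolding K0_def
      by (rule someI[of _ K]) (use that in auto)
    then show ?thesis using cons[of K0 K x] that True by (simp add: \<phi>_def K0_def)
  qed (use bdry that in \<open>auto simp: \<phi>_def\<close>)
  have "\<phi> \<in> Sh \<Omega> \<T>" unfolding Sh_def
  proof (intro CollectI conjI ballI allI impI)
    have "continuous_on (\<Union>K\<in>\<T>. K) \<phi>"
    proof (rule continuous_on_closed_Union[OF finite_T])
      fix K assume K: "K \<in> \<T>"
      show "closed K" using compact_T[OF K] by (rule compact_imp_closed)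
      have "continuous_on K (l K)" unfolding l_def by (intro continuous_intros)
      then show "continuous_on K \<phi>" by (rule continuous_on_eq) (simp add: phi[OF K])
    qed
    then show "continuous_on (closure \<Omega>) \<phi>" using Union_T by simp
    fix K assume K: "K \<in> \<T>"
    show "\<exists>a b. \<forall>x\<in>K. \<phi> x = a \<bullet> x + b" using phi[OF K] unfolding l_def by blast
  qed (simp add: \<phi>_def)
  moreover have "\<phi> a = f a" if a: "a \<in> vertices_of \<T>" for a
  proof -
    obtain K where "K \<in> \<T>" "a extreme_point_of K" using a unfolding vertices_of_def by blast
    then show ?thesis using phi[of K a] lv by (simp add: extreme_point_of_def)
  qed
  ultimately show ?thesis by blast
qed

lemma Sh_unique:
  assumes "\<phi> \<in> Sh \<Omega> \<T>" "\<phi>' \<in> Sh \<Omega> \<T>" "\<And>a. a \<in> vertices_of \<T> \<Longrightarrow> \<phi> a = \<phi>' a"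
  shows "\<phi> = \<phi>'"
proof
  fix x
  show "\<phi> x = \<phi>' x"
  proof (cases "x \<in> \<Omega>")
    case True
    then have "x \<in> \<Union>\<T>" using Union_T closure_subset by auto
    then obtain K where K: "K \<in> \<T>" "x \<in> K" by blast
    obtain a b where ab: "\<And>x. x \<in> K \<Longrightarrow> \<phi> x = a \<bullet> x + b" using assms(1) K by (auto simp: Sh_def)
    obtain a' b' where ab': "\<And>x. x \<in> K \<Longrightarrow> \<phi>' x = a' \<bullet> x + b'" using assms(2) K by (auto simp: Sh_def)
    have "a \<bullet> x + b = a' \<bullet> x + b'"
    proof (rule affine_eq_on_hull)
      show "x \<in> convex hull {a. a extreme_point_of K}" using extreme_T(1)[OF K(1)] K by simp
      fix c assume c: "c \<in> {a. a extreme_point_of K}"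
      then have "c \<in> K" by (simp add: extreme_point_of_def)
      then show "a \<bullet> c + b = a' \<bullet> c + b'"
        using assms(3)[of c] ab ab' c extreme_T(3)[OF K(1)] by (metis subsetD)
    qed
    then show ?thesis using ab ab' K by simp
  qed (use assms in \<open>auto simp: Sh_def\<close>)
qed

text \<open>Existence and uniqueness together make the definite description in \<open>interp\<close>
  meaningful; data vanishing outside \<Omega> are required since members of the space do.\<close>

lemma interp_in_Sh:
  assumes f: "\<And>a. a \<notin> \<Omega> \<Longrightarrow> f a = 0"
  shows "interp \<Omega> \<T> f \<in> Sh \<Omega> \<T>"
proof -
  obtain \<phi> where \<phi>: "\<phi> \<in> Sh \<Omega> \<T>" "\<forall>a\<in>vertices_of \<T>. \<phi> a = f a" using Sh_exists[of f] f by blast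
  have "interp \<Omega> \<T> f = \<phi>" unfolding interp_def
    by (rule the_equality) (use \<phi> Sh_unique in auto)
  then show ?thesis using \<phi> by simp
qed

section \<open>Linear structure and regularity of the finite element space\<close>

lemma Sh_lincomb: "\<phi> \<in> Sh \<Omega> \<T> \<Longrightarrow> \<phi>' \<in> Sh \<Omega> \<T> \<Longrightarrow> (\<lambda>x. a * \<phi> x + b * \<phi>' x) \<in> Sh \<Omega> \<T>"
proof -
  assume h: "\<phi> \<in> Sh \<Omega> \<T>" "\<phi>' \<in> Sh \<Omega> \<T>"
  show ?thesis unfolding Sh_def
  proof (intro CollectI conjI ballI allI impI)
    show "continuous_on (closure \<Omega>) (\<lambda>x. a * \<phi> x + b * \<phi>' x)"
      using h by (intro continuous_intros) (auto simp: Sh_def)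
    fix K assume K: "K \<in> \<T>"
    have "\<exists>p q. \<forall>x\<in>K. \<phi> x = p \<bullet> x + q" "\<exists>p q. \<forall>x\<in>K. \<phi>' x = p \<bullet> x + q" using h K by (simp_all add: Sh_def)
    then obtain p q p' q' where "\<forall>x\<in>K. \<phi> x = p \<bullet> x + q" "\<forall>x\<in>K. \<phi>' x = p' \<bullet> x + q'" by metis
    then show "\<exists>r t. \<forall>x\<in>K. a * \<phi> x + b * \<phi>' x = r \<bullet> x + t"
      by (intro exI[of _ "a *\<^sub>R p + b *\<^sub>R p'"] exI[of _ "a * q + b * q'"]) (auto simp: inner_add_left algebra_simps)
  qed (use h in \<open>auto simp: Sh_def\<close>)
qed

lemma Sh_zero: "(\<lambda>x. 0) \<in> Sh \<Omega> \<T>"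
  unfolding Sh_def by (auto intro!: exI[of _ 0])

lemma Sh_sum: "(\<And>i. i \<in> I \<Longrightarrow> f i \<in> Sh \<Omega> \<T>) \<Longrightarrow> (\<lambda>x. \<Sum>i\<in>I. a i * f i x) \<in> Sh \<Omega> \<T>"
proof (induction I rule: infinite_finite_induct)
  case (insert i I)
  then show ?case using Sh_lincomb[of "f i" "\<lambda>x. \<Sum>i\<in>I. a i * f i x" "a i" 1] by auto
qed (auto simp: Sh_zero)

lemma Sh_Lipschitz:
  assumes "\<phi> \<in> Sh \<Omega> \<T>"
  obtains L where "0 \<le> L" "\<And>x y. \<bar>\<phi> x - \<phi> y\<bar> \<le> L * norm (x - y)"
proof -
  have "\<forall>K\<in>\<T>. \<exists>p. \<forall>x\<in>K. \<phi> x = fst p \<bullet> x + snd p" using assms unfolding Sh_def by fastforce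
  then obtain p where p: "\<And>K x. K \<in> \<T> \<Longrightarrow> x \<in> K \<Longrightarrow> \<phi> x = fst (p K) \<bullet> x + snd (p K)" by metis
  \<comment> \<open>The sum over the finite triangulation is a simple upper bound for all gradients
    on the simplices.\<close>
  define L where "L = (\<Sum>K\<in>\<T>. norm (fst (p K)))"
  have L0: "0 \<le> L" unfolding L_def by (intro sum_nonneg) auto
  have LK: "norm (fst (p K)) \<le> L" if "K \<in> \<T>" for K
    unfolding L_def using finite_T that by (intro member_le_sum) auto
  have inside: "\<bar>\<phi> x - \<phi> y\<bar> \<le> L * norm (x - y)" if xy: "x \<in> closure \<Omega>" "y \<in> closure \<Omega>" for x y
  proof -
    define \<gamma> where "\<gamma> t = x + t *\<^sub>R (y - x)" for t :: real
    have seg: "\<gamma> t \<in> closure \<Omega>" if "t \<in> {0..1}" for t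
    proof -
      have "\<gamma> t = (1 - t) *\<^sub>R x + t *\<^sub>R y" by (simp add: \<gamma>_def algebra_simps)
      then show ?thesis using convex_closure[OF cvx] xy that by (simp add: convex_alt)
    qed
    have cg: "continuous_on UNIV \<gamma>" unfolding \<gamma>_def by (intro continuous_intros)
    \<comment> \<open>By convexity the segment from x to y stays in the closure. The simplices
      divide it into finitely many closed pieces on each of which the function is affine, so a
      common Lipschitz constant on the pieces holds on the whole segment.\<close>
    have "(L * norm (x - y))-lipschitz_on {0..1} (\<phi> \<circ> \<gamma>)"
    proof (rule lipschitz_on_closed_Union[where I = \<T> and U = "\<lambda>K. \<gamma> -` K"])
      fix K assume K: "K \<in> \<T>"
      show "closed (\<gamma> -` K)"
        by (rule closed_vimage[OF compact_imp_closed[OF compact_T[OF K]] cg])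
      show "(L * norm (x - y))-lipschitz_on (\<gamma> -` K) (\<phi> \<circ> \<gamma>)"
      proof (rule lipschitz_onI)
        fix t t' assume "t \<in> \<gamma> -` K" "t' \<in> \<gamma> -` K"
        then have "(\<phi> \<circ> \<gamma>) t - (\<phi> \<circ> \<gamma>) t' = fst (p K) \<bullet> (\<gamma> t - \<gamma> t')" using p[OF K] by (simp add: inner_diff_right)
        also have "\<gamma> t - \<gamma> t' = (t - t') *\<^sub>R (y - x)" by (simp add: \<gamma>_def algebra_simps)
        finally have "dist ((\<phi> \<circ> \<gamma>) t) ((\<phi> \<circ> \<gamma>) t') = \<bar>t - t'\<bar> * \<bar>fst (p K) \<bullet> (y - x)\<bar>"
          by (simp add: dist_real_def abs_mult)
        also have "\<dots> \<le> \<bar>t - t'\<bar> * (L * norm (x - y))"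
        proof (rule mult_left_mono)
          have "\<bar>fst (p K) \<bullet> (y - x)\<bar> \<le> norm (fst (p K)) * norm (y - x)" by (rule Cauchy_Schwarz_ineq2)
          also have "\<dots> \<le> L * norm (y - x)" by (intro mult_right_mono LK K) auto
          finally show "\<bar>fst (p K) \<bullet> (y - x)\<bar> \<le> L * norm (x - y)" by (simp add: norm_minus_commute)
        qed simp
        finally show "dist ((\<phi> \<circ> \<gamma>) t) ((\<phi> \<circ> \<gamma>) t') \<le> L * norm (x - y) * dist t t'"
          by (simp add: dist_real_def mult_ac)
      qed (use L0 in auto)
    next
      show "{0..1} \<subseteq> (\<Union>K\<in>\<T>. \<gamma> -` K)" using seg Union_T by fastforce
    qed (use finite_T L0 in auto)
    then have "dist ((\<phi> \<circ> \<gamma>) 0) ((\<phi> \<circ> \<gamma>) 1) \<le> L * norm (x - y) * dist (0::real) 1"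
      by (rule lipschitz_onD) auto
    then show ?thesis by (simp add: \<gamma>_def dist_real_def)
  qed
  \<comment> \<open>The segment meets the frontier at a point z where the function vanishes, and z
    is no farther from x than y is.\<close>
  have mixed: "\<bar>\<phi> x\<bar> \<le> L * norm (x - y)" if xy: "x \<in> \<Omega>" "y \<notin> \<Omega>" for x y
  proof -
    have "closed_segment x y \<inter> frontier \<Omega> \<noteq> {}"
    proof (rule connected_Int_frontier[OF connected_segment(1)])
      have "x \<in> closed_segment x y" "y \<in> closed_segment x y" by simp_all
      then show "closed_segment x y \<inter> \<Omega> \<noteq> {}" "closed_segment x y - \<Omega> \<noteq> {}" using xy by blast+
    qed
    then obtain z where z: "z \<in> closed_segment x y" "z \<in> frontier \<Omega>" by blast
    have "z \<notin> \<Omega>" "z \<in> closure \<Omega>" using z op by (auto simp: frontier_def interior_open)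
    then have "\<phi> z = 0" using assms by (auto simp: Sh_def)
    moreover have "\<bar>\<phi> x - \<phi> z\<bar> \<le> L * norm (x - z)" using xy closure_subset \<open>z \<in> closure \<Omega>\<close> by (intro inside) auto
    moreover have "L * norm (x - z) \<le> L * norm (x - y)"
      using L0 segment_bound(1)[OF z(1)] by (intro mult_left_mono) (auto simp: norm_minus_commute)
    ultimately show ?thesis by simp
  qed
  show ?thesis
  proof (rule that[OF L0])
    fix x y
    consider "x \<in> \<Omega>" "y \<in> \<Omega>" | "x \<in> \<Omega>" "y \<notin> \<Omega>" | "x \<notin> \<Omega>" "y \<in> \<Omega>" | "x \<notin> \<Omega>" "y \<notin> \<Omega>" by blast
    then show "\<bar>\<phi> x - \<phi> y\<bar> \<le> L * norm (x - y)"
    proof cases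
      case 1 then show ?thesis using closure_subset by (intro inside) auto
    next
      case 2 then show ?thesis using mixed[of x y] assms by (auto simp: Sh_def)
    next
      case 3 then show ?thesis using mixed[of y x] assms by (auto simp: Sh_def norm_minus_commute)
    next
      case 4 then show ?thesis using assms L0 by (auto simp: Sh_def)
    qed
  qed
qed

lemma
  assumes "\<phi> \<in> Sh \<Omega> \<T>"
  shows Sh_measurable: "\<phi> \<in> borel_measurable borel" and Sh_continuous: "continuous_on UNIV \<phi>"
proof -
  obtain L where L: "0 \<le> L" "\<And>x y. \<bar>\<phi> x - \<phi> y\<bar> \<le> L * norm (x - y)" using Sh_Lipschitz[OF assms] by metis
  then have "L-lipschitz_on UNIV \<phi>" by (intro lipschitz_onI) (auto simp: dist_norm)
  then show "continuous_on UNIV \<phi>" by (rule lipschitz_on_continuous_on)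
  then show "\<phi> \<in> borel_measurable borel" by (rule borel_measurable_continuous_onI)
qed

lemma Sh_bounded:
  assumes "\<phi> \<in> Sh \<Omega> \<T>" obtains B where "\<And>x. \<bar>\<phi> x\<bar> \<le> B"
proof -
  have "compact (\<phi> ` closure \<Omega>)"
    using bd assms by (intro compact_continuous_image) (auto simp: Sh_def)
  then obtain B where B: "\<And>x. x \<in> closure \<Omega> \<Longrightarrow> \<bar>\<phi> x\<bar> \<le> B"
    using compact_imp_bounded bounded_iff[of "\<phi> ` closure \<Omega>"] by auto
  have "\<bar>\<phi> x\<bar> \<le> max B 0" for x
  proof (cases "x \<in> \<Omega>")
    case True
    then show ?thesis using B[of x] closure_subset[of \<Omega>] by (auto simp: le_max_iff_disj)
  next
    case False
    then have "\<phi> x = 0" using assms by (simp add: Sh_def)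
    then show ?thesis by simp
  qed
  then show ?thesis by (rule that)
qed

lemma Sh_hs_fun:
  assumes s: "0 < s" "s < 1" and "\<phi> \<in> Sh \<Omega> \<T>" shows "hs_fun s \<phi>"
proof -
  obtain L where L: "\<And>x y. \<bar>\<phi> x - \<phi> y\<bar> \<le> L * norm (x - y)" using Sh_Lipschitz[OF assms(3)] by metis
  obtain B where B: "\<And>x. \<bar>\<phi> x\<bar> \<le> B" using Sh_bounded[OF assms(3)] by blast
  show ?thesis
    by (rule hs_fun_Lipschitz[OF s L B _ bd]) (use assms op in \<open>auto simp: Sh_def\<close>)
qed

text \<open>The Poincare inequality gives a function vanishing almost everywhere; by continuity its
  nonzero set is open, and an open negligible set is empty.\<close>

lemma Sh_definite:
  assumes s: "0 < s" "s < 1" and \<phi>: "\<phi> \<in> Sh \<Omega> \<T>" and z: "frac_form s \<phi> \<phi> = 0"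
  shows "\<phi> = (\<lambda>x. 0)"
proof -
  have [measurable]: "\<phi> \<in> borel_measurable borel" by (rule Sh_measurable[OF \<phi>])
  obtain C where C: "0 < C" "\<And>f. f \<in> borel_measurable borel \<Longrightarrow> (\<And>x. x \<notin> \<Omega> \<Longrightarrow> f x = 0) \<Longrightarrow>
     (\<integral>\<^sup>+x. ennreal ((f x)\<^sup>2) \<partial>lborel) \<le> ennreal C * gagliardo_sq s f" using poincare[OF s(1) bd] by metis
  have "(\<integral>\<^sup>+x. ennreal ((\<phi> x)\<^sup>2) \<partial>lborel) \<le> ennreal C * gagliardo_sq s \<phi>"
    by (rule C) (use \<phi> in \<open>auto simp: Sh_def\<close>)
  also have "\<dots> = 0" using gagliardo_frac_form[OF Sh_hs_fun[OF s \<phi>]] z by simp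
  finally have "(\<integral>\<^sup>+x. ennreal ((\<phi> x)\<^sup>2) \<partial>lborel) = 0" by simp
  then have "AE x in lborel. \<phi> x = 0"
    by (subst (asm) nn_integral_0_iff_AE) auto
  then have "AE x in lebesgue. \<phi> x = 0" by (rule AE_completion)
  then have neg: "negligible {x. \<phi> x \<noteq> 0}"
    by (subst (asm) eventually_ae_filter) (auto simp: negligible_iff_null_sets intro: null_sets_subset)
  moreover have "open {x. \<phi> x \<noteq> 0}"
  proof -
    have "{x. \<phi> x \<noteq> 0} = \<phi> -` (- {0})" by auto
    moreover have "open (\<phi> -` (- {0}))" by (rule open_vimage[OF _ Sh_continuous[OF \<phi>]]) auto
    ultimately show ?thesis by simp
  qed
  ultimately have "{x. \<phi> x \<noteq> 0} = {}" using open_not_negligible[of "{x. \<phi> x \<noteq> 0}"] by blast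
  then show ?thesis by auto
qed

section \<open>Orthonormal bases for the fractional form\<close>

definition orthonormal_upto :: "real \<Rightarrow> nat \<Rightarrow> (nat \<Rightarrow> real^'n \<Rightarrow> real) \<Rightarrow> bool" where
  "orthonormal_upto s d e \<longleftrightarrow> (\<forall>i<d. e i \<in> Sh \<Omega> \<T>) \<and> (\<forall>i<d. \<forall>j<d. frac_form s (e i) (e j) = (if i = j then 1 else 0))"

lemma frac_form_expansion:
  assumes s: "0 < s" "s < 1" and o: "orthonormal_upto s d e" and j: "j < d"
  shows "frac_form s (\<lambda>x. \<Sum>i<d. c i * e i x) (e j) = c j"
proof -
  have "frac_form s (\<lambda>x. \<Sum>i<d. c i * e i x) (e j) = (\<Sum>i<d. c i * frac_form s (e i) (e j))"
    using o j by (intro frac_form_sum_left) (auto simp: orthonormal_upto_def intro: Sh_hs_fun[OF s])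
  also have "\<dots> = (\<Sum>i<d. if i = j then c i else 0)"
    using o j by (intro sum.cong) (auto simp: orthonormal_upto_def)
  finally show ?thesis using j by simp
qed

text \<open>Gram-Schmidt for an indexed family without assuming independence: a residual of zero
  energy is the zero function by definiteness, and such a member adds no new basis element.\<close>

lemma gram_schmidt:
  assumes s: "0 < s" "s < 1" and "finite A" "\<And>a. a \<in> A \<Longrightarrow> f a \<in> Sh \<Omega> \<T>"
  shows "\<exists>d e. orthonormal_upto s d e \<and> (\<forall>a\<in>A. \<exists>c. f a = (\<lambda>x. \<Sum>i<d. c i * e i x))"
  using assms(3,4)
proof (induction A rule: finite_induct)
  case empty
  show ?case by (intro exI[of _ 0]) (auto simp: orthonormal_upto_def)
next
  case (insert a A)
  then obtain d e where o: "orthonormal_upto s d e" and sp: "\<forall>a\<in>A. \<exists>c. f a = (\<lambda>x. \<Sum>i<d. c i * e i x)" by auto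
  have fa: "f a \<in> Sh \<Omega> \<T>" using insert by simp
  have eS: "e i \<in> Sh \<Omega> \<T>" if "i < d" for i using o that by (simp add: orthonormal_upto_def)
  note hs = Sh_hs_fun[OF s]
  define p where "p x = (\<Sum>i<d. frac_form s (f a) (e i) * e i x)" for x
  define r where "r x = f a x - p x" for x
  have pS: "p \<in> Sh \<Omega> \<T>" unfolding p_def using eS by (intro Sh_sum) auto
  have rS: "r \<in> Sh \<Omega> \<T>" unfolding r_def using Sh_lincomb[OF fa pS, of 1 "-1"] by simp
  have orth: "frac_form s r (e j) = 0" if "j < d" for j
  proof -
    have "frac_form s p (e j) = frac_form s (f a) (e j)" unfolding p_def by (rule frac_form_expansion[OF s o that])
    then show ?thesis unfolding r_def using frac_form_diff_left[OF hs[OF fa] hs[OF pS] hs[OF eS[OF that]]] by simp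
  qed
  show ?case
  proof (cases "frac_form s r r = 0")
    case True
    then have "r = (\<lambda>x. 0)" by (rule Sh_definite[OF s rS])
    then have "f a = (\<lambda>x. \<Sum>i<d. frac_form s (f a) (e i) * e i x)" by (auto simp: r_def p_def fun_eq_iff)
    then have "\<exists>c. f a = (\<lambda>x. \<Sum>i<d. c i * e i x)" by (rule exI[of _ "\<lambda>i. frac_form s (f a) (e i)"])
    with sp have "\<forall>b\<in>insert a A. \<exists>c. f b = (\<lambda>x. \<Sum>i<d. c i * e i x)" by simp
    with o show ?thesis by (intro exI[of _ d] exI[of _ e] conjI)
  next
    case False
    then have rr: "0 < frac_form s r r" using frac_form_nonneg[OF hs[OF rS]] by simp
    define k where "k = 1 / sqrt (frac_form s r r)"
    have k: "0 < k" "k * k * frac_form s r r = 1" using rr by (simp_all add: k_def)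
    define e' where "e' i = (if i = d then (\<lambda>x. k * r x) else e i)" for i
    have krS: "(\<lambda>x. k * r x) \<in> Sh \<Omega> \<T>" using Sh_lincomb[OF rS Sh_zero, of k 0] by simp
    have sc: "frac_form s (\<lambda>x. k * r x) z = k * frac_form s r z" if "hs_fun s z" for z
      using frac_form_lincomb_left[OF hs[OF rS] hs_fun_zero that, of k 0] by simp
    have "orthonormal_upto s (Suc d) e'" unfolding orthonormal_upto_def
    proof (intro conjI allI impI)
      fix i assume "i < Suc d"
      then show "e' i \<in> Sh \<Omega> \<T>" using eS krS by (auto simp: e'_def less_Suc_eq)
      fix j assume "j < Suc d"
      have 1: "frac_form s (\<lambda>x. k * r x) (e j) = 0" if "j < d" for j using sc[OF hs[OF eS[OF that]]] orth[OF that] by simp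
      have "frac_form s r (\<lambda>x. k * r x) = k * frac_form s r r" using sc[OF hs[OF rS]] frac_form_commute by metis
      then have 2: "frac_form s (\<lambda>x. k * r x) (\<lambda>x. k * r x) = 1" using sc[OF hs[OF krS]] k by simp
      have 3: "frac_form s (e i) (\<lambda>x. k * r x) = 0" if "i < d" for i using 1[OF that] frac_form_commute by metis
      show "frac_form s (e' i) (e' j) = (if i = j then 1 else 0)"
        using \<open>i < Suc d\<close> \<open>j < Suc d\<close> o 1 2 3 by (auto simp: e'_def less_Suc_eq orthonormal_upto_def)
    qed
    moreover have "\<exists>c. f b = (\<lambda>x. \<Sum>i<Suc d. c i * e' i x)" if b: "b \<in> insert a A" for b
    proof (cases "b = a")
      case True
      have "f a x = (\<Sum>i<Suc d. (if i = d then 1 / k else frac_form s (f a) (e i)) * e' i x)" for x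
        using k by (simp add: e'_def r_def p_def)
      then show ?thesis using True by (intro exI[of _ "\<lambda>i. if i = d then 1 / k else frac_form s (f a) (e i)"]) auto
    next
      case False
      then obtain c where c: "f b = (\<lambda>x. \<Sum>i<d. c i * e i x)" using sp b by auto
      have "f b x = (\<Sum>i<Suc d. (if i = d then 0 else c i) * e' i x)" for x
        by (simp add: e'_def c)
      then show ?thesis by (intro exI[of _ "\<lambda>i. if i = d then 0 else c i"]) auto
    qed
    ultimately have "orthonormal_upto s (Suc d) e' \<and> (\<forall>b\<in>insert a A. \<exists>c. f b = (\<lambda>x. \<Sum>i<Suc d. c i * e' i x))" by simp
    then show ?thesis by (intro exI[of _ "Suc d"] exI[of _ e'])
  qed
qed

text \<open>The hat functions of the vertices inside \<Omega> span the space because its members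
  vanish at the other vertices. In the resulting orthonormal basis the Galerkin orthogonality
  determines each coordinate, which resolves the definite description in
  \<open>ritz\<close>.\<close>

lemma Sh_orthonormal_basis:
  assumes s: "0 < s" "s < 1"
  obtains d e where "orthonormal_upto s d e"
    "\<And>\<phi> x. \<phi> \<in> Sh \<Omega> \<T> \<Longrightarrow> \<phi> x = (\<Sum>i<d. frac_form s \<phi> (e i) * e i x)"
    "\<And>v x. hs_fun s v \<Longrightarrow> ritz s \<Omega> \<T> v x = (\<Sum>i<d. frac_form s v (e i) * e i x)"
proof -
  let ?A = "vertices_of \<T> \<inter> \<Omega>"
  have "\<forall>a\<in>?A. \<exists>hh. hh \<in> Sh \<Omega> \<T> \<and> (\<forall>b\<in>vertices_of \<T>. hh b = (if b = a then 1 else 0))"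
  proof
    fix a assume a: "a \<in> ?A"
    have "\<exists>hh\<in>Sh \<Omega> \<T>. \<forall>b\<in>vertices_of \<T>. hh b = (if b = a then 1 else 0)"
      by (rule Sh_exists) (use a in auto)
    then show "\<exists>hh. hh \<in> Sh \<Omega> \<T> \<and> (\<forall>b\<in>vertices_of \<T>. hh b = (if b = a then 1 else 0))" by blast
  qed
  then obtain hat where hat: "\<And>a. a \<in> ?A \<Longrightarrow> hat a \<in> Sh \<Omega> \<T>"
    "\<And>a b. a \<in> ?A \<Longrightarrow> b \<in> vertices_of \<T> \<Longrightarrow> hat a b = (if b = a then 1 else 0)" by metis
  have fA: "finite ?A" using finite_vertices by simp
  obtain d e where o: "orthonormal_upto s d e" and sp: "\<forall>a\<in>?A. \<exists>c. hat a = (\<lambda>x. \<Sum>i<d. c i * e i x)"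
    using gram_schmidt[OF s fA, of hat] hat(1) by blast
  then obtain c where c: "\<And>a. a \<in> ?A \<Longrightarrow> hat a = (\<lambda>x. \<Sum>i<d. c a i * e i x)" by metis
  note hs = Sh_hs_fun[OF s]
  have eS: "e i \<in> Sh \<Omega> \<T>" if "i < d" for i using o that by (simp add: orthonormal_upto_def)
  have ex: "\<phi> = (\<lambda>x. \<Sum>i<d. frac_form s \<phi> (e i) * e i x)" if \<phi>: "\<phi> \<in> Sh \<Omega> \<T>" for \<phi>
  proof -
    have "\<phi> = (\<lambda>x. \<Sum>a\<in>?A. \<phi> a * hat a x)"
    proof (rule Sh_unique[OF \<phi>])
      show "(\<lambda>x. \<Sum>a\<in>?A. \<phi> a * hat a x) \<in> Sh \<Omega> \<T>" using hat(1) by (rule Sh_sum)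
      fix b assume b: "b \<in> vertices_of \<T>"
      have "(\<Sum>a\<in>?A. \<phi> a * hat a b) = (\<Sum>a\<in>?A. if a = b then \<phi> b else 0)"
        by (intro sum.cong refl) (auto simp: hat(2)[OF _ b])
      also have "\<dots> = \<phi> b" using fA b \<phi> by (auto simp: Sh_def)
      finally show "\<phi> b = (\<Sum>a\<in>?A. \<phi> a * hat a b)" ..
    qed
    also have "\<dots> = (\<lambda>x. \<Sum>i<d. (\<Sum>a\<in>?A. \<phi> a * c a i) * e i x)"
    proof
      fix x
      have "(\<Sum>a\<in>?A. \<phi> a * hat a x) = (\<Sum>a\<in>?A. \<Sum>i<d. \<phi> a * c a i * e i x)"
        by (intro sum.cong refl) (simp add: c sum_distrib_left mult.assoc)
      also have "\<dots> = (\<Sum>i<d. \<Sum>a\<in>?A. \<phi> a * c a i * e i x)" by (rule sum.swap)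
      finally show "(\<Sum>a\<in>?A. \<phi> a * hat a x) = (\<Sum>i<d. (\<Sum>a\<in>?A. \<phi> a * c a i) * e i x)"
        by (simp add: sum_distrib_right)
    qed
    finally have e1: "\<phi> = (\<lambda>x. \<Sum>i<d. (\<Sum>a\<in>?A. \<phi> a * c a i) * e i x)" .
    have "frac_form s \<phi> (e j) = (\<Sum>a\<in>?A. \<phi> a * c a j)" if "j < d" for j
      using frac_form_expansion[OF s o that, of "\<lambda>i. \<Sum>a\<in>?A. \<phi> a * c a i"] unfolding e1[symmetric] .
    then have e2: "(\<Sum>i<d. frac_form s \<phi> (e i) * e i x) = (\<Sum>i<d. (\<Sum>a\<in>?A. \<phi> a * c a i) * e i x)" for x
      by (intro sum.cong refl) auto
    show ?thesis by (rule ext, rule trans[OF fun_cong[OF e1] e2[symmetric]])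
  qed
  have rz: "ritz s \<Omega> \<T> v = (\<lambda>x. \<Sum>i<d. frac_form s v (e i) * e i x)" if v: "hs_fun s v" for v
    unfolding ritz_def
  proof (rule the_equality)
    let ?p = "\<lambda>x. \<Sum>i<d. frac_form s v (e i) * e i x"
    have pS: "?p \<in> Sh \<Omega> \<T>" using eS by (intro Sh_sum) auto
    have ez: "frac_form s (\<lambda>x. v x - ?p x) (e j) = 0" if "j < d" for j
      using frac_form_diff_left[OF v hs[OF pS] hs[OF eS[OF that]]] frac_form_expansion[OF s o that] by simp
    have "frac_form s (\<lambda>x. v x - ?p x) \<zeta> = 0" if \<zeta>: "\<zeta> \<in> Sh \<Omega> \<T>" for \<zeta>
    proof -
      have h: "hs_fun s (\<lambda>x. v x - ?p x)" by (intro hs_fun_diff v hs[OF pS])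
      have "frac_form s \<zeta> (\<lambda>x. v x - ?p x) = frac_form s (\<lambda>x. \<Sum>i<d. frac_form s \<zeta> (e i) * e i x) (\<lambda>x. v x - ?p x)"
        by (rule arg_cong[where f = "\<lambda>z. frac_form s z (\<lambda>x. v x - ?p x)"]) (rule ex[OF \<zeta>])
      also have "\<dots> = (\<Sum>i<d. frac_form s \<zeta> (e i) * frac_form s (e i) (\<lambda>x. v x - ?p x))"
        using eS hs h by (intro frac_form_sum_left) auto
      also have "\<dots> = 0" using ez by (intro sum.neutral ballI) (simp add: frac_form_commute[of s "e _"])
      finally show ?thesis by (simp add: frac_form_commute[of s \<zeta>])
    qed
    then show "?p \<in> Sh \<Omega> \<T> \<and> (\<forall>\<zeta>\<in>Sh \<Omega> \<T>. frac_form s (\<lambda>x. v x - ?p x) \<zeta> = 0)" using pS by blast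
    fix p assume p: "p \<in> Sh \<Omega> \<T> \<and> (\<forall>\<zeta>\<in>Sh \<Omega> \<T>. frac_form s (\<lambda>x. v x - p x) \<zeta> = 0)"
    have "frac_form s p (e i) = frac_form s v (e i)" if "i < d" for i
      using p frac_form_diff_left[OF v hs hs[OF eS[OF that]], of p] eS[OF that] by simp
    then have "(\<Sum>i<d. frac_form s p (e i) * e i x) = ?p x" for x by (intro sum.cong refl) auto
    then show "p = ?p" using fun_cong[OF ex[OF conjunct1[OF p]]] by (intro ext) (rule trans)
  qed
  show ?thesis
  proof (rule that[OF o])
    show "\<phi> x = (\<Sum>i<d. frac_form s \<phi> (e i) * e i x)" if "\<phi> \<in> Sh \<Omega> \<T>" for \<phi> x by (rule fun_cong[OF ex[OF that]])
    show "ritz s \<Omega> \<T> v x = (\<Sum>i<d. frac_form s v (e i) * e i x)" if "hs_fun s v" for v x by (rule fun_cong[OF rz[OF that]])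
  qed
qed

end

section \<open>Approximation of Lipschitz functions by test functions\<close>

text \<open>A C1 kernel suffices, because the test functions of the weak formulation are only C1.\<close>

definition bump :: "real \<Rightarrow> real^'n \<Rightarrow> real" where
  "bump \<delta> h = (max 0 (1 - (h \<bullet> h) / \<delta>\<^sup>2))\<^sup>2"

definition bump' :: "real \<Rightarrow> real^'n \<Rightarrow> (real^'n) \<Rightarrow>\<^sub>L real" where
  "bump' \<delta> h = (- 4 * max 0 (1 - (h \<bullet> h) / \<delta>\<^sup>2) / \<delta>\<^sup>2) *\<^sub>R blinfun_inner_left h"

lemma max_zero_square_has_derivative: "((\<lambda>t. (max 0 t)\<^sup>2) has_real_derivative 2 * max 0 t) (at t)"
proof -
  consider "0 < t" | "t < 0" | "t = 0" by linarith
  then show ?thesis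
  proof cases
    case 1
    have "((\<lambda>t. t\<^sup>2) has_real_derivative 2 * max 0 t) (at t)"
      using 1 by (auto intro!: derivative_eq_intros)
    then show ?thesis
      by (rule has_field_derivative_transform_within_open[where S = "{0<..}"]) (use 1 in auto)
  next
    case 2
    have "((\<lambda>t. 0) has_real_derivative 2 * max 0 t) (at t)" using 2 by simp
    then show ?thesis
      by (rule has_field_derivative_transform_within_open[where S = "{..<0}"]) (use 2 in auto)
  next
    case 3
    have "(\<lambda>h::real. ((max 0 h)\<^sup>2) / h) \<midarrow>0\<rightarrow> 0"
    proof (rule tendsto_norm_zero_cancel, rule tendsto_sandwich)
      show "\<forall>\<^sub>F h::real in at 0. 0 \<le> norm ((max 0 h)\<^sup>2 / h)" by simp
      show "\<forall>\<^sub>F h::real in at 0. norm ((max 0 h)\<^sup>2 / h) \<le> \<bar>h\<bar>"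
        by (rule always_eventually) (auto simp: max_def power2_eq_square)
      show "(\<lambda>h::real. \<bar>h\<bar>) \<midarrow>0\<rightarrow> 0" using tendsto_rabs_zero tendsto_ident_at by blast
    qed simp
    then show ?thesis using 3 by (simp add: DERIV_def)
  qed
qed

lemma bump_nonneg [simp]: "0 \<le> bump \<delta> h" and bump_le_one: "bump \<delta> h \<le> 1"
proof -
  show "0 \<le> bump \<delta> h" by (simp add: bump_def)
  have "0 \<le> (h \<bullet> h) / \<delta>\<^sup>2" by simp
  then have "max 0 (1 - (h \<bullet> h) / \<delta>\<^sup>2) \<le> 1" by simp
  then show "bump \<delta> h \<le> 1" unfolding bump_def by (intro power_le_one) auto
qed

lemma bump_eq_zero: "0 < \<delta> \<Longrightarrow> \<delta> \<le> norm h \<Longrightarrow> bump \<delta> h = 0"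
proof -
  assume "0 < \<delta>" "\<delta> \<le> norm h"
  then have "\<delta>\<^sup>2 \<le> h \<bullet> h" by (simp add: power2_norm_eq_inner[symmetric] power_mono)
  then show ?thesis using \<open>0 < \<delta>\<close> by (simp add: bump_def max_def field_simps)
qed

lemma continuous_bump: "continuous_on S (bump \<delta>)"
  unfolding bump_def divide_inverse by (intro continuous_intros)

lemma bump_has_derivative:
  fixes h :: "real^'n"
  shows "(bump \<delta> has_derivative blinfun_apply (bump' \<delta> h)) (at h)"
proof -
  have 1: "((\<lambda>h::real^'n. 1 - (h \<bullet> h) / \<delta>\<^sup>2) has_derivative (\<lambda>k. - (2 * (h \<bullet> k) / \<delta>\<^sup>2))) (at h)"
    by (auto intro!: derivative_eq_intros simp: inner_commute divide_inverse)
  have 2: "((\<lambda>t. (max 0 t)\<^sup>2) has_derivative (*) (2 * max 0 (1 - (h \<bullet> h) / \<delta>\<^sup>2))) (at (1 - (h \<bullet> h) / \<delta>\<^sup>2))"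
    using max_zero_square_has_derivative by (simp add: has_field_derivative_def)
  have "((\<lambda>h. (max 0 (1 - (h \<bullet> h) / \<delta>\<^sup>2))\<^sup>2) has_derivative (\<lambda>k. 2 * max 0 (1 - (h \<bullet> h) / \<delta>\<^sup>2) * - (2 * (h \<bullet> k) / \<delta>\<^sup>2))) (at h)"
    by (rule has_derivative_compose[OF 1 2])
  also have "(\<lambda>k. 2 * max 0 (1 - (h \<bullet> h) / \<delta>\<^sup>2) * - (2 * (h \<bullet> k) / \<delta>\<^sup>2)) = blinfun_apply (bump' \<delta> h)"
    by (auto simp: bump'_def blinfun.scaleR_left blinfun.minus_left fun_eq_iff inner_commute)
  finally show ?thesis unfolding bump_def[abs_def] .
qed

lemma continuous_bump': "continuous_on S (bump' \<delta>)"
  unfolding bump'_def divide_inverse by (intro continuous_intros)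

lemma bump_integral_pos:
  assumes "0 < \<delta>"
  shows "integrable lborel (bump \<delta> :: real^'n \<Rightarrow> real)" "0 < (\<integral>h. bump \<delta> (h :: real^'n) \<partial>lborel)"
proof -
  have meas: "(bump \<delta> :: real^'n \<Rightarrow> real) \<in> borel_measurable borel"
    by (rule borel_measurable_continuous_onI[OF continuous_bump])
  have ball: "integrable lborel (\<lambda>h. indicator (ball (0::real^'n) r) h :: real)" for r
    by (rule integrable_real_indicator[OF _ emeasure_lborel_ball_finite]) simp
  show I: "integrable lborel (bump \<delta> :: real^'n \<Rightarrow> real)"
  proof (rule Bochner_Integration.integrable_bound[OF ball[of \<delta>]])
    show "AE h in lborel. norm (bump \<delta> (h::real^'n)) \<le> norm (indicator (ball (0::real^'n) \<delta>) h :: real)"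
      by (intro AE_I2) (auto simp: indicator_def not_less bump_eq_zero[OF assms] bump_le_one)
  qed (use meas in simp)
  \<comment> \<open>On the ball of half the radius the kernel is at least the square of 3/4.\<close>
  have "0 < measure lborel (ball (0::real^'n) (\<delta>/2)) * (9/16)" using assms content_ball_pos[of "\<delta>/2"] by simp
  also have "\<dots> = (\<integral>h. indicator (ball (0::real^'n) (\<delta>/2)) h * (9/16) \<partial>lborel)" by simp
  also have "\<dots> \<le> (\<integral>h. bump \<delta> (h :: real^'n) \<partial>lborel)"
  proof (rule integral_mono[OF _ I])
    show "integrable lborel (\<lambda>h. indicator (ball (0::real^'n) (\<delta>/2)) h * (9/16 :: real))" using ball[of "\<delta>/2"] by simp
    fix h :: "real^'n"
    show "indicator (ball (0::real^'n) (\<delta>/2)) h * (9/16) \<le> bump \<delta> h"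
    proof (cases "h \<in> ball 0 (\<delta>/2)")
      case True
      then have "norm h \<le> \<delta> / 2" by simp
      then have "(norm h)\<^sup>2 \<le> (\<delta> / 2)\<^sup>2" by (intro power_mono) auto
      then have "h \<bullet> h \<le> (1/4) * \<delta>\<^sup>2" unfolding power2_norm_eq_inner by (simp add: power_divide)
      then have "(h \<bullet> h) / \<delta>\<^sup>2 \<le> 1/4" using assms by (simp add: divide_le_eq)
      then have "3/4 \<le> max 0 (1 - (h \<bullet> h) / \<delta>\<^sup>2)" by (intro max.coboundedI2) linarith
      then have "(3/4)\<^sup>2 \<le> bump \<delta> h" unfolding bump_def by (rule power_mono) simp
      then show ?thesis using True by (simp add: power2_eq_square)
    qed simp
  qed
  finally show "0 < (\<integral>h. bump \<delta> (h :: real^'n) \<partial>lborel)" .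
qed

definition mollify :: "real \<Rightarrow> (real^'n \<Rightarrow> real) \<Rightarrow> real^'n \<Rightarrow> real" where
  "mollify \<delta> f x = (\<integral>y. f y * bump \<delta> (x - y) \<partial>lborel) / (\<integral>h. bump \<delta> (h :: real^'n) \<partial>lborel)"

lemma integral_lborel_diff:
  fixes f :: "real^'n \<Rightarrow> real"
  assumes "f \<in> borel_measurable borel"
  shows "(\<integral>y. f (x - y) \<partial>lborel) = (\<integral>y. f y \<partial>lborel)"
proof -
  have 1: "lborel = distr lborel borel (\<lambda>z. x + (-1) *\<^sub>R z)"
    using lborel_affine[of "-1" x] by (simp add: density_1)
  have "(\<integral>z. f z \<partial>lborel) = (\<integral>z. f z \<partial>distr lborel borel (\<lambda>z. x + (-1) *\<^sub>R z))" by (subst 1) simp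
  also have "\<dots> = (\<integral>z. f (x - z) \<partial>lborel)" using assms by (subst integral_distr) auto
  finally show ?thesis ..
qed

lemma
  fixes f :: "real^'n \<Rightarrow> real"
  assumes \<delta>: "0 < \<delta>" and lip: "\<And>x y. \<bar>f x - f y\<bar> \<le> L * norm (x - y)" and bd: "\<And>x. \<bar>f x\<bar> \<le> B"
    and f: "continuous_on UNIV f"
  shows mollify_close: "0 \<le> L \<Longrightarrow> \<bar>mollify \<delta> f x - f x\<bar> \<le> L * \<delta>"
    and mollify_lipschitz: "\<bar>mollify \<delta> f x - mollify \<delta> f x'\<bar> \<le> L * norm (x - x')"
    and mollify_bound: "\<bar>mollify \<delta> f x\<bar> \<le> B"
proof -
  let ?c = "\<integral>h. bump \<delta> (h :: real^'n) \<partial>lborel"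
  have [measurable]: "f \<in> borel_measurable borel" "(bump \<delta> :: real^'n \<Rightarrow> real) \<in> borel_measurable borel"
    using f continuous_bump by (auto intro: borel_measurable_continuous_onI)
  note I = bump_integral_pos(1)[OF \<delta>, where 'n = 'n] and c = bump_integral_pos(2)[OF \<delta>, where 'n = 'n]
  have alt: "mollify \<delta> f x = (\<integral>h. f (x - h) * bump \<delta> h \<partial>lborel) / ?c" for x
    using integral_lborel_diff[of "\<lambda>y. f y * bump \<delta> (x - y)" x] unfolding mollify_def by simp
  have If: "integrable lborel (\<lambda>h. f (x - h) * bump \<delta> h)" for x
  proof (rule Bochner_Integration.integrable_bound[OF integrable_mult_right[OF I, of B]])
    show "AE h in lborel. norm (f (x - h) * bump \<delta> h) \<le> norm (B * bump \<delta> h)"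
    proof (rule AE_I2)
      fix h
      have "\<bar>f (x - h)\<bar> \<le> \<bar>B\<bar>" using bd[of "x - h"] by linarith
      then show "norm (f (x - h) * bump \<delta> h) \<le> norm (B * bump \<delta> h)" by (simp add: abs_mult mult_right_mono)
    qed
  qed simp
  have bnd: "\<bar>\<integral>h. g h * bump \<delta> h \<partial>lborel\<bar> \<le> K * ?c"
    if g: "integrable lborel (\<lambda>h. g h * bump \<delta> h)" "\<And>h. norm h < \<delta> \<Longrightarrow> \<bar>g h\<bar> \<le> K" for g :: "real^'n \<Rightarrow> real" and K
  proof -
    have "\<bar>\<integral>h. g h * bump \<delta> h \<partial>lborel\<bar> \<le> (\<integral>h. \<bar>g h * bump \<delta> h\<bar> \<partial>lborel)"
      using integral_norm_bound[of lborel "\<lambda>h. g h * bump \<delta> h"] by simp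
    also have "\<dots> \<le> (\<integral>h. K * bump \<delta> (h :: real^'n) \<partial>lborel)"
    proof (rule Bochner_Integration.integral_mono[OF integrable_abs[OF g(1)] integrable_mult_right[OF I]])
      fix h
      show "\<bar>g h * bump \<delta> h\<bar> \<le> K * bump \<delta> h"
      proof (cases "norm h < \<delta>")
        case True then show ?thesis using g(2)[OF True] by (simp add: abs_mult mult_right_mono)
      next
        case False
        then have "bump \<delta> h = 0" by (intro bump_eq_zero[OF \<delta>]) simp
        then show ?thesis by simp
      qed
    qed
    finally show ?thesis by simp
  qed
  show "\<bar>mollify \<delta> f x\<bar> \<le> B"
    unfolding alt using bnd[OF If, of x B] bd c by (simp add: abs_divide divide_le_eq)
  have e: "mollify \<delta> f x - mollify \<delta> f x' = (\<integral>h. (f (x - h) - f (x' - h)) * bump \<delta> h \<partial>lborel) / ?c"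
    unfolding alt using If[of x] If[of x'] by (simp add: left_diff_distrib diff_divide_distrib)
  have "\<bar>\<integral>h. (f (x - h) - f (x' - h)) * bump \<delta> h \<partial>lborel\<bar> \<le> (L * norm (x - x')) * ?c"
  proof (rule bnd)
    show "integrable lborel (\<lambda>h. (f (x - h) - f (x' - h)) * bump \<delta> h)" using If[of x] If[of x'] by (simp add: left_diff_distrib)
    show "\<bar>f (x - h) - f (x' - h)\<bar> \<le> L * norm (x - x')" for h using lip[of "x - h" "x' - h"] by simp
  qed
  then show "\<bar>mollify \<delta> f x - mollify \<delta> f x'\<bar> \<le> L * norm (x - x')"
    unfolding e using c by (simp add: abs_divide divide_le_eq)
  assume L: "0 \<le> L"
  have e2: "mollify \<delta> f x - f x = (\<integral>h. (f (x - h) - f x) * bump \<delta> h \<partial>lborel) / ?c"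
    unfolding alt using If[of x] I c by (simp add: left_diff_distrib diff_divide_distrib)
  have "\<bar>\<integral>h. (f (x - h) - f x) * bump \<delta> h \<partial>lborel\<bar> \<le> (L * \<delta>) * ?c"
  proof (rule bnd)
    show "integrable lborel (\<lambda>h. (f (x - h) - f x) * bump \<delta> h)" using If[of x] I by (simp add: left_diff_distrib)
    show "\<bar>f (x - h) - f x\<bar> \<le> L * \<delta>" if "norm h < \<delta>" for h
    proof -
      have "\<bar>f (x - h) - f x\<bar> \<le> L * norm h" using lip[of "x - h" x] by simp
      also have "\<dots> \<le> L * \<delta>" using that L by (intro mult_left_mono) auto
      finally show ?thesis .
    qed
  qed
  then show "\<bar>mollify \<delta> f x - f x\<bar> \<le> L * \<delta>" unfolding e2 using c by (simp add: abs_divide divide_le_eq)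
qed

text \<open>Only the kernel depends on x, so differentiation under the integral over a box
  containing the support applies even though f is merely continuous.\<close>

lemma mollify_C1:
  fixes f :: "real^'n \<Rightarrow> real"
  assumes f: "continuous_on UNIV f" and D: "bounded D" "\<And>x. x \<notin> D \<Longrightarrow> f x = 0"
  shows "\<exists>G :: real^'n \<Rightarrow> (real^'n) \<Rightarrow>\<^sub>L real. (\<forall>x. (mollify \<delta> f has_derivative blinfun_apply (G x)) (at x)) \<and> continuous_on UNIV G"
proof -
  let ?c = "\<integral>h. bump \<delta> (h :: real^'n) \<partial>lborel"
  obtain a b where ab: "D \<subseteq> cbox a b" using bounded_subset_cbox_symmetric[OF D(1)] by blast
  have cb: "continuous_on UNIV (\<lambda>y. f y * bump \<delta> (x - y))" for x
    by (intro continuous_intros f continuous_on_compose2[OF continuous_bump[of UNIV]]) auto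
  have fb: "continuous_on UNIV (\<lambda>p::(real^'n) \<times> (real^'n). bump' \<delta> (fst p - snd p))"
    by (rule continuous_on_compose2[OF continuous_bump'[of UNIV]]) (auto intro!: continuous_intros)
  have ff: "continuous_on UNIV (\<lambda>p::(real^'n) \<times> (real^'n). f (snd p))"
    by (rule continuous_on_compose2[OF f]) (auto intro!: continuous_intros)
  have gcont: "continuous_on (UNIV \<times> cbox a b) (\<lambda>(x, y). f y *\<^sub>R bump' \<delta> (x - y))"
    unfolding case_prod_beta
    by (rule continuous_on_subset[OF continuous_on_scaleR[OF ff fb]]) auto
  define G where "G x = integral (cbox a b) (\<lambda>y. f y *\<^sub>R bump' \<delta> (x - y))" for x
  have der: "((\<lambda>x. integral (cbox a b) (\<lambda>y. f y * bump \<delta> (x - y))) has_derivative blinfun_apply (G x)) (at x)" for x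
    unfolding G_def
  proof (rule leibniz_rule[where U = UNIV, simplified])
    fix x y :: "real^'n"
    have "((\<lambda>x. bump \<delta> (x - y)) has_derivative blinfun_apply (bump' \<delta> (x - y))) (at x)"
    proof (rule has_derivative_compose[OF _ bump_has_derivative, where f' = "\<lambda>k. k" and f = "\<lambda>x. x - y"])
      show "((\<lambda>x. x - y) has_derivative (\<lambda>k. k)) (at x)" by (auto intro!: derivative_eq_intros)
    qed
    then have "((\<lambda>x. f y * bump \<delta> (x - y)) has_derivative (\<lambda>k. f y * blinfun_apply (bump' \<delta> (x - y)) k)) (at x)"
      by (rule has_derivative_mult_right)
    then show "((\<lambda>x. f y * bump \<delta> (x - y)) has_derivative blinfun_apply (f y *\<^sub>R bump' \<delta> (x - y))) (at x)"
      by (simp add: blinfun.scaleR_left[abs_def])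
  next
    show "(\<lambda>y. f y * bump \<delta> (x - y)) integrable_on cbox a b" for x
      by (rule integrable_continuous[OF continuous_on_subset[OF cb]]) simp
    show "continuous_on (UNIV \<times> cbox a b) (\<lambda>(x, y). f y *\<^sub>R bump' \<delta> (x - y))" by (rule gcont)
  qed
  have G: "continuous_on UNIV G" unfolding G_def
    by (rule integral_continuous_on_param) (rule gcont)
  have eq: "mollify \<delta> f x = (1 / ?c) * integral (cbox a b) (\<lambda>y. f y * bump \<delta> (x - y))" for x
  proof -
    have "set_integrable lborel (cbox a b) (\<lambda>y. f y * bump \<delta> (x - y))"
      using borel_integrable_compact[of "cbox a b" "\<lambda>y. f y * bump \<delta> (x - y)"] continuous_on_subset[OF cb]
      by (simp add: set_integrable_def)
    then have "integral (cbox a b) (\<lambda>y. f y * bump \<delta> (x - y)) = (LINT y:cbox a b|lborel. f y * bump \<delta> (x - y))"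
      by (rule set_borel_integral_eq_integral(2)[symmetric])
    also have "\<dots> = (\<integral>y. f y * bump \<delta> (x - y) \<partial>lborel)"
      unfolding set_lebesgue_integral_def
      by (intro Bochner_Integration.integral_cong) (use D(2) ab in \<open>auto simp: indicator_def\<close>)
    finally show ?thesis by (simp add: mollify_def)
  qed
  have "(mollify \<delta> f has_derivative blinfun_apply ((1 / ?c) *\<^sub>R G x)) (at x)" for x
    unfolding eq[abs_def] blinfun.scaleR_left[abs_def] real_scaleR_def by (rule has_derivative_mult_right[OF der])
  moreover have "continuous_on UNIV (\<lambda>x. (1 / ?c) *\<^sub>R G x)" by (intro continuous_intros G)
  ultimately show ?thesis by (intro exI[of _ "\<lambda>x. (1 / ?c) *\<^sub>R G x"]) blast
qed

text \<open>Soft thresholding moves the support of a Lipschitz function that vanishes outside a bounded set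
  into a compact subset of it, without increasing the Lipschitz constant.\<close>

definition soft_threshold :: "real \<Rightarrow> real \<Rightarrow> real" where
  "soft_threshold \<epsilon> a = max 0 (a - \<epsilon>) + min 0 (a + \<epsilon>)"

lemma soft_threshold:
  assumes "0 \<le> \<epsilon>"
  shows "\<bar>soft_threshold \<epsilon> a - soft_threshold \<epsilon> b\<bar> \<le> \<bar>a - b\<bar>" "\<bar>soft_threshold \<epsilon> a - a\<bar> \<le> \<epsilon>"
    "\<bar>soft_threshold \<epsilon> a\<bar> \<le> \<bar>a\<bar>" "\<bar>a\<bar> \<le> \<epsilon> \<Longrightarrow> soft_threshold \<epsilon> a = 0"
  using assms by (auto simp: soft_threshold_def max_def min_def abs_if split: if_splits)

text \<open>Thresholding creates room at the boundary, which mollification then uses up. Keeping the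
  Lipschitz constant and the bound of f is what gives all approximations a common majorant in the
  later limit.\<close>

lemma C1_approximation:
  fixes f :: "real^'n \<Rightarrow> real"
  assumes L: "0 \<le> L" and lip: "\<And>x y. \<bar>f x - f y\<bar> \<le> L * norm (x - y)" and bd: "\<And>x. \<bar>f x\<bar> \<le> B"
    and D: "bounded D" "\<And>x. x \<notin> D \<Longrightarrow> f x = 0" and \<epsilon>: "0 < \<epsilon>"
  shows "\<exists>g (G :: real^'n \<Rightarrow> (real^'n) \<Rightarrow>\<^sub>L real). (\<forall>x. (g has_derivative blinfun_apply (G x)) (at x)) \<and> continuous_on UNIV G
     \<and> (\<exists>C. compact C \<and> C \<subseteq> D \<and> (\<forall>x. x \<notin> C \<longrightarrow> g x = 0))
     \<and> (\<forall>x y. \<bar>g x - g y\<bar> \<le> L * norm (x - y)) \<and> (\<forall>x. \<bar>g x\<bar> \<le> B) \<and> (\<forall>x. \<bar>g x - f x\<bar> \<le> 2 * \<epsilon>)"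
proof -
  define \<psi> where "\<psi> x = soft_threshold \<epsilon> (f x)" for x
  \<comment> \<open>Within distance \<delta> the function f changes by at most \<epsilon> / 2, so
    outside \<open>C\<close> the thresholded function vanishes on the whole support of the shifted
    kernel. Adding 1 avoids a division by zero when L = 0.\<close>
  define \<delta> where "\<delta> = \<epsilon> / (2 * (L + 1))"
  have \<delta>: "0 < \<delta>" using L \<epsilon> by (simp add: \<delta>_def)
  have L\<delta>: "L * \<delta> \<le> \<epsilon> / 2" using L \<epsilon> by (simp add: \<delta>_def field_simps)
  have lip\<psi>: "\<bar>\<psi> x - \<psi> y\<bar> \<le> L * norm (x - y)" for x y
    unfolding \<psi>_def using soft_threshold(1)[of \<epsilon> "f x" "f y"] lip[of x y] \<epsilon> by linarith
  have bd\<psi>: "\<bar>\<psi> x\<bar> \<le> B" for x unfolding \<psi>_def using soft_threshold(3)[of \<epsilon> "f x"] bd[of x] \<epsilon> by linarith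
  have cont: "continuous_on UNIV h" if "\<And>x y. \<bar>h x - h y\<bar> \<le> L * norm (x - y)" for h :: "real^'n \<Rightarrow> real"
  proof -
    have "L-lipschitz_on UNIV h" using that L by (intro lipschitz_onI) (auto simp: dist_norm)
    then show ?thesis by (rule lipschitz_on_continuous_on)
  qed
  have out: "\<psi> x = 0" if "x \<notin> D" for x using D(2)[OF that] \<epsilon> by (simp add: \<psi>_def soft_threshold_def)
  obtain G :: "real^'n \<Rightarrow> (real^'n) \<Rightarrow>\<^sub>L real" where G: "\<And>x. (mollify \<delta> \<psi> has_derivative blinfun_apply (G x)) (at x)" "continuous_on UNIV G"
    using mollify_C1[OF cont[OF lip\<psi>] D(1) out, of \<delta>] by metis
  define C where "C = {x. \<epsilon> / 2 \<le> \<bar>f x\<bar>}"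
  have CD: "C \<subseteq> D" using D(2) \<epsilon> by (force simp: C_def)
  have "closed C" unfolding C_def using cont[OF lip] by (intro closed_Collect_le continuous_intros)
  then have "compact C" using bounded_subset[OF D(1) CD] by (simp add: compact_eq_bounded_closed)
  moreover have "mollify \<delta> \<psi> x = 0" if x: "x \<notin> C" for x
  proof -
    have "\<psi> y * bump \<delta> (x - y) = 0" for y
    proof (cases "norm (x - y) < \<delta>")
      case True
      have "\<bar>f y\<bar> \<le> \<bar>f x\<bar> + L * norm (x - y)" using lip[of x y] by linarith
      also have "L * norm (x - y) \<le> L * \<delta>" using True L by (intro mult_left_mono) auto
      finally have "\<bar>f y\<bar> \<le> \<epsilon>" using x L\<delta> by (simp add: C_def)
      then show ?thesis using soft_threshold(4)[of \<epsilon> "f y"] \<epsilon> by (simp add: \<psi>_def)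
    next
      case False
      then have "bump \<delta> (x - y) = 0" by (intro bump_eq_zero[OF \<delta>]) simp
      then show ?thesis by simp
    qed
    then have e: "(\<lambda>y. \<psi> y * bump \<delta> (x - y)) = (\<lambda>_. 0)" by (rule ext)
    show ?thesis unfolding mollify_def e by simp
  qed
  moreover have "\<bar>mollify \<delta> \<psi> x - f x\<bar> \<le> 2 * \<epsilon>" for x
  proof -
    have "\<bar>mollify \<delta> \<psi> x - \<psi> x\<bar> \<le> L * \<delta>" by (rule mollify_close[OF \<delta> lip\<psi> bd\<psi> cont[OF lip\<psi>] L])
    moreover have "\<bar>\<psi> x - f x\<bar> \<le> \<epsilon>" unfolding \<psi>_def using \<epsilon> by (intro soft_threshold(2)) simp
    ultimately show ?thesis using L\<delta> \<epsilon> by linarith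
  qed
  ultimately show ?thesis
    using G CD mollify_lipschitz[OF \<delta> lip\<psi> bd\<psi> cont[OF lip\<psi>]] mollify_bound[OF \<delta> lip\<psi> bd\<psi> cont[OF lip\<psi>]]
    by (intro exI[of _ "mollify \<delta> \<psi>"] exI[of _ G]) blast
qed

section \<open>Weak solutions\<close>

locale weak_sol =
  fixes s m T :: real and \<Omega> :: "(real^'n) set" and u0 :: "real^'n \<Rightarrow> real" and u :: "real^'n \<Rightarrow> real \<Rightarrow> real"
  assumes s: "0 < s" "s < 1" and m: "0 < m" and T: "0 < T"
    and op: "open \<Omega>" and bd: "bounded \<Omega>"
    and u0_meas: "u0 \<in> borel_measurable lebesgue"
    and u0_bdd: "\<exists>B. AE x in lebesgue. \<bar>u0 x\<bar> \<le> B"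
    and u0_out: "\<forall>x. x \<notin> \<Omega> \<longrightarrow> u0 x = 0"
    and sol: "weak_solution s m T \<Omega> u0 u"
begin

section \<open>Measurability and integrability in time of the weak solution\<close>

definition w :: "real^'n \<Rightarrow> real \<Rightarrow> real" where "w x t = pw m (u x t)"

lemma u_pair [measurable]: "(\<lambda>p. u (fst p) (snd p)) \<in> borel_measurable (borel \<Otimes>\<^sub>M borel)"
  using sol by (simp add: weak_solution_def borel_prod)

lemma u_comp [measurable (raw)]:
  assumes [measurable]: "f \<in> M \<rightarrow>\<^sub>M borel" "g \<in> M \<rightarrow>\<^sub>M borel"
  shows "(\<lambda>x. u (f x) (g x)) \<in> borel_measurable M"
proof -
  have "(\<lambda>x. (f x, g x)) \<in> M \<rightarrow>\<^sub>M borel \<Otimes>\<^sub>M borel" by measurable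
  from measurable_compose[OF this u_pair] show ?thesis by simp
qed

lemma w_comp [measurable (raw)]:
  assumes [measurable]: "f \<in> M \<rightarrow>\<^sub>M borel" "g \<in> M \<rightarrow>\<^sub>M borel"
  shows "(\<lambda>x. w (f x) (g x)) \<in> borel_measurable M"
  unfolding w_def by measurable

lemma w_meas [measurable]: "(\<lambda>x. w x t) \<in> borel_measurable borel" by measurable

lemma psi_w: "psi m (w x t) = u x t" by (simp add: w_def psi_pw m)

definition u_mass :: "real \<Rightarrow> real" where "u_mass t = (\<integral>x. \<bar>u x t\<bar> \<partial>lborel)"

definition en :: "real \<Rightarrow> real" where "en t = frac_form s (\<lambda>x. w x t) (\<lambda>x. w x t)"

lemma nn_u: "(\<integral>\<^sup>+t. indicator {0..T} t * (\<integral>\<^sup>+x. ennreal \<bar>u x t\<bar> \<partial>lborel) \<partial>lborel) < \<infinity>"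
  using sol by (simp add: weak_solution_def nn_integral_completion mult.commute)

lemma nn_w: "(\<integral>\<^sup>+t. indicator {0..T} t * ((\<integral>\<^sup>+x. ennreal ((w x t)\<^sup>2) \<partial>lborel) + gagliardo_sq s (\<lambda>x. w x t)) \<partial>lborel) < \<infinity>"
  using sol by (simp add: weak_solution_def nn_integral_completion mult.commute w_def)

lemma AE_u_integrable: "AE t in lborel. t \<in> {0..T} \<longrightarrow> integrable lborel (\<lambda>x. u x t)"
proof -
  have "AE t in lborel. indicator {0..T} t * (\<integral>\<^sup>+x. ennreal \<bar>u x t\<bar> \<partial>lborel) \<noteq> \<infinity>"
    by (rule nn_integral_PInf_AE) (use nn_u in auto)
  then show ?thesis
  proof eventually_elim
    case (elim t)
    show ?case
    proof
      assume "t \<in> {0..T}"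
      then have "(\<integral>\<^sup>+x. ennreal \<bar>u x t\<bar> \<partial>lborel) < \<infinity>" using elim by (simp add: less_top)
      then show "integrable lborel (\<lambda>x. u x t)" by (intro integrableI_bounded) auto
    qed
  qed
qed

lemma u_mass_integrable: "set_integrable lborel {0..T} u_mass"
  unfolding set_integrable_def
proof (rule integrableI_bounded)
  show "(\<lambda>t. indicator {0..T} t *\<^sub>R u_mass t) \<in> borel_measurable lborel" unfolding u_mass_def by measurable
  have "(\<integral>\<^sup>+t. ennreal (norm (indicator {0..T} t *\<^sub>R u_mass t)) \<partial>lborel) = (\<integral>\<^sup>+t. indicator {0..T} t * (\<integral>\<^sup>+x. ennreal \<bar>u x t\<bar> \<partial>lborel) \<partial>lborel)"
  proof (rule nn_integral_cong_AE)
    show "AE t in lborel. ennreal (norm (indicator {0..T} t *\<^sub>R u_mass t)) = indicator {0..T} t * (\<integral>\<^sup>+x. ennreal \<bar>u x t\<bar> \<partial>lborel)"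
      using AE_u_integrable
    proof eventually_elim
      case (elim t)
      show ?case
      proof (cases "t \<in> {0..T}")
        case True
        then have "integrable lborel (\<lambda>x. \<bar>u x t\<bar>)" using elim by simp
        then have "(\<integral>\<^sup>+x. ennreal \<bar>u x t\<bar> \<partial>lborel) = ennreal (u_mass t)" unfolding u_mass_def by (rule nn_integral_eq_integral) simp
        then show ?thesis using True by (simp add: u_mass_def)
      qed simp
    qed
  qed
  then show "(\<integral>\<^sup>+t. ennreal (norm (indicator {0..T} t *\<^sub>R u_mass t)) \<partial>lborel) < \<infinity>" using nn_u by simp
qed

lemma gagliardo_lborel:
  fixes v :: "real^'n \<Rightarrow> real"
  assumes [measurable]: "v \<in> borel_measurable borel"
  shows "gagliardo_sq s v = (\<integral>\<^sup>+x. \<integral>\<^sup>+z. ennreal ((v x - v z)\<^sup>2 / norm (x - z) powr (real CARD('n) + 2 * s)) \<partial>lborel \<partial>lborel)"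
  unfolding gagliardo_sq_def by (simp add: nn_integral_completion)

lemma gagliardo_w_meas [measurable]: "(\<lambda>t. gagliardo_sq s (\<lambda>x. w x t)) \<in> borel_measurable borel"
  by (subst gagliardo_lborel) measurable

lemma AE_hs: "AE t in lborel. t \<in> {0..T} \<longrightarrow> hs_fun s (\<lambda>x. w x t)"
proof -
  have "AE t in lborel. indicator {0..T} t * ((\<integral>\<^sup>+x. ennreal ((w x t)\<^sup>2) \<partial>lborel) + gagliardo_sq s (\<lambda>x. w x t)) \<noteq> \<infinity>"
    by (rule nn_integral_PInf_AE) (use nn_w in auto)
  then show ?thesis
  proof eventually_elim
    case (elim t)
    show ?case
    proof
      assume "t \<in> {0..T}"
      then have "gagliardo_sq s (\<lambda>x. w x t) < \<infinity>" using elim by (simp add: less_top)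
      then show "hs_fun s (\<lambda>x. w x t)" by (simp add: hs_fun_def)
    qed
  qed
qed

lemma frac_form_w_meas [measurable]:
  assumes [measurable]: "f \<in> borel_measurable borel"
  shows "(\<lambda>t. frac_form s (\<lambda>x. w x t) f) \<in> borel_measurable borel"
proof -
  have "(\<lambda>t. \<integral>x. \<integral>z. gag_weight s (x, z) * ((w x t - w z t) * (f x - f z)) \<partial>lborel \<partial>lborel) \<in> borel_measurable borel"
    unfolding gag_weight_def by measurable
  then show ?thesis by (subst frac_form_lborel) auto
qed

lemma en_meas [measurable]: "en \<in> borel_measurable borel"
proof -
  have "(\<lambda>t. \<integral>x. \<integral>z. gag_weight s (x, z) * ((w x t - w z t) * (w x t - w z t)) \<partial>lborel \<partial>lborel) \<in> borel_measurable borel"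
    unfolding gag_weight_def by measurable
  then show ?thesis unfolding en_def[abs_def] by (subst frac_form_lborel) auto
qed

lemma en_integrable: "set_integrable lborel {0..T} en"
  unfolding set_integrable_def
proof (rule integrableI_bounded)
  show "(\<lambda>t. indicator {0..T} t *\<^sub>R en t) \<in> borel_measurable lborel" by measurable
  have "(\<integral>\<^sup>+t. ennreal (norm (indicator {0..T} t *\<^sub>R en t)) \<partial>lborel) \<le> (\<integral>\<^sup>+t. indicator {0..T} t * ((\<integral>\<^sup>+x. ennreal ((w x t)\<^sup>2) \<partial>lborel) + gagliardo_sq s (\<lambda>x. w x t)) \<partial>lborel)"
  proof (rule nn_integral_mono_AE)
    show "AE t in lborel. ennreal (norm (indicator {0..T} t *\<^sub>R en t)) \<le> indicator {0..T} t * ((\<integral>\<^sup>+x. ennreal ((w x t)\<^sup>2) \<partial>lborel) + gagliardo_sq s (\<lambda>x. w x t))"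
      using AE_hs
    proof eventually_elim
      case (elim t)
      show ?case
      proof (cases "t \<in> {0..T}")
        case True
        then have h: "hs_fun s (\<lambda>x. w x t)" using elim by simp
        have "gagliardo_sq s (\<lambda>x. w x t) = ennreal (en t)" unfolding en_def by (rule gagliardo_frac_form[OF h])
        moreover have "0 \<le> en t" unfolding en_def by (rule frac_form_nonneg[OF h])
        ultimately show ?thesis using True by (simp add: add_increasing)
      qed simp
    qed
  qed
  then show "(\<integral>\<^sup>+t. ennreal (norm (indicator {0..T} t *\<^sub>R en t)) \<partial>lborel) < \<infinity>" using nn_w by (rule le_less_trans)
qed

text \<open>Cauchy-Schwarz, with the product of the two energies enlarged to the square of their
  sum; \<open>en\<close> is integrable in time, so this is the majorant for the form as a function
  of t.\<close>

lemma frac_form_w_bound: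
  assumes "hs_fun s (\<lambda>x. w x t)" "hs_fun s f"
  shows "\<bar>frac_form s (\<lambda>x. w x t) f\<bar> \<le> en t + frac_form s f f"
proof -
  have n: "0 \<le> en t" "0 \<le> frac_form s f f" using assms by (auto simp: en_def frac_form_nonneg)
  have "(frac_form s (\<lambda>x. w x t) f)\<^sup>2 \<le> en t * frac_form s f f"
    unfolding en_def by (rule frac_form_Cauchy_Schwarz[OF assms])
  also have "\<dots> \<le> (en t + frac_form s f f)\<^sup>2" using n by (simp add: power2_eq_square algebra_simps)
  finally show ?thesis using n by (simp add: abs_le_square_iff[symmetric])
qed

lemma frac_form_w_integrable:
  assumes f: "hs_fun s f"
  shows "set_integrable lborel {0..T} (\<lambda>t. frac_form s (\<lambda>x. w x t) f)"
proof (rule set_integrable_bound[of _ _ "\<lambda>t. en t + frac_form s f f"])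
  have [measurable]: "f \<in> borel_measurable borel" using f by (rule hs_fun_measurable)
  show "set_integrable lborel {0..T} (\<lambda>t. en t + frac_form s f f)"
    by (intro set_integral_add en_integrable) simp
  show "set_borel_measurable lborel {0..T} (\<lambda>t. frac_form s (\<lambda>x. w x t) f)"
    unfolding set_borel_measurable_def by measurable
  show "AE t in lborel. t \<in> {0..T} \<longrightarrow> norm (frac_form s (\<lambda>x. w x t) f) \<le> norm (en t + frac_form s f f)"
    using AE_hs by eventually_elim (use frac_form_w_bound[OF _ f] in \<open>auto intro: order_trans[OF _ abs_ge_self]\<close>)
qed

lemma u0_integrable: "integrable lebesgue u0"
proof -
  obtain B where B: "AE x in lebesgue. \<bar>u0 x\<bar> \<le> B" using u0_bdd by blast
  have "\<Omega> \<in> sets lborel" "emeasure lborel \<Omega> < \<infinity>" using op emeasure_bounded_finite[OF bd] by auto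
  then have I: "integrable lebesgue (\<lambda>x. B * indicator \<Omega> x)"
    by (intro integrable_mult_right integrable_real_indicator) auto
  show ?thesis
    by (rule Bochner_Integration.integrable_bound[OF I u0_meas])
      (use B in eventually_elim, use u0_out in \<open>auto simp: indicator_def\<close>)
qed

end

text \<open>A nonzero factor preserves integrability and its failure, and the integral of a
  non-integrable function is 0; the identity therefore holds at every time when the weak equation is
  tested with products.\<close>

lemma frac_form_mult_right: "frac_form s v (\<lambda>x. k * f x) = k * frac_form s v f"
proof -
  have "frac_form s v (\<lambda>x. k * f x) = (\<integral>x. (\<integral>z. k * ((v x - v z) * (f x - f z) / norm (x - z) powr (real CARD('a) + 2 * s)) \<partial>lebesgue) \<partial>lebesgue)"
    unfolding frac_form_def by (simp add: algebra_simps diff_divide_distrib)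
  then show ?thesis unfolding frac_form_def by (simp only: integral_mult_right_zero)
qed

lemma test_fun_product:
  fixes g :: "real^'n \<Rightarrow> real"
  assumes g: "\<And>x. (g has_derivative blinfun_apply (G x)) (at x)" "continuous_on UNIV G"
    and C: "compact C" "C \<subseteq> \<Omega>" "\<And>x. x \<notin> C \<Longrightarrow> g x = 0"
    and \<eta>: "\<And>t. (\<eta> has_real_derivative \<eta>' t) (at t)" "continuous_on UNIV \<eta>'"
  shows "test_fun \<Omega> (\<lambda>x t. g x * \<eta> t)"
proof -
  let ?f = "Blinfun fst :: ((real^'n) \<times> real) \<Rightarrow>\<^sub>L (real^'n)" and ?s = "Blinfun snd :: ((real^'n) \<times> real) \<Rightarrow>\<^sub>L real"
  have fs: "blinfun_apply ?f = fst" "blinfun_apply ?s = snd"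
    by (simp_all add: bounded_linear_Blinfun_apply bounded_linear_fst bounded_linear_snd)
  define D where "D p = \<eta> (snd p) *\<^sub>R (G (fst p) o\<^sub>L ?f) + (g (fst p) * \<eta>' (snd p)) *\<^sub>R ?s" for p
  have "((\<lambda>q. g (fst q) * \<eta> (snd q)) has_derivative blinfun_apply (D p)) (at p)" for p
  proof -
    have 1: "((\<lambda>q. g (fst q)) has_derivative (\<lambda>h. blinfun_apply (G (fst p)) (fst h))) (at p)"
      by (rule has_derivative_compose[OF has_derivative_fst[OF has_derivative_ident] g(1)])
    have "(\<eta> has_derivative (*) (\<eta>' (snd p))) (at (snd p))" using \<eta>(1) by (simp add: has_field_derivative_def)
    then have 2: "((\<lambda>q. \<eta> (snd q)) has_derivative (\<lambda>h. \<eta>' (snd p) * snd h)) (at p)"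
      by (rule has_derivative_compose[OF has_derivative_snd[OF has_derivative_ident]])
    show ?thesis
      by (rule has_derivative_eq_rhs[OF has_derivative_mult[OF 1 2]])
        (auto simp: D_def blinfun.add_left blinfun.scaleR_left fs fun_eq_iff)
  qed
  moreover have "continuous_on UNIV D"
  proof -
    have c\<eta>: "continuous_on UNIV \<eta>" using \<eta>(1) by (meson DERIV_isCont continuous_at_imp_continuous_on)
    have cg: "continuous_on UNIV g" using g(1) by (meson has_derivative_continuous continuous_at_imp_continuous_on)
    have cf: "continuous_on UNIV (\<lambda>p. G (fst p))" "continuous_on UNIV (\<lambda>p. g (fst p))"
      by (rule continuous_on_compose2[OF g(2)], auto intro!: continuous_intros)
        (rule continuous_on_compose2[OF cg], auto intro!: continuous_intros)
    have cs: "continuous_on UNIV (\<lambda>p. \<eta> (snd p))" "continuous_on UNIV (\<lambda>p. \<eta>' (snd p))"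
      by (rule continuous_on_compose2[OF c\<eta>], auto intro!: continuous_intros)
        (rule continuous_on_compose2[OF \<eta>(2)], auto intro!: continuous_intros)
    have cc: "continuous_on UNIV (\<lambda>p. G (fst p) o\<^sub>L ?f)"
      by (rule bounded_bilinear.continuous_on[OF bounded_bilinear_blinfun_compose cf(1) continuous_on_const])
    show ?thesis unfolding D_def
      by (intro continuous_on_add continuous_on_scaleR continuous_on_mult continuous_on_const cf cs cc)
  qed
  moreover have "\<exists>C. compact C \<and> C \<subseteq> \<Omega> \<and> (\<forall>x t. x \<notin> C \<longrightarrow> g x * \<eta> t = 0)"
    using C by (intro exI[of _ C]) auto
  ultimately show ?thesis unfolding test_fun_def by blast
qed

section \<open>The weak identity for Lipschitz functions of space\<close>

context weak_sol
begin

lemma weak_identity_C1: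
  assumes g: "\<And>x. (g has_derivative blinfun_apply (G x)) (at x)" "continuous_on UNIV G"
    and C: "compact C" "C \<subseteq> \<Omega>" "\<And>x. x \<notin> C \<Longrightarrow> g x = 0"
    and \<eta>: "\<And>t. (\<eta> has_real_derivative \<eta>' t) (at t)" "continuous_on UNIV \<eta>'" "\<eta> T = 0"
  shows "- (LINT t:{0..T}|lborel. \<eta>' t * (\<integral>x. u x t * g x \<partial>lborel))
      + (LINT t:{0..T}|lborel. \<eta> t * frac_form s (\<lambda>x. w x t) g) = \<eta> 0 * (\<integral>x. u0 x * g x \<partial>lebesgue)"
proof -
  have "continuous_on UNIV g" using g(1) by (meson has_derivative_continuous continuous_at_imp_continuous_on)
  then have [measurable]: "g \<in> borel_measurable borel" by (rule borel_measurable_continuous_onI)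
  have "test_fun \<Omega> (\<lambda>x t. g x * \<eta> t)" by (rule test_fun_product[OF g C \<eta>(1,2)])
  then have I: "- (LINT t:{0..T}|lborel. (\<integral>x. u x t * deriv (\<lambda>\<sigma>. g x * \<eta> \<sigma>) t \<partial>lebesgue))
        + (LINT t:{0..T}|lborel. frac_form s (\<lambda>x. pw m (u x t)) (\<lambda>x. g x * \<eta> t))
        = (\<integral>x. u0 x * (g x * \<eta> 0) \<partial>lebesgue)"
    using sol \<eta>(3) unfolding weak_solution_def by simp
  have d: "deriv (\<lambda>\<sigma>. g x * \<eta> \<sigma>) t = g x * \<eta>' t" for x t
    by (rule DERIV_imp_deriv) (auto intro!: derivative_eq_intros \<eta>(1))
  have e1: "(\<integral>x. u x t * deriv (\<lambda>\<sigma>. g x * \<eta> \<sigma>) t \<partial>lebesgue) = \<eta>' t * (\<integral>x. u x t * g x \<partial>lborel)" for t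
  proof -
    have "(\<integral>x. u x t * deriv (\<lambda>\<sigma>. g x * \<eta> \<sigma>) t \<partial>lebesgue) = (\<integral>x. \<eta>' t * (u x t * g x) \<partial>lborel)"
      unfolding d by (subst integral_completion) (auto simp: mult_ac)
    then show ?thesis by simp
  qed
  have e2: "frac_form s (\<lambda>x. pw m (u x t)) (\<lambda>x. g x * \<eta> t) = \<eta> t * frac_form s (\<lambda>x. w x t) g" for t
    using frac_form_mult_right[of s "\<lambda>x. w x t" "\<eta> t" g] by (simp add: w_def mult.commute)
  have e3: "(\<integral>x. u0 x * (g x * \<eta> 0) \<partial>lebesgue) = \<eta> 0 * (\<integral>x. u0 x * g x \<partial>lebesgue)"
  proof -
    have "(\<integral>x. u0 x * (g x * \<eta> 0) \<partial>lebesgue) = (\<integral>x. \<eta> 0 * (u0 x * g x) \<partial>lebesgue)" by (simp add: mult_ac)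
    then show ?thesis by simp
  qed
  show ?thesis using I unfolding e1 e2 e3 .
qed

text \<open>The finite element functions are not admissible test functions, being only Lipschitz and
  without compact support inside \<Omega>. The identity passes to them by dominated convergence in
  each of the three terms.\<close>

lemma weak_identity_Lipschitz:
  assumes L: "0 \<le> L" and lip: "\<And>x y. \<bar>f x - f y\<bar> \<le> L * norm (x - y)" and fb: "\<And>x. \<bar>f x\<bar> \<le> B"
    and out: "\<And>x. x \<notin> \<Omega> \<Longrightarrow> f x = 0"
    and \<eta>: "\<And>t. (\<eta> has_real_derivative \<eta>' t) (at t)" "continuous_on UNIV \<eta>'" "\<eta> T = 0"
  shows "- (LINT t:{0..T}|lborel. \<eta>' t * (\<integral>x. u x t * f x \<partial>lborel))
      + (LINT t:{0..T}|lborel. \<eta> t * frac_form s (\<lambda>x. w x t) f) = \<eta> 0 * (\<integral>x. u0 x * f x \<partial>lebesgue)"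
proof -
  have "\<forall>k::nat. \<exists>g. (\<exists>G C. (\<forall>x. (g has_derivative blinfun_apply (G x)) (at x)) \<and> continuous_on UNIV (G :: real^'n \<Rightarrow> (real^'n) \<Rightarrow>\<^sub>L real)
     \<and> compact C \<and> C \<subseteq> \<Omega> \<and> (\<forall>x. x \<notin> C \<longrightarrow> g x = 0))
     \<and> (\<forall>x y. \<bar>g x - g y\<bar> \<le> L * norm (x - y)) \<and> (\<forall>x. \<bar>g x\<bar> \<le> B) \<and> (\<forall>x. \<bar>g x - f x\<bar> \<le> 2 * (1 / real (Suc k)))"
  proof
    fix k :: nat
    have "0 < 1 / real (Suc k)" by simp
    from C1_approximation[OF L lip fb bd out this]
    show "\<exists>g. (\<exists>G C. (\<forall>x. (g has_derivative blinfun_apply (G x)) (at x)) \<and> continuous_on UNIV (G :: real^'n \<Rightarrow> (real^'n) \<Rightarrow>\<^sub>L real)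
     \<and> compact C \<and> C \<subseteq> \<Omega> \<and> (\<forall>x. x \<notin> C \<longrightarrow> g x = 0))
     \<and> (\<forall>x y. \<bar>g x - g y\<bar> \<le> L * norm (x - y)) \<and> (\<forall>x. \<bar>g x\<bar> \<le> B) \<and> (\<forall>x. \<bar>g x - f x\<bar> \<le> 2 * (1 / real (Suc k)))"
      by metis
  qed
  then obtain g where g: "\<And>k. \<exists>G C. (\<forall>x. (g k has_derivative blinfun_apply (G x)) (at x)) \<and> continuous_on UNIV (G :: real^'n \<Rightarrow> (real^'n) \<Rightarrow>\<^sub>L real)
     \<and> compact C \<and> C \<subseteq> \<Omega> \<and> (\<forall>x. x \<notin> C \<longrightarrow> g k x = 0)"
    "\<And>k x y. \<bar>g k x - g k y\<bar> \<le> L * norm (x - y)" "\<And>k x. \<bar>g k x\<bar> \<le> B" "\<And>k x. \<bar>g k x - f x\<bar> \<le> 2 * (1 / real (Suc k))"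
    by metis
  have gout: "g k x = 0" if "x \<notin> \<Omega>" for k x using g(1)[of k] that by blast
  have \<Omega>b: "\<Omega> \<in> sets borel" using op by simp
  have gm [measurable]: "g k \<in> borel_measurable borel" for k by (rule borel_measurable_Lipschitz[OF g(2)])
  have fm [measurable]: "f \<in> borel_measurable borel" by (rule borel_measurable_Lipschitz[OF lip])
  have hg: "hs_fun s (g k)" for k by (rule hs_fun_Lipschitz[OF s g(2,3) gout bd \<Omega>b])
  have hf: "hs_fun s f" by (rule hs_fun_Lipschitz[OF s lip fb out bd \<Omega>b])
  have conv: "(\<lambda>k. g k x) \<longlonglongrightarrow> f x" for x
  proof (rule LIMSEQ_I)
    fix r :: real assume "0 < r"
    then obtain n where n: "2 / r < real n" using reals_Archimedean2 by blast
    show "\<exists>no. \<forall>k\<ge>no. norm (g k x - f x) < r"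
    proof (intro exI[of _ n] allI impI)
      fix k assume "n \<le> k"
      then have "2 / r < real (Suc k)" using n by simp
      then have "2 * (1 / real (Suc k)) < r" using \<open>0 < r\<close> by (simp add: field_simps)
      then show "norm (g k x - f x) < r" using g(4)[of k x] by simp
    qed
  qed
  \<comment> \<open>\<open>K * gag_dom \<Omega>\<close> dominates the squared differences of all
    approximations at once, and its integral \<open>E\<close> bounds all their energies.\<close>
  define K where "K = max (L\<^sup>2) ((2 * B)\<^sup>2)"
  have K0: "0 \<le> K" by (simp add: K_def le_max_iff_disj)
  define E where "E = K * (\<integral>p. gag_dom \<Omega> p \<partial>gag_measure s)"
  have Id: "integrable (gag_measure s) (\<lambda>p. K * gag_dom \<Omega> p)" using integrable_gag_dom[OF s bd \<Omega>b] by simp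
  have gE: "frac_form s (g k) (g k) \<le> E" for k
  proof -
    have "frac_form s (g k) (g k) = (\<integral>p. (diff2 (g k) p)\<^sup>2 \<partial>gag_measure s)" by (simp add: frac_form_hs[OF hg hg] power2_eq_square)
    also have "\<dots> \<le> (\<integral>p. K * gag_dom \<Omega> p \<partial>gag_measure s)"
      by (rule Bochner_Integration.integral_mono[OF integrable_diff2_sq[OF hg] Id]) (use diff2_sq_le_gag_dom[OF g(2,3) gout] K_def in auto)
    finally show ?thesis by (simp add: E_def)
  qed
  obtain H where H: "\<And>t. t \<in> {0..T} \<Longrightarrow> \<bar>\<eta> t\<bar> \<le> H" "\<And>t. t \<in> {0..T} \<Longrightarrow> \<bar>\<eta>' t\<bar> \<le> H"
  proof -
    have "continuous_on {0..T} \<eta>" using \<eta>(1) by (meson DERIV_isCont continuous_at_imp_continuous_on)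
    then have "bounded (\<eta> ` {0..T})" by (intro compact_imp_bounded compact_continuous_image) auto
    then obtain H1 where "\<forall>y\<in>\<eta> ` {0..T}. norm y \<le> H1" unfolding bounded_iff by blast
    then have H1: "\<And>t. t \<in> {0..T} \<Longrightarrow> \<bar>\<eta> t\<bar> \<le> H1" by simp
    have "bounded (\<eta>' ` {0..T})" using continuous_on_subset[OF \<eta>(2)]
      by (intro compact_imp_bounded compact_continuous_image) auto
    then obtain H2 where "\<forall>y\<in>\<eta>' ` {0..T}. norm y \<le> H2" unfolding bounded_iff by blast
    then have H2: "\<And>t. t \<in> {0..T} \<Longrightarrow> \<bar>\<eta>' t\<bar> \<le> H2" by simp
    show ?thesis
    proof (rule that[of "max H1 H2"])
      show "\<bar>\<eta> t\<bar> \<le> max H1 H2" "\<bar>\<eta>' t\<bar> \<le> max H1 H2" if "t \<in> {0..T}" for t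
        using H1[OF that] H2[OF that] by (simp_all add: le_max_iff_disj)
    qed
  qed
  have [measurable]: "\<eta>' \<in> borel_measurable borel" by (rule borel_measurable_continuous_onI[OF \<eta>(2)])
  have [measurable]: "\<eta> \<in> borel_measurable borel"
    using \<eta>(1) by (intro borel_measurable_continuous_onI) (meson DERIV_isCont continuous_at_imp_continuous_on)
  have c1: "(\<lambda>k. LINT t:{0..T}|lborel. \<eta>' t * (\<integral>x. u x t * g k x \<partial>lborel)) \<longlonglongrightarrow> (LINT t:{0..T}|lborel. \<eta>' t * (\<integral>x. u x t * f x \<partial>lborel))"
    unfolding set_lebesgue_integral_def
  proof (rule integral_dominated_convergence[where w = "\<lambda>t. indicator {0..T} t * (H * (B * u_mass t))"])
    show "integrable lborel (\<lambda>t. indicator {0..T} t * (H * (B * u_mass t)))"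
    proof -
      have "set_integrable lborel {0..T} (\<lambda>t. H * (B * u_mass t))"
        by (intro set_integrable_mult_right u_mass_integrable)
      then show ?thesis by (simp add: set_integrable_def)
    qed
    show "AE t in lborel. (\<lambda>k. indicator {0..T} t *\<^sub>R (\<eta>' t * (\<integral>x. u x t * g k x \<partial>lborel))) \<longlonglongrightarrow> indicator {0..T} t *\<^sub>R (\<eta>' t * (\<integral>x. u x t * f x \<partial>lborel))"
      using AE_u_integrable
    proof eventually_elim
      case (elim t)
      show ?case
      proof (cases "t \<in> {0..T}")
        case True
        then have iu: "integrable lborel (\<lambda>x. u x t)" using elim by simp
        have "(\<lambda>k. \<integral>x. u x t * g k x \<partial>lborel) \<longlonglongrightarrow> (\<integral>x. u x t * f x \<partial>lborel)"
        proof (rule integral_dominated_convergence[where w = "\<lambda>x. B * \<bar>u x t\<bar>"])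
          show "integrable lborel (\<lambda>x. B * \<bar>u x t\<bar>)" using iu by simp
          show "AE x in lborel. (\<lambda>k. u x t * g k x) \<longlonglongrightarrow> u x t * f x" by (intro AE_I2 tendsto_mult_left conv)
          show "AE x in lborel. norm (u x t * g k x) \<le> B * \<bar>u x t\<bar>" for k
            using g(3)[of k] by (intro AE_I2) (simp add: abs_mult mult.commute mult_right_mono)
        qed measurable
        then show ?thesis by (intro tendsto_scaleR tendsto_mult tendsto_const)
      qed simp
    qed
    fix k
    show "AE t in lborel. norm (indicator {0..T} t *\<^sub>R (\<eta>' t * (\<integral>x. u x t * g k x \<partial>lborel))) \<le> indicator {0..T} t * (H * (B * u_mass t))"
      using AE_u_integrable
    proof eventually_elim
      case (elim t)
      show ?case
      proof (cases "t \<in> {0..T}")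
        case True
        then have iu: "integrable lborel (\<lambda>x. u x t)" using elim by simp
        have iug: "integrable lborel (\<lambda>x. u x t * g k x)"
        proof (rule Bochner_Integration.integrable_bound)
          show "integrable lborel (\<lambda>x. B * \<bar>u x t\<bar>)" using iu by simp
          show "AE x in lborel. norm (u x t * g k x) \<le> norm (B * \<bar>u x t\<bar>)"
            using g(3)[of k] by (intro AE_I2 order_trans[OF _ abs_ge_self[of "B * _", folded real_norm_def]]) (simp add: abs_mult mult.commute mult_right_mono)
        qed measurable
        have "\<bar>\<integral>x. u x t * g k x \<partial>lborel\<bar> \<le> (\<integral>x. \<bar>u x t * g k x\<bar> \<partial>lborel)"
          using integral_norm_bound[of lborel "\<lambda>x. u x t * g k x"] by simp
        also have "\<dots> \<le> (\<integral>x. B * \<bar>u x t\<bar> \<partial>lborel)"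
        proof (rule Bochner_Integration.integral_mono[OF integrable_abs[OF iug]])
          show "integrable lborel (\<lambda>x. B * \<bar>u x t\<bar>)" using iu by simp
        qed (simp add: abs_mult mult.commute mult_right_mono g(3))
        finally have "\<bar>\<integral>x. u x t * g k x \<partial>lborel\<bar> \<le> B * u_mass t" by (simp add: u_mass_def)
        then show ?thesis using True H(2)[of t] by (simp add: abs_mult mult_mono')
      qed simp
    qed
  qed measurable
  have c2: "(\<lambda>k. LINT t:{0..T}|lborel. \<eta> t * frac_form s (\<lambda>x. w x t) (g k)) \<longlonglongrightarrow> (LINT t:{0..T}|lborel. \<eta> t * frac_form s (\<lambda>x. w x t) f)"
    unfolding set_lebesgue_integral_def
  proof (rule integral_dominated_convergence[where w = "\<lambda>t. indicator {0..T} t * (H * (en t + E))"])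
    show "integrable lborel (\<lambda>t. indicator {0..T} t * (H * (en t + E)))"
    proof -
      have "set_integrable lborel {0..T} (\<lambda>t. H * (en t + E))"
        by (intro set_integrable_mult_right set_integral_add en_integrable) simp
      then show ?thesis by (simp add: set_integrable_def)
    qed
    show "AE t in lborel. (\<lambda>k. indicator {0..T} t *\<^sub>R (\<eta> t * frac_form s (\<lambda>x. w x t) (g k))) \<longlonglongrightarrow> indicator {0..T} t *\<^sub>R (\<eta> t * frac_form s (\<lambda>x. w x t) f)"
      using AE_hs
    proof eventually_elim
      case (elim t)
      show ?case
      proof (cases "t \<in> {0..T}")
        case True
        then have hw: "hs_fun s (\<lambda>x. w x t)" using elim by simp
        have "(\<lambda>k. frac_form s (\<lambda>x. w x t) (g k)) \<longlonglongrightarrow> frac_form s (\<lambda>x. w x t) f"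
          unfolding frac_form_hs[OF hw hg] frac_form_hs[OF hw hf]
        proof (rule integral_dominated_convergence[where w = "\<lambda>p. (diff2 (\<lambda>x. w x t) p)\<^sup>2 + K * gag_dom \<Omega> p"])
          show "integrable (gag_measure s) (\<lambda>p. (diff2 (\<lambda>x. w x t) p)\<^sup>2 + K * gag_dom \<Omega> p)"
            using integrable_diff2_sq[OF hw] Id by simp
          show "AE p in gag_measure s. (\<lambda>k. diff2 (\<lambda>x. w x t) p * diff2 (g k) p) \<longlonglongrightarrow> diff2 (\<lambda>x. w x t) p * diff2 f p"
            unfolding diff2_def by (intro always_eventually allI tendsto_mult_left tendsto_diff conv)
          show "AE p in gag_measure s. norm (diff2 (\<lambda>x. w x t) p * diff2 (g k) p) \<le> (diff2 (\<lambda>x. w x t) p)\<^sup>2 + K * gag_dom \<Omega> p" for k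
          proof (intro always_eventually allI)
            fix p
            let ?a = "diff2 (\<lambda>x. w x t) p" and ?b = "diff2 (g k) p"
            have "0 \<le> (\<bar>?a\<bar> - \<bar>?b\<bar>)\<^sup>2" by simp
            then have "2 * (\<bar>?a\<bar> * \<bar>?b\<bar>) \<le> ?a\<^sup>2 + ?b\<^sup>2"
              by (simp add: power2_eq_square algebra_simps)
            moreover have "0 \<le> \<bar>?a\<bar> * \<bar>?b\<bar>" by simp
            moreover have "?b\<^sup>2 \<le> K * gag_dom \<Omega> p" unfolding K_def by (rule diff2_sq_le_gag_dom[OF g(2,3) gout])
            ultimately show "norm (?a * ?b) \<le> ?a\<^sup>2 + K * gag_dom \<Omega> p" unfolding real_norm_def abs_mult by linarith
          qed
        qed measurable
        then show ?thesis by (intro tendsto_scaleR tendsto_mult tendsto_const)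
      qed simp
    qed
    fix k
    show "AE t in lborel. norm (indicator {0..T} t *\<^sub>R (\<eta> t * frac_form s (\<lambda>x. w x t) (g k))) \<le> indicator {0..T} t * (H * (en t + E))"
      using AE_hs
    proof eventually_elim
      case (elim t)
      show ?case
      proof (cases "t \<in> {0..T}")
        case True
        then have hw: "hs_fun s (\<lambda>x. w x t)" using elim by simp
        have "\<bar>frac_form s (\<lambda>x. w x t) (g k)\<bar> \<le> en t + E" using frac_form_w_bound[OF hw hg[of k]] gE[of k] by simp
        then show ?thesis using True H(1)[of t] by (simp add: abs_mult mult_mono')
      qed simp
    qed
  qed measurable
  have c3: "(\<lambda>k. \<eta> 0 * (\<integral>x. u0 x * g k x \<partial>lebesgue)) \<longlonglongrightarrow> \<eta> 0 * (\<integral>x. u0 x * f x \<partial>lebesgue)"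
  proof (intro tendsto_mult_left integral_dominated_convergence[where w = "\<lambda>x. B * \<bar>u0 x\<bar>"])
    show "integrable lebesgue (\<lambda>x. B * \<bar>u0 x\<bar>)" using u0_integrable by simp
    show "AE x in lebesgue. (\<lambda>k. u0 x * g k x) \<longlonglongrightarrow> u0 x * f x" by (intro AE_I2 tendsto_mult_left conv)
    show "AE x in lebesgue. norm (u0 x * g k x) \<le> B * \<bar>u0 x\<bar>" for k
      by (intro AE_I2) (simp add: abs_mult mult.commute[of B] mult_left_mono g(3))
    show "(\<lambda>x. u0 x * g k x) \<in> borel_measurable lebesgue" for k
      using u0_meas measurable_completion[of "g k" lborel borel] by simp
    show "(\<lambda>x. u0 x * f x) \<in> borel_measurable lebesgue"
      using u0_meas measurable_completion[of f lborel borel] by simp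
  qed
  have "- (LINT t:{0..T}|lborel. \<eta>' t * (\<integral>x. u x t * g k x \<partial>lborel))
      + (LINT t:{0..T}|lborel. \<eta> t * frac_form s (\<lambda>x. w x t) (g k)) = \<eta> 0 * (\<integral>x. u0 x * g k x \<partial>lebesgue)" for k
  proof -
    obtain G C where "\<And>x. (g k has_derivative blinfun_apply (G x)) (at x)" "continuous_on UNIV (G :: real^'n \<Rightarrow> (real^'n) \<Rightarrow>\<^sub>L real)"
      "compact C" "C \<subseteq> \<Omega>" "\<And>x. x \<notin> C \<Longrightarrow> g k x = 0" using g(1)[of k] by metis
    from weak_identity_C1[OF this \<eta>] show ?thesis .
  qed
  then have "(\<lambda>k. \<eta> 0 * (\<integral>x. u0 x * g k x \<partial>lebesgue)) \<longlonglongrightarrow> - (LINT t:{0..T}|lborel. \<eta>' t * (\<integral>x. u x t * f x \<partial>lborel))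
      + (LINT t:{0..T}|lborel. \<eta> t * frac_form s (\<lambda>x. w x t) f)"
    using tendsto_add[OF tendsto_minus[OF c1] c2] by simp
  then show ?thesis using c3 LIMSEQ_unique by blast
qed

end

text \<open>Continuous ramps approximate indicators of half-lines, so the positive and the negative
  part of g are densities of finite measures that agree on all half-lines and hence
  coincide.\<close>

lemma AE_zero_of_continuous_test:
  fixes g :: "real \<Rightarrow> real"
  assumes g: "set_integrable lborel {0..T} g"
    and z: "\<And>\<zeta>. continuous_on UNIV \<zeta> \<Longrightarrow> (LINT t:{0..T}|lborel. \<zeta> t * g t) = 0"
  shows "AE t in lborel. t \<in> {0..T} \<longrightarrow> g t = 0"
proof -
  define F where "F = (\<lambda>t. indicator {0..T} t * g t)"
  have F: "integrable lborel F" using g by (simp add: F_def set_integrable_def)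
  have [measurable]: "F \<in> borel_measurable borel" using F by (simp add: borel_measurable_integrable)
  have half: "(\<integral>t. indicator {x<..} t * F t \<partial>lborel) = 0" for x
  proof -
    \<comment> \<open>The ramp is 0 up to x and reaches 1 at distance 1 / k beyond x, so it
      increases to the indicator of the open half-line.\<close>
    define ramp where "ramp k t = min 1 (max 0 (real k * (t - x)))" for k :: nat and t
    have c: "continuous_on UNIV (ramp k)" for k unfolding ramp_def by (intro continuous_intros)
    have [measurable]: "ramp k \<in> borel_measurable borel" for k by (rule borel_measurable_continuous_onI[OF c])
    have zk: "(\<integral>t. ramp k t * F t \<partial>lborel) = 0" for k
      using z[OF c[of k]] by (simp add: set_lebesgue_integral_def F_def mult.left_commute)
    have "(\<lambda>k. \<integral>t. ramp k t * F t \<partial>lborel) \<longlonglongrightarrow> (\<integral>t. indicator {x<..} t * F t \<partial>lborel)"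
    proof (rule integral_dominated_convergence[where w = "\<lambda>t. \<bar>F t\<bar>"])
      show "AE t in lborel. (\<lambda>k. ramp k t * F t) \<longlonglongrightarrow> indicator {x<..} t * F t"
      proof (intro AE_I2 tendsto_mult_right)
        fix t
        show "(\<lambda>k. ramp k t) \<longlonglongrightarrow> indicator {x<..} t"
        proof (cases "x < t")
          case True
          obtain n where n: "1 / (t - x) < real n" using reals_Archimedean2 by blast
          have "ramp k t = 1" if "n \<le> k" for k
          proof -
            have "1 / (t - x) < real k" using n that by simp
            then have "1 \<le> real k * (t - x)" using True by (simp add: field_simps)
            then show ?thesis by (simp add: ramp_def)
          qed
          then show ?thesis using True by (intro tendsto_eventually eventually_sequentiallyI[of n]) simp
        next
          case False
          then have "ramp k t = 0" for k by (simp add: ramp_def mult_nonneg_nonpos)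
          then show ?thesis using False by simp
        qed
      qed
      show "AE t in lborel. norm (ramp k t * F t) \<le> \<bar>F t\<bar>" for k
        by (intro AE_I2) (simp add: abs_mult ramp_def mult_left_le_one_le)
    qed (use F in \<open>auto intro!: integrable_abs\<close>)
    then show ?thesis unfolding zk by (simp add: LIMSEQ_const_iff)
  qed
  let ?P = "\<lambda>t. ennreal (F t)" and ?N = "\<lambda>t. ennreal (- F t)"
  have fin: "(\<integral>\<^sup>+t. ?P t \<partial>lborel) < \<infinity>" "(\<integral>\<^sup>+t. ?N t \<partial>lborel) < \<infinity>"
  proof -
    have "(\<integral>\<^sup>+t. ennreal (norm (F t)) \<partial>lborel) < \<infinity>" using F by (simp add: integrable_iff_bounded)
    moreover have "(\<integral>\<^sup>+t. ?P t \<partial>lborel) \<le> (\<integral>\<^sup>+t. ennreal (norm (F t)) \<partial>lborel)" "(\<integral>\<^sup>+t. ?N t \<partial>lborel) \<le> (\<integral>\<^sup>+t. ennreal (norm (F t)) \<partial>lborel)"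
      by (intro nn_integral_mono ennreal_leI; simp)+
    ultimately show "(\<integral>\<^sup>+t. ?P t \<partial>lborel) < \<infinity>" "(\<integral>\<^sup>+t. ?N t \<partial>lborel) < \<infinity>" by (auto intro: le_less_trans)
  qed
  have eqm: "density lborel ?P = density lborel ?N"
  proof (rule measure_eqI_lessThan)
    fix x
    have e: "emeasure (density lborel ?P) {x<..} = (\<integral>\<^sup>+t. ennreal (indicator {x<..} t * F t) \<partial>lborel)"
      "emeasure (density lborel ?N) {x<..} = (\<integral>\<^sup>+t. ennreal (- (indicator {x<..} t * F t)) \<partial>lborel)"
      by (subst emeasure_density; auto intro!: nn_integral_cong simp: indicator_def)+
    have I: "integrable lborel (\<lambda>t. indicator {x<..} t * F t)"
      using integrable_mult_indicator[OF _ F, of "{x<..}"] by simp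
    have f1: "(\<integral>\<^sup>+t. ennreal (indicator {x<..} t * F t) \<partial>lborel) < \<infinity>" "(\<integral>\<^sup>+t. ennreal (- (indicator {x<..} t * F t)) \<partial>lborel) < \<infinity>"
      using real_integrable_def[of lborel "\<lambda>t. indicator {x<..} t * F t"] I by (auto simp: less_top)
    show "emeasure (density lborel ?P) {x<..} < \<infinity>" using e f1 by simp
    have "enn2real (\<integral>\<^sup>+t. ennreal (indicator {x<..} t * F t) \<partial>lborel) = enn2real (\<integral>\<^sup>+t. ennreal (- (indicator {x<..} t * F t)) \<partial>lborel)"
      using real_lebesgue_integral_def[OF I] half[of x] by simp
    then show "emeasure (density lborel ?P) {x<..} = emeasure (density lborel ?N) {x<..}"
      unfolding e using f1 by (metis ennreal_enn2real infinity_ennreal_def)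
  qed simp_all
  have "AE t in lborel. ?P t = ?N t"
    using finite_density_unique[of ?P lborel ?N] eqm fin by auto
  then show ?thesis
  proof eventually_elim
    case (elim t)
    show ?case
    proof
      assume t: "t \<in> {0..T}"
      have "F t = 0"
      proof (cases "0 \<le> F t")
        case True
        then have "ennreal (F t) = 0" using elim by (simp add: ennreal_neg)
        then show ?thesis using True by simp
      next
        case False
        then have "ennreal (- F t) = 0" using elim by (simp add: ennreal_neg)
        then show ?thesis using False by simp
      qed
      then show "g t = 0" using t by (simp add: F_def)
    qed
  qed
qed

text \<open>The primitive of the merely integrable a need not be differentiable everywhere; Fubini
  on the triangle t \<le> r replaces the product rule, and \<open>\<eta> T = 0\<close> removes the
  boundary term.\<close>

lemma integral_by_parts_indefinite:
  fixes a \<zeta> \<eta> :: "real \<Rightarrow> real"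
  assumes a: "set_integrable lborel {0..T} a" and \<zeta>: "continuous_on UNIV \<zeta>"
    and \<eta>: "\<And>t. (\<eta> has_real_derivative \<zeta> t) (at t)" "\<eta> T = 0"
  shows "set_integrable lborel {0..T} (\<lambda>r. \<zeta> r * (LINT t:{0..r}|lborel. a t))"
    "(LINT t:{0..T}|lborel. \<eta> t * a t) = - (LINT r:{0..T}|lborel. \<zeta> r * (LINT t:{0..r}|lborel. a t))"
proof -
  define F where "F = (\<lambda>t. indicator {0..T} t * a t)"
  define Z where "Z = (\<lambda>r. indicator {0..T} r * \<zeta> r)"
  have F: "integrable lborel F" using a by (simp add: F_def set_integrable_def)
  have Z: "integrable lborel Z"
    using borel_integrable_compact[of "{0..T}" \<zeta>] continuous_on_subset[OF \<zeta>] by (simp add: Z_def)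
  have [measurable]: "F \<in> borel_measurable borel" "Z \<in> borel_measurable borel"
    using F Z by (simp_all add: borel_measurable_integrable)
  have FZ: "integrable (lborel \<Otimes>\<^sub>M lborel) (\<lambda>(t, r). F t * Z r)"
  proof (rule lborel_pair.Fubini_integrable)
    show "integrable lborel (\<lambda>x. \<integral>y. norm (case (x, y) of (t, r) \<Rightarrow> F t * Z r) \<partial>lborel)"
      using F by (simp add: abs_mult)
    show "AE x in lborel. integrable lborel (\<lambda>y. case (x, y) of (t, r) \<Rightarrow> F t * Z r)"
      using Z by simp
  qed simp
  have I: "integrable (lborel \<Otimes>\<^sub>M lborel) (\<lambda>(t, r). indicator {..r} t * (F t * Z r))"
    by (rule Bochner_Integration.integrable_bound[OF FZ]) (auto simp: indicator_def split_beta')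
  have inner1: "(\<integral>r. indicator {..r} t * (F t * Z r) \<partial>lborel) = - (indicator {0..T} t * (\<eta> t * a t))" for t
  proof (cases "t \<in> {0..T}")
    case True
    have "(\<integral>r. indicator {..r} t * (F t * Z r) \<partial>lborel) = (\<integral>r. a t * (\<zeta> r * indicator {t..T} r) \<partial>lborel)"
      using True by (intro Bochner_Integration.integral_cong) (auto simp: F_def Z_def indicator_def)
    also have "\<dots> = a t * (\<integral>r. \<zeta> r * indicator {t..T} r \<partial>lborel)" by simp
    also have "(\<integral>r. \<zeta> r * indicator {t..T} r \<partial>lborel) = \<eta> T - \<eta> t"
      using True \<eta>(1) \<zeta> by (intro integral_FTC_Icc_real) (auto simp: continuous_on_eq_continuous_at)
    finally show ?thesis using True \<eta>(2) by (simp add: mult.commute)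
  qed (simp add: F_def)
  have inner2: "(\<integral>t. indicator {..r} t * (F t * Z r) \<partial>lborel) = indicator {0..T} r * (\<zeta> r * (LINT t:{0..r}|lborel. a t))" for r
  proof (cases "r \<in> {0..T}")
    case True
    have "(\<integral>t. indicator {..r} t * (F t * Z r) \<partial>lborel) = (\<integral>t. \<zeta> r * (indicator {0..r} t * a t) \<partial>lborel)"
      using True by (intro Bochner_Integration.integral_cong) (auto simp: F_def Z_def indicator_def)
    then show ?thesis using True by (simp add: set_lebesgue_integral_def)
  qed (simp add: Z_def)
  have "integrable lborel (\<lambda>r. \<integral>t. indicator {..r} t * (F t * Z r) \<partial>lborel)"
    using lborel_pair.integrable_snd[OF I] by simp
  then show "set_integrable lborel {0..T} (\<lambda>r. \<zeta> r * (LINT t:{0..r}|lborel. a t))"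
    unfolding inner2 set_integrable_def by simp
  have "(\<integral>r. \<integral>t. indicator {..r} t * (F t * Z r) \<partial>lborel \<partial>lborel) = (\<integral>t. \<integral>r. indicator {..r} t * (F t * Z r) \<partial>lborel \<partial>lborel)"
    using lborel_pair.Fubini_integral[of "\<lambda>t r. indicator {..r} t * (F t * Z r)"] I by simp
  then have "(\<integral>r. indicator {0..T} r * (\<zeta> r * (LINT t:{0..r}|lborel. a t)) \<partial>lborel) = (\<integral>t. - (indicator {0..T} t * (\<eta> t * a t)) \<partial>lborel)"
    unfolding inner1 inner2 .
  moreover have "(LINT r:{0..T}|lborel. \<zeta> r * (LINT t:{0..r}|lborel. a t)) = (\<integral>r. indicator {0..T} r * (\<zeta> r * (LINT t:{0..r}|lborel. a t)) \<partial>lborel)"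
    by (subst set_lebesgue_integral_def) simp
  moreover have "(LINT t:{0..T}|lborel. \<eta> t * a t) = (\<integral>t. indicator {0..T} t * (\<eta> t * a t) \<partial>lborel)"
    by (subst set_lebesgue_integral_def) simp
  ultimately show "(LINT t:{0..T}|lborel. \<eta> t * a t) = - (LINT r:{0..T}|lborel. \<zeta> r * (LINT t:{0..r}|lborel. a t))"
    by simp
qed

context weak_sol
begin

text \<open>Integration by parts turns the weak identity into a statement about the moment of u plus
  the primitive of the form minus the initial moment: its integral against every continuous function
  of time vanishes.\<close>

lemma weak_moment:
  assumes L: "0 \<le> L" and lip: "\<And>x y. \<bar>f x - f y\<bar> \<le> L * norm (x - y)" and fb: "\<And>x. \<bar>f x\<bar> \<le> B"
    and out: "\<And>x. x \<notin> \<Omega> \<Longrightarrow> f x = 0"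
  shows "AE t in lborel. t \<in> {0..T} \<longrightarrow>
    (\<integral>x. u x t * f x \<partial>lborel) = (\<integral>x. u0 x * f x \<partial>lebesgue) - (LINT r:{0..t}|lborel. frac_form s (\<lambda>x. w x r) f)"
proof -
  define b where "b = (\<integral>x. u0 x * f x \<partial>lebesgue)"
  define U where "U t = (\<integral>x. u x t * f x \<partial>lborel)" for t
  define a where "a t = frac_form s (\<lambda>x. w x t) f" for t
  have \<Omega>b: "\<Omega> \<in> sets borel" using op by simp
  have fm [measurable]: "f \<in> borel_measurable borel" by (rule borel_measurable_Lipschitz[OF lip])
  have hf: "hs_fun s f" by (rule hs_fun_Lipschitz[OF s lip fb out bd \<Omega>b])
  have ai: "set_integrable lborel {0..T} a" unfolding a_def by (rule frac_form_w_integrable[OF hf])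
  have Ui: "set_integrable lborel {0..T} U"
  proof (rule set_integrable_bound[of _ _ "\<lambda>t. B * u_mass t"])
    show "set_integrable lborel {0..T} (\<lambda>t. B * u_mass t)" by (intro set_integrable_mult_right u_mass_integrable)
    show "set_borel_measurable lborel {0..T} U" unfolding set_borel_measurable_def U_def by measurable
    show "AE t in lborel. t \<in> {0..T} \<longrightarrow> norm (U t) \<le> norm (B * u_mass t)"
      using AE_u_integrable
    proof eventually_elim
      case (elim t)
      show ?case
      proof
        assume "t \<in> {0..T}"
        then have iu: "integrable lborel (\<lambda>x. u x t)" using elim by simp
        have iug: "integrable lborel (\<lambda>x. u x t * f x)"
        proof (rule Bochner_Integration.integrable_bound)
          show "integrable lborel (\<lambda>x. B * \<bar>u x t\<bar>)" using iu by simp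
          show "AE x in lborel. norm (u x t * f x) \<le> norm (B * \<bar>u x t\<bar>)"
            using fb by (intro AE_I2 order_trans[OF _ abs_ge_self[of "B * _", folded real_norm_def]]) (simp add: abs_mult mult.commute mult_right_mono)
        qed measurable
        have "\<bar>\<integral>x. u x t * f x \<partial>lborel\<bar> \<le> (\<integral>x. \<bar>u x t * f x\<bar> \<partial>lborel)"
          using integral_norm_bound[of lborel "\<lambda>x. u x t * f x"] by simp
        also have "\<dots> \<le> (\<integral>x. B * \<bar>u x t\<bar> \<partial>lborel)"
        proof (rule Bochner_Integration.integral_mono[OF integrable_abs[OF iug]])
          show "integrable lborel (\<lambda>x. B * \<bar>u x t\<bar>)" using iu by simp
        qed (simp add: abs_mult mult.commute mult_right_mono fb)
        finally show "norm (U t) \<le> norm (B * u_mass t)" by (simp add: u_mass_def U_def)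
      qed
    qed
  qed
  define g where "g t = U t + (LINT r:{0..t}|lborel. a r) - b" for t
  have id1: "\<And>t. ((\<lambda>t. t - T) has_real_derivative 1) (at t)" by (auto intro!: derivative_eq_intros)
  have Ai: "set_integrable lborel {0..T} (\<lambda>t. LINT r:{0..t}|lborel. a r)"
    using integral_by_parts_indefinite(1)[OF ai continuous_on_const id1] by simp
  have gi: "set_integrable lborel {0..T} g" unfolding g_def
    by (intro set_integral_diff set_integral_add Ui Ai) simp
  have "AE t in lborel. t \<in> {0..T} \<longrightarrow> g t = 0"
  proof (rule AE_zero_of_continuous_test[OF gi])
    fix \<zeta> :: "real \<Rightarrow> real" assume \<zeta>: "continuous_on UNIV \<zeta>"
    \<comment> \<open>An arbitrary continuous function has to be the time derivative of an
      admissible time factor; its antiderivative on the whole line, shifted to vanish at T, is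
      one.\<close>
    have "\<exists>F. \<forall>x. -\<infinity> < ereal x \<longrightarrow> ereal x < \<infinity> \<longrightarrow> (F has_vector_derivative \<zeta> x) (at x)"
      using \<zeta> by (intro einterval_antiderivative) (auto simp: continuous_on_eq_continuous_at)
    then obtain F where F: "\<And>x. (F has_real_derivative \<zeta> x) (at x)"
      by (auto simp: has_real_derivative_iff_has_vector_derivative)
    define \<eta> where "\<eta> t = F t - F T" for t
    have \<eta>: "(\<eta> has_real_derivative \<zeta> t) (at t)" "\<eta> T = 0" for t
      unfolding \<eta>_def by (auto intro!: derivative_eq_intros F)
    have W: "- (LINT t:{0..T}|lborel. \<zeta> t * U t) + (LINT t:{0..T}|lborel. \<eta> t * a t) = \<eta> 0 * b"
      unfolding U_def a_def b_def by (rule weak_identity_Lipschitz[OF L lip fb out \<eta>(1) \<zeta> \<eta>(2)])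
    note bp = integral_by_parts_indefinite[OF ai \<zeta> \<eta>]
    have z0: "(LINT t:{0..T}|lborel. \<zeta> t) = - \<eta> 0"
    proof -
      have "(\<integral>r. \<zeta> r * indicator {0..T} r \<partial>lborel) = \<eta> T - \<eta> 0"
        using T \<eta>(1) \<zeta> by (intro integral_FTC_Icc_real) (auto simp: continuous_on_eq_continuous_at)
      then show ?thesis using \<eta>(2) by (simp add: set_lebesgue_integral_def mult.commute)
    qed
    have zi: "set_integrable lborel {0..T} \<zeta>"
      using borel_integrable_compact[of "{0..T}" \<zeta>] continuous_on_subset[OF \<zeta>] by (simp add: set_integrable_def)
    have zU: "set_integrable lborel {0..T} (\<lambda>t. \<zeta> t * U t)"
    proof -
      have "bounded (\<zeta> ` {0..T})" using continuous_on_subset[OF \<zeta>]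
        by (intro compact_imp_bounded compact_continuous_image) auto
      then obtain H where "\<forall>y\<in>\<zeta> ` {0..T}. norm y \<le> H" unfolding bounded_iff by blast
      then have H: "\<And>t. t \<in> {0..T} \<Longrightarrow> \<bar>\<zeta> t\<bar> \<le> H" by simp
      have [measurable]: "\<zeta> \<in> borel_measurable borel" by (rule borel_measurable_continuous_onI[OF \<zeta>])
      show ?thesis
      proof (rule set_integrable_bound[of _ _ "\<lambda>t. H * U t"])
        show "set_integrable lborel {0..T} (\<lambda>t. H * U t)" by (intro set_integrable_mult_right Ui)
        show "set_borel_measurable lborel {0..T} (\<lambda>t. \<zeta> t * U t)" unfolding set_borel_measurable_def U_def by measurable
        show "AE t in lborel. t \<in> {0..T} \<longrightarrow> norm (\<zeta> t * U t) \<le> norm (H * U t)"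
        proof (intro AE_I2 impI)
          fix t assume "t \<in> {0..T}"
          then have "\<bar>\<zeta> t\<bar> \<le> \<bar>H\<bar>" using H[of t] by linarith
          then show "norm (\<zeta> t * U t) \<le> norm (H * U t)" by (simp add: abs_mult mult_right_mono)
        qed
      qed
    qed
    have "(LINT t:{0..T}|lborel. \<zeta> t * g t) = (LINT t:{0..T}|lborel. \<zeta> t * U t + \<zeta> t * (LINT r:{0..t}|lborel. a r) - \<zeta> t * b)"
      by (simp add: g_def distrib_left right_diff_distrib)
    also have "\<dots> = (LINT t:{0..T}|lborel. \<zeta> t * U t) + (LINT t:{0..T}|lborel. \<zeta> t * (LINT r:{0..t}|lborel. a r)) - (LINT t:{0..T}|lborel. \<zeta> t) * b"
      using zU bp(1) zi by (simp add: set_integral_diff set_integral_add set_integrable_mult_left)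
    also have "\<dots> = 0" using W bp(2) z0 by simp
    finally show "(LINT t:{0..T}|lborel. \<zeta> t * g t) = 0" .
  qed
  then show ?thesis by eventually_elim (auto simp: g_def U_def a_def b_def)
qed

end

section \<open>Time steps\<close>

lemma indicator_time_partition:
  assumes \<tau>: "0 < \<tau>" and t: "\<And>n. n \<le> M \<Longrightarrow> t \<noteq> \<tau> * real n"
  shows "(indicator {0<..<\<tau> * real M} t :: 'a::semiring_1) = (\<Sum>n=1..M. indicator {\<tau> * real (n - 1)<..<\<tau> * real n} t)"
  using t
proof (induction M)
  case (Suc M)
  have "0 \<le> \<tau> * real M" "\<tau> * real M \<le> \<tau> * real (Suc M)" "t \<noteq> \<tau> * real M" using \<tau> Suc.prems by auto
  then have "indicator {0<..<\<tau> * real (Suc M)} t = indicator {0<..<\<tau> * real M} t + (indicator {\<tau> * real (Suc M - 1)<..<\<tau> * real (Suc M)} t :: 'a)"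
    by (auto simp: indicator_def simp del: of_nat_Suc)
  moreover have "(indicator {0<..<\<tau> * real M} t :: 'a) = (\<Sum>n=1..M. indicator {\<tau> * real (n - 1)<..<\<tau> * real n} t)"
    by (rule Suc.IH) (use Suc.prems in auto)
  moreover have "(\<Sum>n=1..Suc M. F n) = (\<Sum>n=1..M. F n) + F (Suc M)" for F :: "nat \<Rightarrow> 'a" by simp
  ultimately show ?case by (simp only:)
qed simp

lemma AE_off_grid: "AE t in lborel. \<forall>n\<le>M. t \<noteq> \<tau> * real n"
proof -
  have "AE t in lborel. \<forall>n\<in>{..M}. t \<noteq> \<tau> * real n"
    by (rule AE_finite_allI) (auto intro: AE_lborel_singleton)
  then show ?thesis by eventually_elim auto
qed

text \<open>Measurability is asked of the step functions \<open>hn n\<close> and only almost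
  everywhere equality of h, because h will contain a Ritz projection that is known only for almost
  every time.\<close>

lemma nn_integral_time_partition:
  fixes h :: "real \<Rightarrow> ennreal"
  assumes \<tau>: "0 < \<tau>" and hn: "\<And>n. n \<in> {1..M} \<Longrightarrow> hn n \<in> borel_measurable borel"
    and eq: "\<And>n. n \<in> {1..M} \<Longrightarrow> AE t in lborel. t \<in> {\<tau> * real (n - 1)<..<\<tau> * real n} \<longrightarrow> h t = hn n t"
  shows "(\<integral>\<^sup>+t\<in>{0<..<\<tau> * real M}. h t \<partial>lborel) = (\<Sum>n=1..M. \<integral>\<^sup>+t\<in>{\<tau> * real (n - 1)<..<\<tau> * real n}. hn n t \<partial>lborel)"
proof -
  have "AE t in lborel. \<forall>n\<in>{1..M}. t \<in> {\<tau> * real (n - 1)<..<\<tau> * real n} \<longrightarrow> h t = hn n t"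
    by (rule AE_finite_allI) (use eq in auto)
  then have "AE t in lborel. h t * indicator {0<..<\<tau> * real M} t = (\<Sum>n=1..M. hn n t * indicator {\<tau> * real (n - 1)<..<\<tau> * real n} t)"
    using AE_off_grid[of M \<tau>]
  proof eventually_elim
    case (elim t)
    have "h t * indicator {0<..<\<tau> * real M} t = (\<Sum>n=1..M. h t * indicator {\<tau> * real (n - 1)<..<\<tau> * real n} t)"
      using indicator_time_partition[OF \<tau>, of M t, where 'a = ennreal] elim by (simp add: sum_distrib_left)
    also have "\<dots> = (\<Sum>n=1..M. hn n t * indicator {\<tau> * real (n - 1)<..<\<tau> * real n} t)"
    proof (intro sum.cong refl)
      fix n assume "n \<in> {1..M}"
      then show "h t * indicator {\<tau> * real (n - 1)<..<\<tau> * real n} t = hn n t * indicator {\<tau> * real (n - 1)<..<\<tau> * real n} t"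
        using elim(1) by (cases "t \<in> {\<tau> * real (n - 1)<..<\<tau> * real n}") auto
    qed
    finally show ?case .
  qed
  then have "(\<integral>\<^sup>+t\<in>{0<..<\<tau> * real M}. h t \<partial>lborel) = (\<integral>\<^sup>+t. (\<Sum>n=1..M. hn n t * indicator {\<tau> * real (n - 1)<..<\<tau> * real n} t) \<partial>lborel)"
    by (rule nn_integral_cong_AE)
  also have "\<dots> = (\<Sum>n=1..M. \<integral>\<^sup>+t\<in>{\<tau> * real (n - 1)<..<\<tau> * real n}. hn n t \<partial>lborel)"
  proof (rule nn_integral_sum)
    fix n assume "n \<in> {1..M}"
    then have [measurable]: "hn n \<in> borel_measurable borel" by (rule hn)
    show "(\<lambda>t. hn n t * indicator {\<tau> * real (n - 1)<..<\<tau> * real n} t) \<in> borel_measurable lborel" by measurable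
  qed
  finally show ?thesis .
qed

lemma indicator_open_closed: "AE t in lborel. indicator {a<..<b} t = (indicator {a..b::real} t :: 'a::zero_neq_one)"
  using AE_lborel_singleton[of a] AE_lborel_singleton[of b] by eventually_elim (auto simp: indicator_def)

lemma nn_integral_open_closed:
  fixes h :: "real \<Rightarrow> ennreal"
  shows "(\<integral>\<^sup>+t\<in>{a<..<b}. h t \<partial>lborel) = (\<integral>\<^sup>+t\<in>{a..b}. h t \<partial>lborel)"
  by (rule nn_integral_cong_AE, use indicator_open_closed[of a b, where 'a = ennreal] in eventually_elim) simp

lemma set_integral_time_partition:
  fixes f :: "real \<Rightarrow> real"
  assumes \<tau>: "0 < \<tau>" and [measurable]: "f \<in> borel_measurable borel"
    and fn: "\<And>n. n \<in> {1..M} \<Longrightarrow> set_integrable lborel {\<tau> * real (n - 1)<..<\<tau> * real n} (fn n)"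
    and eq: "\<And>n t. n \<in> {1..M} \<Longrightarrow> t \<in> {\<tau> * real (n - 1)<..<\<tau> * real n} \<Longrightarrow> f t = fn n t"
  shows "(LINT t:{0..\<tau> * real M}|lborel. f t) = (\<Sum>n=1..M. LINT t:{\<tau> * real (n - 1)<..<\<tau> * real n}|lborel. fn n t)"
proof -
  let ?R = "\<lambda>t. \<Sum>n=1..M. indicator {\<tau> * real (n - 1)<..<\<tau> * real n} t *\<^sub>R fn n t"
  have int: "integrable lborel ?R" using fn by (intro Bochner_Integration.integrable_sum) (simp add: set_integrable_def)
  have AE: "AE t in lborel. indicator {0..\<tau> * real M} t *\<^sub>R f t = ?R t"
    using AE_off_grid[of M \<tau>] indicator_open_closed[of 0 "\<tau> * real M", where 'a = real]
  proof eventually_elim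
    case (elim t)
    have "indicator {0..\<tau> * real M} t *\<^sub>R f t = (\<Sum>n=1..M. indicator {\<tau> * real (n - 1)<..<\<tau> * real n} t *\<^sub>R f t)"
      using indicator_time_partition[OF \<tau>, of M t, where 'a = real] elim by (simp add: sum_distrib_right)
    also have "\<dots> = ?R t"
    proof (intro sum.cong refl)
      fix n assume "n \<in> {1..M}"
      then show "indicator {\<tau> * real (n - 1)<..<\<tau> * real n} t *\<^sub>R f t = indicator {\<tau> * real (n - 1)<..<\<tau> * real n} t *\<^sub>R fn n t"
        using eq[of n t] by (cases "t \<in> {\<tau> * real (n - 1)<..<\<tau> * real n}") auto
    qed
    finally show ?case .
  qed
  have [measurable]: "?R \<in> borel_measurable lborel" using int by (rule borel_measurable_integrable)
  have "(LINT t:{0..\<tau> * real M}|lborel. f t) = (\<integral>t. ?R t \<partial>lborel)"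
    unfolding set_lebesgue_integral_def by (rule integral_cong_AE[OF _ _ AE]) measurable
  also have "\<dots> = (\<Sum>n=1..M. LINT t:{\<tau> * real (n - 1)<..<\<tau> * real n}|lborel. fn n t)"
    unfolding set_lebesgue_integral_def
    by (rule Bochner_Integration.integral_sum) (use fn in \<open>simp add: set_integrable_def\<close>)
  finally show ?thesis .
qed

lemma set_integral_open_closed:
  fixes f :: "real \<Rightarrow> real"
  assumes [measurable]: "f \<in> borel_measurable borel"
  shows "(LINT t:{a<..<b}|lborel. f t) = (LINT t:{a..b}|lborel. f t)"
  unfolding set_lebesgue_integral_def
proof (rule integral_cong_AE)
  show "AE t in lborel. indicator {a<..<b} t *\<^sub>R f t = indicator {a..b} t *\<^sub>R f t"
    using indicator_open_closed[of a b, where 'a = real] by eventually_elim simp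
qed measurable

lemma step_integral:
  fixes \<phi> :: "nat \<Rightarrow> real"
  assumes \<tau>: "0 < \<tau>"
  shows "(LINT t:{0..\<tau> * real M}|lborel. \<phi> (nat \<lceil>t / \<tau>\<rceil>)) = \<tau> * (\<Sum>n=1..M. \<phi> n)"
proof -
  have "(LINT t:{0..\<tau> * real M}|lborel. \<phi> (nat \<lceil>t / \<tau>\<rceil>)) = (\<Sum>n=1..M. LINT t:{\<tau> * real (n - 1)<..<\<tau> * real n}|lborel. \<phi> n)"
  proof (rule set_integral_time_partition[OF \<tau>])
    have "(\<lambda>t. nat \<lceil>t / \<tau>\<rceil>) \<in> borel \<rightarrow>\<^sub>M count_space UNIV" by measurable
    from measurable_compose[OF this, of \<phi> borel] show "(\<lambda>t. \<phi> (nat \<lceil>t / \<tau>\<rceil>)) \<in> borel_measurable borel" by simp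
    show "set_integrable lborel {\<tau> * real (n - 1)<..<\<tau> * real n} (\<lambda>t. \<phi> n)" for n
      unfolding set_integrable_def
      by (intro integrable_scaleR_left integrable_real_indicator emeasure_bounded_finite)
        (auto intro: bounded_subset[OF bounded_closed_interval[of "\<tau> * real (n - 1)" "\<tau> * real n"]])
    fix n t assume n: "n \<in> {1..M}" and t: "t \<in> {\<tau> * real (n - 1)<..<\<tau> * real n}"
    have "\<lceil>t / \<tau>\<rceil> = int n"
      by (rule ceiling_unique) (use n t \<tau> in \<open>auto simp: field_simps of_nat_diff\<close>)
    then show "\<phi> (nat \<lceil>t / \<tau>\<rceil>) = \<phi> n" by simp
  qed
  also have "\<dots> = (\<Sum>n=1..M. \<tau> * \<phi> n)"
  proof (intro sum.cong refl)
    fix n assume "n \<in> {1..M}"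
    then have "\<tau> * real (n - 1) \<le> \<tau> * real n" "\<tau> * real n - \<tau> * real (n - 1) = \<tau>" using \<tau> by (auto simp: of_nat_diff algebra_simps)
    then show "(LINT t:{\<tau> * real (n - 1)<..<\<tau> * real n}|lborel. \<phi> n) = \<tau> * \<phi> n"
      by (simp add: set_lebesgue_integral_def)
  qed
  finally show ?thesis by (simp add: sum_distrib_left)
qed

lemma ceiling_step:
  assumes "0 < \<tau>" "1 \<le> n" "t \<in> {\<tau> * real (n - 1)<..<\<tau> * real n}"
  shows "nat \<lceil>t / \<tau>\<rceil> = n"
proof -
  have "\<lceil>t / \<tau>\<rceil> = int n"
    by (rule ceiling_unique) (use assms in \<open>auto simp: field_simps of_nat_diff\<close>)
  then show ?thesis by simp
qed

section \<open>Iterated integrals over space and time\<close>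

lemma
  fixes f :: "'a \<Rightarrow> real \<Rightarrow> real"
  assumes [measurable]: "(\<lambda>p. f (fst p) (snd p)) \<in> borel_measurable (\<mu> \<Otimes>\<^sub>M borel)" and sf: "sigma_finite_measure \<mu>"
    and nn: "\<And>x t. 0 \<le> f x t"
    and fin: "(\<integral>\<^sup>+t\<in>{a..b}. (\<integral>\<^sup>+x. ennreal (f x t) \<partial>\<mu>) \<partial>lborel) < \<infinity>"
  shows AE_slice_integrable: "AE t in lborel. t \<in> {a..b} \<longrightarrow> integrable \<mu> (\<lambda>x. f x t)"
    and slice_integrable: "set_integrable lborel {a..b} (\<lambda>t. \<integral>x. f x t \<partial>\<mu>)"
    and nn_integral_slice: "(\<integral>\<^sup>+t\<in>{a..b}. (\<integral>\<^sup>+x. ennreal (f x t) \<partial>\<mu>) \<partial>lborel) = ennreal (LINT t:{a..b}|lborel. \<integral>x. f x t \<partial>\<mu>)"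
proof -
  interpret sigma_finite_measure \<mu> by fact
  have fm: "(\<lambda>x. f x t) \<in> borel_measurable \<mu>" for t
    using measurable_compose[OF measurable_Pair2' assms(1)] by simp
  have sw [measurable]: "(\<lambda>p. f (snd p) (fst p)) \<in> borel_measurable (borel \<Otimes>\<^sub>M \<mu>)"
    using measurable_compose[OF measurable_pair_swap' assms(1)] by (simp add: split_beta')
  have M1 [measurable]: "(\<lambda>t. \<integral>\<^sup>+x. ennreal (f x t) \<partial>\<mu>) \<in> borel_measurable borel"
    using borel_measurable_nn_integral[of "\<lambda>t x. ennreal (f x t)" borel] sw by (simp add: split_beta')
  have M2 [measurable]: "(\<lambda>t. \<integral>x. f x t \<partial>\<mu>) \<in> borel_measurable borel"
    using borel_measurable_lebesgue_integral[of "\<lambda>t x. f x t" borel] sw by (simp add: split_beta')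
  have "AE t in lborel. (\<integral>\<^sup>+x. ennreal (f x t) \<partial>\<mu>) * indicator {a..b} t \<noteq> \<infinity>"
    by (rule nn_integral_PInf_AE) (use fin in auto)
  then show AE: "AE t in lborel. t \<in> {a..b} \<longrightarrow> integrable \<mu> (\<lambda>x. f x t)"
  proof eventually_elim
    case (elim t)
    show ?case
    proof
      assume "t \<in> {a..b}"
      then have "(\<integral>\<^sup>+x. ennreal (f x t) \<partial>\<mu>) < \<infinity>" using elim by (simp add: less_top)
      then show "integrable \<mu> (\<lambda>x. f x t)" using fm nn by (intro integrableI_nonneg) auto
    qed
  qed
  have eq: "AE t in lborel. (\<integral>\<^sup>+x. ennreal (f x t) \<partial>\<mu>) * indicator {a..b} t = ennreal (indicator {a..b} t *\<^sub>R (\<integral>x. f x t \<partial>\<mu>))"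
    using AE
  proof eventually_elim
    case (elim t)
    show ?case
      using elim nn nn_integral_eq_integral[of \<mu> "\<lambda>x. f x t"] by (cases "t \<in> {a..b}") auto
  qed
  have "(\<integral>\<^sup>+t\<in>{a..b}. (\<integral>\<^sup>+x. ennreal (f x t) \<partial>\<mu>) \<partial>lborel) = (\<integral>\<^sup>+t. ennreal (indicator {a..b} t *\<^sub>R (\<integral>x. f x t \<partial>\<mu>)) \<partial>lborel)"
    by (rule nn_integral_cong_AE[OF eq])
  note e = this
  have n2: "0 \<le> indicator {a..b} t *\<^sub>R (\<integral>x. f x t \<partial>\<mu>)" for t
    using nn by (simp add: Bochner_Integration.integral_nonneg)
  show I: "set_integrable lborel {a..b} (\<lambda>t. \<integral>x. f x t \<partial>\<mu>)"
    unfolding set_integrable_def using e fin n2 by (intro integrableI_nonneg) auto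
  show "(\<integral>\<^sup>+t\<in>{a..b}. (\<integral>\<^sup>+x. ennreal (f x t) \<partial>\<mu>) \<partial>lborel) = ennreal (LINT t:{a..b}|lborel. \<integral>x. f x t \<partial>\<mu>)"
    unfolding e set_lebesgue_integral_def using I n2 by (intro nn_integral_eq_integral) (auto simp: set_integrable_def)
qed

text \<open>Here integrability comes first and the value of the extended integral second. This is
  the direction for the discretisation error, whose finiteness is derived and not given.\<close>

lemma nn_integral_slice_converse:
  fixes f :: "'a \<Rightarrow> real \<Rightarrow> real"
  assumes nn: "\<And>x t. 0 \<le> f x t" and AE: "AE t in lborel. t \<in> {a..b} \<longrightarrow> integrable \<mu> (\<lambda>x. f x t)"
    and I: "set_integrable lborel {a..b} (\<lambda>t. \<integral>x. f x t \<partial>\<mu>)"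
  shows "(\<integral>\<^sup>+t\<in>{a..b}. (\<integral>\<^sup>+x. ennreal (f x t) \<partial>\<mu>) \<partial>lborel) = ennreal (LINT t:{a..b}|lborel. \<integral>x. f x t \<partial>\<mu>)"
proof -
  have n2: "0 \<le> indicator {a..b} t *\<^sub>R (\<integral>x. f x t \<partial>\<mu>)" for t
    using nn by (simp add: Bochner_Integration.integral_nonneg)
  have "(\<integral>\<^sup>+t\<in>{a..b}. (\<integral>\<^sup>+x. ennreal (f x t) \<partial>\<mu>) \<partial>lborel) = (\<integral>\<^sup>+t. ennreal (indicator {a..b} t *\<^sub>R (\<integral>x. f x t \<partial>\<mu>)) \<partial>lborel)"
  proof (rule nn_integral_cong_AE)
    show "AE t in lborel. (\<integral>\<^sup>+x. ennreal (f x t) \<partial>\<mu>) * indicator {a..b} t = ennreal (indicator {a..b} t *\<^sub>R (\<integral>x. f x t \<partial>\<mu>))"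
      using AE
    proof eventually_elim
      case (elim t)
      show ?case
        using elim nn nn_integral_eq_integral[of \<mu> "\<lambda>x. f x t"] by (cases "t \<in> {a..b}") auto
    qed
  qed
  also have "\<dots> = ennreal (LINT t:{a..b}|lborel. \<integral>x. f x t \<partial>\<mu>)"
    unfolding set_lebesgue_integral_def using I n2 by (intro nn_integral_eq_integral) (auto simp: set_integrable_def)
  finally show ?thesis .
qed

lemma gagliardo_cong_AE:
  fixes v w :: "real^'n \<Rightarrow> real"
  assumes "AE x in lborel. v x = w x"
  shows "gagliardo_sq s v = gagliardo_sq s w"
proof -
  have a: "AE x in lebesgue. v x = w x" using assms by (rule AE_completion)
  show ?thesis unfolding gagliardo_sq_def
  proof (rule nn_integral_cong_AE, use a in eventually_elim)
    fix x assume x: "v x = w x"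
    show "(\<integral>\<^sup>+ z. ennreal ((v x - v z)\<^sup>2 / norm (x - z) powr (real CARD('n) + 2 * s)) \<partial>lebesgue) = (\<integral>\<^sup>+ z. ennreal ((w x - w z)\<^sup>2 / norm (x - z) powr (real CARD('n) + 2 * s)) \<partial>lebesgue)"
      by (rule nn_integral_cong_AE, use a in eventually_elim) (simp add: x)
  qed
qed

lemma gagliardo_add_le:
  assumes [measurable]: "v \<in> borel_measurable borel" "w \<in> borel_measurable borel"
  shows "gagliardo_sq s (\<lambda>x. v x + w x) \<le> 2 * gagliardo_sq s v + 2 * gagliardo_sq s w"
proof -
  have "(\<integral>\<^sup>+p. ennreal ((diff2 (\<lambda>x. v x + w x) p)\<^sup>2) \<partial>gag_measure s) \<le> (\<integral>\<^sup>+p. 2 * ennreal ((diff2 v p)\<^sup>2) + 2 * ennreal ((diff2 w p)\<^sup>2) \<partial>gag_measure s)"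
  proof (rule nn_integral_mono)
    fix p
    have "0 \<le> (diff2 v p - diff2 w p)\<^sup>2" by simp
    then have "(diff2 (\<lambda>x. v x + w x) p)\<^sup>2 \<le> 2 * (diff2 v p)\<^sup>2 + 2 * (diff2 w p)\<^sup>2"
      unfolding diff2_add by (simp add: power2_eq_square algebra_simps)
    then have "ennreal ((diff2 (\<lambda>x. v x + w x) p)\<^sup>2) \<le> ennreal (2 * (diff2 v p)\<^sup>2 + 2 * (diff2 w p)\<^sup>2)" by (rule ennreal_leI)
    then show "ennreal ((diff2 (\<lambda>x. v x + w x) p)\<^sup>2) \<le> 2 * ennreal ((diff2 v p)\<^sup>2) + 2 * ennreal ((diff2 w p)\<^sup>2)"
      by (simp add: ennreal_mult)
  qed
  also have "\<dots> = 2 * (\<integral>\<^sup>+p. ennreal ((diff2 v p)\<^sup>2) \<partial>gag_measure s) + 2 * (\<integral>\<^sup>+p. ennreal ((diff2 w p)\<^sup>2) \<partial>gag_measure s)"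
    by (simp add: nn_integral_add nn_integral_cmult)
  finally show ?thesis by (simp add: gagliardo_eq)
qed

text \<open>The weight is finite everywhere, the diagonal included, so the density preserves
  sigma-finiteness. This permits Fubini between pairs of points and time.\<close>

lemma sigma_finite_gag_measure: "sigma_finite_measure (gag_measure s :: ((real^'n) \<times> (real^'n)) measure)"
proof -
  have "(\<lambda>p. ennreal (gag_weight s p)) \<in> borel_measurable (lborel :: ((real^'n) \<times> (real^'n)) measure)"
    unfolding lborel_prod[symmetric] by measurable
  then show ?thesis unfolding gag_measure_def lborel_prod
    by (subst sigma_finite_measure.sigma_finite_iff_density_finite[OF sigma_finite_lborel]) auto
qed

text \<open>An exceptional null set N for single points becomes the union of the two cylinders over
  N, which is null for the product and hence for any density.\<close>

lemma AE_gag_measure: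
  assumes "AE x in lborel. P (x :: real^'n)"
  shows "AE p in gag_measure s. P (fst p) \<and> P (snd p)"
proof -
  obtain N where N0: "\<And>x. x \<in> space lborel - N \<Longrightarrow> P x" and N1: "N \<in> null_sets lborel" using AE_E3[OF assms] by blast
  have N: "N \<in> null_sets lborel" "{x. \<not> P x} \<subseteq> N" using N0 N1 by auto
  have "N \<times> UNIV \<in> null_sets (lborel \<Otimes>\<^sub>M lborel)" "UNIV \<times> N \<in> null_sets (lborel \<Otimes>\<^sub>M lborel)"
    using lborel.times_in_null_sets1[OF N(1), of UNIV] lborel.times_in_null_sets2[OF _ N(1), of UNIV lborel] by auto
  then have "(N \<times> UNIV) \<union> (UNIV \<times> N) \<in> null_sets (lborel \<Otimes>\<^sub>M lborel)" by (rule null_sets.Un)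
  then have "AE p in lborel \<Otimes>\<^sub>M lborel. p \<notin> (N \<times> UNIV) \<union> (UNIV \<times> N)" by (rule AE_not_in)
  then have "AE p in lborel \<Otimes>\<^sub>M lborel. P (fst p) \<and> P (snd p)"
    by eventually_elim (use N(2) in \<open>auto simp: mem_Times_iff\<close>)
  then show ?thesis unfolding gag_measure_def by (subst AE_density) auto
qed

lemma set_integral_square_le:
  fixes g :: "real \<Rightarrow> real"
  assumes g: "set_integrable lborel {a..b} g" "set_integrable lborel {a..b} (\<lambda>t. (g t)\<^sup>2)" and ab: "a < b"
  shows "(LINT t:{a..b}|lborel. g t)\<^sup>2 \<le> (b - a) * (LINT t:{a..b}|lborel. (g t)\<^sup>2)"
proof -
  \<comment> \<open>With k the mean of g, Cauchy-Schwarz is the nonnegativity of the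
    variance.\<close>
  define k where "k = (LINT t:{a..b}|lborel. g t) / (b - a)"
  have k: "(LINT t:{a..b}|lborel. g t) = k * (b - a)" using ab by (simp add: k_def)
  have "0 \<le> (LINT t:{a..b}|lborel. (g t - k)\<^sup>2)" by (rule set_integral_nonneg) simp
  also have "\<dots> = (LINT t:{a..b}|lborel. (g t)\<^sup>2 - 2 * k * g t + k\<^sup>2)"
    by (simp add: power2_eq_square algebra_simps)
  also have "\<dots> = (LINT t:{a..b}|lborel. (g t)\<^sup>2) - 2 * k * (LINT t:{a..b}|lborel. g t) + (b - a) * k\<^sup>2"
    using g ab by (simp add: set_integral_add set_integral_diff set_integral_const_Icc set_integrable_mult_right)
  also have "\<dots> = (LINT t:{a..b}|lborel. (g t)\<^sup>2) - k\<^sup>2 * (b - a)" unfolding k by (simp add: power2_eq_square algebra_simps)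
  finally have "k\<^sup>2 * (b - a) \<le> (LINT t:{a..b}|lborel. (g t)\<^sup>2)" by simp
  then have "(b - a) * (k\<^sup>2 * (b - a)) \<le> (b - a) * (LINT t:{a..b}|lborel. (g t)\<^sup>2)" using ab by (intro mult_left_mono) auto
  then show ?thesis unfolding k by (simp add: power2_eq_square mult_ac)
qed

section \<open>Time integrals of the exact solution\<close>

context weak_sol
begin

definition tint :: "real \<Rightarrow> real \<Rightarrow> real^'n \<Rightarrow> real" where
  "tint a b x = (LINT t:{a..b}|lborel. w x t)"

lemma tint_meas [measurable]: "tint a b \<in> borel_measurable borel"
  unfolding tint_def set_lebesgue_integral_def by measurable

lemma AE_w_time: "AE x in lborel. set_integrable lborel {0..T} (\<lambda>t. w x t) \<and> set_integrable lborel {0..T} (\<lambda>t. (w x t)\<^sup>2)"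
proof -
  have "(\<integral>\<^sup>+x. \<integral>\<^sup>+t. indicator {0..T} t * ennreal ((w x t)\<^sup>2) \<partial>lborel \<partial>lborel) = (\<integral>\<^sup>+t. \<integral>\<^sup>+x. indicator {0..T} t * ennreal ((w x t)\<^sup>2) \<partial>lborel \<partial>lborel)"
    by (rule lborel_pair.Fubini'[symmetric]) measurable
  also have "\<dots> = (\<integral>\<^sup>+t. indicator {0..T} t * (\<integral>\<^sup>+x. ennreal ((w x t)\<^sup>2) \<partial>lborel) \<partial>lborel)"
    by (simp add: nn_integral_cmult)
  also have "\<dots> \<le> (\<integral>\<^sup>+t. indicator {0..T} t * ((\<integral>\<^sup>+x. ennreal ((w x t)\<^sup>2) \<partial>lborel) + gagliardo_sq s (\<lambda>x. w x t)) \<partial>lborel)"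
    by (intro nn_integral_mono mult_left_mono) auto
  also have "\<dots> < \<infinity>" by (rule nn_w)
  finally have fin: "(\<integral>\<^sup>+x. \<integral>\<^sup>+t. indicator {0..T} t * ennreal ((w x t)\<^sup>2) \<partial>lborel \<partial>lborel) < \<infinity>" .
  have "AE x in lborel. (\<integral>\<^sup>+t. indicator {0..T} t * ennreal ((w x t)\<^sup>2) \<partial>lborel) \<noteq> \<infinity>"
    by (rule nn_integral_PInf_AE) (use fin in auto)
  then show ?thesis
  proof eventually_elim
    case (elim x)
    have e: "ennreal (norm (indicator {0..T} t *\<^sub>R (w x t)\<^sup>2)) = indicator {0..T} t * ennreal ((w x t)\<^sup>2)" for t
      by (auto simp: indicator_def)
    have 2: "set_integrable lborel {0..T} (\<lambda>t. (w x t)\<^sup>2)"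
      unfolding set_integrable_def
    proof (rule integrableI_bounded)
      show "(\<integral>\<^sup>+t. ennreal (norm (indicator {0..T} t *\<^sub>R (w x t)\<^sup>2)) \<partial>lborel) < \<infinity>"
        unfolding e using elim by (simp add: less_top)
    qed measurable
    have "set_integrable lborel {0..T} (\<lambda>t. w x t)"
    proof (rule set_integrable_bound[of _ _ "\<lambda>t. 1 + (w x t)\<^sup>2"])
      show "set_integrable lborel {0..T} (\<lambda>t. 1 + (w x t)\<^sup>2)" by (intro set_integral_add 2) simp
      show "set_borel_measurable lborel {0..T} (w x)" unfolding set_borel_measurable_def by measurable
      show "AE t in lborel. t \<in> {0..T} \<longrightarrow> norm (w x t) \<le> norm (1 + (w x t)\<^sup>2)"
      proof (intro AE_I2 impI)
        fix t
        have "0 \<le> (\<bar>w x t\<bar> - 1)\<^sup>2" by simp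
        then have "2 * \<bar>w x t\<bar> \<le> 1 + (w x t)\<^sup>2" by (simp add: power2_eq_square algebra_simps)
        moreover have "0 \<le> \<bar>w x t\<bar>" by simp
        ultimately show "norm (w x t) \<le> norm (1 + (w x t)\<^sup>2)" unfolding real_norm_def by linarith
      qed
    qed
    with 2 show ?case by simp
  qed
qed

lemma AE_diff2_tint:
  assumes ab: "0 \<le> a" "a < b" "b \<le> T"
  shows "AE p in gag_measure s. set_integrable lborel {a..b} (\<lambda>t. diff2 (\<lambda>x. w x t) p) \<and> set_integrable lborel {a..b} (\<lambda>t. (diff2 (\<lambda>x. w x t) p)\<^sup>2)
     \<and> diff2 (tint a b) p = (LINT t:{a..b}|lborel. diff2 (\<lambda>x. w x t) p)"
  using AE_gag_measure[OF AE_w_time, of s]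
proof eventually_elim
  case (elim p)
  have i: "set_integrable lborel {a..b} (\<lambda>t. w (fst p) t)" "set_integrable lborel {a..b} (\<lambda>t. w (snd p) t)"
    "set_integrable lborel {a..b} (\<lambda>t. (w (fst p) t)\<^sup>2)" "set_integrable lborel {a..b} (\<lambda>t. (w (snd p) t)\<^sup>2)"
    using elim ab by (auto intro: set_integrable_sub)
  have 1: "set_integrable lborel {a..b} (\<lambda>t. diff2 (\<lambda>x. w x t) p)"
    unfolding diff2_def using i by (intro set_integral_diff)
  have 2: "set_integrable lborel {a..b} (\<lambda>t. (diff2 (\<lambda>x. w x t) p)\<^sup>2)"
  proof (rule set_integrable_bound[of _ _ "\<lambda>t. 2 * (w (fst p) t)\<^sup>2 + 2 * (w (snd p) t)\<^sup>2"])
    show "set_integrable lborel {a..b} (\<lambda>t. 2 * (w (fst p) t)\<^sup>2 + 2 * (w (snd p) t)\<^sup>2)"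
      using i by (intro set_integral_add set_integrable_mult_right) auto
    show "set_borel_measurable lborel {a..b} (\<lambda>t. (diff2 (\<lambda>x. w x t) p)\<^sup>2)" unfolding set_borel_measurable_def diff2_def by measurable
    show "AE t in lborel. t \<in> {a..b} \<longrightarrow> norm ((diff2 (\<lambda>x. w x t) p)\<^sup>2) \<le> norm (2 * (w (fst p) t)\<^sup>2 + 2 * (w (snd p) t)\<^sup>2)"
    proof (intro AE_I2 impI)
      fix t
      have "0 \<le> (w (fst p) t + w (snd p) t)\<^sup>2" by simp
      then have "(diff2 (\<lambda>x. w x t) p)\<^sup>2 \<le> 2 * (w (fst p) t)\<^sup>2 + 2 * (w (snd p) t)\<^sup>2"
        by (simp add: diff2_def power2_eq_square algebra_simps)
      then show "norm ((diff2 (\<lambda>x. w x t) p)\<^sup>2) \<le> norm (2 * (w (fst p) t)\<^sup>2 + 2 * (w (snd p) t)\<^sup>2)" by simp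
    qed
  qed
  have "diff2 (tint a b) p = (LINT t:{a..b}|lborel. diff2 (\<lambda>x. w x t) p)"
    unfolding diff2_def tint_def using i by (simp add: set_integral_diff)
  with 1 2 show ?case by simp
qed

lemma gagliardo_time:
  assumes ab: "0 \<le> a" "a < b" "b \<le> T"
  shows "(\<integral>\<^sup>+p. \<integral>\<^sup>+t. indicator {a..b} t * ennreal ((diff2 (\<lambda>x. w x t) p)\<^sup>2) \<partial>lborel \<partial>gag_measure s) < \<infinity>"
proof -
  interpret G: sigma_finite_measure "gag_measure s :: ((real^'n) \<times> (real^'n)) measure" by (rule sigma_finite_gag_measure)
  interpret GL: pair_sigma_finite "lborel :: real measure" "gag_measure s :: ((real^'n) \<times> (real^'n)) measure" ..
  have "(\<integral>\<^sup>+p. \<integral>\<^sup>+t. indicator {a..b} t * ennreal ((diff2 (\<lambda>x. w x t) p)\<^sup>2) \<partial>lborel \<partial>gag_measure s)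
     = (\<integral>\<^sup>+t. \<integral>\<^sup>+p. indicator {a..b} t * ennreal ((diff2 (\<lambda>x. w x t) p)\<^sup>2) \<partial>gag_measure s \<partial>lborel)"
    by (rule GL.Fubini') (unfold diff2_def, measurable)
  also have "\<dots> = (\<integral>\<^sup>+t. indicator {a..b} t * gagliardo_sq s (\<lambda>x. w x t) \<partial>lborel)"
    by (simp add: nn_integral_cmult gagliardo_eq)
  also have "\<dots> \<le> (\<integral>\<^sup>+t. indicator {0..T} t * ((\<integral>\<^sup>+x. ennreal ((w x t)\<^sup>2) \<partial>lborel) + gagliardo_sq s (\<lambda>x. w x t)) \<partial>lborel)"
    using ab by (intro nn_integral_mono mult_mono) (auto simp: indicator_def)
  also have "\<dots> < \<infinity>" by (rule nn_w)
  finally show ?thesis .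
qed

text \<open>Cauchy-Schwarz in time, applied at almost every pair of points, bounds the squared
  difference of the time integral by the time integral of the squared differences; Tonelli then
  leads back to the energy bound of the weak solution.\<close>

lemma hs_tint:
  assumes ab: "0 \<le> a" "a < b" "b \<le> T"
  shows "hs_fun s (tint a b)"
proof -
  have "(\<integral>\<^sup>+p. ennreal ((diff2 (tint a b) p)\<^sup>2) \<partial>gag_measure s) \<le> (\<integral>\<^sup>+p. ennreal (b - a) * (\<integral>\<^sup>+t. indicator {a..b} t * ennreal ((diff2 (\<lambda>x. w x t) p)\<^sup>2) \<partial>lborel) \<partial>gag_measure s)"
  proof (rule nn_integral_mono_AE, use AE_diff2_tint[OF ab] in eventually_elim)
    case (elim p)
    have "(diff2 (tint a b) p)\<^sup>2 \<le> (b - a) * (LINT t:{a..b}|lborel. (diff2 (\<lambda>x. w x t) p)\<^sup>2)"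
      using elim set_integral_square_le[OF _ _ ab(2), of "\<lambda>t. diff2 (\<lambda>x. w x t) p"] by simp
    then have "ennreal ((diff2 (tint a b) p)\<^sup>2) \<le> ennreal ((b - a) * (LINT t:{a..b}|lborel. (diff2 (\<lambda>x. w x t) p)\<^sup>2))" by (rule ennreal_leI)
    also have "\<dots> = ennreal (b - a) * ennreal (LINT t:{a..b}|lborel. (diff2 (\<lambda>x. w x t) p)\<^sup>2)"
      using ab by (intro ennreal_mult set_integral_nonneg) auto
    also have "ennreal (LINT t:{a..b}|lborel. (diff2 (\<lambda>x. w x t) p)\<^sup>2) = (\<integral>\<^sup>+t. indicator {a..b} t * ennreal ((diff2 (\<lambda>x. w x t) p)\<^sup>2) \<partial>lborel)"
    proof -
      have "integrable lborel (\<lambda>t. indicator {a..b} t *\<^sub>R (diff2 (\<lambda>x. w x t) p)\<^sup>2)" using elim by (simp add: set_integrable_def)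
      then have "(\<integral>\<^sup>+t. ennreal (indicator {a..b} t *\<^sub>R (diff2 (\<lambda>x. w x t) p)\<^sup>2) \<partial>lborel) = ennreal (LINT t:{a..b}|lborel. (diff2 (\<lambda>x. w x t) p)\<^sup>2)"
        unfolding set_lebesgue_integral_def by (rule nn_integral_eq_integral) simp
      moreover have "ennreal (indicator {a..b} t *\<^sub>R (diff2 (\<lambda>x. w x t) p)\<^sup>2) = indicator {a..b} t * ennreal ((diff2 (\<lambda>x. w x t) p)\<^sup>2)" for t
        by (auto simp: indicator_def)
      ultimately show ?thesis by simp
    qed
    finally show ?case .
  qed
  also have "\<dots> = ennreal (b - a) * (\<integral>\<^sup>+p. \<integral>\<^sup>+t. indicator {a..b} t * ennreal ((diff2 (\<lambda>x. w x t) p)\<^sup>2) \<partial>lborel \<partial>gag_measure s)"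
    by (rule nn_integral_cmult) (unfold diff2_def, measurable)
  also have "\<dots> < \<infinity>" using gagliardo_time[OF ab] by (simp add: ennreal_mult_less_top)
  finally show ?thesis by (simp add: hs_fun_def gagliardo_eq)
qed

text \<open>The source of the fact that the Ritz projection commutes with averaging in time.
  Absolute integrability over pairs and time follows from bounding a product by the sum of
  squares.\<close>

lemma frac_form_tint:
  assumes ab: "0 \<le> a" "a < b" "b \<le> T" and f: "hs_fun s f"
  shows "frac_form s (tint a b) f = (LINT t:{a..b}|lborel. frac_form s (\<lambda>x. w x t) f)"
proof -
  interpret G: sigma_finite_measure "gag_measure s :: ((real^'n) \<times> (real^'n)) measure" by (rule sigma_finite_gag_measure)
  interpret GL: pair_sigma_finite "gag_measure s :: ((real^'n) \<times> (real^'n)) measure" "lborel :: real measure" ..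
  have [measurable]: "f \<in> borel_measurable borel" using f by (rule hs_fun_measurable)
  let ?F = "\<lambda>p t. indicator {a..b} t * (diff2 (\<lambda>x. w x t) p * diff2 f p)"
  have Fm: "(\<lambda>(p, t). ?F p t) \<in> borel_measurable (gag_measure s \<Otimes>\<^sub>M lborel)" unfolding diff2_def by measurable
  have I: "integrable (gag_measure s \<Otimes>\<^sub>M lborel) (\<lambda>(p, t). ?F p t)"
  proof (rule integrableI_bounded[OF Fm])
    have "(\<integral>\<^sup>+q. ennreal (norm (case q of (p, t) \<Rightarrow> ?F p t)) \<partial>(gag_measure s \<Otimes>\<^sub>M lborel)) = (\<integral>\<^sup>+p. \<integral>\<^sup>+t. ennreal (norm (?F p t)) \<partial>lborel \<partial>gag_measure s)"
      using lborel.nn_integral_fst[of "\<lambda>q. ennreal (norm (case q of (p, t) \<Rightarrow> ?F p t))" "gag_measure s"] Fm by simp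
    also have "\<dots> \<le> (\<integral>\<^sup>+p. (\<integral>\<^sup>+t. indicator {a..b} t * ennreal ((diff2 (\<lambda>x. w x t) p)\<^sup>2) \<partial>lborel) + ennreal (b - a) * ennreal ((diff2 f p)\<^sup>2) \<partial>gag_measure s)"
    proof (rule nn_integral_mono)
      fix p
      have "(\<integral>\<^sup>+t. ennreal (norm (?F p t)) \<partial>lborel) \<le> (\<integral>\<^sup>+t. indicator {a..b} t * ennreal ((diff2 (\<lambda>x. w x t) p)\<^sup>2) + indicator {a..b} t * ennreal ((diff2 f p)\<^sup>2) \<partial>lborel)"
      proof (rule nn_integral_mono)
        fix t
        let ?a = "diff2 (\<lambda>x. w x t) p" and ?b = "diff2 f p"
        have "0 \<le> (\<bar>?a\<bar> - \<bar>?b\<bar>)\<^sup>2" by simp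
        then have "2 * (\<bar>?a\<bar> * \<bar>?b\<bar>) \<le> ?a\<^sup>2 + ?b\<^sup>2" by (simp add: power2_eq_square algebra_simps)
        moreover have "0 \<le> \<bar>?a\<bar> * \<bar>?b\<bar>" by simp
        ultimately have "\<bar>?a * ?b\<bar> \<le> ?a\<^sup>2 + ?b\<^sup>2" unfolding abs_mult by linarith
        then have "ennreal \<bar>?a * ?b\<bar> \<le> ennreal (?a\<^sup>2) + ennreal (?b\<^sup>2)" by (simp add: ennreal_leI flip: ennreal_plus)
        then show "ennreal (norm (?F p t)) \<le> indicator {a..b} t * ennreal (?a\<^sup>2) + indicator {a..b} t * ennreal (?b\<^sup>2)"
          by (cases "t \<in> {a..b}") auto
      qed
      also have "\<dots> = (\<integral>\<^sup>+t. indicator {a..b} t * ennreal ((diff2 (\<lambda>x. w x t) p)\<^sup>2) \<partial>lborel) + (\<integral>\<^sup>+t. indicator {a..b} t * ennreal ((diff2 f p)\<^sup>2) \<partial>lborel)"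
        by (rule nn_integral_add) (unfold diff2_def, measurable)
      also have "(\<integral>\<^sup>+t. indicator {a..b} t * ennreal ((diff2 f p)\<^sup>2) \<partial>lborel) = ennreal (b - a) * ennreal ((diff2 f p)\<^sup>2)"
        using ab by (simp add: nn_integral_multc)
      finally show "(\<integral>\<^sup>+t. ennreal (norm (?F p t)) \<partial>lborel) \<le> (\<integral>\<^sup>+t. indicator {a..b} t * ennreal ((diff2 (\<lambda>x. w x t) p)\<^sup>2) \<partial>lborel) + ennreal (b - a) * ennreal ((diff2 f p)\<^sup>2)" .
    qed
    also have "\<dots> = (\<integral>\<^sup>+p. \<integral>\<^sup>+t. indicator {a..b} t * ennreal ((diff2 (\<lambda>x. w x t) p)\<^sup>2) \<partial>lborel \<partial>gag_measure s) + (\<integral>\<^sup>+p. ennreal (b - a) * ennreal ((diff2 f p)\<^sup>2) \<partial>gag_measure s)"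
      by (rule nn_integral_add) (unfold diff2_def, measurable)
    also have "(\<integral>\<^sup>+p. ennreal (b - a) * ennreal ((diff2 f p)\<^sup>2) \<partial>gag_measure s) = ennreal (b - a) * gagliardo_sq s f"
      by (simp add: nn_integral_cmult gagliardo_eq)
    also have "(\<integral>\<^sup>+p. \<integral>\<^sup>+t. indicator {a..b} t * ennreal ((diff2 (\<lambda>x. w x t) p)\<^sup>2) \<partial>lborel \<partial>gag_measure s) + ennreal (b - a) * gagliardo_sq s f < \<infinity>"
      using gagliardo_time[OF ab] f by (simp add: hs_fun_def ennreal_mult_less_top)
    finally show "(\<integral>\<^sup>+q. ennreal (norm (case q of (p, t) \<Rightarrow> ?F p t)) \<partial>(gag_measure s \<Otimes>\<^sub>M lborel)) < \<infinity>" .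
  qed
  have "frac_form s (tint a b) f = (\<integral>p. diff2 (tint a b) p * diff2 f p \<partial>gag_measure s)"
    by (rule frac_form_hs[OF hs_tint[OF ab] f])
  also have "\<dots> = (\<integral>p. \<integral>t. ?F p t \<partial>lborel \<partial>gag_measure s)"
  proof (rule integral_cong_AE)
    show "AE p in gag_measure s. diff2 (tint a b) p * diff2 f p = (\<integral>t. ?F p t \<partial>lborel)"
      using AE_diff2_tint[OF ab]
    proof eventually_elim
      case (elim p)
      have "(\<integral>t. ?F p t \<partial>lborel) = (\<integral>t. (indicator {a..b} t * diff2 (\<lambda>x. w x t) p) * diff2 f p \<partial>lborel)" by (simp add: mult.assoc)
      also have "\<dots> = (LINT t:{a..b}|lborel. diff2 (\<lambda>x. w x t) p) * diff2 f p"
        by (simp add: set_lebesgue_integral_def)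
      finally show ?case using elim by simp
    qed
    show "(\<lambda>p. \<integral>t. ?F p t \<partial>lborel) \<in> borel_measurable (gag_measure s)" by (rule lborel.borel_measurable_lebesgue_integral[OF Fm])
  qed measurable
  also have "\<dots> = (\<integral>t. \<integral>p. ?F p t \<partial>gag_measure s \<partial>lborel)" by (rule GL.Fubini_integral[OF I, symmetric])
  also have "\<dots> = (LINT t:{a..b}|lborel. frac_form s (\<lambda>x. w x t) f)"
    unfolding set_lebesgue_integral_def
  proof (rule integral_cong_AE)
    show "AE t in lborel. (\<integral>p. ?F p t \<partial>gag_measure s) = indicator {a..b} t *\<^sub>R frac_form s (\<lambda>x. w x t) f"
      using AE_hs
    proof eventually_elim
      case (elim t)
      show ?case
      proof (cases "t \<in> {a..b}")
        case True
        then show ?thesis using frac_form_hs[OF _ f] elim ab by simp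
      qed simp
    qed
    have "(\<lambda>(t, p). ?F p t) \<in> borel_measurable (lborel \<Otimes>\<^sub>M gag_measure s)" unfolding diff2_def by measurable
    from G.borel_measurable_lebesgue_integral[OF this] show "(\<lambda>t. \<integral>p. ?F p t \<partial>gag_measure s) \<in> borel_measurable lborel" .
  qed measurable
  finally show ?thesis .
qed

end

section \<open>The fully discrete scheme\<close>

lemma set_integral_Icc_diff:
  fixes f :: "real \<Rightarrow> real"
  assumes f: "set_integrable lborel {a..b} f" and st: "a \<le> s" "s \<le> t" "t \<le> b"
  shows "(LINT r:{a..t}|lborel. f r) - (LINT r:{a..s}|lborel. f r) = (LINT r:{s..t}|lborel. f r)"
proof -
  have i: "set_integrable lborel {a..t} f" "set_integrable lborel {a..s} f" "set_integrable lborel {s..t} f"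
    using f st by (auto intro: set_integrable_sub)
  have "(LINT r:{a..t}|lborel. f r) = (\<integral>r. indicator {a..s} r *\<^sub>R f r + indicator {s..t} r *\<^sub>R f r \<partial>lborel)"
    unfolding set_lebesgue_integral_def
  proof (rule integral_cong_AE)
    show "AE r in lborel. indicator {a..t} r *\<^sub>R f r = indicator {a..s} r *\<^sub>R f r + indicator {s..t} r *\<^sub>R f r"
      using AE_lborel_singleton[of s] by eventually_elim (use st in \<open>auto simp: indicator_def\<close>)
    show "(\<lambda>r. indicator {a..t} r *\<^sub>R f r) \<in> borel_measurable lborel"
      using i by (auto simp: set_integrable_def dest: borel_measurable_integrable)
    show "(\<lambda>r. indicator {a..s} r *\<^sub>R f r + indicator {s..t} r *\<^sub>R f r) \<in> borel_measurable lborel"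
      using i by (intro borel_measurable_add) (auto simp: set_integrable_def dest: borel_measurable_integrable)
  qed
  also have "\<dots> = (LINT r:{a..s}|lborel. f r) + (LINT r:{s..t}|lborel. f r)"
    unfolding set_lebesgue_integral_def using i by (intro Bochner_Integration.integral_add) (auto simp: set_integrable_def)
  finally show ?thesis by simp
qed

text \<open>The constants \<open>c1\<close>, \<open>C1\<close>, \<open>C2\<close>, \<open>C3\<close>
  and \<open>Cp\<close> are parameters, so that they can be fixed before any triangulation, step
  number or discrete solution; the final constant is built from these five alone.\<close>

locale fem_scheme = weak_sol s m T \<Omega> u0 u + triangulated_domain \<Omega> \<T>
  for s m T :: real and \<Omega> :: "(real^'n) set" and u0 :: "real^'n \<Rightarrow> real" and u :: "real^'n \<Rightarrow> real \<Rightarrow> real"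
    and \<T> :: "(real^'n) set set" +
  fixes c1 C1 C2 C3 Cp Be :: real and d :: nat and e :: "nat \<Rightarrow> real^'n \<Rightarrow> real" and M :: nat and W :: "nat \<Rightarrow> real^'n \<Rightarrow> real"
  assumes pos: "0 < c1" "0 < C1" "0 < C2" "0 < C3" "0 < Cp"
    and lower: "\<And>w V P va. c1 * shifted_sq m w (w - V) \<le> (psi m va - psi m V) * (P - V)
        + C1 * (shifted_sq m w (w - P) + shifted_sq m w (w - va))"
    and drift: "\<And>w w' P P' wa. - ((psi m w - psi m wa) * (P - P'))
        \<le> C2 * (shifted_sq m w (w - P) + shifted_sq m w' (w' - P') + shifted_sq m w' (w' - wa))"
    and extrapolate: "\<And>w w1 w2 wa v \<rho>. psi m wa - psi m w2 = \<rho> * (psi m w2 - psi m w1) \<Longrightarrow> 0 \<le> \<rho> \<Longrightarrow> \<rho> \<le> 1 \<Longrightarrow>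
       shifted_sq m w (w - wa) \<le> C3 * (shifted_sq m w (w - v) + shifted_sq m w1 (w1 - v) + shifted_sq m w2 (w2 - v))"
    and Cp: "\<And>f. f \<in> borel_measurable borel \<Longrightarrow> (\<And>x. x \<notin> \<Omega> \<Longrightarrow> f x = 0) \<Longrightarrow>
     (\<integral>\<^sup>+x. ennreal ((f x)\<^sup>2) \<partial>lborel) \<le> ennreal Cp * gagliardo_sq s f"
    and orth: "orthonormal_upto s d e"
    and expand: "\<And>\<phi> x. \<phi> \<in> Sh \<Omega> \<T> \<Longrightarrow> \<phi> x = (\<Sum>i<d. frac_form s \<phi> (e i) * e i x)"
    and ritz_eq: "\<And>v x. hs_fun s v \<Longrightarrow> ritz s \<Omega> \<T> v x = (\<Sum>i<d. frac_form s v (e i) * e i x)"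
    and Be: "\<And>i x. i < d \<Longrightarrow> \<bar>e i x\<bar> \<le> Be"
    and M: "1 \<le> M"
    and W: "discrete_solution s m \<Omega> \<T> (T / real M) M (\<lambda>x. pw m (u0 x)) W"
begin

definition \<tau> where "\<tau> = T / real M"

text \<open>Lebesgue measure restricted to \<Omega> but kept on the Borel sets of the whole space:
  it is finite, as the Galerkin locale demands, and global functions need no restriction.\<close>

definition \<mu> :: "(real^'n) measure" where "\<mu> = density lborel (\<lambda>x. ennreal (indicator \<Omega> x))"

lemma tau: "0 < \<tau>" "\<tau> * real M = T"
  using T M by (auto simp: \<tau>_def)

lemma sets_mu [measurable_cong]: "sets \<mu> = sets borel"
  by (simp add: \<mu>_def)

lemma \<Omega>_borel [measurable]: "\<Omega> \<in> sets borel"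
  using op by simp

lemma finite_mu: "finite_measure \<mu>"
proof (rule finite_measureI)
  have "emeasure \<mu> (space \<mu>) = emeasure lborel \<Omega>"
    unfolding \<mu>_def by (subst emeasure_density) (auto simp: ennreal_indicator)
  then show "emeasure \<mu> (space \<mu>) \<noteq> \<infinity>" using emeasure_bounded_finite[OF bd] by simp
qed

lemma e_Sh: "i < d \<Longrightarrow> e i \<in> Sh \<Omega> \<T>"
  using orth by (simp add: orthonormal_upto_def)

lemma e_borel: "i < d \<Longrightarrow> e i \<in> borel_measurable borel"
  by (rule Sh_measurable[OF e_Sh])

lemma e_out: "i < d \<Longrightarrow> x \<notin> \<Omega> \<Longrightarrow> e i x = 0"
  using e_Sh[of i] by (simp add: Sh_def)

lemma hs_e: "i < d \<Longrightarrow> hs_fun s (e i)"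
  by (rule Sh_hs_fun[OF s e_Sh])

sublocale G: galerkin_system \<mu> m c1 C1 C2 C3 Be e d
proof -
  interpret finite_measure \<mu> by (rule finite_mu)
  show "galerkin_system \<mu> m c1 C1 C2 C3 Be e d"
  proof
    show "e i \<in> borel_measurable \<mu>" if "i < d" for i using e_borel[OF that] by measurable
  qed (use m pos lower drift extrapolate Be in auto)
qed

lemma integral_mu_e:
  assumes [measurable]: "f \<in> borel_measurable borel" and i: "i < d"
  shows "(\<integral>x. f x * e i x \<partial>\<mu>) = (\<integral>x. f x * e i x \<partial>lborel)"
proof -
  have [measurable]: "e i \<in> borel_measurable borel" by (rule e_borel[OF i])
  have "(\<integral>x. f x * e i x \<partial>\<mu>) = (\<integral>x. indicator \<Omega> x *\<^sub>R (f x * e i x) \<partial>lborel)"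
    unfolding \<mu>_def by (rule integral_density) auto
  also have "\<dots> = (\<integral>x. f x * e i x \<partial>lborel)"
    by (intro Bochner_Integration.integral_cong) (auto simp: indicator_def e_out[OF i])
  finally show ?thesis .
qed

lemma integrable_mu:
  fixes f :: "real^'n \<Rightarrow> real"
  assumes "integrable lborel f" shows "integrable \<mu> f"
proof -
  have [measurable]: "f \<in> borel_measurable borel" using assms by (simp add: borel_measurable_integrable)
  have "integrable lborel (\<lambda>x. indicator \<Omega> x *\<^sub>R f x)" using assms by (intro integrable_mult_indicator) auto
  then show ?thesis unfolding \<mu>_def by (subst integrable_density) auto
qed

lemma nn_integral_mu:
  assumes [measurable]: "f \<in> borel_measurable borel"
  shows "(\<integral>\<^sup>+x. f x \<partial>\<mu>) = (\<integral>\<^sup>+x\<in>\<Omega>. f x \<partial>lebesgue)"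
proof -
  have "(\<integral>\<^sup>+x. f x \<partial>\<mu>) = (\<integral>\<^sup>+x. ennreal (indicator \<Omega> x) * f x \<partial>lborel)"
    unfolding \<mu>_def by (rule nn_integral_density) auto
  also have "\<dots> = (\<integral>\<^sup>+x\<in>\<Omega>. f x \<partial>lborel)" by (simp add: ennreal_indicator mult.commute)
  finally show ?thesis by (simp add: nn_integral_completion)
qed

lemma qnorm_eq:
  assumes [measurable]: "v1 \<in> borel_measurable borel" "v2 \<in> borel_measurable borel"
  shows "qnorm_sq \<Omega> ((m + 1) / m) v1 v2 = (\<integral>\<^sup>+x. ennreal (shifted_sq m (v1 x) (v2 x)) \<partial>\<mu>)"
proof -
  have "(m + 1) / m - 2 = (1 - m) / m" using m by (simp add: field_simps)
  then show ?thesis by (simp add: nn_integral_mu qnorm_sq_def shifted_sq_def)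
qed

definition \<alpha> where "\<alpha> i t = frac_form s (\<lambda>x. w x t) (e i)"
definition A where "A i t = (LINT r:{0..t}|lborel. \<alpha> i r)"
definition g where "g i = (\<integral>x. u0 x * e i x \<partial>lebesgue)"
definition \<beta> where "\<beta> n i = frac_form s (W n) (e i)"
definition v where "v n x = w x (\<tau> * real n)"
text \<open>Since \<open>psi m\<close> inverts \<open>pw m\<close>, psi(w_0) is u_0 itself, and
  \<open>I0\<close> is psi(W_0). Its moments \<open>gh\<close> therefore start the discrete moment
  identity as \<open>g\<close> starts the exact one.\<close>

definition I0 where "I0 = interp \<Omega> \<T> u0"
definition gh where "gh i = (\<integral>x. I0 x * e i x \<partial>lborel)"

lemma \<alpha>_meas [measurable]: "i < d \<Longrightarrow> \<alpha> i \<in> borel_measurable borel"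
  unfolding \<alpha>_def by (rule frac_form_w_meas[OF e_borel])

lemma lin_pair_meas [measurable]: "(\<lambda>p. G.lin (\<lambda>i. \<alpha> i (snd p)) (fst p)) \<in> borel_measurable (\<mu> \<Otimes>\<^sub>M borel)"
  unfolding G.lin_def
proof (rule borel_measurable_sum)
  fix i assume "i \<in> {..<d}"
  then have [measurable]: "\<alpha> i \<in> borel_measurable borel" "e i \<in> borel_measurable borel" by (auto intro: e_borel)
  show "(\<lambda>p. \<alpha> i (snd p) * e i (fst p)) \<in> borel_measurable (\<mu> \<Otimes>\<^sub>M borel)" by measurable
qed

lemma lin_borel [measurable]: "G.lin a \<in> borel_measurable borel"
  using G.lin_meas[of a] by measurable

lemma W_Sh: "n \<in> {1..M} \<Longrightarrow> W n \<in> Sh \<Omega> \<T>"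
  using W by (simp add: discrete_solution_def)

lemma W_lin: "n \<in> {1..M} \<Longrightarrow> W n x = G.lin (\<beta> n) x"
  using expand[OF W_Sh, of n x] by (simp add: G.lin_def \<beta>_def)

lemma ritz_lin: "hs_fun s (\<lambda>x. w x t) \<Longrightarrow> ritz s \<Omega> \<T> (\<lambda>x. w x t) x = G.lin (\<lambda>i. \<alpha> i t) x"
  by (simp add: ritz_eq G.lin_def \<alpha>_def)

lemma I0_Sh: "I0 \<in> Sh \<Omega> \<T>"
  unfolding I0_def using u0_out by (intro interp_in_Sh) auto

lemma W0: "psi m (W 0 x) = I0 x"
proof -
  have "surj (psi m)" using psi_pw[OF m] by (metis surjI)
  then show ?thesis using W by (simp add: discrete_solution_def I0_def psi_pw[OF m] surj_f_inv_f)
qed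

lemma psi_W_borel: "n \<le> M \<Longrightarrow> (\<lambda>x. psi m (W n x)) \<in> borel_measurable borel"
  and psi_W_integrable: "n \<le> M \<Longrightarrow> integrable \<mu> (\<lambda>x. psi m (W n x))"
proof -
  have bdd: "integrable \<mu> f" if "\<And>x. \<bar>f x\<bar> \<le> B" and [measurable]: "f \<in> borel_measurable borel" for f :: "real^'n \<Rightarrow> real" and B
    by (rule G.integrable_const_bound[of _ B]) (use that in auto)
  assume n: "n \<le> M"
  show "(\<lambda>x. psi m (W n x)) \<in> borel_measurable borel"
  proof (cases "n = 0")
    case True
    then show ?thesis using W0 Sh_measurable[OF I0_Sh] by simp
  next
    case False
    then have "W n \<in> Sh \<Omega> \<T>" using n by (intro W_Sh) auto
    then have [measurable]: "W n \<in> borel_measurable borel" by (rule Sh_measurable)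
    show ?thesis by measurable
  qed
  show "integrable \<mu> (\<lambda>x. psi m (W n x))"
  proof (cases "n = 0")
    case True
    obtain B where B: "\<And>x. \<bar>I0 x\<bar> \<le> B" using Sh_bounded[OF I0_Sh] by blast
    have "(\<lambda>x. psi m (W n x)) = I0" using True W0 by auto
    then show ?thesis using bdd[OF B Sh_measurable[OF I0_Sh]] by simp
  next
    case False
    then have "n \<in> {1..M}" using n by simp
    from W_lin[OF this] have "W n = G.lin (\<beta> n)" by (rule ext)
    then show ?thesis using G.integrable_psi_lin[of "\<beta> n"] by simp
  qed
qed

text \<open>Summing the scheme tested with \<open>e i\<close> telescopes the differences of psi(W).
  The result has the form of the exact moment identity with a Riemann sum in place of the primitive
  \<open>A\<close>.\<close>

lemma discrete_moment:
  assumes "n \<le> M" "i < d"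
  shows "(\<integral>x. psi m (W n x) * e i x \<partial>\<mu>) = gh i - \<tau> * (\<Sum>k=1..n. \<beta> k i)"
  using assms(1)
proof (induction n)
  case 0
  show ?case using integral_mu_e[OF Sh_measurable[OF I0_Sh] assms(2)] by (simp add: W0 gh_def)
next
  case (Suc n)
  have [measurable]: "e i \<in> borel_measurable borel" by (rule e_borel[OF assms(2)])
  have [measurable]: "(\<lambda>x. psi m (W n x)) \<in> borel_measurable borel" "(\<lambda>x. psi m (W (Suc n) x)) \<in> borel_measurable borel"
    using Suc.prems psi_W_borel by auto
  have J: "integrable \<mu> (\<lambda>x. psi m (W k x) * e i x)" if "k \<le> M" for k
    by (rule G.integrable_bounded_mult[OF psi_W_integrable[OF that] G.e_meas[OF assms(2)] G.e_bdd[OF assms(2)]])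
  have "L2_inner (\<lambda>x. (psi m (W (Suc n) x) - psi m (W n x)) / \<tau>) (e i) + \<beta> (Suc n) i = 0"
  proof -
    have "\<forall>n\<in>{1..M}. W n \<in> Sh \<Omega> \<T> \<and> (\<forall>\<zeta>\<in>Sh \<Omega> \<T>.
        L2_inner (\<lambda>x. (psi m (W n x) - psi m (W (n - 1) x)) / \<tau>) \<zeta> + frac_form s (W n) \<zeta> = 0)"
      using W unfolding discrete_solution_def \<tau>_def by (rule conjunct2)
    then have "W (Suc n) \<in> Sh \<Omega> \<T> \<and> (\<forall>\<zeta>\<in>Sh \<Omega> \<T>.
        L2_inner (\<lambda>x. (psi m (W (Suc n) x) - psi m (W (Suc n - 1) x)) / \<tau>) \<zeta> + frac_form s (W (Suc n)) \<zeta> = 0)"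
      by (rule bspec) (use Suc.prems in simp)
    then show ?thesis using e_Sh[OF assms(2)] unfolding \<beta>_def by simp
  qed
  moreover have "L2_inner (\<lambda>x. (psi m (W (Suc n) x) - psi m (W n x)) / \<tau>) (e i)
      = ((\<integral>x. psi m (W (Suc n) x) * e i x \<partial>\<mu>) - (\<integral>x. psi m (W n x) * e i x \<partial>\<mu>)) / \<tau>"
  proof -
    have "L2_inner (\<lambda>x. (psi m (W (Suc n) x) - psi m (W n x)) / \<tau>) (e i) = (\<integral>x. (psi m (W (Suc n) x) - psi m (W n x)) / \<tau> * e i x \<partial>lborel)"
      unfolding L2_inner_def by (rule integral_completion) measurable
    also have "\<dots> = (\<integral>x. (psi m (W (Suc n) x) - psi m (W n x)) / \<tau> * e i x \<partial>\<mu>)"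
      by (rule integral_mu_e[symmetric, OF _ assms(2)]) measurable
    also have "\<dots> = (\<integral>x. (psi m (W (Suc n) x) * e i x - psi m (W n x) * e i x) / \<tau> \<partial>\<mu>)"
      by (simp add: left_diff_distrib diff_divide_distrib)
    also have "\<dots> = ((\<integral>x. psi m (W (Suc n) x) * e i x \<partial>\<mu>) - (\<integral>x. psi m (W n x) * e i x \<partial>\<mu>)) / \<tau>"
      using J[of n] J[of "Suc n"] Suc.prems by simp
    finally show ?thesis .
  qed
  ultimately have "(\<integral>x. psi m (W (Suc n) x) * e i x \<partial>\<mu>) = (\<integral>x. psi m (W n x) * e i x \<partial>\<mu>) - \<tau> * \<beta> (Suc n) i"
    using tau by (simp add: field_simps)
  then show ?case using Suc by (simp add: algebra_simps)
qed

definition R2 where "R2 = (\<integral>x. (u0 x - I0 x)\<^sup>2 \<partial>lebesgue)"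

lemma I0_lebesgue: "I0 \<in> borel_measurable lebesgue"
  using measurable_completion[of I0 lborel borel] Sh_measurable[OF I0_Sh] by simp

lemma rho_square_integrable: "integrable lebesgue (\<lambda>x. (u0 x - I0 x)\<^sup>2)"
proof -
  obtain B where B: "AE x in lebesgue. \<bar>u0 x\<bar> \<le> B" using u0_bdd by blast
  obtain B' where B': "\<And>x. \<bar>I0 x\<bar> \<le> B'" using Sh_bounded[OF I0_Sh] by blast
  have "\<Omega> \<in> sets lborel" "emeasure lborel \<Omega> < \<infinity>" using op emeasure_bounded_finite[OF bd] by auto
  then have I: "integrable lebesgue (\<lambda>x. (B + B')\<^sup>2 * indicator \<Omega> x)"
    by (intro integrable_mult_right integrable_real_indicator) auto
  show ?thesis
  proof (rule Bochner_Integration.integrable_bound[OF I])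
    show "(\<lambda>x. (u0 x - I0 x)\<^sup>2) \<in> borel_measurable lebesgue" using u0_meas I0_lebesgue by (intro borel_measurable_power borel_measurable_diff)
    show "AE x in lebesgue. norm ((u0 x - I0 x)\<^sup>2) \<le> norm ((B + B')\<^sup>2 * indicator \<Omega> x)"
      using B
    proof eventually_elim
      case (elim x)
      show ?case
      proof (cases "x \<in> \<Omega>")
        case True
        have "\<bar>u0 x - I0 x\<bar> \<le> B + B'" using elim B'[of x] by linarith
        then have "\<bar>u0 x - I0 x\<bar>\<^sup>2 \<le> (B + B')\<^sup>2" by (intro power_mono) auto
        then show ?thesis using True by simp
      next
        case False
        then show ?thesis using u0_out I0_Sh by (simp add: Sh_def)
      qed
    qed
  qed
qed

lemma lin_square:
  shows "frac_form s (G.lin a) (G.lin a) = (\<Sum>i<d. (a i)\<^sup>2)" and hs_lin: "hs_fun s (G.lin a)" and lin_Sh: "G.lin a \<in> Sh \<Omega> \<T>"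
proof -
  show S: "G.lin a \<in> Sh \<Omega> \<T>" unfolding G.lin_def using e_Sh by (intro Sh_sum) auto
  show h: "hs_fun s (G.lin a)" by (rule Sh_hs_fun[OF s S])
  have "frac_form s (G.lin a) (G.lin a) = (\<Sum>i<d. a i * frac_form s (e i) (G.lin a))"
  proof -
    have l: "G.lin a = (\<lambda>x. \<Sum>i<d. a i * e i x)" by (simp add: G.lin_def fun_eq_iff)
    have "frac_form s (\<lambda>x. \<Sum>i<d. a i * e i x) (G.lin a) = (\<Sum>i<d. a i * frac_form s (e i) (G.lin a))"
      by (rule frac_form_sum_left) (use hs_e h in auto)
    then show ?thesis unfolding l[symmetric] .
  qed
  also have "\<dots> = (\<Sum>i<d. (a i)\<^sup>2)"
  proof (intro sum.cong refl)
    fix i assume "i \<in> {..<d}"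
    moreover have "G.lin a = (\<lambda>x. \<Sum>i<d. a i * e i x)" by (simp add: G.lin_def fun_eq_iff)
    ultimately have "frac_form s (G.lin a) (e i) = a i" using frac_form_expansion[OF s orth, of i a] by simp
    then show "a i * frac_form s (e i) (G.lin a) = (a i)\<^sup>2" by (simp add: frac_form_commute[of s "e i"] power2_eq_square)
  qed
  finally show "frac_form s (G.lin a) (G.lin a) = (\<Sum>i<d. (a i)\<^sup>2)" .
qed

text \<open>The moment mismatch paired with a is the L2 pairing of the initial error with the finite
  element function of coordinates a; the Poincare inequality bounds the L2 norm of that function by
  its coordinates.\<close>

lemma initial_error: "(\<Sum>i<d. (g i - gh i) * a i) \<le> Cp * R2 + (\<Sum>i<d. (a i)\<^sup>2) / 4"
proof -
  have e_leb: "e i \<in> borel_measurable lebesgue" if "i < d" for i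
    using measurable_completion[of "e i" lborel borel] e_borel[OF that] by simp
  have lin_leb: "G.lin a \<in> borel_measurable lebesgue"
    using measurable_completion[of "G.lin a" lborel borel] by simp
  have sq: "(\<integral>\<^sup>+x. ennreal ((G.lin a x)\<^sup>2) \<partial>lborel) \<le> ennreal (Cp * (\<Sum>i<d. (a i)\<^sup>2))"
  proof -
    have "(\<integral>\<^sup>+x. ennreal ((G.lin a x)\<^sup>2) \<partial>lborel) \<le> ennreal Cp * gagliardo_sq s (G.lin a)"
      by (rule Cp) (use lin_Sh in \<open>auto simp: Sh_def\<close>)
    also have "\<dots> = ennreal (Cp * (\<Sum>i<d. (a i)\<^sup>2))"
      using pos by (simp add: gagliardo_frac_form[OF hs_lin] lin_square ennreal_mult' sum_nonneg)
    finally show ?thesis .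
  qed
  have L2: "integrable lborel (\<lambda>x. (G.lin a x)\<^sup>2)"
    by (rule integrableI_nonneg) (use sq in \<open>auto intro: le_less_trans\<close>)
  have L2le: "(\<integral>x. (G.lin a x)\<^sup>2 \<partial>lborel) \<le> Cp * (\<Sum>i<d. (a i)\<^sup>2)"
  proof -
    have "ennreal (\<integral>x. (G.lin a x)\<^sup>2 \<partial>lborel) = (\<integral>\<^sup>+x. ennreal ((G.lin a x)\<^sup>2) \<partial>lborel)"
      by (rule nn_integral_eq_integral[symmetric, OF L2]) simp
    then have "ennreal (\<integral>x. (G.lin a x)\<^sup>2 \<partial>lborel) \<le> ennreal (Cp * (\<Sum>i<d. (a i)\<^sup>2))" using sq by simp
    moreover have "0 \<le> Cp * (\<Sum>i<d. (a i)\<^sup>2)" using pos by (simp add: sum_nonneg)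
    ultimately show ?thesis by (simp add: ennreal_le_iff)
  qed
  have L2': "integrable lebesgue (\<lambda>x. (G.lin a x)\<^sup>2)" "(\<integral>x. (G.lin a x)\<^sup>2 \<partial>lebesgue) = (\<integral>x. (G.lin a x)\<^sup>2 \<partial>lborel)"
    using L2 by (simp_all add: integrable_completion integral_completion)
  have int_e: "integrable lebesgue (\<lambda>x. f x * e i x)" if f: "integrable lebesgue f" and i: "i < d" for f i
  proof (rule Bochner_Integration.integrable_bound)
    show "integrable lebesgue (\<lambda>x. Be * \<bar>f x\<bar>)" using f by simp
    show "(\<lambda>x. f x * e i x) \<in> borel_measurable lebesgue" using f e_leb[OF i] by (intro borel_measurable_times) (auto dest: borel_measurable_integrable)
    show "AE x in lebesgue. norm (f x * e i x) \<le> norm (Be * \<bar>f x\<bar>)"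
    proof (rule AE_I2)
      fix x
      have "\<bar>e i x\<bar> \<le> \<bar>Be\<bar>" using Be[OF i, of x] by linarith
      then show "norm (f x * e i x) \<le> norm (Be * \<bar>f x\<bar>)" by (simp add: abs_mult mult.commute[of "\<bar>f x\<bar>"] mult_right_mono)
    qed
  qed
  have I0i: "integrable lebesgue I0"
  proof -
    obtain B where B: "\<And>x. \<bar>I0 x\<bar> \<le> B" using Sh_bounded[OF I0_Sh] by blast
    have "\<Omega> \<in> sets lborel" "emeasure lborel \<Omega> < \<infinity>" using op emeasure_bounded_finite[OF bd] by auto
    then have I: "integrable lebesgue (\<lambda>x. B * indicator \<Omega> x)"
      by (intro integrable_mult_right integrable_real_indicator) auto
    show ?thesis
    proof (rule Bochner_Integration.integrable_bound[OF I I0_lebesgue], rule AE_I2)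
      fix x
      have "\<bar>I0 x\<bar> \<le> \<bar>B\<bar>" using B[of x] by linarith
      then show "norm (I0 x) \<le> norm (B * indicator \<Omega> x)"
        using I0_Sh by (cases "x \<in> \<Omega>") (auto simp: Sh_def)
    qed
  qed
  have gh': "gh i = (\<integral>x. I0 x * e i x \<partial>lebesgue)" if "i < d" for i
  proof -
    have "(\<lambda>x. I0 x * e i x) \<in> borel_measurable lborel"
      using Sh_measurable[OF I0_Sh] e_borel[OF that] by simp
    then show ?thesis unfolding gh_def by (rule integral_completion[symmetric])
  qed
  have "(\<Sum>i<d. (g i - gh i) * a i) = (\<Sum>i<d. \<integral>x. (u0 x - I0 x) * (a i * e i x) \<partial>lebesgue)"
  proof (intro sum.cong refl)
    fix i assume "i \<in> {..<d}"
    then have i: "i < d" by simp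
    have "(\<integral>x. (u0 x - I0 x) * (a i * e i x) \<partial>lebesgue) = (\<integral>x. a i * (u0 x * e i x - I0 x * e i x) \<partial>lebesgue)"
      by (simp add: algebra_simps)
    also have "\<dots> = a i * (g i - gh i)"
      using int_e[OF u0_integrable i] int_e[OF I0i i] by (simp add: g_def gh'[OF i])
    finally show "(g i - gh i) * a i = (\<integral>x. (u0 x - I0 x) * (a i * e i x) \<partial>lebesgue)" by simp
  qed
  also have "\<dots> = (\<integral>x. (\<Sum>i<d. (u0 x - I0 x) * (a i * e i x)) \<partial>lebesgue)"
  proof (rule Bochner_Integration.integral_sum[symmetric])
    fix i assume "i \<in> {..<d}"
    then have "integrable lebesgue (\<lambda>x. a i * ((u0 x - I0 x) * e i x))"
      using int_e[of "\<lambda>x. u0 x - I0 x" i] u0_integrable I0i by simp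
    then show "integrable lebesgue (\<lambda>x. (u0 x - I0 x) * (a i * e i x))" by (simp add: mult.left_commute)
  qed
  also have "\<dots> = (\<integral>x. (u0 x - I0 x) * G.lin a x \<partial>lebesgue)" by (simp add: G.lin_def sum_distrib_left)
  \<comment> \<open>The Young weight is chosen so that the Poincare constant cancels and exactly a
    quarter of the squared coordinates remains.\<close>
  also have "\<dots> \<le> (\<integral>x. Cp * (u0 x - I0 x)\<^sup>2 + (G.lin a x)\<^sup>2 / (4 * Cp) \<partial>lebesgue)"
  proof (rule integral_mono_AE')
    show "integrable lebesgue (\<lambda>x. Cp * (u0 x - I0 x)\<^sup>2 + (G.lin a x)\<^sup>2 / (4 * Cp))"
      using rho_square_integrable L2'(1) by simp
    show "AE x in lebesgue. (u0 x - I0 x) * G.lin a x \<le> Cp * (u0 x - I0 x)\<^sup>2 + (G.lin a x)\<^sup>2 / (4 * Cp)"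
    proof (rule AE_I2)
      fix x
      have "0 \<le> (2 * Cp * (u0 x - I0 x) - G.lin a x)\<^sup>2 / (4 * Cp)" using pos by simp
      also have "\<dots> = Cp * (u0 x - I0 x)\<^sup>2 + (G.lin a x)\<^sup>2 / (4 * Cp) - (u0 x - I0 x) * G.lin a x"
        using pos by (simp add: power2_eq_square field_simps)
      finally show "(u0 x - I0 x) * G.lin a x \<le> Cp * (u0 x - I0 x)\<^sup>2 + (G.lin a x)\<^sup>2 / (4 * Cp)" by simp
    qed
    show "AE x in lebesgue. 0 \<le> Cp * (u0 x - I0 x)\<^sup>2 + (G.lin a x)\<^sup>2 / (4 * Cp)"
      using pos by (intro AE_I2 add_nonneg_nonneg mult_nonneg_nonneg) auto
  qed
  also have "\<dots> = Cp * R2 + (\<integral>x. (G.lin a x)\<^sup>2 \<partial>lborel) / (4 * Cp)"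
    using rho_square_integrable L2' by (simp add: R2_def)
  also have "\<dots> \<le> Cp * R2 + (Cp * (\<Sum>i<d. (a i)\<^sup>2)) / (4 * Cp)"
    using L2le pos by (intro add_left_mono divide_right_mono) auto
  finally show ?thesis using pos by simp
qed

section \<open>Transfer of the Galerkin estimate to the time grid\<close>

abbreviation tl :: "nat \<Rightarrow> real" where "tl n \<equiv> \<tau> * real (n - 1)"
abbreviation tr :: "nat \<Rightarrow> real" where "tr n \<equiv> \<tau> * real n"

lemma grid:
  assumes "n \<in> {1..M}"
  shows "0 \<le> tl n" "tl n < tr n" "tr n \<le> T" "tr n - tl n = \<tau>"
proof -
  show "0 \<le> tl n" using tau by simp
  show e: "tr n - tl n = \<tau>" using assms by (simp add: of_nat_diff algebra_simps)
  then show "tl n < tr n" using tau(1) by linarith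
  have "tr n \<le> \<tau> * real M" using assms tau by (intro mult_left_mono) auto
  then show "tr n \<le> T" using tau by simp
qed

text \<open>An extended-valued version, since the terms of the bound may be infinite. The coordinate
  form of the projection is used because it is jointly measurable at all times; it agrees with
  \<open>ritz\<close> for almost every t.\<close>

definition proj_nn :: "real \<Rightarrow> ennreal" where
  "proj_nn t = (\<integral>\<^sup>+x. ennreal (shifted_sq m (w x t) (w x t - G.lin (\<lambda>i. \<alpha> i t) x)) \<partial>\<mu>)"

definition dist_nn :: "(real^'n \<Rightarrow> real) \<Rightarrow> real \<Rightarrow> ennreal" where
  "dist_nn f t = (\<integral>\<^sup>+x. ennreal (shifted_sq m (w x t) (w x t - f x)) \<partial>\<mu>)"

lemma pair_meas:
  "(\<lambda>p. shifted_sq m (w (fst p) (snd p)) (w (fst p) (snd p) - G.lin (\<lambda>i. \<alpha> i (snd p)) (fst p))) \<in> borel_measurable (\<mu> \<Otimes>\<^sub>M borel)"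
  "f \<in> borel_measurable borel \<Longrightarrow> (\<lambda>p. shifted_sq m (w (fst p) (snd p)) (w (fst p) (snd p) - f (fst p))) \<in> borel_measurable (\<mu> \<Otimes>\<^sub>M borel)"
proof -
  show "(\<lambda>p. shifted_sq m (w (fst p) (snd p)) (w (fst p) (snd p) - G.lin (\<lambda>i. \<alpha> i (snd p)) (fst p))) \<in> borel_measurable (\<mu> \<Otimes>\<^sub>M borel)"
    using lin_pair_meas by measurable
  assume [measurable]: "f \<in> borel_measurable borel"
  show "(\<lambda>p. shifted_sq m (w (fst p) (snd p)) (w (fst p) (snd p) - f (fst p))) \<in> borel_measurable (\<mu> \<Otimes>\<^sub>M borel)"
    by measurable
qed

lemma nn_meas:
  assumes f: "(\<lambda>p. f (fst p) (snd p)) \<in> borel_measurable (\<mu> \<Otimes>\<^sub>M borel)"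
  shows "(\<lambda>t. \<integral>\<^sup>+x. ennreal (f x t) \<partial>\<mu>) \<in> borel_measurable borel" "(\<lambda>t. \<integral>x. f x t \<partial>\<mu>) \<in> borel_measurable borel"
proof -
  have sw: "(\<lambda>p. f (snd p) (fst p)) \<in> borel_measurable (borel \<Otimes>\<^sub>M \<mu>)"
    using measurable_compose[OF measurable_pair_swap' f] by (simp add: split_beta')
  show "(\<lambda>t. \<integral>\<^sup>+x. ennreal (f x t) \<partial>\<mu>) \<in> borel_measurable borel"
    using G.borel_measurable_nn_integral[of "\<lambda>t x. ennreal (f x t)" borel] sw by (simp add: split_beta')
  show "(\<lambda>t. \<integral>x. f x t \<partial>\<mu>) \<in> borel_measurable borel"
    using G.borel_measurable_lebesgue_integral[of "\<lambda>t x. f x t" borel] sw by (simp add: split_beta')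
qed

lemma proj_nn_meas: "proj_nn \<in> borel_measurable borel"
  unfolding proj_nn_def[abs_def] by (rule nn_meas(1)[OF pair_meas(1)])

lemma dist_nn_meas: "f \<in> borel_measurable borel \<Longrightarrow> dist_nn f \<in> borel_measurable borel"
  unfolding dist_nn_def[abs_def] by (rule nn_meas(1)[OF pair_meas(2)])

lemma dist_err_meas: "f \<in> borel_measurable borel \<Longrightarrow> G.dist_err w f \<in> borel_measurable borel"
  unfolding G.dist_err_def[abs_def] by (rule nn_meas(2)[OF pair_meas(2)])

lemma v_meas: "v n \<in> borel_measurable borel"
  unfolding v_def[abs_def] by (rule w_meas)

text \<open>Finiteness of the two extended integrals makes the slices integrable for almost every
  time. With the moment identities, finitely many and hence valid simultaneously almost everywhere,
  this supplies the \<open>good\<close> times.\<close>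

lemma
  assumes n: "n \<in> {1..M}" and finE: "(\<integral>\<^sup>+t\<in>{tl n..tr n}. proj_nn t \<partial>lborel) < \<infinity>"
    and finI: "(\<integral>\<^sup>+t\<in>{tl n..tr n}. dist_nn (v n) t \<partial>lborel) < \<infinity>"
  shows interval_data_scheme: "G.interval_data \<alpha> A g w (v n) (tl n) (tr n)"
    and proj_nn_eq: "(\<integral>\<^sup>+t\<in>{tl n..tr n}. proj_nn t \<partial>lborel) = ennreal (LINT t:{tl n..tr n}|lborel. G.proj_err \<alpha> w t)"
    and dist_nn_eq: "(\<integral>\<^sup>+t\<in>{tl n..tr n}. dist_nn (v n) t \<partial>lborel) = ennreal (LINT t:{tl n..tr n}|lborel. G.dist_err w (v n) t)"
proof -
  note gr = grid[OF n]
  have sf: "sigma_finite_measure \<mu>" by (rule G.sigma_finite_measure_axioms)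
  note E = AE_slice_integrable[OF pair_meas(1) sf shifted_sq_nonneg finE[unfolded proj_nn_def]]
    slice_integrable[OF pair_meas(1) sf shifted_sq_nonneg finE[unfolded proj_nn_def]]
    nn_integral_slice[OF pair_meas(1) sf shifted_sq_nonneg finE[unfolded proj_nn_def]]
  note I = AE_slice_integrable[OF pair_meas(2)[OF v_meas] sf shifted_sq_nonneg finI[unfolded dist_nn_def]]
    slice_integrable[OF pair_meas(2)[OF v_meas] sf shifted_sq_nonneg finI[unfolded dist_nn_def]]
    nn_integral_slice[OF pair_meas(2)[OF v_meas] sf shifted_sq_nonneg finI[unfolded dist_nn_def]]
  show "(\<integral>\<^sup>+t\<in>{tl n..tr n}. proj_nn t \<partial>lborel) = ennreal (LINT t:{tl n..tr n}|lborel. G.proj_err \<alpha> w t)"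
    unfolding proj_nn_def G.proj_err_def by (rule E(3))
  show "(\<integral>\<^sup>+t\<in>{tl n..tr n}. dist_nn (v n) t \<partial>lborel) = ennreal (LINT t:{tl n..tr n}|lborel. G.dist_err w (v n) t)"
    unfolding dist_nn_def G.dist_err_def by (rule I(3))
  have \<alpha>i: "set_integrable lborel {0..T} (\<alpha> i)" if "i < d" for i
    unfolding \<alpha>_def by (rule frac_form_w_integrable[OF hs_e[OF that]])
  have mom: "AE t in lborel. \<forall>i\<in>{..<d}. t \<in> {0..T} \<longrightarrow> (\<integral>x. u x t * e i x \<partial>lborel) = g i - A i t"
  proof (rule AE_finite_allI)
    fix i assume "i \<in> {..<d}"
    then have i: "i < d" by simp
    obtain L where L: "0 \<le> L" "\<And>x y. \<bar>e i x - e i y\<bar> \<le> L * norm (x - y)" using Sh_Lipschitz[OF e_Sh[OF i]] by metis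
    show "AE t in lborel. t \<in> {0..T} \<longrightarrow> (\<integral>x. u x t * e i x \<partial>lborel) = g i - A i t"
      using weak_moment[OF L Be[OF i] e_out[OF i]] unfolding g_def A_def \<alpha>_def .
  qed simp
  show "G.interval_data \<alpha> A g w (v n) (tl n) (tr n)"
    unfolding G.interval_data_def
  proof (intro conjI allI impI)
    show "tl n < tr n" by (rule gr)
    show "set_integrable lborel {tl n..tr n} (\<alpha> i)" if "i < d" for i
      by (rule set_integrable_sub[OF \<alpha>i[OF that]]) (use gr in auto)
    show "A i t - A i s = (LINT r:{s..t}|lborel. \<alpha> i r)" if "i < d" "tl n \<le> s" "s \<le> t" "t \<le> tr n" for i s t
    proof -
      have "0 \<le> s" "t \<le> T" using that gr by linarith+
      then show ?thesis unfolding A_def using that(3) by (intro set_integral_Icc_diff[OF \<alpha>i[OF that(1)]])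
    qed
    show "set_integrable lborel {tl n..tr n} (G.proj_err \<alpha> w)" unfolding G.proj_err_def[abs_def] by (rule E(2))
    show "set_integrable lborel {tl n..tr n} (G.dist_err w (v n))" unfolding G.dist_err_def[abs_def] by (rule I(2))
    show "AE t in lborel. t \<in> {tl n..tr n} \<longrightarrow> G.good \<alpha> A g w (v n) t"
      using E(1) I(1) mom AE_u_integrable
    proof eventually_elim
      case (elim t)
      show ?case
      proof
        assume t: "t \<in> {tl n..tr n}"
        then have "tl n \<le> t" "t \<le> tr n" by (simp_all only: atLeastAtMost_iff)
        then have "0 \<le> t" "t \<le> T" using gr by linarith+
        then have tT: "t \<in> {0..T}" by simp
        show "G.good \<alpha> A g w (v n) t"
          unfolding G.good_def
        proof (intro conjI allI impI)
          show "(\<lambda>x. w x t) \<in> borel_measurable \<mu>" "v n \<in> borel_measurable \<mu>" using v_meas by measurable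
          show "integrable \<mu> (\<lambda>x. psi m (w x t))" unfolding psi_w using elim tT by (intro integrable_mu) auto
          show "integrable \<mu> (\<lambda>x. shifted_sq m (w x t) (w x t - G.lin (\<lambda>i. \<alpha> i t) x))"
            "integrable \<mu> (\<lambda>x. shifted_sq m (w x t) (w x t - v n x))" using elim t by auto
          fix i assume i: "i < d"
          show "(\<integral>x. psi m (w x t) * e i x \<partial>\<mu>) = g i - A i t"
            unfolding psi_w using integral_mu_e[of "\<lambda>x. u x t", OF _ i] elim(3) i tT by simp
        qed
      qed
    qed
  qed
qed

text \<open>The coordinates of the time integral over [0,T] of P_h w - W.\<close>

definition S where "S i = A i T - \<tau> * (\<Sum>k=1..M. \<beta> k i)"

text \<open>Under these finiteness conditions every extended integral equals its real counterpart,
  so the real estimate of the Galerkin system can be read in the extended reals; for the error of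
  \<open>W\<close> this rests on the integrability obtained in \<open>interval_step\<close>.\<close>

lemma finite_error_estimate:
  assumes fin: "\<And>n. n \<in> {1..M} \<Longrightarrow> (\<integral>\<^sup>+t\<in>{tl n..tr n}. proj_nn t \<partial>lborel) < \<infinity>"
     "\<And>n. n \<in> {1..M} \<Longrightarrow> (\<integral>\<^sup>+t\<in>{tl n..tr n}. dist_nn (v n) t \<partial>lborel) < \<infinity>"
  shows "ennreal c1 * (\<Sum>n=1..M. \<integral>\<^sup>+t\<in>{tl n..tr n}. dist_nn (W n) t \<partial>lborel) + ennreal ((\<Sum>i<d. (S i)\<^sup>2) / 4)
    \<le> ennreal Cp * ennreal R2 + ennreal (C1 + 2 * C2) * (\<Sum>n=1..M. \<integral>\<^sup>+t\<in>{tl n..tr n}. proj_nn t \<partial>lborel)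
      + ennreal (7 * C3 * (C1 + C2)) * (\<Sum>n=1..M. \<integral>\<^sup>+t\<in>{tl n..tr n}. dist_nn (v n) t \<partial>lborel)"
proof -
  have D: "G.interval_data \<alpha> A g w (v n) (tl n) (tr n)" if "n \<in> {1..M}" for n
    by (rule interval_data_scheme[OF that fin(1)[OF that] fin(2)[OF that]])
  have Wf: "W n = G.lin (\<beta> n)" if "n \<in> {1..M}" for n using W_lin[OF that] by (rule ext)
  have qm: "G.dist_err w (G.lin (\<beta> n)) \<in> borel_measurable borel" for n by (rule dist_err_meas[OF lin_borel])
  have A0: "A i 0 = 0" if "i < d" for i
  proof -
    have "AE r in lborel. indicator {0..0::real} r *\<^sub>R \<alpha> i r = 0"
      using AE_lborel_singleton[of 0] by eventually_elim (auto simp: indicator_def)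
    then show ?thesis unfolding A_def set_lebesgue_integral_def by (rule integral_eq_zero_AE)
  qed
  let ?Q = "\<lambda>n. LINT t:{tl n..tr n}|lborel. G.dist_err w (G.lin (\<beta> n)) t"
  let ?E = "\<lambda>n. LINT t:{tl n..tr n}|lborel. G.proj_err \<alpha> w t"
  let ?I = "\<lambda>n. LINT t:{tl n..tr n}|lborel. G.dist_err w (v n) t"
  have R20: "0 \<le> R2" unfolding R2_def by (intro Bochner_Integration.integral_nonneg) simp
  have R: "c1 * (\<Sum>n=1..M. ?Q n) + (\<Sum>i<d. (S i)\<^sup>2) / 4 \<le> Cp * R2 + (C1 + 2 * C2) * (\<Sum>n=1..M. ?E n) + 7 * C3 * (C1 + C2) * (\<Sum>n=1..M. ?I n)"
  proof -
    have "c1 * (\<Sum>n=1..M. ?Q n) + (\<Sum>i<d. (A i (\<tau> * real M) - \<tau> * (\<Sum>k=1..M. \<beta> k i))\<^sup>2) / 4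
      \<le> Cp * R2 + (C1 + 2 * C2) * (\<Sum>n=1..M. ?E n) + 7 * C3 * (C1 + C2) * (\<Sum>n=1..M. ?I n)"
    proof (rule G.galerkin_estimate[OF tau(1) D A0 _ initial_error qm])
      fix n i assume n: "n \<in> {1..M}" and i: "i < d"
      show "(\<integral>x. psi m (G.lin (\<beta> n) x) * e i x \<partial>\<mu>) = gh i - \<tau> * (\<Sum>k=1..n. \<beta> k i)"
        using discrete_moment[OF _ i, of n] n unfolding Wf[OF n] by simp
    qed
    then show ?thesis by (simp add: S_def tau)
  qed
  have Q: "(\<integral>\<^sup>+t\<in>{tl n..tr n}. dist_nn (W n) t \<partial>lborel) = ennreal (?Q n)" if n: "n \<in> {1..M}" for n
    unfolding Wf[OF n] dist_nn_def G.dist_err_def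
    by (rule nn_integral_slice_converse[OF shifted_sq_nonneg G.interval_step(1)[OF D[OF n] qm] G.interval_step(2)[OF D[OF n] qm, unfolded G.dist_err_def[abs_def]]])
  have E: "(\<integral>\<^sup>+t\<in>{tl n..tr n}. proj_nn t \<partial>lborel) = ennreal (?E n)"
    and I: "(\<integral>\<^sup>+t\<in>{tl n..tr n}. dist_nn (v n) t \<partial>lborel) = ennreal (?I n)" if n: "n \<in> {1..M}" for n
    using proj_nn_eq[OF n fin(1)[OF n] fin(2)[OF n]] dist_nn_eq[OF n fin(1)[OF n] fin(2)[OF n]] by auto
  have nn: "0 \<le> ?Q n" "0 \<le> ?E n" "0 \<le> ?I n" for n by (intro set_integral_nonneg G.err_nonneg)+
  have sQ: "(\<Sum>n=1..M. \<integral>\<^sup>+t\<in>{tl n..tr n}. dist_nn (W n) t \<partial>lborel) = ennreal (\<Sum>n=1..M. ?Q n)"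
    and sE: "(\<Sum>n=1..M. \<integral>\<^sup>+t\<in>{tl n..tr n}. proj_nn t \<partial>lborel) = ennreal (\<Sum>n=1..M. ?E n)"
    and sI: "(\<Sum>n=1..M. \<integral>\<^sup>+t\<in>{tl n..tr n}. dist_nn (v n) t \<partial>lborel) = ennreal (\<Sum>n=1..M. ?I n)"
    using sum.cong[OF refl Q, of "{1..M}"] sum.cong[OF refl E, of "{1..M}"] sum.cong[OF refl I, of "{1..M}"]
      sum_ennreal[of "{1..M}" ?Q, OF nn(1)] sum_ennreal[of "{1..M}" ?E, OF nn(2)] sum_ennreal[of "{1..M}" ?I, OF nn(3)]
    by (simp_all only:)
  have snn: "0 \<le> (\<Sum>n=1..M. ?Q n)" "0 \<le> (\<Sum>n=1..M. ?E n)" "0 \<le> (\<Sum>n=1..M. ?I n)" "0 \<le> (\<Sum>i<d. (S i)\<^sup>2) / 4"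
    by (intro sum_nonneg nn divide_nonneg_nonneg; simp)+
  have cn: "0 \<le> c1" "0 \<le> Cp" "0 \<le> C1 + 2 * C2" "0 \<le> 7 * C3 * (C1 + C2)" using pos by auto
  show ?thesis unfolding sQ sE sI
    using R snn cn R20 by (simp add: ennreal_mult[symmetric] ennreal_plus[symmetric] ennreal_leI del: ennreal_plus)
qed

lemma tint_partition:
  fixes f :: "real \<Rightarrow> real"
  assumes [measurable]: "f \<in> borel_measurable borel" and f: "set_integrable lborel {0..T} f"
  shows "(LINT t:{0..T}|lborel. f t) = (\<Sum>n=1..M. LINT t:{tl n..tr n}|lborel. f t)"
proof -
  have "(LINT t:{0..\<tau> * real M}|lborel. f t) = (\<Sum>n=1..M. LINT t:{tl n<..<tr n}|lborel. f t)"
  proof (rule set_integral_time_partition[OF tau(1), of f M "\<lambda>_. f"])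
    show "f \<in> borel_measurable borel" by (rule assms(1))
    fix n assume "n \<in> {1..M}"
    note gr = grid[OF this]
    have "{tl n<..<tr n} \<subseteq> {0..T}"
    proof
      fix t assume "t \<in> {tl n<..<tr n}"
      then have "tl n < t" "t < tr n" by (simp_all only: greaterThanLessThan_iff)
      then have "0 \<le> t" "t \<le> T" using gr by linarith+
      then show "t \<in> {0..T}" by simp
    qed
    then show "set_integrable lborel {tl n<..<tr n} f" by (intro set_integrable_subset[OF f]) auto
  qed auto
  then show ?thesis by (simp add: tau set_integral_open_closed)
qed

definition wbn :: "nat \<Rightarrow> real^'n \<Rightarrow> real" where
  "wbn n x = (1 / \<tau>) * (LINT t:{tl n<..<tr n}|lborel. w x t)"

lemma wbn_eq: "wbn n = (\<lambda>x. (1 / \<tau>) * tint (tl n) (tr n) x)"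
proof -
  have "(LINT t:{tl n<..<tr n}|lborel. w x t) = tint (tl n) (tr n) x" for x
    unfolding tint_def by (rule set_integral_open_closed) measurable
  then show ?thesis by (simp add: wbn_def fun_eq_iff)
qed

lemma hs_wbn: "n \<in> {1..M} \<Longrightarrow> hs_fun s (wbn n)"
  unfolding wbn_eq by (rule hs_fun_mult[OF hs_tint]) (use grid[of n] in blast)+

text \<open>Projection commutes with averaging: the i-th coordinate of the projected mean is the
  mean of the coordinates \<open>\<alpha> i\<close>.\<close>

lemma ritz_wbn:
  assumes n: "n \<in> {1..M}"
  shows "\<tau> * ritz s \<Omega> \<T> (wbn n) x = (\<Sum>i<d. (LINT t:{tl n..tr n}|lborel. \<alpha> i t) * e i x)"
proof -
  have "frac_form s (wbn n) (e i) = (1 / \<tau>) * (LINT t:{tl n..tr n}|lborel. \<alpha> i t)" if "i < d" for i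
  proof -
    have "frac_form s (wbn n) (e i) = (1 / \<tau>) * frac_form s (tint (tl n) (tr n)) (e i)"
      unfolding wbn_eq using frac_form_mult_right[of s "e i"] by (simp only: frac_form_commute[of s _ "e i"])
    also have "frac_form s (tint (tl n) (tr n)) (e i) = (LINT t:{tl n..tr n}|lborel. \<alpha> i t)"
      unfolding \<alpha>_def by (rule frac_form_tint[OF grid(1,2,3)[OF n] hs_e[OF that]])
    finally show ?thesis .
  qed
  then have "(\<Sum>i<d. frac_form s (wbn n) (e i) * e i x) = (\<Sum>i<d. (1 / \<tau>) * (LINT t:{tl n..tr n}|lborel. \<alpha> i t) * e i x)"
    by (intro sum.cong refl) simp
  then show ?thesis using tau(1) by (simp add: ritz_eq[OF hs_wbn[OF n]] sum_distrib_left)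
qed

section \<open>The error of the time integrals\<close>

definition time_err :: "real^'n \<Rightarrow> real" where
  "time_err x = (LINT t:{0..T}|lborel. w x t) - (LINT t:{0..T}|lborel. step_ext \<tau> W x t)"

definition ritz_time_err :: "real^'n \<Rightarrow> real" where
  "ritz_time_err x = \<tau> * (\<Sum>n=1..M. wbn n x - ritz s \<Omega> \<T> (wbn n) x)"

lemma ritz_time_err_meas: "ritz_time_err \<in> borel_measurable borel"
  unfolding ritz_time_err_def
proof (intro borel_measurable_times borel_measurable_const borel_measurable_sum borel_measurable_diff)
  fix n assume n: "n \<in> {1..M}"
  show "wbn n \<in> borel_measurable borel" by (rule hs_fun_measurable[OF hs_wbn[OF n]])
  have "ritz s \<Omega> \<T> (wbn n) = G.lin (\<lambda>i. frac_form s (wbn n) (e i))"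
    by (rule ext) (simp add: ritz_eq[OF hs_wbn[OF n]] G.lin_def)
  then show "ritz s \<Omega> \<T> (wbn n) \<in> borel_measurable borel" by simp
qed

text \<open>The projected means add up to the finite element function with coordinates
  \<open>A i T\<close>, so subtracting it splits the error into a projection part and a discrete
  part. Equality holds only almost everywhere, because w(x, .) is integrable in time only for almost
  every x.\<close>

lemma error_decomposition: "AE x in lborel. time_err x = ritz_time_err x + G.lin S x"
  using AE_w_time
proof eventually_elim
  case (elim x)
  have "(\<lambda>t. w x t) \<in> borel_measurable borel" by measurable
  then have 1: "(LINT t:{0..T}|lborel. w x t) = (\<Sum>n=1..M. tint (tl n) (tr n) x)"
    unfolding tint_def using elim by (intro tint_partition) auto
  have 2: "(LINT t:{0..T}|lborel. step_ext \<tau> W x t) = (\<Sum>i<d. (\<tau> * (\<Sum>n=1..M. \<beta> n i)) * e i x)"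
  proof -
    have "(LINT t:{0..T}|lborel. step_ext \<tau> W x t) = \<tau> * (\<Sum>n=1..M. W n x)"
      using step_integral[OF tau(1), of M "\<lambda>n. W n x"] by (simp add: step_ext_def tau)
    also have "(\<Sum>n=1..M. W n x) = (\<Sum>n=1..M. \<Sum>i<d. \<beta> n i * e i x)"
      by (intro sum.cong refl) (simp add: W_lin G.lin_def)
    also have "\<dots> = (\<Sum>i<d. \<Sum>n=1..M. \<beta> n i * e i x)" by (rule sum.swap)
    finally show ?thesis by (simp add: sum_distrib_left sum_distrib_right mult.assoc)
  qed
  have 3: "(\<Sum>n=1..M. \<tau> * ritz s \<Omega> \<T> (wbn n) x) = (\<Sum>i<d. A i T * e i x)"
  proof -
    have "(\<Sum>n=1..M. \<tau> * ritz s \<Omega> \<T> (wbn n) x) = (\<Sum>n=1..M. \<Sum>i<d. (LINT t:{tl n..tr n}|lborel. \<alpha> i t) * e i x)"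
      by (intro sum.cong refl ritz_wbn)
    also have "\<dots> = (\<Sum>i<d. \<Sum>n=1..M. (LINT t:{tl n..tr n}|lborel. \<alpha> i t) * e i x)" by (rule sum.swap)
    also have "\<dots> = (\<Sum>i<d. A i T * e i x)"
    proof (intro sum.cong refl)
      fix i assume "i \<in> {..<d}"
      then have i: "i < d" by simp
      have "A i T = (\<Sum>n=1..M. LINT t:{tl n..tr n}|lborel. \<alpha> i t)"
        unfolding A_def
      proof (rule tint_partition[OF \<alpha>_meas[OF i]])
        show "set_integrable lborel {0..T} (\<alpha> i)" unfolding \<alpha>_def by (rule frac_form_w_integrable[OF hs_e[OF i]])
      qed
      then show "(\<Sum>n=1..M. (LINT t:{tl n..tr n}|lborel. \<alpha> i t) * e i x) = A i T * e i x" by (simp only: sum_distrib_right)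
    qed
    finally show ?thesis .
  qed
  have 4: "ritz_time_err x = (\<Sum>n=1..M. tint (tl n) (tr n) x) - (\<Sum>n=1..M. \<tau> * ritz s \<Omega> \<T> (wbn n) x)"
  proof -
    have "\<tau> * wbn n x = tint (tl n) (tr n) x" for n using tau(1) by (simp add: wbn_eq)
    then show ?thesis unfolding ritz_time_err_def sum_distrib_left sum_subtractf[symmetric] right_diff_distrib by simp
  qed
  have "G.lin S x = (\<Sum>i<d. A i T * e i x) - (\<Sum>i<d. (\<tau> * (\<Sum>n=1..M. \<beta> n i)) * e i x)"
    by (simp add: G.lin_def S_def left_diff_distrib sum_subtractf)
  then show ?case unfolding time_err_def 1 2 4 3 by simp
qed

text \<open>The seminorm of the discrete part is the sum of squares of its coordinates. The factor 8
  is the 2 from splitting the square times the 4 that undoes the quarter in the Galerkin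
  estimate.\<close>

lemma gagliardo_time_err: "gagliardo_sq s time_err \<le> 2 * gagliardo_sq s ritz_time_err + 8 * ennreal ((\<Sum>i<d. (S i)\<^sup>2) / 4)"
proof -
  have "gagliardo_sq s time_err = gagliardo_sq s (\<lambda>x. ritz_time_err x + G.lin S x)"
    by (rule gagliardo_cong_AE[OF error_decomposition])
  also have "\<dots> \<le> 2 * gagliardo_sq s ritz_time_err + 2 * gagliardo_sq s (G.lin S)"
    by (rule gagliardo_add_le[OF ritz_time_err_meas lin_borel])
  also have "2 * gagliardo_sq s (G.lin S) = 8 * ennreal ((\<Sum>i<d. (S i)\<^sup>2) / 4)"
  proof -
    have "2 * ennreal (\<Sum>i<d. (S i)\<^sup>2) = ennreal (2 * (\<Sum>i<d. (S i)\<^sup>2))" by (simp add: ennreal_mult' sum_nonneg)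
    also have "2 * (\<Sum>i<d. (S i)\<^sup>2) = 8 * ((\<Sum>i<d. (S i)\<^sup>2) / 4)" by simp
    also have "ennreal \<dots> = 8 * ennreal ((\<Sum>i<d. (S i)\<^sup>2) / 4)" by (subst ennreal_mult) (auto simp: sum_nonneg)
    finally show ?thesis by (simp add: gagliardo_frac_form[OF hs_lin] lin_square)
  qed
  finally show ?thesis .
qed

abbreviation Wsum where "Wsum \<equiv> (\<Sum>n=1..M. \<integral>\<^sup>+t\<in>{tl n..tr n}. dist_nn (W n) t \<partial>lborel)"
abbreviation Vsum where "Vsum \<equiv> (\<Sum>n=1..M. \<integral>\<^sup>+t\<in>{tl n..tr n}. dist_nn (v n) t \<partial>lborel)"
abbreviation Psum where "Psum \<equiv> (\<Sum>n=1..M. \<integral>\<^sup>+t\<in>{tl n..tr n}. proj_nn t \<partial>lborel)"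

text \<open>The middle factor bounds the three coefficients of the Galerkin estimate; 1 / c1 turns
  it into a bound for the quasi-norm error, 8 into one for the discrete part of the time integral,
  and the final 2 belongs to the projection part.\<close>

definition "err_const = (1 / c1 + 8) * (Cp + (C1 + 2 * C2) + 7 * C3 * (C1 + C2)) + 2"

lemma err_const_pos: "0 < err_const"
  unfolding err_const_def using pos by (intro add_nonneg_pos mult_nonneg_nonneg add_nonneg_nonneg) auto

lemma error_estimate: "Wsum + gagliardo_sq s time_err \<le> ennreal err_const * (Vsum + Psum + ennreal R2 + gagliardo_sq s ritz_time_err)"
proof (cases "Vsum < \<infinity> \<and> Psum < \<infinity>")
  \<comment> \<open>If one of these sums is infinite, so is the right side, because the constant is
    positive; the finite estimate is needed only otherwise.\<close>
  case False
  then have "Vsum = \<infinity> \<or> Psum = \<infinity>" by (simp only: infinity_ennreal_def less_top[symmetric] not_less de_Morgan_conj top_unique) blast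
  then have "Vsum + Psum + ennreal R2 + gagliardo_sq s ritz_time_err = \<infinity>" by auto
  moreover have "ennreal err_const * \<infinity> = \<infinity>" using err_const_pos by (simp add: ennreal_mult_top)
  ultimately show ?thesis by (simp only: infinity_ennreal_def top_greatest)
next
  case True
  define k where "k = Cp + (C1 + 2 * C2) + 7 * C3 * (C1 + C2)"
  define X where "X = Vsum + Psum + ennreal R2"
  let ?P = "ennreal ((\<Sum>i<d. (S i)\<^sup>2) / 4)"
  have k: "0 \<le> k" "Cp \<le> k" "C1 + 2 * C2 \<le> k" "7 * C3 * (C1 + C2) \<le> k" using pos by (auto simp: k_def)
  have "ennreal c1 * Wsum + ?P \<le> ennreal Cp * ennreal R2 + ennreal (C1 + 2 * C2) * Psum + ennreal (7 * C3 * (C1 + C2)) * Vsum"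
  proof (rule finite_error_estimate)
    fix n assume n: "n \<in> {1..M}"
    have "(\<integral>\<^sup>+t\<in>{tl n..tr n}. proj_nn t \<partial>lborel) \<le> Psum" by (rule member_le_sum[OF n]) auto
    then show "(\<integral>\<^sup>+t\<in>{tl n..tr n}. proj_nn t \<partial>lborel) < \<infinity>" using True by (meson le_less_trans)
    have "(\<integral>\<^sup>+t\<in>{tl n..tr n}. dist_nn (v n) t \<partial>lborel) \<le> Vsum" by (rule member_le_sum[OF n]) auto
    then show "(\<integral>\<^sup>+t\<in>{tl n..tr n}. dist_nn (v n) t \<partial>lborel) < \<infinity>" using True by (meson le_less_trans)
  qed
  also have "\<dots> \<le> ennreal k * ennreal R2 + ennreal k * Psum + ennreal k * Vsum"
    using k by (intro add_mono mult_right_mono ennreal_leI) auto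
  also have "\<dots> = ennreal k * X" by (simp add: X_def algebra_simps)
  finally have est: "ennreal c1 * Wsum + ?P \<le> ennreal k * X" .
  have "ennreal (1 / c1) * (ennreal c1 * Wsum) \<le> ennreal (1 / c1) * (ennreal k * X)"
    using est by (intro mult_left_mono) (auto intro: order_trans[rotated])
  moreover have "ennreal (1 / c1) * ennreal c1 = 1" using pos by (subst ennreal_mult[symmetric]) auto
  ultimately have 1: "Wsum \<le> ennreal (1 / c1) * (ennreal k * X)" by (simp add: mult.assoc[symmetric])
  have 2: "8 * ?P \<le> 8 * (ennreal k * X)" using est by (intro mult_left_mono) (auto intro: order_trans[rotated])
  have "Wsum + gagliardo_sq s time_err \<le> ennreal (1 / c1) * (ennreal k * X) + (2 * gagliardo_sq s ritz_time_err + 8 * (ennreal k * X))"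
    using 1 gagliardo_time_err 2 by (intro add_mono) (auto intro: order_trans add_mono)
  also have "\<dots> = ennreal ((1 / c1 + 8) * k) * X + 2 * gagliardo_sq s ritz_time_err"
  proof -
    have "ennreal ((1 / c1 + 8) * k) = (ennreal (1 / c1) + 8) * ennreal k"
      using pos k by (simp add: ennreal_mult ennreal_plus)
    then show ?thesis by (simp add: algebra_simps)
  qed
  also have "\<dots> \<le> ennreal err_const * X + ennreal err_const * gagliardo_sq s ritz_time_err"
  proof (intro add_mono mult_right_mono)
    show "ennreal ((1 / c1 + 8) * k) \<le> ennreal err_const" by (rule ennreal_leI) (simp add: err_const_def k_def)
    have "0 \<le> (1 / c1 + 8) * k" using pos k by simp
    then have "ennreal 2 \<le> ennreal err_const" by (intro ennreal_leI) (simp add: err_const_def k_def)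
    then show "2 \<le> ennreal err_const" by simp
  qed auto
  finally show ?thesis by (simp add: X_def distrib_left)
qed

section \<open>Identification of the terms in the stated estimate\<close>

lemma qnorm_step_ext:
  "(\<integral>\<^sup>+t\<in>{0<..<T}. qnorm_sq \<Omega> ((m + 1) / m) (\<lambda>x. w x t) (\<lambda>x. w x t - step_ext \<tau> W x t) \<partial>lborel) = Wsum"
proof -
  have "(\<integral>\<^sup>+t\<in>{0<..<\<tau> * real M}. qnorm_sq \<Omega> ((m + 1) / m) (\<lambda>x. w x t) (\<lambda>x. w x t - step_ext \<tau> W x t) \<partial>lborel)
     = (\<Sum>n=1..M. \<integral>\<^sup>+t\<in>{tl n<..<tr n}. dist_nn (W n) t \<partial>lborel)"
  proof (rule nn_integral_time_partition[OF tau(1)])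
    fix n assume n: "n \<in> {1..M}"
    have Wm: "W n \<in> borel_measurable borel" by (rule Sh_measurable[OF W_Sh[OF n]])
    show "dist_nn (W n) \<in> borel_measurable borel" by (rule dist_nn_meas[OF Wm])
    show "AE t in lborel. t \<in> {tl n<..<tr n} \<longrightarrow> qnorm_sq \<Omega> ((m + 1) / m) (\<lambda>x. w x t) (\<lambda>x. w x t - step_ext \<tau> W x t) = dist_nn (W n) t"
    proof (intro AE_I2 impI)
      fix t assume t: "t \<in> {tl n<..<tr n}"
      have "nat \<lceil>t / \<tau>\<rceil> = n" by (rule ceiling_step[OF tau(1) _ t]) (use n in simp)
      then have "step_ext \<tau> W x t = W n x" for x by (simp add: step_ext_def)
      then show "qnorm_sq \<Omega> ((m + 1) / m) (\<lambda>x. w x t) (\<lambda>x. w x t - step_ext \<tau> W x t) = dist_nn (W n) t"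
        unfolding dist_nn_def using Wm by (simp add: qnorm_eq)
    qed
  qed
  then show ?thesis by (simp only: tau nn_integral_open_closed)
qed

text \<open>\<open>ritz\<close> has its coordinate form only where w(., t) has a finite seminorm,
  that is for almost every t, so the integrands are identified only almost everywhere in
  time.\<close>

lemma qnorm_ritz:
  "(\<integral>\<^sup>+t\<in>{0<..<T}. qnorm_sq \<Omega> ((m + 1) / m) (\<lambda>x. w x t) (\<lambda>x. w x t - ritz s \<Omega> \<T> (\<lambda>y. w y t) x) \<partial>lborel) = Psum"
proof -
  have "(\<integral>\<^sup>+t\<in>{0<..<\<tau> * real M}. qnorm_sq \<Omega> ((m + 1) / m) (\<lambda>x. w x t) (\<lambda>x. w x t - ritz s \<Omega> \<T> (\<lambda>y. w y t) x) \<partial>lborel)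
     = (\<Sum>n=1..M. \<integral>\<^sup>+t\<in>{tl n<..<tr n}. proj_nn t \<partial>lborel)"
  proof (rule nn_integral_time_partition[OF tau(1) proj_nn_meas])
    fix n assume n: "n \<in> {1..M}"
    show "AE t in lborel. t \<in> {tl n<..<tr n} \<longrightarrow> qnorm_sq \<Omega> ((m + 1) / m) (\<lambda>x. w x t) (\<lambda>x. w x t - ritz s \<Omega> \<T> (\<lambda>y. w y t) x) = proj_nn t"
      using AE_hs
    proof eventually_elim
      case (elim t)
      show ?case
      proof
        assume "t \<in> {tl n<..<tr n}"
        then have "tl n < t" "t < tr n" by (simp_all only: greaterThanLessThan_iff)
        then have "0 \<le> t" "t \<le> T" using grid[OF n] by linarith+
        then have "hs_fun s (\<lambda>x. w x t)" using elim by simp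
        then show "qnorm_sq \<Omega> ((m + 1) / m) (\<lambda>x. w x t) (\<lambda>x. w x t - ritz s \<Omega> \<T> (\<lambda>y. w y t) x) = proj_nn t"
          unfolding proj_nn_def by (simp add: ritz_lin qnorm_eq)
      qed
    qed
  qed
  then show ?thesis by (simp only: tau nn_integral_open_closed)
qed

lemma qnorm_grid:
  "(\<Sum>n=1..M. \<integral>\<^sup>+t\<in>{tl n<..<tr n}. qnorm_sq \<Omega> ((m + 1) / m) (\<lambda>x. w x t) (\<lambda>x. w x (\<tau> * real n) - w x t) \<partial>lborel) = Vsum"
proof (intro sum.cong refl)
  fix n
  have "qnorm_sq \<Omega> ((m + 1) / m) (\<lambda>x. w x t) (\<lambda>x. w x (\<tau> * real n) - w x t) = dist_nn (v n) t" for t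
    unfolding dist_nn_def v_def by (simp add: qnorm_eq shifted_sq_commute[of m "w _ t" "w _ t"])
  then show "(\<integral>\<^sup>+t\<in>{tl n<..<tr n}. qnorm_sq \<Omega> ((m + 1) / m) (\<lambda>x. w x t) (\<lambda>x. w x (\<tau> * real n) - w x t) \<partial>lborel)
      = (\<integral>\<^sup>+t\<in>{tl n..tr n}. dist_nn (v n) t \<partial>lborel)"
    by (simp only: nn_integral_open_closed)
qed

lemma initial_term: "(\<integral>\<^sup>+x. ennreal ((psi m (pw m (u0 x)) - interp \<Omega> \<T> (\<lambda>y. psi m (pw m (u0 y))) x)\<^sup>2) \<partial>lebesgue) = ennreal R2"
  unfolding psi_pw[OF m] I0_def[symmetric] R2_def by (rule nn_integral_eq_integral[OF rho_square_integrable]) simp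

end

theorem theorem3p1:
  fixes s m T c0 :: real
    and \<Omega> :: "(real^'n) set"
    and u0 :: "real^'n \<Rightarrow> real"
    and u :: "real^'n \<Rightarrow> real \<Rightarrow> real"
    and H :: "real set"
    and Th :: "real \<Rightarrow> (real^'n) set set"
  assumes s: "0 < s" "s < 1"
    and m: "0 < m"
    and T: "0 < T"
    and dom: "polyhedral_domain \<Omega>"
    and u0_meas: "u0 \<in> borel_measurable lebesgue"
    and u0_bdd: "\<exists>B. AE x in lebesgue. \<bar>u0 x\<bar> \<le> B"
    and u0_out: "\<forall>x. x \<notin> \<Omega> \<longrightarrow> u0 x = 0"
    and sol: "weak_solution s m T \<Omega> u0 u"
    and tri: "\<forall>h\<in>H. triangulation_of \<Omega> (Th h) \<and> mesh_size (Th h) = h"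
    and reg: "0 < c0" "\<forall>h\<in>H. \<forall>K\<in>Th h. measure lebesgue K \<ge> c0 * diameter K ^ CARD('n)"
  shows "\<exists>c>0. \<forall>h\<in>H. \<forall>M::nat. \<forall>W::nat \<Rightarrow> real^'n \<Rightarrow> real.
     let \<tau> = T / real M;
         w = (\<lambda>x t. pw m (u x t));
         w0 = (\<lambda>x. pw m (u0 x));
         p = (m + 1) / m;
         Wt = step_ext \<tau> W;
         wbar = (\<lambda>x. LINT t:{0..T}|lborel. w x t);
         Wbar = (\<lambda>x. LINT t:{0..T}|lborel. Wt x t);
         wbn = (\<lambda>n x. (1 / \<tau>) * (LINT t:{\<tau> * real (n - 1)<..<\<tau> * real n}|lborel. w x t));
         Ph = ritz s \<Omega> (Th h);
         N2s = real CARD('n) + 2 * s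
     in M \<ge> 1 \<longrightarrow> discrete_solution s m \<Omega> (Th h) \<tau> M w0 W \<longrightarrow>
       (\<integral>\<^sup>+ t\<in>{0<..<T}. qnorm_sq \<Omega> p (\<lambda>x. w x t) (\<lambda>x. w x t - Wt x t) \<partial>lborel)
       + (\<integral>\<^sup>+ x. (\<integral>\<^sup>+ z. ennreal (((wbar x - wbar z) - (Wbar x - Wbar z))\<^sup>2
                                        / norm (x - z) powr N2s) \<partial>lebesgue) \<partial>lebesgue)
       \<le> ennreal c *
         ((\<Sum>n=1..M. (\<integral>\<^sup>+ t\<in>{\<tau> * real (n - 1)<..<\<tau> * real n}.
                          qnorm_sq \<Omega> p (\<lambda>x. w x t) (\<lambda>x. w x (\<tau> * real n) - w x t) \<partial>lborel))
          + (\<integral>\<^sup>+ t\<in>{0<..<T}. qnorm_sq \<Omega> p (\<lambda>x. w x t) (\<lambda>x. w x t - Ph (\<lambda>y. w y t) x) \<partial>lborel)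
          + (\<integral>\<^sup>+ x. ennreal ((psi m (w0 x) - interp \<Omega> (Th h) (\<lambda>y. psi m (w0 y)) x)\<^sup>2) \<partial>lebesgue)
          + (\<integral>\<^sup>+ x. (\<integral>\<^sup>+ z. ennreal ((\<tau> * (\<Sum>n=1..M. (wbn n x - wbn n z) - (Ph (wbn n) x - Ph (wbn n) z)))\<^sup>2
                                          / norm (x - z) powr N2s) \<partial>lebesgue) \<partial>lebesgue))"
proof -
  obtain c1 C1 where c1: "0 < c1" "0 < C1"
    "\<And>w V P va. c1 * shifted_sq m w (w - V) \<le> (psi m va - psi m V) * (P - V)
        + C1 * (shifted_sq m w (w - P) + shifted_sq m w (w - va))"
    using error_pointwise_lower[OF m] by blast
  obtain C2 where C2: "0 < C2"
    "\<And>w w' P P' wa. - ((psi m w - psi m wa) * (P - P'))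
        \<le> C2 * (shifted_sq m w (w - P) + shifted_sq m w' (w' - P') + shifted_sq m w' (w' - wa))"
    using drift_pointwise_upper[OF m] by blast
  obtain C3 where C3: "0 < C3"
    "\<And>w w1 w2 wa v \<rho>. psi m wa - psi m w2 = \<rho> * (psi m w2 - psi m w1) \<Longrightarrow> 0 \<le> \<rho> \<Longrightarrow> \<rho> \<le> 1 \<Longrightarrow>
       shifted_sq m w (w - wa) \<le> C3 * (shifted_sq m w (w - v) + shifted_sq m w1 (w1 - v) + shifted_sq m w2 (w2 - v))"
    using extrapolation_pointwise[OF m] by blast
  have \<Omega>: "open \<Omega>" "bounded \<Omega>" "convex \<Omega>" "\<Omega> \<noteq> {}"
    using dom by (auto simp: polyhedral_domain_def)
  obtain Cp where Cp: "0 < Cp" "\<And>f. f \<in> borel_measurable borel \<Longrightarrow> (\<And>x. x \<notin> \<Omega> \<Longrightarrow> f x = 0) \<Longrightarrow>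
     (\<integral>\<^sup>+x. ennreal ((f x)\<^sup>2) \<partial>lborel) \<le> ennreal Cp * gagliardo_sq s f"
    using poincare[OF s(1) \<Omega>(2)] by blast
  \<comment> \<open>Chosen before \<open>h\<close>, \<open>M\<close> and \<open>W\<close> are fixed,
    which is the claimed independence of the discretisation; it is the value that
    \<open>err_const\<close> takes in the interpretation below.\<close>
  define c where "c = (1 / c1 + 8) * (Cp + (C1 + 2 * C2) + 7 * C3 * (C1 + C2)) + 2"
  have "0 < c"
    unfolding c_def using c1 C2(1) C3(1) Cp(1) by (intro add_nonneg_pos mult_nonneg_nonneg add_nonneg_nonneg) auto
  show ?thesis
    unfolding Let_def
  proof (intro exI[of _ c] conjI ballI allI impI)
    show "0 < c" by fact
    fix h M W
    assume h: "h \<in> H" and M: "1 \<le> M" and W: "discrete_solution s m \<Omega> (Th h) (T / real M) M (\<lambda>x. pw m (u0 x)) W"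
    interpret triangulated_domain \<Omega> "Th h"
      using \<Omega> tri h by unfold_locales auto
    obtain d e where e: "orthonormal_upto s d e"
      "\<And>\<phi> x. \<phi> \<in> Sh \<Omega> (Th h) \<Longrightarrow> \<phi> x = (\<Sum>i<d. frac_form s \<phi> (e i) * e i x)"
      "\<And>v x. hs_fun s v \<Longrightarrow> ritz s \<Omega> (Th h) v x = (\<Sum>i<d. frac_form s v (e i) * e i x)"
      using Sh_orthonormal_basis[OF s] by blast
    have "\<forall>i\<in>{..<d}. \<exists>B. \<forall>x. \<bar>e i x\<bar> \<le> B"
    proof
      fix i assume "i \<in> {..<d}"
      then have "e i \<in> Sh \<Omega> (Th h)" using e(1) by (simp add: orthonormal_upto_def)
      then show "\<exists>B. \<forall>x. \<bar>e i x\<bar> \<le> B" using Sh_bounded by metis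
    qed
    then obtain B where B: "\<And>i x. i < d \<Longrightarrow> \<bar>e i x\<bar> \<le> B i" by (metis lessThan_iff)
    \<comment> \<open>One bound for all basis functions at once; it depends on the mesh but does not
      enter \<open>c\<close>.\<close>
    define Be where "Be = (\<Sum>i<d. B i)"
    have Be: "\<bar>e i x\<bar> \<le> Be" if "i < d" for i x
    proof -
      have "B i \<le> Be" unfolding Be_def
      proof (rule member_le_sum)
        fix j assume "j \<in> {..<d} - {i}"
        then show "0 \<le> B j" using B[of j x] by simp
      qed (use that in auto)
      then show ?thesis using B[OF that, of x] by linarith
    qed
    interpret fem_scheme s m T \<Omega> u0 u "Th h" c1 C1 C2 C3 Cp Be d e M W
      by unfold_locales (fact s m T op bd u0_meas u0_bdd u0_out sol c1 C2 C3 Cp e Be M W)+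
    have F: "((LINT t:{0..T}|lborel. pw m (u x t)) - (LINT t:{0..T}|lborel. pw m (u z t))
         - ((LINT t:{0..T}|lborel. step_ext (T / real M) W x t) - (LINT t:{0..T}|lborel. step_ext (T / real M) W z t)))
       = time_err x - time_err z" for x z
      by (simp add: time_err_def w_def \<tau>_def)
    \<comment> \<open>The differences under the sum are regrouped by point, so that the last double
      integral becomes the seminorm of \<open>ritz_time_err\<close>; \<open>F\<close> does the same
      for the error of the time integrals.\<close>
    have H: "(T / real M) * (\<Sum>n=1..M.
         (1 / (T / real M) * (LINT t:{T / real M * real (n - 1)<..<T / real M * real n}|lborel. pw m (u x t))
          - 1 / (T / real M) * (LINT t:{T / real M * real (n - 1)<..<T / real M * real n}|lborel. pw m (u z t)))
         - (ritz s \<Omega> (Th h) (\<lambda>x. 1 / (T / real M) * (LINT t:{T / real M * real (n - 1)<..<T / real M * real n}|lborel. pw m (u x t))) x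
          - ritz s \<Omega> (Th h) (\<lambda>x. 1 / (T / real M) * (LINT t:{T / real M * real (n - 1)<..<T / real M * real n}|lborel. pw m (u x t))) z))
       = ritz_time_err x - ritz_time_err z" for x z
    proof -
      have "ritz_time_err x - ritz_time_err z = \<tau> * (\<Sum>n=1..M. (wbn n x - wbn n z) - (ritz s \<Omega> (Th h) (wbn n) x - ritz s \<Omega> (Th h) (wbn n) z))"
        unfolding ritz_time_err_def right_diff_distrib[symmetric] sum_subtractf[symmetric]
        by (intro arg_cong[where f = "\<lambda>y. \<tau> * y"] sum.cong refl) linarith
      then show ?thesis unfolding wbn_def[abs_def] w_def \<tau>_def by (rule sym)
    qed
    have c: "c = err_const" by (simp only: c_def err_const_def)
    note terms = qnorm_step_ext qnorm_grid qnorm_ritz initial_term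
    show "(\<integral>\<^sup>+ t\<in>{0<..<T}. qnorm_sq \<Omega> ((m + 1) / m) (\<lambda>x. pw m (u x t)) (\<lambda>x. pw m (u x t) - step_ext (T / real M) W x t) \<partial>lborel)
       + (\<integral>\<^sup>+ x. (\<integral>\<^sup>+ z. ennreal (((LINT t:{0..T}|lborel. pw m (u x t)) - (LINT t:{0..T}|lborel. pw m (u z t))
         - ((LINT t:{0..T}|lborel. step_ext (T / real M) W x t) - (LINT t:{0..T}|lborel. step_ext (T / real M) W z t)))\<^sup>2
           / norm (x - z) powr (real CARD('n) + 2 * s)) \<partial>lebesgue) \<partial>lebesgue)
       \<le> ennreal c *
         ((\<Sum>n=1..M. (\<integral>\<^sup>+ t\<in>{T / real M * real (n - 1)<..<T / real M * real n}.
                          qnorm_sq \<Omega> ((m + 1) / m) (\<lambda>x. pw m (u x t)) (\<lambda>x. pw m (u x (T / real M * real n)) - pw m (u x t)) \<partial>lborel))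
          + (\<integral>\<^sup>+ t\<in>{0<..<T}. qnorm_sq \<Omega> ((m + 1) / m) (\<lambda>x. pw m (u x t)) (\<lambda>x. pw m (u x t) - ritz s \<Omega> (Th h) (\<lambda>y. pw m (u y t)) x) \<partial>lborel)
          + (\<integral>\<^sup>+ x. ennreal ((psi m (pw m (u0 x)) - interp \<Omega> (Th h) (\<lambda>y. psi m (pw m (u0 y))) x)\<^sup>2) \<partial>lebesgue)
          + (\<integral>\<^sup>+ x. (\<integral>\<^sup>+ z. ennreal (((T / real M) * (\<Sum>n=1..M.
         (1 / (T / real M) * (LINT t:{T / real M * real (n - 1)<..<T / real M * real n}|lborel. pw m (u x t))
          - 1 / (T / real M) * (LINT t:{T / real M * real (n - 1)<..<T / real M * real n}|lborel. pw m (u z t)))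
         - (ritz s \<Omega> (Th h) (\<lambda>x. 1 / (T / real M) * (LINT t:{T / real M * real (n - 1)<..<T / real M * real n}|lborel. pw m (u x t))) x
          - ritz s \<Omega> (Th h) (\<lambda>x. 1 / (T / real M) * (LINT t:{T / real M * real (n - 1)<..<T / real M * real n}|lborel. pw m (u x t))) z)))\<^sup>2
                                          / norm (x - z) powr (real CARD('n) + 2 * s)) \<partial>lebesgue) \<partial>lebesgue))"
      unfolding F H c gagliardo_sq_def[symmetric] terms[unfolded w_def \<tau>_def]
      by (rule error_estimate[unfolded \<tau>_def w_def])
  qed
qed

end
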